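(* Assume that $\mathbb{L}$ and its Green function $G^\Omega$ satisfy properties (L1)–(L4) and (G1)–(G3) listed in the context. Let $\mu\in\mathcal{M}(\Omega,\delta^\gamma)$, $d\nu=\delta^\gamma d\mu$, and let $p\in(1,\infty)$, $p'=\frac{p}{p-1}$, be such that $s-\frac{\gamma}{2p'}>0$. If $\nu$ is absolutely continuous with respect to the Bessel capacity $\mathrm{Cap}_{2s-\frac{\gamma}{p'},\,p'}$, then the problem $$\mathbb{L}u+|u|^{p-1}u=\mu\ \text{ in }\Omega,\qquad u=0\ \text{ on }\partial\Omega\ \text{ or in }\mathbb{R}^N\setminus\Omega\ \text{(if applicable)}$$ has a unique weak-dual solution $u$. Moreover, the solution satisfies $$-\mathbb{G}^\Omega[\mu^-]\le u\le\mathbb{G}^\Omega[\mu^+]\quad\text{a.e. in }\Omega$$ and $$\|u\|_{L^1(\Omega,\delta^\gamma)}+\||u|^{p}\|_{L^1(\Omega,\delta^\gamma)}\le C\|\mu\|_{\mathcal{M}(\Omega,\delta^\gamma)}$$ for a positive constant $C=C(N,\Omega,s,\gamma)$.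
   Context: Throughout, $N\ge 3$, $\Omega\subset\mathbb{R}^N$ is a bounded $C^2$ domain, $\delta(x)=\operatorname{dist}(x,\mathbb{R}^N\setminus\Omega)$, $D_\Omega=\{(x,x):x\in\Omega\}$, $a\wedge b=\min\{a,b\}$; $f\asymp g$ means $C^{-1}g\le f\le Cg$ for some constant $C>0$. Operator: (L1) $\mathbb{L}:C_c^\infty(\Omega)\to L^2(\Omega)$ is given by $\mathbb{L}u(x)=\lim_{\varepsilon\to0^+}\mathbb{L}_\varepsilon u(x)$, where $\mathbb{L}_\varepsilon u(x)=\int_{\{y\in\Omega:|x-y|>\varepsilon\}}J(x,y)(u(x)-u(y))\,dy+B(x)u(x)$; $J,B$ are measurable, $J$ is nonnegative, symmetric, finite on $(\Omega\times\Omega)\setminus D_\Omega$, $\int_\Omega\int_\Omega|x-y|^2J(x,y)\,dx\,dy<\infty$, and $B$ is nonnegative and locally bounded in $\Omega$. (L2) For every $u\in C_c^\infty(\Omega)$ there exist $\varphi_u\in L^1_{\rm loc}(\Omega)$ and $\varepsilon_0>0$ with $|\mathbb{L}_\varepsilon u|\le\varphi_u$ a.e. in $\Omega$ for all $\varepsilon\in(0,\varepsilon_0]$. Put $\mathcal{E}(u,v)=\frac12\int_\Omega\int_\Omega J(x,y)(u(x)-u(y))(v(x)-v(y))\,dx\,dy+\int_\Omega Buv\,dx$ on $\mathcal{D}(\mathcal{E})=\{u\in L^2(\Omega):\mathcal{E}(u,u)<\infty\}$, with inner product $\langle u,v\rangle_{L^2(\Omega)}+\mathcal{E}(u,v)$;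 $\mathbb{H}(\Omega)$ is the closure of $C_c^\infty(\Omega)$ in $\mathcal{D}(\mathcal{E})$. $\mathbb{L}$ also denotes its Friedrichs extension, the nonnegative self-adjoint operator on $L^2(\Omega)$ associated with $\mathcal{E}|_{\mathbb{H}(\Omega)}$. (L3) There is $\Lambda>0$ with $\|u\|_{L^2(\Omega)}^2\le\Lambda\langle\mathbb{L}u,u\rangle_{L^2(\Omega)}$ for all $u\in C_c^\infty(\Omega)$. (L4) $\mathbb{H}(\Omega)=H^s_{00}(\Omega):=\{u\in H^s(\Omega):u/\delta^s\in L^2(\Omega)\}$, a Banach space with norm $\|u\|^2_{H^s_{00}(\Omega)}=\int_\Omega(1+\delta^{-2s})|u|^2dx+\int_\Omega\int_\Omega\frac{|u(x)-u(y)|^2}{|x-y|^{N+2s}}dx\,dy$ ($s$ as in (G1)). Green operator: for $f\in L^2(\Omega)$, $\mathbb{G}^\Omega[f]$ is the unique $u\in\mathbb{H}(\Omega)$ with $\mathcal{E}(u,v)=\int_\Omega fv\,dx$ for all $v\in\mathbb{H}(\Omega)$. (G1) $\mathbb{G}^\Omega[f](x)=\int_\Omega G^\Omega(x,y)f(y)\,dy$, where $G^\Omega:(\Omega\times\Omega)\setminus D_\Omega\to(0,\infty)$ is Borel measurable, symmetric, and for some $s,\gamma\in(0,1]$, $N>2s$, $$G^\Omega(x,y)\asymp\frac{1}{|x-y|^{N-2s}}\Big(\frac{\delta(x)}{|x-y|}\wedge1\Big)^\gamma\Big(\frac{\delta(y)}{|x-y|}\wedge1\Big)^\gamma,\quad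 x\ne y.$$ (G2) $G^\Omega$ is jointly continuous in $(\Omega\times\Omega)\setminus D_\Omega$. (G3) For every $x_0\in\Omega$, $z_0\in\partial\Omega$ the limit $M^\Omega(x_0,z_0)=\lim_{(x,y)\to(x_0,z_0)}\frac{G^\Omega(x,y)}{\delta(y)^\gamma}$ exists, and $M^\Omega:\Omega\times\partial\Omega\to\mathbb{R}^+$ is continuous. Spaces: $L^1(\Omega,\delta^\gamma)$ has norm $\int_\Omega|u|\delta^\gamma dx$; $\delta^\gamma L^\infty(\Omega)=\{\delta^\gamma u:u\in L^\infty(\Omega)\}$; $\mathcal{M}(\Omega,\delta^\gamma)$ is the space of signed Radon measures on $\Omega$ with $\|\mu\|_{\mathcal{M}(\Omega,\delta^\gamma)}=\int_\Omega\delta^\gamma d|\mu|<\infty$; $\mu^\pm$ are the positive and negative parts of $\mu$. For such $\mu$, $\mathbb{G}^\Omega[\mu](x)=\int_\Omega G^\Omega(x,y)\,d\mu(y)$, and for $f\in L^1(\Omega,\delta^\gamma)$, $\mathbb{G}^\Omega[f](x)=\int_\Omega G^\Omega(x,y)f(y)\,dy$. Weak-dual solution: $u$ is a weak-dual solution of the problem if $u\in L^1(\Omega,\delta^\gamma)$, $|u|^p\in L^1(\Omega,\delta^\gamma)$ and $$\int_\Omega u\xi\,dx+\int_\Omega|u|^{p-1}u\,\mathbb{G}^\Omega[\xi]\,dx=\int_\Omega\mathbb{G}^\Omega[\xi]\,d\mu\quad\text{for all }\xi\in\delta^\gamma L^\infty(\Omega).$$ Bessel capacity: for $\alpha>0$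 let $\mathcal{B}_\alpha=\mathcal{F}^{-1}\big((1+|\cdot|^2)^{-\alpha/2}\big)$ be the Bessel kernel of order $\alpha$ on $\mathbb{R}^N$ ($\mathcal{F}$ the Fourier transform on tempered distributions). For $q\in(1,\infty)$ and $E\subset\mathbb{R}^N$ compact, $$\mathrm{Cap}_{\alpha,q}(E)=\inf\{\|h\|_{L^q(\mathbb{R}^N)}^q:\ h\in L^q(\mathbb{R}^N),\ h\ge0,\ \mathcal{B}_\alpha*h\ge\mathbf{1}_E\}$$ ($=\infty$ if no such $h$ exists); for open sets it is the supremum over compact subsets, and for arbitrary sets the infimum over open supersets. A measure $\nu$ in $\Omega$ is absolutely continuous with respect to $\mathrm{Cap}_{\alpha,q}$ if for every Borel set $E\subset\Omega$, $\mathrm{Cap}_{\alpha,q}(E)=0$ implies $|\nu|(E)=0$. The kernel $G^\Omega$ is fixed; the notation $C(\cdot)$ for constants suppresses dependence on the comparison constants in (G1). *)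

theory Defs
  imports "HOL-Analysis.Analysis"
begin

section \<open>Differentiability classes and domains\<close>

text \<open>\<open>partials [i1, ..., ik] f\<close> is the iterated partial derivative of \<open>f\<close> in the basis
  directions \<open>i1, ..., ik\<close>.\<close>

primrec partials ::
    "'a::euclidean_space list \<Rightarrow> ('a \<Rightarrow> 'b::real_normed_vector) \<Rightarrow> 'a \<Rightarrow> 'b" where
  "partials [] f = f"
| "partials (i # vs) f = (\<lambda>x. frechet_derivative (partials vs f) (at x) i)"

definition Ck :: "nat \<Rightarrow> ('a::euclidean_space \<Rightarrow> 'b::real_normed_vector) \<Rightarrow> bool" where
  "Ck k f \<longleftrightarrow>
     (\<forall>vs. set vs \<subseteq> Basis \<and> length vs < k \<longrightarrow> (\<forall>x. partials vs f differentiable (at x))) \<and>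
     (\<forall>vs. set vs \<subseteq> Basis \<and> length vs \<le> k \<longrightarrow> continuous_on UNIV (partials vs f))"

definition smooth :: "('a::euclidean_space \<Rightarrow> 'b::real_normed_vector) \<Rightarrow> bool" where
  "smooth f \<longleftrightarrow> (\<forall>k. Ck k f)"

text \<open>Near each boundary point the domain is the strict epigraph of a \<open>C^2\<close> function over a
  hyperplane orthogonal to some unit vector \<open>e\<close>; \<open>x - (x \<bullet> e) *\<^sub>R e\<close> is the projection
  of \<open>x\<close> to that hyperplane, so only the values of \<open>g\<close> on the hyperplane matter.\<close>

definition C2_domain :: "'a::euclidean_space set \<Rightarrow> bool" where
  "C2_domain \<Omega> \<longleftrightarrow> open \<Omega> \<and> connected \<Omega> \<and> \<Omega> \<noteq> {} \<and>
     (\<forall>z\<in>frontier \<Omega>. \<exists>r>0. \<exists>e (g :: 'a \<Rightarrow> real). norm e = 1 \<and> Ck 2 g \<and>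
        \<Omega> \<inter> ball z r = {x \<in> ball z r. g (x - (x \<bullet> e) *\<^sub>R e) < x \<bullet> e})"

definition bdist :: "'a::euclidean_space set \<Rightarrow> 'a \<Rightarrow> real" where
  "bdist \<Omega> x = infdist x (- \<Omega>)"

abbreviation off_diag :: "'a set \<Rightarrow> ('a \<times> 'a) set" where
  "off_diag \<Omega> \<equiv> \<Omega> \<times> \<Omega> - {(x, x) | x. x \<in> \<Omega>}"


section \<open>Function spaces\<close>

text \<open>A function on \<open>\<Omega>\<close> is represented by a function on the whole space whose values outside
  \<open>\<Omega>\<close> are irrelevant; equality in the spaces below is equality almost everywhere in
  \<open>\<Omega>\<close>. Test functions are extended by zero.\<close>

definition Cc_smooth :: "'a::euclidean_space set \<Rightarrow> ('a \<Rightarrow> real) set" where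
  "Cc_smooth \<Omega> = {\<phi>. smooth \<phi> \<and> compact (closure {x. \<phi> x \<noteq> 0}) \<and> closure {x. \<phi> x \<noteq> 0} \<subseteq> \<Omega>}"

definition L2 :: "'a::euclidean_space set \<Rightarrow> ('a \<Rightarrow> real) set" where
  "L2 \<Omega> = {u \<in> borel_measurable (lebesgue_on \<Omega>). integrable (lebesgue_on \<Omega>) (\<lambda>x. (u x)\<^sup>2)}"

definition L1_loc :: "'a::euclidean_space set \<Rightarrow> ('a \<Rightarrow> real) set" where
  "L1_loc \<Omega> = {u \<in> borel_measurable (lebesgue_on \<Omega>).
     \<forall>K. compact K \<and> K \<subseteq> \<Omega> \<longrightarrow> integrable (lebesgue_on K) u}"

definition L1_weighted :: "'a::euclidean_space set \<Rightarrow> real \<Rightarrow> ('a \<Rightarrow> real) set" where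
  "L1_weighted \<Omega> \<gamma> = {u \<in> borel_measurable (lebesgue_on \<Omega>).
     integrable (lebesgue_on \<Omega>) (\<lambda>x. u x * bdist \<Omega> x powr \<gamma>)}"

definition L1_weighted_norm :: "'a::euclidean_space set \<Rightarrow> real \<Rightarrow> ('a \<Rightarrow> real) \<Rightarrow> real" where
  "L1_weighted_norm \<Omega> \<gamma> u = (\<integral>x. \<bar>u x\<bar> * bdist \<Omega> x powr \<gamma> \<partial>lebesgue_on \<Omega>)"

definition Linf :: "'a::euclidean_space set \<Rightarrow> ('a \<Rightarrow> real) set" where
  "Linf \<Omega> = {w \<in> borel_measurable (lebesgue_on \<Omega>). \<exists>K. AE x in lebesgue_on \<Omega>. \<bar>w x\<bar> \<le> K}"

definition Linf_weighted :: "'a::euclidean_space set \<Rightarrow> real \<Rightarrow> ('a \<Rightarrow> real) set" where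
  "Linf_weighted \<Omega> \<gamma> = {\<xi>. \<exists>w\<in>Linf \<Omega>. \<forall>x\<in>\<Omega>. \<xi> x = bdist \<Omega> x powr \<gamma> * w x}"

text \<open>The fractional Sobolev space for \<open>0 < s < 1\<close> (Gagliardo seminorm), and the classical space
  \<open>H^1\<close> (weak gradient) for \<open>s = 1\<close>, where the Gagliardo double integral would be infinite for
  every nonconstant function.\<close>

definition Hs :: "'a::euclidean_space set \<Rightarrow> real \<Rightarrow> ('a \<Rightarrow> real) set" where
  "Hs \<Omega> s = {u \<in> L2 \<Omega>.
     if s = 1 then
       \<exists>g :: 'a \<Rightarrow> 'a. \<forall>i\<in>Basis. (\<lambda>x. g x \<bullet> i) \<in> L2 \<Omega> \<and>
         (\<forall>\<phi>\<in>Cc_smooth \<Omega>. (\<integral>x. u x * partials [i] \<phi> x \<partial>lebesgue_on \<Omega>)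
            = - (\<integral>x. (g x \<bullet> i) * \<phi> x \<partial>lebesgue_on \<Omega>))
     else
       (\<integral>\<^sup>+(x, y). ennreal (\<bar>u x - u y\<bar>\<^sup>2 / norm (x - y) powr (real DIM('a) + 2 * s))
          \<partial>lebesgue_on (\<Omega> \<times> \<Omega>)) < \<infinity>}"

definition Hs00 :: "'a::euclidean_space set \<Rightarrow> real \<Rightarrow> ('a \<Rightarrow> real) set" where
  "Hs00 \<Omega> s = {u \<in> Hs \<Omega> s. (\<lambda>x. u x / bdist \<Omega> x powr s) \<in> L2 \<Omega>}"


section \<open>The operator, its energy form and energy space\<close>

definition L_eps ::
    "'a::euclidean_space set \<Rightarrow> ('a \<Rightarrow> 'a \<Rightarrow> real) \<Rightarrow> ('a \<Rightarrow> real) \<Rightarrow> real \<Rightarrow> ('a \<Rightarrow> real) \<Rightarrow> 'a \<Rightarrow> real" where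
  "L_eps \<Omega> J B \<epsilon> u x =
     (\<integral>y. J x y * (u x - u y) \<partial>lebesgue_on {y \<in> \<Omega>. norm (x - y) > \<epsilon>}) + B x * u x"

definition L_op ::
    "'a::euclidean_space set \<Rightarrow> ('a \<Rightarrow> 'a \<Rightarrow> real) \<Rightarrow> ('a \<Rightarrow> real) \<Rightarrow> ('a \<Rightarrow> real) \<Rightarrow> 'a \<Rightarrow> real" where
  "L_op \<Omega> J B u x = Lim (at_right 0) (\<lambda>\<epsilon>. L_eps \<Omega> J B \<epsilon> u x)"

definition energy ::
    "'a::euclidean_space set \<Rightarrow> ('a \<Rightarrow> 'a \<Rightarrow> real) \<Rightarrow> ('a \<Rightarrow> real) \<Rightarrow> ('a \<Rightarrow> real) \<Rightarrow> ('a \<Rightarrow> real) \<Rightarrow> real" where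
  "energy \<Omega> J B u v =
     1 / 2 * (\<integral>(x, y). J x y * (u x - u y) * (v x - v y) \<partial>lebesgue_on (\<Omega> \<times> \<Omega>))
     + (\<integral>x. B x * u x * v x \<partial>lebesgue_on \<Omega>)"

text \<open>The quadratic form \<open>\<E>(u,u)\<close> with values in \<open>[0,\<infinity>]\<close>; it agrees with
  \<open>energy \<Omega> J B u u\<close> when finite.\<close>

definition quad_energy ::
    "'a::euclidean_space set \<Rightarrow> ('a \<Rightarrow> 'a \<Rightarrow> real) \<Rightarrow> ('a \<Rightarrow> real) \<Rightarrow> ('a \<Rightarrow> real) \<Rightarrow> ennreal" where
  "quad_energy \<Omega> J B u =
     ennreal (1 / 2) * (\<integral>\<^sup>+(x, y). ennreal (J x y * (u x - u y)\<^sup>2) \<partial>lebesgue_on (\<Omega> \<times> \<Omega>))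
     + (\<integral>\<^sup>+x. ennreal (B x * (u x)\<^sup>2) \<partial>lebesgue_on \<Omega>)"

definition energy_dom ::
    "'a::euclidean_space set \<Rightarrow> ('a \<Rightarrow> 'a \<Rightarrow> real) \<Rightarrow> ('a \<Rightarrow> real) \<Rightarrow> ('a \<Rightarrow> real) set" where
  "energy_dom \<Omega> J B = {u \<in> L2 \<Omega>. quad_energy \<Omega> J B u < \<infinity>}"

definition H_space ::
    "'a::euclidean_space set \<Rightarrow> ('a \<Rightarrow> 'a \<Rightarrow> real) \<Rightarrow> ('a \<Rightarrow> real) \<Rightarrow> ('a \<Rightarrow> real) set" where
  "H_space \<Omega> J B = {u \<in> energy_dom \<Omega> J B. \<forall>\<epsilon>>0. \<exists>\<phi>\<in>Cc_smooth \<Omega>.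
     (\<integral>\<^sup>+x. ennreal ((u x - \<phi> x)\<^sup>2) \<partial>lebesgue_on \<Omega>) + quad_energy \<Omega> J B (\<lambda>x. u x - \<phi> x)
       < ennreal \<epsilon>}"

definition cond_L1 ::
    "'a::euclidean_space set \<Rightarrow> ('a \<Rightarrow> 'a \<Rightarrow> real) \<Rightarrow> ('a \<Rightarrow> real) \<Rightarrow> bool" where
  "cond_L1 \<Omega> J B \<longleftrightarrow>
     (\<lambda>(x, y). J x y) \<in> borel_measurable (lebesgue_on (off_diag \<Omega>)) \<and>
     (\<forall>(x, y)\<in>off_diag \<Omega>. 0 \<le> J x y \<and> J x y = J y x) \<and>
     (\<integral>\<^sup>+(x, y). ennreal ((norm (x - y))\<^sup>2 * J x y) \<partial>lebesgue_on (\<Omega> \<times> \<Omega>)) < \<infinity> \<and>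
     B \<in> borel_measurable (lebesgue_on \<Omega>) \<and>
     (\<forall>x\<in>\<Omega>. 0 \<le> B x) \<and>
     (\<forall>K. compact K \<and> K \<subseteq> \<Omega> \<longrightarrow> bounded (B ` K)) \<and>
     (\<forall>u\<in>Cc_smooth \<Omega>.
        (AE x in lebesgue_on \<Omega>. \<exists>l. ((\<lambda>\<epsilon>. L_eps \<Omega> J B \<epsilon> u x) \<longlongrightarrow> l) (at_right 0)) \<and>
        L_op \<Omega> J B u \<in> L2 \<Omega>)"

definition cond_L2 ::
    "'a::euclidean_space set \<Rightarrow> ('a \<Rightarrow> 'a \<Rightarrow> real) \<Rightarrow> ('a \<Rightarrow> real) \<Rightarrow> bool" where
  "cond_L2 \<Omega> J B \<longleftrightarrow>
     (\<forall>u\<in>Cc_smooth \<Omega>. \<exists>\<phi>\<in>L1_loc \<Omega>. \<exists>\<epsilon>0>0. \<forall>\<epsilon>. 0 < \<epsilon> \<and> \<epsilon> \<le> \<epsilon>0 \<longrightarrow>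
        (AE x in lebesgue_on \<Omega>. \<bar>L_eps \<Omega> J B \<epsilon> u x\<bar> \<le> \<phi> x))"

definition cond_L3 ::
    "'a::euclidean_space set \<Rightarrow> ('a \<Rightarrow> 'a \<Rightarrow> real) \<Rightarrow> ('a \<Rightarrow> real) \<Rightarrow> bool" where
  "cond_L3 \<Omega> J B \<longleftrightarrow>
     (\<exists>\<Lambda>>0. \<forall>u\<in>Cc_smooth \<Omega>.
        (\<integral>x. (u x)\<^sup>2 \<partial>lebesgue_on \<Omega>) \<le> \<Lambda> * (\<integral>x. L_op \<Omega> J B u x * u x \<partial>lebesgue_on \<Omega>))"

definition cond_L4 ::
    "'a::euclidean_space set \<Rightarrow> real \<Rightarrow> ('a \<Rightarrow> 'a \<Rightarrow> real) \<Rightarrow> ('a \<Rightarrow> real) \<Rightarrow> bool" where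
  "cond_L4 \<Omega> s J B \<longleftrightarrow> H_space \<Omega> J B = Hs00 \<Omega> s"


section \<open>The Green function\<close>

definition green_fun ::
    "'a::euclidean_space set \<Rightarrow> ('a \<Rightarrow> 'a \<Rightarrow> real) \<Rightarrow> ('a \<Rightarrow> real) \<Rightarrow> 'a \<Rightarrow> real" where
  "green_fun \<Omega> G f x = (\<integral>y. G x y * f y \<partial>lebesgue_on \<Omega>)"

definition green_meas :: "('a::euclidean_space \<Rightarrow> 'a \<Rightarrow> real) \<Rightarrow> 'a measure \<Rightarrow> 'a \<Rightarrow> real" where
  "green_meas G M x = (\<integral>y. G x y \<partial>M)"

text \<open>\<open>u\<close> represents the value of the Green operator at \<open>f\<close>; under the coercivity condition
  \<open>cond_L3\<close> such a \<open>u\<close> is unique up to null sets.\<close>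

definition is_green_op ::
    "'a::euclidean_space set \<Rightarrow> ('a \<Rightarrow> 'a \<Rightarrow> real) \<Rightarrow> ('a \<Rightarrow> real) \<Rightarrow> ('a \<Rightarrow> real) \<Rightarrow> ('a \<Rightarrow> real) \<Rightarrow> bool" where
  "is_green_op \<Omega> J B f u \<longleftrightarrow> u \<in> H_space \<Omega> J B \<and>
     (\<forall>v\<in>H_space \<Omega> J B. energy \<Omega> J B u v = (\<integral>x. f x * v x \<partial>lebesgue_on \<Omega>))"

definition green_bound ::
    "'a::euclidean_space set \<Rightarrow> real \<Rightarrow> real \<Rightarrow> 'a \<Rightarrow> 'a \<Rightarrow> real" where
  "green_bound \<Omega> s \<gamma> x y =
     1 / norm (x - y) powr (real DIM('a) - 2 * s)
       * min (bdist \<Omega> x / norm (x - y)) 1 powr \<gamma>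
       * min (bdist \<Omega> y / norm (x - y)) 1 powr \<gamma>"

definition cond_G1 ::
    "'a::euclidean_space set \<Rightarrow> real \<Rightarrow> real \<Rightarrow> real \<Rightarrow>
     ('a \<Rightarrow> 'a \<Rightarrow> real) \<Rightarrow> ('a \<Rightarrow> real) \<Rightarrow> ('a \<Rightarrow> 'a \<Rightarrow> real) \<Rightarrow> bool" where
  "cond_G1 \<Omega> s \<gamma> c J B G \<longleftrightarrow>
     (\<forall>f\<in>L2 \<Omega>. is_green_op \<Omega> J B f (green_fun \<Omega> G f)) \<and>
     (\<lambda>(x, y). G x y) \<in> borel_measurable (restrict_space borel (off_diag \<Omega>)) \<and>
     (\<forall>(x, y)\<in>off_diag \<Omega>. 0 < G x y \<and> G x y = G y x) \<and>
     (\<forall>(x, y)\<in>off_diag \<Omega>.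
        inverse c * green_bound \<Omega> s \<gamma> x y \<le> G x y \<and> G x y \<le> c * green_bound \<Omega> s \<gamma> x y)"

definition cond_G2 :: "'a::euclidean_space set \<Rightarrow> ('a \<Rightarrow> 'a \<Rightarrow> real) \<Rightarrow> bool" where
  "cond_G2 \<Omega> G \<longleftrightarrow> continuous_on (off_diag \<Omega>) (\<lambda>(x, y). G x y)"

definition cond_G3 :: "'a::euclidean_space set \<Rightarrow> real \<Rightarrow> ('a \<Rightarrow> 'a \<Rightarrow> real) \<Rightarrow> bool" where
  "cond_G3 \<Omega> \<gamma> G \<longleftrightarrow>
     (\<exists>M :: 'a \<Rightarrow> 'a \<Rightarrow> real.
        (\<forall>x0\<in>\<Omega>. \<forall>z0\<in>frontier \<Omega>. 0 < M x0 z0 \<and>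
           ((\<lambda>(x, y). G x y / bdist \<Omega> y powr \<gamma>) \<longlongrightarrow> M x0 z0) (at (x0, z0) within off_diag \<Omega>)) \<and>
        continuous_on (\<Omega> \<times> frontier \<Omega>) (\<lambda>(x, z). M x z))"


section \<open>Signed Radon measures\<close>

text \<open>A signed Radon measure on \<open>\<Omega>\<close> need not have a finite total variation, so it is not a
  set function on all Borel sets. It is represented by its Jordan decomposition: the pair of its
  positive and negative parts, two locally finite, mutually singular Borel measures on
  \<open>\<Omega>\<close>. (Local finiteness implies regularity in an open subset of a Euclidean space.)\<close>

type_synonym 'a signed_measure = "'a measure \<times> 'a measure"

abbreviation pos_part :: "'a signed_measure \<Rightarrow> 'a measure" where "pos_part \<equiv> fst"
abbreviation neg_part :: "'a signed_measure \<Rightarrow> 'a measure" where "neg_part \<equiv> snd"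

definition radon_on :: "'a::euclidean_space set \<Rightarrow> 'a measure \<Rightarrow> bool" where
  "radon_on \<Omega> M \<longleftrightarrow> sets M = sets (restrict_space borel \<Omega>) \<and>
     (\<forall>K. compact K \<and> K \<subseteq> \<Omega> \<longrightarrow> emeasure M K < \<infinity>)"

definition signed_radon :: "'a::euclidean_space set \<Rightarrow> 'a signed_measure set" where
  "signed_radon \<Omega> = {\<mu>. radon_on \<Omega> (pos_part \<mu>) \<and> radon_on \<Omega> (neg_part \<mu>) \<and>
     (\<exists>A\<in>sets (restrict_space borel \<Omega>).
        emeasure (pos_part \<mu>) (\<Omega> - A) = 0 \<and> emeasure (neg_part \<mu>) A = 0)}"

definition total_var :: "'a signed_measure \<Rightarrow> 'a set \<Rightarrow> ennreal" where
  "total_var \<mu> E = emeasure (pos_part \<mu>) E + emeasure (neg_part \<mu>) E"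

definition signed_integral :: "'a signed_measure \<Rightarrow> ('a \<Rightarrow> real) \<Rightarrow> real" where
  "signed_integral \<mu> f = (\<integral>x. f x \<partial>pos_part \<mu>) - (\<integral>x. f x \<partial>neg_part \<mu>)"

definition meas_weighted :: "'a::euclidean_space set \<Rightarrow> real \<Rightarrow> 'a signed_measure set" where
  "meas_weighted \<Omega> \<gamma> = {\<mu> \<in> signed_radon \<Omega>.
     (\<integral>\<^sup>+x. ennreal (bdist \<Omega> x powr \<gamma>) \<partial>pos_part \<mu>)
       + (\<integral>\<^sup>+x. ennreal (bdist \<Omega> x powr \<gamma>) \<partial>neg_part \<mu>) < \<infinity>}"

definition meas_weighted_norm :: "'a::euclidean_space set \<Rightarrow> real \<Rightarrow> 'a signed_measure \<Rightarrow> real" where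
  "meas_weighted_norm \<Omega> \<gamma> \<mu> =
     (\<integral>x. bdist \<Omega> x powr \<gamma> \<partial>pos_part \<mu>) + (\<integral>x. bdist \<Omega> x powr \<gamma> \<partial>neg_part \<mu>)"

text \<open>The signed measure \<open>\<nu>\<close> with \<open>d\<nu> = \<delta>^\<gamma> d\<mu>\<close>.\<close>

definition weighted_meas :: "'a::euclidean_space set \<Rightarrow> real \<Rightarrow> 'a signed_measure \<Rightarrow> 'a signed_measure" where
  "weighted_meas \<Omega> \<gamma> \<mu> =
     (density (pos_part \<mu>) (\<lambda>x. ennreal (bdist \<Omega> x powr \<gamma>)),
      density (neg_part \<mu>) (\<lambda>x. ennreal (bdist \<Omega> x powr \<gamma>)))"


section \<open>Bessel kernels and capacities\<close>

definition schwartz :: "('a::euclidean_space \<Rightarrow> complex) set" where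
  "schwartz = {\<phi>. smooth \<phi> \<and>
     (\<forall>m vs. set vs \<subseteq> Basis \<longrightarrow> bounded (range (\<lambda>x. norm x ^ m *\<^sub>R partials vs \<phi> x)))}"

definition fourier :: "('a::euclidean_space \<Rightarrow> complex) \<Rightarrow> 'a \<Rightarrow> complex" where
  "fourier \<phi> \<xi> = (\<integral>x. cis (- (x \<bullet> \<xi>)) * \<phi> x \<partial>lborel)"

text \<open>A function acts as a tempered distribution by integration against Schwartz functions.\<close>

definition tempered_fun :: "('a::euclidean_space \<Rightarrow> complex) \<Rightarrow> bool" where
  "tempered_fun k \<longleftrightarrow> k \<in> borel_measurable borel \<and>
     (\<forall>\<phi>\<in>schwartz. integrable lborel (\<lambda>x. k x * \<phi> x))"

text \<open>The Fourier transform of the tempered distribution \<open>k\<close>, which by definition acts on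
  \<open>\<phi>\<close> as \<open>k\<close> acts on the Fourier transform of \<open>\<phi>\<close>, is the tempered
  distribution \<open>m\<close>.\<close>

definition has_tempered_fourier ::
    "('a::euclidean_space \<Rightarrow> complex) \<Rightarrow> ('a \<Rightarrow> complex) \<Rightarrow> bool" where
  "has_tempered_fourier k m \<longleftrightarrow> tempered_fun k \<and> tempered_fun m \<and>
     (\<forall>\<phi>\<in>schwartz. (\<integral>x. k x * fourier \<phi> x \<partial>lborel) = (\<integral>\<xi>. m \<xi> * \<phi> \<xi> \<partial>lborel))"

text \<open>The inverse Fourier transform determines the Bessel kernel up to a null set; a nonnegative
  representative is chosen. Convolutions do not depend on this choice.\<close>

definition bessel_kernel :: "real \<Rightarrow> 'a::euclidean_space \<Rightarrow> real" where
  "bessel_kernel \<alpha> = (SOME k. (\<forall>x. 0 \<le> k x) \<and>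
     has_tempered_fourier (\<lambda>x. complex_of_real (k x))
       (\<lambda>\<xi>. complex_of_real ((1 + (norm \<xi>)\<^sup>2) powr (- \<alpha> / 2))))"

definition bessel_potential :: "real \<Rightarrow> ('a::euclidean_space \<Rightarrow> real) \<Rightarrow> 'a \<Rightarrow> ennreal" where
  "bessel_potential \<alpha> h x = (\<integral>\<^sup>+y. ennreal (bessel_kernel \<alpha> (x - y) * h y) \<partial>lebesgue)"

definition bessel_cap_compact :: "real \<Rightarrow> real \<Rightarrow> 'a::euclidean_space set \<Rightarrow> ennreal" where
  "bessel_cap_compact \<alpha> q E =
     (INF h\<in>{h \<in> borel_measurable lebesgue. (\<forall>x. 0 \<le> h x) \<and>
              integrable lebesgue (\<lambda>x. h x powr q) \<and>
              (\<forall>x. indicator E x \<le> bessel_potential \<alpha> h x)}.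
        \<integral>\<^sup>+x. ennreal (h x powr q) \<partial>lebesgue)"

definition bessel_cap_open :: "real \<Rightarrow> real \<Rightarrow> 'a::euclidean_space set \<Rightarrow> ennreal" where
  "bessel_cap_open \<alpha> q U = (SUP K\<in>{K. compact K \<and> K \<subseteq> U}. bessel_cap_compact \<alpha> q K)"

definition bessel_cap :: "real \<Rightarrow> real \<Rightarrow> 'a::euclidean_space set \<Rightarrow> ennreal" where
  "bessel_cap \<alpha> q E =
     (if compact E then bessel_cap_compact \<alpha> q E
      else if open E then bessel_cap_open \<alpha> q E
      else (INF U\<in>{U. open U \<and> E \<subseteq> U}. bessel_cap_open \<alpha> q U))"

definition abs_cont_bessel_cap ::
    "'a::euclidean_space set \<Rightarrow> real \<Rightarrow> real \<Rightarrow> 'a signed_measure \<Rightarrow> bool" where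
  "abs_cont_bessel_cap \<Omega> \<alpha> q \<nu> \<longleftrightarrow>
     (\<forall>E\<in>sets borel. E \<subseteq> \<Omega> \<and> bessel_cap \<alpha> q E = 0 \<longrightarrow> total_var \<nu> E = 0)"


section \<open>Weak-dual solutions\<close>

definition weak_dual_solution ::
    "'a::euclidean_space set \<Rightarrow> real \<Rightarrow> ('a \<Rightarrow> 'a \<Rightarrow> real) \<Rightarrow> real \<Rightarrow> 'a signed_measure \<Rightarrow> ('a \<Rightarrow> real) \<Rightarrow> bool" where
  "weak_dual_solution \<Omega> \<gamma> G p \<mu> u \<longleftrightarrow>
     u \<in> L1_weighted \<Omega> \<gamma> \<and> (\<lambda>x. \<bar>u x\<bar> powr p) \<in> L1_weighted \<Omega> \<gamma> \<and>
     (\<forall>\<xi>\<in>Linf_weighted \<Omega> \<gamma>.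
        (\<integral>x. u x * \<xi> x \<partial>lebesgue_on \<Omega>)
        + (\<integral>x. \<bar>u x\<bar> powr (p - 1) * u x * green_fun \<Omega> G \<xi> x \<partial>lebesgue_on \<Omega>)
        = signed_integral \<mu> (green_fun \<Omega> G \<xi>))"

end

theory Submission
 imports Defs "HOL-Probability.Probability"
begin

text \<open>
Put \<open>dm = \<delta>^\<gamma> dx\<close> and \<open>k(x,y) = G(x,y) / \<delta>(y)^\<gamma>\<close>, so that the Green potential of \<open>\<mu>\<close> is
\<open>\<integral> k d\<nu>\<close>. By Fubini, weak-dual solutions are the functions with \<open>u + G[|u|^{p-1}u] = G[\<mu>]\<close> almost
everywhere.

Testing the energy form with smooth approximations of the sign of \<open>u = G[f]\<close> gives Kato's
inequality \<open>\<integral> |u| \<delta>^\<gamma> \<le> \<integral> sgn(u) f G[\<delta>^\<gamma>]\<close>. It survives \<open>L^1\<close> limits and hence holds for measures;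
it implies the two-sided bound, the a priori estimate, uniqueness and the stability of solutions
in \<open>L^1(m)\<close>. Equations with truncated (Lipschitz) nonlinearities are solved by increasing the
Lipschitz constant in small steps, and the truncation is removed when \<open>G[|\<mu>|]\<close> lies in \<open>L^p(m)\<close>.

The capacity enters through the adjoint map \<open>T h(y) = \<integral> k(x,y) h(x) dm(x)\<close> on \<open>L^{p'}(m)\<close>. The two-sided
bound on \<open>G\<close> dominates \<open>T h\<close> by a Bessel potential of order \<open>2s - \<gamma>/p'\<close> of an \<open>L^{p'}\<close> function, so
compact subsets of \<open>{T h = \<infinity>}\<close> have capacity zero and \<open>T h\<close> is finite \<open>\<nu>\<close>-almost everywhere. Nikishin's
argument improves this to a strong type bound of \<open>T\<close> on sets \<open>A_j\<close> exhausting \<open>\<Omega>\<close> up to a \<open>\<nu>\<close>-null set.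
By duality the potentials of \<open>\<mu>\<close> restricted to \<open>A_j\<close> lie in \<open>L^p(m)\<close>, and the corresponding solutions
converge by stability.
\<close>

text \<open>Dividing by \<delta>^\<gamma> normalises the kernel: its columns have
  \<open>m\<close>-mass between two numbers \<open>lc\<close> and \<open>Lc\<close> depending only
  on \<Omega>, s, \<gamma> and the comparison constant. The nonlinearity enters the estimates
  through monotonicity alone, so these two numbers give a constant that is the same for all p.
  Kato's inequality is available only for data in L^2, so measures are mollified at the scale of the
  distance to the boundary; joint continuity of G makes the potentials converge in L^1(m). The order
  2s - \<gamma>/p' comes from splitting \<delta>^\<gamma> into the powers \<gamma>/p' and \<gamma>(1
  - 1/p'). The first turns h in L^{p'}(m) into an L^{p'} function for Lebesgue measure, the second
  is traded for |x-y|^{-\<gamma>/p'} in the kernel bound. Capacity gives only qualitative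
  finiteness, whereas solvability asks for potentials in L^p(m); a quantitative bound off small sets
  closes this gap. The Bessel kernel is known only through its Fourier transform. Its lower bound
  needs an explicit model, the subordinated heat kernel, and a uniqueness theorem identifying the
  two.\<close>

text \<open>Henstock--Kurzweil facts of the same names shadow these.\<close>

lemmas int_add = Bochner_Integration.integrable_add
 and int_diff = Bochner_Integration.integrable_diff
 and int_bound = Bochner_Integration.integrable_bound
 and LINT_cong = Bochner_Integration.integral_cong

section \<open>Smooth functions\<close>

text \<open>The recursion of \<open>partials\<close> peels off the outermost derivative. Inductions
  on the order of differentiability need the innermost one, which changes the function and keeps the
  rest of the list.\<close>

lemma partials_snoc: "partials (vs @ [j]) f = partials vs (partials [j] f)"
 by (induction vs) auto

lemma Ck_0: "Ck 0 f \<longleftrightarrow> continuous_on UNIV f"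
 by (auto simp: Ck_def)

text \<open>Turns the definition over all lists of directions into a recursion in \<open>k\<close>:
  splitting a list at its last entry replaces \<open>f\<close> by a partial derivative of one order
  less. The closure rules below are inductions along this recursion.\<close>

lemma Ck_Suc:
 "Ck (Suc k) f \<longleftrightarrow> (\<forall>x. f differentiable (at x)) \<and> (\<forall>j\<in>Basis. Ck k (partials [j] f))"
 (is "?L \<longleftrightarrow> ?R")
proof
 assume L: ?L
 show ?R
 proof (intro conjI ballI allI)
  show "f differentiable at x" for x using L unfolding Ck_def by (auto dest: spec[of _ "[]"])
  fix j :: 'a assume "j \<in> Basis"
  then show "Ck k (partials [j] f)"
   using L unfolding Ck_def partials_snoc[symmetric] by auto
 qed
next
 assume R: ?R
 have c: "continuous_on UNIV f"
  using R by (auto intro!: continuous_at_imp_continuous_on differentiable_imp_continuous_within)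
 show ?L
  unfolding Ck_def
 proof (intro conjI allI impI)
  fix vs :: "'a list" and x
  assume vs: "set vs \<subseteq> Basis \<and> length vs < Suc k"
  show "partials vs f differentiable at x"
  proof (cases vs rule: rev_cases)
   case (snoc ws j)
   then show ?thesis using R vs unfolding snoc partials_snoc Ck_def by auto
  qed (use R in auto)
 next
  fix vs :: "'a list"
  assume vs: "set vs \<subseteq> Basis \<and> length vs \<le> Suc k"
  show "continuous_on UNIV (partials vs f)"
  proof (cases vs rule: rev_cases)
   case (snoc ws j)
   then show ?thesis using R vs unfolding snoc partials_snoc Ck_def by auto
  qed (use c in auto)
 qed
qed

lemma partials1_eq:
 assumes "\<And>x. (f has_derivative f' x) (at x)"
 shows "partials [j] f = (\<lambda>x. f' x j)"
 using frechet_derivative_at[OF assms] by (auto simp: fun_eq_iff)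

lemma Ck_SucI:
 assumes "\<And>x. (f has_derivative f' x) (at x)" "\<And>j. j \<in> Basis ==> Ck k (\<lambda>x. f' x j)"
 shows "Ck (Suc k) f"
 unfolding Ck_Suc using assms(2) by (auto simp: partials1_eq[OF assms(1), simplified] intro!: differentiableI assms(1))

lemma Ck_Suc_derivative:
 assumes "Ck (Suc k) f"
 shows "(f has_derivative frechet_derivative f (at x)) (at x)"
  "j \<in> Basis ==> Ck k (\<lambda>x. frechet_derivative f (at x) j)"
 using assms unfolding Ck_Suc by (auto simp: frechet_derivative_works)

lemma Ck_SucD: "Ck (Suc k) f ==> Ck k f"
 unfolding Ck_def by auto

lemma Ck_continuous: "Ck k f ==> continuous_on UNIV f"
 unfolding Ck_def by (auto dest: spec[of _ "[]"])

lemma Ck_const: "Ck k (\<lambda>x. c)"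
proof (induction k arbitrary: c)
 case (Suc k)
 show ?case by (rule Ck_SucI[where f'="\<lambda>_ _. 0"]) (use Suc in auto)
qed (auto simp: Ck_0)

lemma Ck_add: "Ck k f ==> Ck k g ==> Ck k (\<lambda>x. f x + g x)"
proof (induction k arbitrary: f g)
 case (Suc k)
 show ?case
  by (rule Ck_SucI, rule has_derivative_add[OF Ck_Suc_derivative(1) Ck_Suc_derivative(1)])
   (use Suc in \<open>auto intro: Ck_Suc_derivative\<close>)
qed (auto simp: Ck_0 intro: continuous_intros)

lemma Ck_mult:
 fixes f g :: "'a::euclidean_space => 'b::real_normed_algebra"
 shows "Ck k f ==> Ck k g ==> Ck k (\<lambda>x. f x * g x)"
proof (induction k arbitrary: f g)
 case (Suc k)
 show ?case
  by (rule Ck_SucI, rule has_derivative_mult[OF Ck_Suc_derivative(1) Ck_Suc_derivative(1)])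
   (use Suc in \<open>auto intro!: Ck_add Suc.IH Ck_Suc_derivative dest: Ck_SucD\<close>)
qed (auto simp: Ck_0 intro: continuous_intros)

text \<open>The exponent has to vary in the induction, since differentiating lowers it by one.
  Positivity of \<open>f\<close> keeps every such power smooth.\<close>

lemma Ck_powr:
 fixes f :: "'a::euclidean_space => real"
 assumes "Ck k f" "\<And>x. f x > 0"
 shows "Ck k (\<lambda>x. f x powr a)"
 using assms
proof (induction k arbitrary: f a)
 case (Suc k)
 show ?case
 proof (rule Ck_SucI)
  show "((\<lambda>x. f x powr a) has_derivative (\<lambda>h. a * (f x powr (a - 1) * frechet_derivative f (at x) h))) (at x)" for x
  proof -
   have "((\<lambda>x. f x powr a) has_derivative (\<lambda>h. (f x powr a) * (0 * ln (f x) + frechet_derivative f (at x) h * a / f x))) (at x)"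
    by (rule has_derivative_powr[OF Ck_Suc_derivative(1)[OF Suc.prems(1)]]) (use Suc.prems in auto)
   moreover have "(f x powr a) * (0 * ln (f x) + frechet_derivative f (at x) h * a / f x)
     = a * (f x powr (a - 1) * frechet_derivative f (at x) h)" for h
    using Suc.prems(2)[of x] by (simp add: powr_diff field_simps)
   ultimately show ?thesis by simp
  qed
  show "Ck k (\<lambda>x. a * (f x powr (a - 1) * frechet_derivative f (at x) j))" if "j \<in> Basis" for j
   using Suc that by (intro Ck_mult Ck_const Suc.IH) (auto intro: Ck_Suc_derivative dest: Ck_SucD)
 qed
next
 case 0
 then show ?case unfolding Ck_0
  by (intro continuous_intros) (auto simp: less_imp_neq[THEN not_sym])
qed

lemma Cc_smoothI:
 assumes "smooth f" "\<phi> \<in> Cc_smooth \<Omega>" "\<And>x. \<phi> x = 0 ==> f x = 0"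
 shows "f \<in> Cc_smooth \<Omega>"
proof -
 have "closure {x. f x \<noteq> 0} \<subseteq> closure {x. \<phi> x \<noteq> 0}" using assms(3) by (intro closure_mono) auto
 then show ?thesis
  using assms compact_Int_closed[OF _ closed_closure, of "closure {x. \<phi> x \<noteq> 0}" "{x. f x \<noteq> 0}"]
  unfolding Cc_smooth_def by (auto simp: inf.absorb2)
qed

text \<open>Smooth versions of sign and modulus, t / sqrt(t^2 + e^2) and sqrt(t^2 + e^2) - e; the
  first is the derivative of the second. Subtracting \<open>e\<close> makes the modulus vanish at 0,
  so that composition preserves compact support. They are written with \<open>powr\<close> so that
  \<open>Ck_powr\<close> applies.\<close>

definition asgn :: "real => real => real" where "asgn e t = t * (t\<^sup>2 + e\<^sup>2) powr (- 1 / 2)"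
definition aabs :: "real => real => real" where "aabs e t = (t\<^sup>2 + e\<^sup>2) powr (1 / 2) - e"

lemma smooth_sq_add:
 assumes "smooth \<phi>" shows "Ck k (\<lambda>x. (\<phi> x)\<^sup>2 + e\<^sup>2 :: real)"
 unfolding power2_eq_square using assms by (intro Ck_add Ck_mult Ck_const) (auto simp: smooth_def)

lemma aabs_Cc_smooth:
 assumes "\<phi> \<in> Cc_smooth \<Omega>" "e > 0" shows "(\<lambda>x. aabs e (\<phi> x)) \<in> Cc_smooth \<Omega>"
proof (rule Cc_smoothI[OF _ assms(1)])
 have s: "smooth \<phi>" using assms by (simp add: Cc_smooth_def)
 have "Ck k (\<lambda>x. ((\<phi> x)\<^sup>2 + e\<^sup>2) powr (1 / 2) + - e)" for k
  by (intro Ck_add Ck_const Ck_powr smooth_sq_add s) (use assms in \<open>simp add: add_nonneg_pos\<close>)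
 then show "smooth (\<lambda>x. aabs e (\<phi> x))" by (simp add: smooth_def aabs_def)
 show "aabs e (\<phi> x) = 0" if "\<phi> x = 0" for x
  using that assms by (simp add: aabs_def powr_half_sqrt)
qed

lemma asgn_Cc_smooth:
 assumes "\<phi> \<in> Cc_smooth \<Omega>" "\<eta> \<in> Cc_smooth \<Omega>" "e > 0"
 shows "(\<lambda>x. asgn e (\<phi> x) * \<eta> x) \<in> Cc_smooth \<Omega>"
proof (rule Cc_smoothI[OF _ assms(1)])
 have s: "smooth \<phi>" "smooth \<eta>" using assms by (simp_all add: Cc_smooth_def)
 have "Ck k (\<lambda>x. \<phi> x * ((\<phi> x)\<^sup>2 + e\<^sup>2) powr (- 1 / 2) * \<eta> x)" for k
  by (intro Ck_mult Ck_powr smooth_sq_add) (use s assms in \<open>auto simp: smooth_def add_nonneg_pos\<close>)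
 then show "smooth (\<lambda>x. asgn e (\<phi> x) * \<eta> x)" by (simp add: smooth_def asgn_def)
qed (auto simp: asgn_def)

lemma Cc_smooth_bounded:
 assumes "\<phi> \<in> Cc_smooth \<Omega>" obtains K where "\<And>x. \<bar>\<phi> x\<bar> \<le> K" "K > 0"
proof -
 have c: "continuous_on UNIV \<phi>" using assms by (auto simp: Cc_smooth_def smooth_def intro: Ck_continuous)
 have "compact (\<phi> ` closure {x. \<phi> x \<noteq> 0})"
  using assms by (intro compact_continuous_image) (auto simp: Cc_smooth_def intro: continuous_on_subset[OF c])
 then obtain K where K: "\<forall>y\<in>\<phi> ` closure {x. \<phi> x \<noteq> 0}. norm y \<le> K" "K > 0"
  using compact_imp_bounded bounded_pos by metis
 have "\<bar>\<phi> x\<bar> \<le> K" for x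
 proof (cases "\<phi> x = 0")
  case False
  then have "x \<in> closure {x. \<phi> x \<noteq> 0}" using closure_subset by fastforce
  then show ?thesis using K by auto
 qed (use K in auto)
 with K show ?thesis using that by blast
qed

text \<open>Provides the bound by |x-y|^2 that the second moment condition on \<open>J\<close>
  integrates. The first partials are continuous and vanish off the support, hence are bounded, and
  the sum of their bounds controls the operator norm of the derivative.\<close>

lemma Cc_smooth_Lipschitz:
 fixes \<phi> :: "'a::euclidean_space => real"
 assumes "\<phi> \<in> Cc_smooth \<Omega>" obtains K where "\<And>x y. \<bar>\<phi> x - \<phi> y\<bar> \<le> K * norm (x - y)" "K > 0"
proof -
 have C1: "Ck (Suc 0) \<phi>" using assms by (auto simp: Cc_smooth_def smooth_def)
 have d: "(\<phi> has_derivative frechet_derivative \<phi> (at x)) (at x)" for x using Ck_Suc_derivative(1)[OF C1] .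
 let ?S = "closure {x. \<phi> x \<noteq> 0}"
 have b: "\<exists>K. \<forall>x. \<bar>frechet_derivative \<phi> (at x) j\<bar> \<le> K" if j: "j \<in> Basis" for j
 proof -
  have c: "continuous_on UNIV (\<lambda>x. frechet_derivative \<phi> (at x) j)"
   using Ck_Suc_derivative(2)[OF C1 j] by (simp add: Ck_0)
  have "compact ((\<lambda>x. frechet_derivative \<phi> (at x) j) ` ?S)"
   using assms by (intro compact_continuous_image) (auto simp: Cc_smooth_def intro: continuous_on_subset[OF c])
  then obtain K where K: "\<forall>y\<in>(\<lambda>x. frechet_derivative \<phi> (at x) j) ` ?S. norm y \<le> K" "K > 0"
   using compact_imp_bounded bounded_pos by metis
  have "\<bar>frechet_derivative \<phi> (at x) j\<bar> \<le> K" for x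
  proof (cases "x \<in> ?S")
   case False
   \<comment> \<open>Off the closed support the function is locally zero, so its derivative is zero
     there.\<close>
   have "((\<lambda>_. 0) has_derivative (\<lambda>_. 0)) (at x)" by simp
   then have "(\<phi> has_derivative (\<lambda>_. 0)) (at x)"
   proof (rule has_derivative_transform_within_open)
    show "0 = \<phi> y" if "y \<in> - ?S" for y using that closure_subset[of "{x. \<phi> x \<noteq> 0}"] by auto
   qed (use False in auto)
   from frechet_derivative_at[OF this] show ?thesis using K by (metis abs_zero less_imp_le)
  qed (use K in auto)
  then show ?thesis by blast
 qed
 then obtain K where K: "\<And>j x. j \<in> Basis ==> \<bar>frechet_derivative \<phi> (at x) j\<bar> \<le> K j" by metis
 define M where "M = (\<Sum>j\<in>Basis. \<bar>K j\<bar>) + 1"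
 have on: "onorm (frechet_derivative \<phi> (at x)) \<le> M" for x
 proof (rule onorm_le)
  fix h :: 'a
  have lin: "linear (frechet_derivative \<phi> (at x))" using d has_derivative_linear by blast
  have "frechet_derivative \<phi> (at x) h = frechet_derivative \<phi> (at x) (\<Sum>j\<in>Basis. (h \<bullet> j) *\<^sub>R j)"
   by (simp add: euclidean_representation)
  also have "... = (\<Sum>j\<in>Basis. (h \<bullet> j) *\<^sub>R frechet_derivative \<phi> (at x) j)"
   by (simp add: linear_sum[OF lin] linear_scale[OF lin])
  also have "norm ... \<le> (\<Sum>j\<in>Basis. \<bar>K j\<bar> * norm h)"
  proof (rule sum_norm_le)
   fix j :: 'a assume j: "j \<in> Basis"
   show "norm ((h \<bullet> j) *\<^sub>R frechet_derivative \<phi> (at x) j) \<le> \<bar>K j\<bar> * norm h"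
    unfolding norm_scaleR real_norm_def
    using mult_mono[of "\<bar>h \<bullet> j\<bar>" "norm h" "\<bar>frechet_derivative \<phi> (at x) j\<bar>" "\<bar>K j\<bar>"]
     K[OF j, of x] Basis_le_norm[OF j, of h] by (auto simp: abs_mult mult.commute)
  qed
  also have "... \<le> M * norm h" by (simp add: M_def sum_distrib_right[symmetric] distrib_right)
  finally show "norm (frechet_derivative \<phi> (at x) h) \<le> M * norm h" .
 qed
 have "norm (\<phi> x - \<phi> y) \<le> M * norm (x - y)" for x y
  by (rule differentiable_bound[where S=UNIV]) (use d on in \<open>auto intro: has_derivative_at_withinI\<close>)
 moreover have "M > 0" unfolding M_def by (intro add_nonneg_pos sum_nonneg) auto
 ultimately show ?thesis using that by auto
qed

section \<open>Gaussians as Schwartz functions\<close>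

inductive_set cpoly :: "('a::euclidean_space => complex) set" where
 const: "(\<lambda>x. c) \<in> cpoly"
| coord: "(\<lambda>x. complex_of_real (x \<bullet> i)) \<in> cpoly"
| add: "f \<in> cpoly ==> g \<in> cpoly ==> (\<lambda>x. f x + g x) \<in> cpoly"
| mult: "f \<in> cpoly ==> g \<in> cpoly ==> (\<lambda>x. f x * g x) \<in> cpoly"

lemma cpoly_derivative:
 assumes "f \<in> cpoly"
 shows "\<exists>f'. (\<forall>x. (f has_derivative f' x) (at x)) \<and> (\<forall>j. (\<lambda>x. f' x j) \<in> cpoly)"
 using assms
proof induction
 case (const c)
 then show ?case by (intro exI[of _ "\<lambda>_ _. 0"]) (auto intro: cpoly.const)
next
 case (coord i)
 show ?case
  by (intro exI[of _ "\<lambda>_ h. complex_of_real (h \<bullet> i)"]) (auto intro!: cpoly.const derivative_eq_intros)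
next
 case (add f g)
 then obtain f' g' where "\<forall>x. (f has_derivative f' x) (at x)" "\<forall>j. (\<lambda>x. f' x j) \<in> cpoly"
  "\<forall>x. (g has_derivative g' x) (at x)" "\<forall>j. (\<lambda>x. g' x j) \<in> cpoly" by metis
 then show ?case by (intro exI[of _ "\<lambda>x h. f' x h + g' x h"]) (auto intro!: cpoly.add has_derivative_add)
next
 case (mult f g)
 then obtain f' g' where "\<forall>x. (f has_derivative f' x) (at x)" "\<forall>j. (\<lambda>x. f' x j) \<in> cpoly"
  "\<forall>x. (g has_derivative g' x) (at x)" "\<forall>j. (\<lambda>x. g' x j) \<in> cpoly" by metis
 then show ?case using mult
  by (intro exI[of _ "\<lambda>x h. f x * g' x h + f' x h * g x"]) (auto intro!: cpoly.intros has_derivative_mult)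
qed

lemma cpoly_growth:
 assumes "f \<in> cpoly" shows "\<exists>C\<ge>0. \<exists>n. \<forall>x. norm (f x) \<le> C * (1 + norm x) ^ n"
 using assms
proof induction
 case (const c)
 show ?case by (intro exI[of _ "norm c"] conjI exI[of _ 0]) auto
next
 case (coord i)
 have "\<bar>x \<bullet> i\<bar> \<le> norm i * (1 + norm x) ^ 1" for x
  using Cauchy_Schwarz_ineq2[of x i] by (simp add: algebra_simps) (smt (verit) norm_ge_zero)
 then show ?case by (intro exI[of _ "norm i"] conjI exI[of _ 1]) (auto simp del: power_one_right)
next
 case (add f g)
 then obtain C n D k where C: "0 \<le> C" "\<And>x. norm (f x) \<le> C * (1 + norm x) ^ n"
  and D: "0 \<le> D" "\<And>x. norm (g x) \<le> D * (1 + norm x) ^ k" by metis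
 have "norm (f x + g x) \<le> (C + D) * (1 + norm x) ^ (n + k)" for x
 proof -
  have "norm (f x + g x) \<le> C * (1 + norm x) ^ n + D * (1 + norm x) ^ k"
   using norm_triangle_mono[OF C(2) D(2)] .
  also have "... \<le> C * (1 + norm x) ^ (n + k) + D * (1 + norm x) ^ (n + k)"
   using C D by (intro add_mono mult_left_mono power_increasing) auto
  finally show ?thesis by (simp add: algebra_simps)
 qed
 then show ?case using C D by (intro exI[of _ "C + D"] conjI exI[of _ "n + k"]) auto
next
 case (mult f g)
 then obtain C n D k where C: "0 \<le> C" "\<And>x. norm (f x) \<le> C * (1 + norm x) ^ n"
  and D: "0 \<le> D" "\<And>x. norm (g x) \<le> D * (1 + norm x) ^ k" by metis
 have "norm (f x * g x) \<le> (C * D) * (1 + norm x) ^ (n + k)" for x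
  using mult_mono[OF C(2)[of x] D(2)[of x]] C by (simp add: norm_mult power_add algebra_simps)
 then show ?case using C D by (intro exI[of _ "C * D"] conjI exI[of _ "n + k"]) auto
qed

lemma power_le_fact_exp:
 fixes x :: real assumes "x \<ge> 0" shows "x ^ n \<le> fact n * exp x"
proof -
 have "x ^ n /\<^sub>R fact n \<le> (\<Sum>k. x ^ k /\<^sub>R fact k)"
  using sum_le_suminf[OF summable_exp_generic[of x], of "{n}"] assms by auto
 then show ?thesis by (simp add: exp_def field_simps)
qed

text \<open>A Gaussian modulated by the frequency \<open>a\<close>. Its Fourier transform is a
  Gaussian centred at \<open>a\<close>, so pairing with this family probes a tempered function by
  Gaussians around every point.\<close>

definition cgauss :: "real => 'a::euclidean_space => 'a => complex" where
 "cgauss t a x = exp (\<i> * complex_of_real (x \<bullet> a) - complex_of_real (t * (x \<bullet> x)))"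

lemma norm_cgauss: "norm (cgauss t a x) = exp (- t * (norm x)\<^sup>2)"
 by (simp add: cgauss_def dot_square_norm)

lemma cgauss_derivative:
 "(cgauss t a has_derivative (\<lambda>h. cgauss t a x * (\<i> * complex_of_real (h \<bullet> a) - complex_of_real (2 * t) * complex_of_real (x \<bullet> h)))) (at x)"
proof -
 have "((\<lambda>x. \<i> * complex_of_real (x \<bullet> a) - complex_of_real (t * (x \<bullet> x))) has_derivative
  (\<lambda>h. \<i> * complex_of_real (h \<bullet> a) - complex_of_real (2 * t) * complex_of_real (x \<bullet> h))) (at x)"
  by (auto intro!: derivative_eq_intros simp: inner_commute fun_eq_iff)
 from has_derivative_compose[OF this DERIV_exp[unfolded has_field_derivative_def]] show ?thesis
  unfolding cgauss_def[abs_def] by (simp add: mult.commute)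
qed

lemma cpoly_cgauss_partial:
 assumes "f \<in> cpoly"
 shows "\<exists>g\<in>cpoly. partials [j] (\<lambda>x. f x * cgauss t a x) = (\<lambda>x. g x * cgauss t a x)"
  and "(\<lambda>x. f x * cgauss t a x) differentiable (at x)"
proof -
 obtain f' where f': "\<forall>x. (f has_derivative f' x) (at x)" "\<forall>j. (\<lambda>x. f' x j) \<in> cpoly"
  using cpoly_derivative[OF assms] by blast
 have d: "((\<lambda>x. f x * cgauss t a x) has_derivative (\<lambda>h. f x * (cgauss t a x * (\<i> * complex_of_real (h \<bullet> a) - complex_of_real (2 * t) * complex_of_real (x \<bullet> h))) + f' x h * cgauss t a x)) (at x)" for x
  by (rule has_derivative_mult[OF f'(1)[rule_format] cgauss_derivative])
 show "(\<lambda>x. f x * cgauss t a x) differentiable (at x)" using d by (rule differentiableI)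
 show "\<exists>g\<in>cpoly. partials [j] (\<lambda>x. f x * cgauss t a x) = (\<lambda>x. g x * cgauss t a x)"
 proof (intro bexI[of _ "\<lambda>x. f x * (\<i> * complex_of_real (j \<bullet> a) + (- complex_of_real (2 * t)) * complex_of_real (x \<bullet> j)) + f' x j"])
  show "partials [j] (\<lambda>x. f x * cgauss t a x) = (\<lambda>x. (f x * (\<i> * complex_of_real (j \<bullet> a) + (- complex_of_real (2 * t)) * complex_of_real (x \<bullet> j)) + f' x j) * cgauss t a x)"
   by (subst partials1_eq[OF d]) (auto simp: fun_eq_iff algebra_simps)
  show "(\<lambda>x. f x * (\<i> * complex_of_real (j \<bullet> a) + (- complex_of_real (2 * t)) * complex_of_real (x \<bullet> j)) + f' x j) \<in> cpoly"
   by (intro cpoly.add cpoly.mult cpoly.const cpoly.coord assms f'(2)[rule_format])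
 qed
qed

lemma cpoly_cgauss_partials:
 assumes "f \<in> cpoly"
 shows "\<exists>g\<in>cpoly. partials vs (\<lambda>x. f x * cgauss t a x) = (\<lambda>x. g x * cgauss t a x)"
proof (induction vs)
 case Nil
 then show ?case using assms by auto
next
 case (Cons j vs)
 then obtain g where g: "g \<in> cpoly" "partials vs (\<lambda>x. f x * cgauss t a x) = (\<lambda>x. g x * cgauss t a x)" by blast
 then have "partials (j # vs) (\<lambda>x. f x * cgauss t a x) = partials [j] (\<lambda>x. g x * cgauss t a x)" by simp
 with cpoly_cgauss_partial(1)[OF g(1), of j t a] show ?case by metis
qed

text \<open>Every iterated partial is a polynomial times the same Gaussian. The polynomial and the
  moment are absorbed into a factorial times exp(1 + |x|), and the quadratic exponent beats the
  linear one.\<close>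

lemma cgauss_schwartz:
 fixes a :: "'a::euclidean_space"
 assumes "t > 0" shows "cgauss t a \<in> schwartz"
proof -
 have P: "\<exists>g\<in>cpoly. partials vs (cgauss t a) = (\<lambda>x. g x * cgauss t a x)" for vs
  using cpoly_cgauss_partials[OF cpoly.const[of 1], of vs t a] by simp
 have D: "partials vs (cgauss t a) differentiable (at x)" for vs x
  using P[of vs] cpoly_cgauss_partial(2) by metis
 have "smooth (cgauss t a)"
  unfolding smooth_def Ck_def using D
  by (auto intro!: continuous_at_imp_continuous_on differentiable_imp_continuous_within)
 moreover have "bounded (range (\<lambda>x. norm x ^ m *\<^sub>R partials vs (cgauss t a) x))" for m vs
 proof -
  obtain g where g: "g \<in> cpoly" "partials vs (cgauss t a) = (\<lambda>x. g x * cgauss t a x)" using P by blast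
  obtain C n where C: "C \<ge> 0" "\<And>x. norm (g x) \<le> C * (1 + norm x) ^ n" using cpoly_growth[OF g(1)] by blast
  have "norm (norm x ^ m *\<^sub>R partials vs (cgauss t a) x) \<le> C * (fact (m + n) * exp (1 + 1 / (4 * t)))" for x
  proof -
   have "norm (norm x ^ m *\<^sub>R partials vs (cgauss t a) x) = norm x ^ m * norm (g x) * exp (- t * (norm x)\<^sup>2)"
    by (simp add: g(2) norm_mult norm_cgauss)
   also have "... \<le> (1 + norm x) ^ m * (C * (1 + norm x) ^ n) * exp (- t * (norm x)\<^sup>2)"
    using C by (intro mult_right_mono mult_mono power_mono) auto
   also have "... = C * ((1 + norm x) ^ (m + n) * exp (- t * (norm x)\<^sup>2))" by (simp add: power_add)
   also have "... \<le> C * ((fact (m + n) * exp (1 + norm x)) * exp (- t * (norm x)\<^sup>2))"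
    using C by (intro mult_left_mono mult_right_mono power_le_fact_exp) auto
   also have "... = C * (fact (m + n) * exp (1 + norm x - t * (norm x)\<^sup>2))" by (simp add: exp_add exp_diff exp_minus field_simps)
   also have "... \<le> C * (fact (m + n) * exp (1 + 1 / (4 * t)))"
   proof -
    \<comment> \<open>Completing the square gives the maximum 1/(4t) of r - t r^2.\<close>
    have "0 \<le> t * (norm x - 1 / (2 * t))\<^sup>2" using assms by simp
    then have "norm x - t * (norm x)\<^sup>2 \<le> 1 / (4 * t)"
    proof -
     have "t * (norm x - 1 / (2 * t))\<^sup>2 = t * (norm x)\<^sup>2 - norm x + 1 / (4 * t)"
      using assms by (simp add: power2_eq_square field_simps)
     with \<open>0 \<le> t * (norm x - 1 / (2 * t))\<^sup>2\<close> show ?thesis by linarith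
    qed
    then show ?thesis using C by (intro mult_left_mono) auto
   qed
   finally show ?thesis .
  qed
  then show ?thesis unfolding bounded_iff by blast
 qed
 ultimately show ?thesis by (simp add: schwartz_def)
qed

section \<open>Monotone perturbations of Kato operators\<close>

text \<open>Fatou's lemma along the subsequence. The limit \<open>v\<close> is prescribed rather
  than constructed because the lemma is also applied to \<open>g (u n)\<close>, whose limit must be
  recognised as \<open>g v\<close> by continuity along a subsequence of \<open>u\<close>.\<close>

lemma L1_limit_of_AE_limit:
 fixes u :: "nat => 'a => real"
 assumes u: "\<And>n. integrable m (u n)"
  and C: "\<And>e. e > 0 ==> \<exists>N. \<forall>i\<ge>N. \<forall>j\<ge>N. (LINT x|m. \<bar>u i x - u j x\<bar>) < e"
  and r: "strict_mono r" and v[measurable]: "v \<in> borel_measurable m"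
  and ae: "AE x in m. (\<lambda>i. u (r i) x) \<longlonglongrightarrow> v x"
 shows "integrable m v" "(\<lambda>n. LINT x|m. \<bar>u n x - v x\<bar>) \<longlonglongrightarrow> 0"
proof -
 have um[measurable]: "u n \<in> borel_measurable m" for n using u by auto
 have key: "(\<integral>\<^sup>+x. ennreal \<bar>u n x - v x\<bar> \<partial>m) \<le> ennreal e"
  if e: "e > 0" and N: "\<forall>i\<ge>N. \<forall>j\<ge>N. (LINT x|m. \<bar>u i x - u j x\<bar>) < e" and n: "n \<ge> N" for e n N
 proof -
  have "(\<integral>\<^sup>+x. ennreal \<bar>u n x - v x\<bar> \<partial>m) = (\<integral>\<^sup>+x. liminf (\<lambda>i. ennreal \<bar>u n x - u (r i) x\<bar>) \<partial>m)"
  proof (rule nn_integral_cong_AE)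
   show "AE x in m. ennreal \<bar>u n x - v x\<bar> = liminf (\<lambda>i. ennreal \<bar>u n x - u (r i) x\<bar>)"
    using ae
   proof eventually_elim
    case (elim x)
    have "(\<lambda>i. ennreal \<bar>u n x - u (r i) x\<bar>) \<longlonglongrightarrow> ennreal \<bar>u n x - v x\<bar>"
     by (intro tendsto_ennrealI tendsto_intros elim)
    from lim_imp_Liminf[OF _ this] show ?case by simp
   qed
  qed
  also have "... \<le> liminf (\<lambda>i. \<integral>\<^sup>+x. ennreal \<bar>u n x - u (r i) x\<bar> \<partial>m)"
   by (intro nn_integral_liminf) auto
  also have "... \<le> ennreal e"
  proof (rule Liminf_le)
   show "\<forall>\<^sub>F i in sequentially. (\<integral>\<^sup>+x. ennreal \<bar>u n x - u (r i) x\<bar> \<partial>m) \<le> ennreal e"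
    unfolding eventually_sequentially
   proof (intro exI[of _ N] allI impI)
    fix i assume "N \<le> i"
    then have "N \<le> r i" using seq_suble[OF r, of i] by simp
    then have "(LINT x|m. \<bar>u n x - u (r i) x\<bar>) \<le> e" using N n by force
    then show "(\<integral>\<^sup>+x. ennreal \<bar>u n x - u (r i) x\<bar> \<partial>m) \<le> ennreal e"
     by (subst nn_integral_eq_integral) (auto intro!: u ennreal_leI)
   qed
  qed simp
  finally show ?thesis .
 qed
 obtain N where N: "\<forall>i\<ge>N. \<forall>j\<ge>N. (LINT x|m. \<bar>u i x - u j x\<bar>) < 1" using C[of 1] by auto
 have "integrable m (\<lambda>x. u N x - v x)"
  using key[OF _ N, of N] by (intro integrableI_bounded) (auto intro: le_less_trans)
 from int_diff[OF u[of N] this] show iv: "integrable m v" by simp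
 show "(\<lambda>n. LINT x|m. \<bar>u n x - v x\<bar>) \<longlonglongrightarrow> 0"
 proof (rule LIMSEQ_I)
  fix e :: real assume "0 < e"
  then have e: "e / 2 > 0" by simp
  obtain N where N: "\<forall>i\<ge>N. \<forall>j\<ge>N. (LINT x|m. \<bar>u i x - u j x\<bar>) < e / 2" using C[OF e] by auto
  have "norm ((LINT x|m. \<bar>u n x - v x\<bar>) - 0) < e" if "n \<ge> N" for n
  proof -
   have "ennreal (LINT x|m. \<bar>u n x - v x\<bar>) \<le> ennreal (e / 2)"
    using key[OF e N that] by (subst nn_integral_eq_integral[symmetric]) (auto intro!: u iv)
   then have "(LINT x|m. \<bar>u n x - v x\<bar>) \<le> e / 2" using e by (simp add: ennreal_le_iff)
   then show ?thesis using \<open>0 < e\<close> by simp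
  qed
  then show "\<exists>N. \<forall>n\<ge>N. norm ((LINT x|m. \<bar>u n x - v x\<bar>) - 0) < e" by blast
 qed
qed

lemma L1_Cauchy_converges:
 fixes u :: "nat => 'a => real"
 assumes u: "\<And>n. integrable m (u n)"
  and C: "\<And>e. e > 0 ==> \<exists>N. \<forall>i\<ge>N. \<forall>j\<ge>N. (LINT x|m. \<bar>u i x - u j x\<bar>) < e"
 obtains v r where "integrable m v" "(\<lambda>n. LINT x|m. \<bar>u n x - v x\<bar>) \<longlonglongrightarrow> 0"
  "strict_mono r" "AE x in m. (\<lambda>i. u (r i) x) \<longlonglongrightarrow> v x"
proof -
 have um[measurable]: "u n \<in> borel_measurable m" for n using u by auto
 obtain r where r: "strict_mono r" "AE x in m. Cauchy (\<lambda>i. u (r i) x)"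
  using cauchy_L1_AE_cauchy_subseq[of m u] u C by (auto simp: real_norm_def)
 define v where "v x = lim (\<lambda>i. u (r i) x)" for x
 have [measurable]: "v \<in> borel_measurable m" unfolding v_def by measurable
 have ae: "AE x in m. (\<lambda>i. u (r i) x) \<longlonglongrightarrow> v x"
  using r(2) by eventually_elim (auto simp: v_def Cauchy_convergent_iff convergent_LIMSEQ_iff)
 from L1_limit_of_AE_limit[OF u C r(1) _ ae] r ae show ?thesis
  by (intro that[of v r]) auto
qed

lemma tendsto_L1_AE_subseq':
 fixes u :: "nat => 'a => real"
 assumes "\<And>n. integrable m (u n)" "integrable m v" "(\<lambda>n. LINT x|m. \<bar>u n x - v x\<bar>) \<longlonglongrightarrow> 0"
 obtains r where "strict_mono r" "AE x in m. (\<lambda>i. u (r i) x) \<longlonglongrightarrow> v x"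
proof -
 obtain r where r: "strict_mono r" "AE x in m. (\<lambda>i. u (r i) x - v x) \<longlonglongrightarrow> 0"
  using tendsto_L1_AE_subseq[of m "\<lambda>n x. u n x - v x"] assms by (auto simp: real_norm_def)
 have "AE x in m. (\<lambda>i. u (r i) x) \<longlonglongrightarrow> v x"
  using r(2) by eventually_elim (rule LIM_zero_cancel)
 with r(1) show ?thesis by (rule that)
qed

text \<open>\<open>G\<close> stands for the Green operator on \<open>m = \<delta>^\<gamma> dx\<close>, and \<open>b\<close> for the quotient of
 \<open>G[\<delta>^\<gamma>]\<close> by \<open>\<delta>^\<gamma>\<close>.\<close>

locale L1_kato =
 fixes m :: "'a measure" and G :: "('a => real) => 'a => real" and b :: "'a => real" and l L :: real
 assumes b_meas[measurable]: "b \<in> borel_measurable m"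
  and b_bounds: "AE x in m. l \<le> b x \<and> b x \<le> L" and l_pos: "0 < l" and L_pos: "0 < L"
  and G_int: "integrable m f ==> integrable m (G f)"
  and G_diff: "integrable m f ==> integrable m g ==>
   AE x in m. G (\<lambda>x. f x - g x) x = G f x - G g x"
  and G_bound: "integrable m f ==> (LINT x|m. \<bar>G f x\<bar>) \<le> L * (LINT x|m. \<bar>f x\<bar>)"
  and kato: "integrable m f ==> (LINT x|m. \<bar>G f x\<bar>) \<le> (LINT x|m. sgn (G f x) * (f x * b x))"
begin

lemma integrable_mult_b: "integrable m f ==> integrable m (\<lambda>x. f x * b x)"
 for f :: "'a => real"
proof (rule int_bound[of m "\<lambda>x. L * f x"])
 show "AE x in m. norm (f x * b x) \<le> norm (L * f x)"
  using b_bounds by eventually_elim (use l_pos L_pos in \<open>auto simp: abs_mult mult.commute intro!: mult_right_mono\<close>)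
qed auto

lemma integrable_sgn_mult: "integrable m f ==> g \<in> borel_measurable m ==> integrable m (\<lambda>x. sgn (g x) * f x)"
 for f g :: "'a => real"
 by (rule int_bound[of m f]) (auto simp: abs_mult abs_sgn_eq)

text \<open>The difference of the solutions is \<open>G f\<close> for the difference
  \<open>f\<close> of the right-hand sides. Its sign agrees with that of g(z1) - g(z2), so in Kato's
  inequality the \<open>g\<close> part appears with a minus sign and moves to the left. No modulus
  of continuity of \<open>g\<close> is involved.\<close>

lemma contraction:
 assumes g: "mono g" and z: "integrable m z1" "integrable m z2"
  and gz: "integrable m (\<lambda>x. g (z1 x))" "integrable m (\<lambda>x. g (z2 x))"
  and j: "integrable m j1" "integrable m j2"
  and e1: "AE x in m. z1 x + G (\<lambda>x. g (z1 x) + j1 x) x = h x"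
  and e2: "AE x in m. z2 x + G (\<lambda>x. g (z2 x) + j2 x) x = h x"
 shows "(LINT x|m. \<bar>z1 x - z2 x\<bar>) + (LINT x|m. \<bar>g (z1 x) - g (z2 x)\<bar> * b x) \<le> (LINT x|m. \<bar>j1 x - j2 x\<bar> * b x)"
proof -
 note [measurable] = borel_measurable_integrable[OF z(1)] borel_measurable_integrable[OF z(2)]
  borel_measurable_integrable[OF gz(1)] borel_measurable_integrable[OF gz(2)]
  borel_measurable_integrable[OF j(1)] borel_measurable_integrable[OF j(2)]
 define f where "f = (\<lambda>x. (g (z2 x) + j2 x) - (g (z1 x) + j1 x))"
 have fi: "integrable m f" unfolding f_def by (intro int_diff int_add gz j)
 note [measurable] = borel_measurable_integrable[OF fi] borel_measurable_integrable[OF G_int[OF fi]]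
 have d: "AE x in m. z1 x - z2 x = G f x"
  using G_diff[OF int_add[OF gz(2) j(2)] int_add[OF gz(1) j(1)]] e1 e2
  unfolding f_def by eventually_elim simp
 have ig: "integrable m (\<lambda>x. \<bar>g (z1 x) - g (z2 x)\<bar> * b x)" "integrable m (\<lambda>x. \<bar>j1 x - j2 x\<bar> * b x)"
  by (intro integrable_mult_b integrable_abs int_diff gz j)+
 have "(LINT x|m. \<bar>z1 x - z2 x\<bar>) = (LINT x|m. \<bar>G f x\<bar>)"
  using d by (intro integral_cong_AE) auto
 also have "... \<le> (LINT x|m. sgn (G f x) * (f x * b x))" by (rule kato[OF fi])
 also have "... \<le> (LINT x|m. \<bar>j1 x - j2 x\<bar> * b x - \<bar>g (z1 x) - g (z2 x)\<bar> * b x)"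
 proof (rule integral_mono_AE)
  show "integrable m (\<lambda>x. sgn (G f x) * (f x * b x))"
   by (intro integrable_sgn_mult integrable_mult_b fi) auto
  show "AE x in m. sgn (G f x) * (f x * b x) \<le> \<bar>j1 x - j2 x\<bar> * b x - \<bar>g (z1 x) - g (z2 x)\<bar> * b x"
   using d b_bounds
  proof eventually_elim
   case (elim x)
   \<comment> \<open>Only monotonicity of \<open>g\<close> is used; where z1 = z2 the left side is 0
     and the \<open>g\<close> term on the right vanishes.\<close>
   have "sgn (z1 x - z2 x) * f x \<le> \<bar>j1 x - j2 x\<bar> - \<bar>g (z1 x) - g (z2 x)\<bar>"
    using monoD[OF g, of "z1 x" "z2 x"] monoD[OF g, of "z2 x" "z1 x"]
    by (cases "z1 x" "z2 x" rule: linorder_cases) (auto simp: f_def sgn_if)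
   from mult_right_mono[OF this, of "b x"] elim l_pos show ?case by (simp add: algebra_simps)
  qed
 qed (intro int_diff ig)
 also have "... = (LINT x|m. \<bar>j1 x - j2 x\<bar> * b x) - (LINT x|m. \<bar>g (z1 x) - g (z2 x)\<bar> * b x)"
  by (intro Bochner_Integration.integral_diff ig)
 finally show ?thesis by simp
qed

lemma integral_mult_b_le:
 fixes f :: "'a => real"
 assumes "integrable m f"
 shows "(LINT x|m. \<bar>f x\<bar> * b x) \<le> L * (LINT x|m. \<bar>f x\<bar>)" "l * (LINT x|m. \<bar>f x\<bar>) \<le> (LINT x|m. \<bar>f x\<bar> * b x)"
proof -
 have i: "integrable m (\<lambda>x. \<bar>f x\<bar> * b x)" using assms by (intro integrable_mult_b) auto
 have "(LINT x|m. \<bar>f x\<bar> * b x) \<le> (LINT x|m. L * \<bar>f x\<bar>)"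
 proof (intro integral_mono_AE i)
  show "AE x in m. \<bar>f x\<bar> * b x \<le> L * \<bar>f x\<bar>"
   using b_bounds
  proof eventually_elim
   case (elim x)
   then show ?case using mult_left_mono[of "b x" L "\<bar>f x\<bar>"] by (simp add: mult.commute)
  qed
 qed (use assms in auto)
 then show "(LINT x|m. \<bar>f x\<bar> * b x) \<le> L * (LINT x|m. \<bar>f x\<bar>)" by simp
 have "(LINT x|m. l * \<bar>f x\<bar>) \<le> (LINT x|m. \<bar>f x\<bar> * b x)"
 proof (intro integral_mono_AE i)
  show "AE x in m. l * \<bar>f x\<bar> \<le> \<bar>f x\<bar> * b x"
   using b_bounds
  proof eventually_elim
   case (elim x)
   then show ?case using mult_left_mono[of l "b x" "\<bar>f x\<bar>"] by (simp add: mult.commute)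
  qed
 qed (use assms in auto)
 then show "l * (LINT x|m. \<bar>f x\<bar>) \<le> (LINT x|m. \<bar>f x\<bar> * b x)" by simp
qed

text \<open>The equation after inversion of the operator. The datum enters through its potential
  \<open>h\<close>, an ordinary integrable function even when the datum is a measure.\<close>

definition solves :: "(real => real) => ('a => real) => ('a => real) => bool" where
 "solves g h z \<longleftrightarrow> integrable m z \<and> integrable m (\<lambda>x. g (z x)) \<and> (AE x in m. z x + G (\<lambda>x. g (z x)) x = h x)"

lemma G_L1_tendsto:
 assumes "\<And>n. integrable m (f n)" "integrable m f'" "(\<lambda>n. LINT x|m. \<bar>f n x - f' x\<bar>) \<longlonglongrightarrow> 0"
 shows "(\<lambda>n. LINT x|m. \<bar>G (f n) x - G f' x\<bar>) \<longlonglongrightarrow> 0"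
proof (rule tendsto_sandwich[OF _ _ tendsto_const tendsto_mult_right_zero[OF assms(3), of L]])
 have "(LINT x|m. \<bar>G (f n) x - G f' x\<bar>) \<le> L * (LINT x|m. \<bar>f n x - f' x\<bar>)" for n
 proof -
  have "(LINT x|m. \<bar>G (f n) x - G f' x\<bar>) = (LINT x|m. \<bar>G (\<lambda>x. f n x - f' x) x\<bar>)"
   using G_diff[OF assms(1)[of n] assms(2)] G_int[OF assms(1)[of n]] G_int[OF assms(2)]
     G_int[OF int_diff[OF assms(1)[of n] assms(2)]]
   by (intro integral_cong_AE) auto
  also have "... \<le> L * (LINT x|m. \<bar>f n x - f' x\<bar>)" by (intro G_bound int_diff assms)
  finally show ?thesis .
 qed
 then show "\<forall>\<^sub>F n in sequentially. (LINT x|m. \<bar>G (f n) x - G f' x\<bar>) \<le> L * (LINT x|m. \<bar>f n x - f' x\<bar>)" by simp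
qed (auto intro: always_eventually)

lemma solves_limit:
 assumes s: "\<And>n. integrable m (z n)" "\<And>n. integrable m (f n)" "\<And>n. integrable m (h n)"
  and e: "\<And>n. AE x in m. z n x + G (f n) x = h n x"
  and l: "integrable m z'" "integrable m f'" "integrable m h'"
  and z: "(\<lambda>n. LINT x|m. \<bar>z n x - z' x\<bar>) \<longlonglongrightarrow> 0"
  and f: "(\<lambda>n. LINT x|m. \<bar>f n x - f' x\<bar>) \<longlonglongrightarrow> 0"
  and h: "(\<lambda>n. LINT x|m. \<bar>h n x - h' x\<bar>) \<longlonglongrightarrow> 0"
 shows "AE x in m. z' x + G f' x = h' x"
proof -
 have i: "integrable m (\<lambda>x. z' x + G f' x - h' x)"
  by (intro int_diff int_add l G_int)
 have "(LINT x|m. \<bar>z' x + G f' x - h' x\<bar>) \<le> (LINT x|m. \<bar>z n x - z' x\<bar>) + (LINT x|m. \<bar>G (f n) x - G f' x\<bar>) + (LINT x|m. \<bar>h n x - h' x\<bar>)" for n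
 proof -
  have "(LINT x|m. \<bar>z' x + G f' x - h' x\<bar>) \<le> (LINT x|m. \<bar>z n x - z' x\<bar> + \<bar>G (f n) x - G f' x\<bar> + \<bar>h n x - h' x\<bar>)"
   using e[of n] by (intro integral_mono_AE) (auto intro!: i s l G_int int_add)
  also have "... = (LINT x|m. \<bar>z n x - z' x\<bar>) + (LINT x|m. \<bar>G (f n) x - G f' x\<bar>) + (LINT x|m. \<bar>h n x - h' x\<bar>)"
   by (subst Bochner_Integration.integral_add, (intro int_add integrable_abs int_diff s l G_int)+)
    (subst Bochner_Integration.integral_add, (intro int_add integrable_abs int_diff s l G_int)+, simp)
  finally show ?thesis .
 qed
 moreover have "(\<lambda>n. (LINT x|m. \<bar>z n x - z' x\<bar>) + (LINT x|m. \<bar>G (f n) x - G f' x\<bar>) + (LINT x|m. \<bar>h n x - h' x\<bar>)) \<longlonglongrightarrow> 0 + 0 + 0"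
  by (intro tendsto_add z h G_L1_tendsto f s l)
 ultimately have "(LINT x|m. \<bar>z' x + G f' x - h' x\<bar>) \<le> 0" by (intro LIMSEQ_le_const[where X="\<lambda>n. (LINT x|m. \<bar>z n x - z' x\<bar>) + (LINT x|m. \<bar>G (f n) x - G f' x\<bar>) + (LINT x|m. \<bar>h n x - h' x\<bar>)"]) auto
 then have "(LINT x|m. \<bar>z' x + G f' x - h' x\<bar>) = 0" by (intro antisym) auto
 then have "AE x in m. \<bar>z' x + G f' x - h' x\<bar> = 0"
  using integral_nonneg_eq_0_iff_AE[of m "\<lambda>x. \<bar>z' x + G f' x - h' x\<bar>"] i by auto
 then show ?thesis by eventually_elim simp
qed

text \<open>Additivity follows from the rule for differences by writing f + g as f - (0 - g); the
  instance 0 - 0 shows that G maps 0 to 0 almost everywhere.\<close>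

lemma G_add:
 assumes "integrable m f" "integrable m g"
 shows "AE x in m. G (\<lambda>x. f x + g x) x = G f x + G g x"
proof -
 have g: "integrable m (\<lambda>x. 0 - g x)" using assms by auto
 have "AE x in m. G (\<lambda>x. 0 - 0) x = G (\<lambda>x. 0) x - G (\<lambda>x. 0) x" by (intro G_diff) auto
 moreover have "AE x in m. G (\<lambda>x. 0 - g x) x = G (\<lambda>x. 0) x - G g x" by (intro G_diff assms) auto
 moreover have "AE x in m. G (\<lambda>x. f x - (0 - g x)) x = G f x - G (\<lambda>x. 0 - g x) x" by (intro G_diff assms g)
 ultimately show ?thesis by eventually_elim simp
qed

lemma solves_limit_Cauchy:
 assumes s: "\<And>n. solves g (h n) (u n)" and g: "continuous_on UNIV g"
  and h: "\<And>n. integrable m (h n)" "integrable m h'" "(\<lambda>n. LINT x|m. \<bar>h n x - h' x\<bar>) \<longlonglongrightarrow> 0"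
  and C: "\<And>e. e > 0 ==> \<exists>N. \<forall>i\<ge>N. \<forall>j\<ge>N. (LINT x|m. \<bar>u i x - u j x\<bar>) < e"
   "\<And>e. e > 0 ==> \<exists>N. \<forall>i\<ge>N. \<forall>j\<ge>N. (LINT x|m. \<bar>g (u i x) - g (u j x)\<bar>) < e"
 obtains v where "solves g h' v"
proof -
 have u: "integrable m (u n)" "integrable m (\<lambda>x. g (u n x))"
  "AE x in m. u n x + G (\<lambda>x. g (u n x)) x = h n x" for n using s[of n] by (auto simp: solves_def)
 obtain v r where v: "integrable m v" "(\<lambda>n. LINT x|m. \<bar>u n x - v x\<bar>) \<longlonglongrightarrow> 0"
  and r: "strict_mono r" and ae: "AE x in m. (\<lambda>i. u (r i) x) \<longlonglongrightarrow> v x"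
  by (rule L1_Cauchy_converges[OF u(1) C(1)])
 have gm: "g \<in> borel_measurable borel" using g by (rule borel_measurable_continuous_onI)
 have "AE x in m. (\<lambda>i. g (u (r i) x)) \<longlonglongrightarrow> g (v x)"
  using ae by eventually_elim (rule continuous_on_tendsto_compose[OF g], auto)
 from L1_limit_of_AE_limit[OF u(2) C(2) r _ this]
 have gv: "integrable m (\<lambda>x. g (v x))" "(\<lambda>n. LINT x|m. \<bar>g (u n x) - g (v x)\<bar>) \<longlonglongrightarrow> 0"
  using borel_measurable_integrable[OF v(1)] gm by auto
 have "AE x in m. v x + G (\<lambda>x. g (v x)) x = h' x"
  by (rule solves_limit[OF u(1) u(2) h(1) u(3) v(1) gv(1) h(2) v(2) gv(2) h(3)])
 with v gv show ?thesis by (intro that[of v]) (auto simp: solves_def)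
qed

text \<open>Telescoping of a geometric series, for the distances of consecutive Picard
  iterates.\<close>

lemma geometric_L1_Cauchy:
 fixes z :: "nat => 'a => real"
 assumes z: "\<And>n. integrable m (z n)"
  and D: "\<And>n. (LINT x|m. \<bar>z (Suc n) x - z n x\<bar>) \<le> D / 2 ^ n" and e: "e > 0"
 shows "\<exists>N. \<forall>i\<ge>N. \<forall>j\<ge>N. (LINT x|m. \<bar>z i x - z j x\<bar>) < e"
proof -
 have tri: "(LINT x|m. \<bar>z i x - z k x\<bar>) \<le> (LINT x|m. \<bar>z i x - z j x\<bar>) + (LINT x|m. \<bar>z k x - z j x\<bar>)" for i j k
  by (subst Bochner_Integration.integral_add[symmetric]) (auto intro!: z integral_mono int_add integrable_abs)
 \<comment> \<open>Subtracting the tail \<open>2 * D / 2 ^ (n + k)\<close> makes the bound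
   inductive: each further step adds exactly \<open>D / 2 ^ (n + k)\<close>.\<close>
 have b: "(LINT x|m. \<bar>z (n + k) x - z n x\<bar>) \<le> 2 * D / 2 ^ n - 2 * D / 2 ^ (n + k)" for n k
 proof (induction k)
  case (Suc k)
  have "(LINT x|m. \<bar>z (n + Suc k) x - z n x\<bar>) \<le> (LINT x|m. \<bar>z (Suc (n + k)) x - z (n + k) x\<bar>) + (LINT x|m. \<bar>z n x - z (n + k) x\<bar>)"
   using tri[of "Suc (n + k)" n "n + k"] by simp
  also have "... \<le> D / 2 ^ (n + k) + (2 * D / 2 ^ n - 2 * D / 2 ^ (n + k))"
   using D[of "n + k"] Suc by (intro add_mono) (auto simp: abs_minus_commute)
  finally show ?case by (simp add: field_simps)
 qed simp
 have D0: "0 \<le> D" using order_trans[OF integral_nonneg_AE D[of 0]] by simp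
 have b': "(LINT x|m. \<bar>z i x - z n x\<bar>) \<le> 2 * D / 2 ^ n" if "i \<ge> n" for i n
  using b[of n "i - n"] that D0 by (auto intro: order_trans)
 have "(\<lambda>n. 4 * D * (1 / 2) ^ n) \<longlonglongrightarrow> 4 * D * 0"
  by (intro tendsto_intros LIMSEQ_power_zero) auto
 then have "\<forall>\<^sub>F n in sequentially. 4 * D * (1 / 2) ^ n < e" using e by (intro order_tendstoD) auto
 then obtain N where N: "4 * D * (1 / 2) ^ N < e" by (auto simp: eventually_sequentially)
 have "(LINT x|m. \<bar>z i x - z j x\<bar>) < e" if "i \<ge> N" "j \<ge> N" for i j
  using tri[of i j N] b'[of N i] b'[of N j] that N by (simp add: power_divide)
 then show ?thesis by blast
qed

lemma Lipschitz_comp_integrable: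
 fixes j :: "real => real"
 assumes "\<And>s t. \<bar>j s - j t\<bar> \<le> \<kappa> * \<bar>s - t\<bar>" "j 0 = 0" "integrable m z"
 shows "integrable m (\<lambda>x. j (z x))"
proof (rule int_bound[of m "\<lambda>x. \<kappa> * z x"])
 have "continuous_on UNIV j"
 proof (rule lipschitz_on_continuous_on[of "\<bar>\<kappa>\<bar>"], rule lipschitz_onI)
  show "dist (j x) (j y) \<le> \<bar>\<kappa>\<bar> * dist x y" for x y
   unfolding dist_real_def by (rule order_trans[OF assms(1)]) (intro mult_right_mono, auto)
 qed simp
 from measurable_compose[OF borel_measurable_integrable[OF assms(3)] borel_measurable_continuous_onI[OF this]]
 show "(\<lambda>x. j (z x)) \<in> borel_measurable m" .
 show "AE x in m. norm (j (z x)) \<le> norm (\<kappa> * z x)"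
 proof (rule AE_I2)
  fix x
  have "\<bar>j (z x) - j 0\<bar> \<le> \<kappa> * \<bar>z x - 0\<bar>" by (rule assms(1))
  also have "... \<le> \<bar>\<kappa>\<bar> * \<bar>z x\<bar>" by (auto intro: mult_right_mono)
  finally show "norm (j (z x)) \<le> norm (\<kappa> * z x)" using assms(2) by (simp add: abs_mult)
 qed
qed (use assms in auto)

text \<open>Adding to \<open>g\<close> a perturbation of small Lipschitz constant preserves solvability, because the
 nonexpansivity of \<open>contraction\<close> does not see \<open>g\<close>.\<close>

lemma solvable_perturb:
 assumes Q: "\<And>h. integrable m h ==> \<exists>z. solves g h z" and g: "mono g" "continuous_on UNIV g"
  and j: "\<And>s t. \<bar>j s - j t\<bar> \<le> \<kappa> * \<bar>s - t\<bar>" "j 0 = 0" and small: "L * \<kappa> \<le> 1 / 2" "0 \<le> \<kappa>"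
  and h: "integrable m h"
 shows "\<exists>z. solves (\<lambda>t. g t + j t) h z"
proof -
 \<comment> \<open>Picard iteration with the perturbation lagging one step behind: the next iterate
   solves the \<open>g\<close>-equation with datum h - G(j(z n)), and \<open>G_add\<close> merges
   the two potentials.\<close>
 have "\<exists>z. \<forall>n. (integrable m (z n) \<and> integrable m (\<lambda>x. g (z n x))) \<and>
   (AE x in m. z (Suc n) x + G (\<lambda>x. g (z (Suc n) x) + j (z n x)) x = h x)"
 proof (rule dependent_nat_choice)
  show "\<exists>z. integrable m z \<and> integrable m (\<lambda>x. g (z x))" using Q[OF h] by (auto simp: solves_def)
  fix z :: "'a => real" and n :: nat assume z: "integrable m z \<and> integrable m (\<lambda>x. g (z x))"
  have jz: "integrable m (\<lambda>x. j (z x))" by (rule Lipschitz_comp_integrable[OF j]) (use z in auto)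
  obtain y where y: "solves g (\<lambda>x. h x - G (\<lambda>x. j (z x)) x) y"
   using Q[OF int_diff[OF h G_int[OF jz]]] by auto
  then have "integrable m (\<lambda>x. g (y x))" by (simp add: solves_def)
  from G_add[OF this jz] y show "\<exists>y. (integrable m y \<and> integrable m (\<lambda>x. g (y x))) \<and>
    (AE x in m. y x + G (\<lambda>x. g (y x) + j (z x)) x = h x)"
   by (intro exI[of _ y]) (auto simp: solves_def)
 qed
 then obtain z where zi: "\<And>n. integrable m (z n)" "\<And>n. integrable m (\<lambda>x. g (z n x))"
  and ze: "\<And>n. AE x in m. z (Suc n) x + G (\<lambda>x. g (z (Suc n) x) + j (z n x)) x = h x" by blast
 have ji: "integrable m (\<lambda>x. j (z n x))" for n by (rule Lipschitz_comp_integrable[OF j zi(1)])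
 define d where "d n = (LINT x|m. \<bar>z (Suc n) x - z n x\<bar>)" for n
 let ?G = "\<lambda>n. \<integral>x. \<bar>g (z (Suc (Suc n)) x) - g (z (Suc n) x)\<bar> \<partial>m"
 \<comment> \<open>Consecutive iterates solve the same equation up to perturbations differing by
   j(z(n+1)) - j(z n), so \<open>contraction\<close> halves the distance because L \<kappa> is at
   most 1/2. Its second term, bounded below by means of \<open>l\<close>, controls the nonlinear
   terms at the same rate.\<close>
 have d: "d (Suc n) \<le> d n / 2" "l * (?G n) \<le> d n / 2" for n
 proof -
  have c: "d (Suc n) + (LINT x|m. \<bar>g (z (Suc (Suc n)) x) - g (z (Suc n) x)\<bar> * b x)
    \<le> (LINT x|m. \<bar>j (z (Suc n) x) - j (z n x)\<bar> * b x)"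
   unfolding d_def by (rule contraction[OF g(1) zi(1) zi(1) zi(2) zi(2) ji ji ze ze])
  also have "... \<le> L * (LINT x|m. \<bar>j (z (Suc n) x) - j (z n x)\<bar>)"
   by (intro integral_mult_b_le int_diff ji)
  also have "... \<le> L * (LINT x|m. \<kappa> * \<bar>z (Suc n) x - z n x\<bar>)"
   using L_pos by (intro mult_left_mono integral_mono integrable_abs int_diff ji integrable_mult_right zi j) auto
  also have "... = (L * \<kappa>) * d n" by (simp add: d_def)
  also have "... \<le> 1 / 2 * d n" by (intro mult_right_mono small) (auto simp: d_def)
  finally have c': "d (Suc n) + (LINT x|m. \<bar>g (z (Suc (Suc n)) x) - g (z (Suc n) x)\<bar> * b x) \<le> d n / 2" by simp
  have "l * (?G n) \<le> (LINT x|m. \<bar>g (z (Suc (Suc n)) x) - g (z (Suc n) x)\<bar> * b x)"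
   by (intro integral_mult_b_le int_diff zi)
  moreover have "0 \<le> l * (?G n)" using l_pos by auto
  moreover have "0 \<le> d (Suc n)" by (auto simp: d_def)
  ultimately show "d (Suc n) \<le> d n / 2" "l * (?G n) \<le> d n / 2"
   using c' by linarith+
 qed
 have dn: "d n \<le> d 0 / 2 ^ n" for n
 proof (induction n)
  case (Suc n)
  have "d n / 2 \<le> d 0 / 2 ^ n / 2" by (rule divide_right_mono[OF Suc]) simp
  then show ?case using d(1)[of n] by simp
 qed simp
 have C1: "\<exists>N. \<forall>i\<ge>N. \<forall>j\<ge>N. (LINT x|m. \<bar>z i x - z j x\<bar>) < e" if "e > 0" for e
  by (rule geometric_L1_Cauchy[OF zi(1) _ that]) (use dn in \<open>auto simp: d_def\<close>)
 have C2: "\<exists>N. \<forall>i\<ge>N. \<forall>j\<ge>N. (LINT x|m. \<bar>g (z (Suc i) x) - g (z (Suc j) x)\<bar>) < e" if "e > 0" for e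
 proof (rule geometric_L1_Cauchy[OF _ _ that])
  show "(?G n) \<le> (d 0 / (2 * l)) / 2 ^ n" for n
  proof -
   have "l * (?G n) \<le> d 0 / 2 ^ n / 2"
    using d(2)[of n] divide_right_mono[OF dn[of n], of 2] by simp
   then show ?thesis using l_pos by (simp add: field_simps)
  qed
 qed (rule zi)
 obtain v r where v: "integrable m v" "(\<lambda>n. LINT x|m. \<bar>z n x - v x\<bar>) \<longlonglongrightarrow> 0"
  and r: "strict_mono r" and ae: "AE x in m. (\<lambda>i. z (r i) x) \<longlonglongrightarrow> v x"
  by (rule L1_Cauchy_converges[OF zi(1) C1])
 \<comment> \<open>In the iteration the \<open>g\<close> term has index n + 1 and the
   \<open>j\<close> term index n, so convergence is needed for the sequence and for its
   shift.\<close>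
 have v': "(\<lambda>n. LINT x|m. \<bar>z (Suc n) x - v x\<bar>) \<longlonglongrightarrow> 0" using v(2) by (rule LIMSEQ_Suc)
 obtain r' where r': "strict_mono r'" and ae': "AE x in m. (\<lambda>i. z (Suc (r' i)) x) \<longlonglongrightarrow> v x"
  by (rule tendsto_L1_AE_subseq'[OF zi(1) v(1) v'])
 have gm: "g \<in> borel_measurable borel" using g(2) by (rule borel_measurable_continuous_onI)
 have "AE x in m. (\<lambda>i. g (z (Suc (r' i)) x)) \<longlonglongrightarrow> g (v x)"
  using ae' by eventually_elim (rule continuous_on_tendsto_compose[OF g(2)], auto)
 from L1_limit_of_AE_limit[where u="\<lambda>n x. g (z (Suc n) x)", OF zi(2) C2 r' _ this]
 have gv: "integrable m (\<lambda>x. g (v x))" "(\<lambda>n. LINT x|m. \<bar>g (z (Suc n) x) - g (v x)\<bar>) \<longlonglongrightarrow> 0"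
  using borel_measurable_integrable[OF v(1)] gm by auto
 have jv: "integrable m (\<lambda>x. j (v x))" by (rule Lipschitz_comp_integrable[OF j v(1)])
 have jl: "(\<lambda>n. LINT x|m. \<bar>j (z n x) - j (v x)\<bar>) \<longlonglongrightarrow> 0"
 proof (rule tendsto_sandwich[OF _ _ tendsto_const tendsto_mult_right_zero[OF v(2), of \<kappa>]])
  have "(LINT x|m. \<bar>j (z n x) - j (v x)\<bar>) \<le> (LINT x|m. \<kappa> * \<bar>z n x - v x\<bar>)" for n
   by (intro integral_mono integrable_abs int_diff ji jv integrable_mult_right zi v j)
  then show "\<forall>\<^sub>F n in sequentially. (LINT x|m. \<bar>j (z n x) - j (v x)\<bar>) \<le> \<kappa> * (LINT x|m. \<bar>z n x - v x\<bar>)" by simp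
 qed (auto intro: always_eventually)
 have fl: "(\<lambda>n. LINT x|m. \<bar>(g (z (Suc n) x) + j (z n x)) - (g (v x) + j (v x))\<bar>) \<longlonglongrightarrow> 0"
 proof (rule tendsto_sandwich[OF _ _ tendsto_const])
  have "(LINT x|m. \<bar>(g (z (Suc n) x) + j (z n x)) - (g (v x) + j (v x))\<bar>)
   \<le> (LINT x|m. \<bar>g (z (Suc n) x) - g (v x)\<bar>) + (LINT x|m. \<bar>j (z n x) - j (v x)\<bar>)" for n
   by (subst Bochner_Integration.integral_add[symmetric])
    (auto intro!: zi gv jv ji integral_mono int_add int_diff integrable_abs)
  then show "\<forall>\<^sub>F n in sequentially. (LINT x|m. \<bar>(g (z (Suc n) x) + j (z n x)) - (g (v x) + j (v x))\<bar>)
   \<le> (LINT x|m. \<bar>g (z (Suc n) x) - g (v x)\<bar>) + (LINT x|m. \<bar>j (z n x) - j (v x)\<bar>)" by simp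
  show "(\<lambda>n. (LINT x|m. \<bar>g (z (Suc n) x) - g (v x)\<bar>) + (LINT x|m. \<bar>j (z n x) - j (v x)\<bar>)) \<longlonglongrightarrow> 0"
   using tendsto_add[OF gv(2) jl] by simp
 qed (auto intro: always_eventually)
 have "AE x in m. v x + G (\<lambda>x. g (v x) + j (v x)) x = h x"
  by (rule solves_limit[where h="\<lambda>_. h", OF zi(1) _ h ze v(1) _ h v' fl])
    (auto intro!: int_add zi ji gv jv)
 then show ?thesis
  using v gv jv by (intro exI[of _ v]) (auto simp: solves_def)
qed

text \<open>A continuation in finitely many steps from the trivial equation z = h to the one with
  \<open>g\<close>, adding \<open>g / n\<close> each time. The admissible step size depends on
  \<open>L\<close> and on the Lipschitz constant only, not on the part already added.\<close>

lemma solvable_Lipschitz: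
 assumes g: "mono g" "g 0 = 0" "\<And>s t. \<bar>g s - g t\<bar> \<le> K * \<bar>s - t\<bar>" and h: "integrable m h"
 shows "\<exists>z. solves g h z"
proof -
 have K: "0 \<le> K" using order_trans[OF abs_ge_zero g(3)[of 1 0]] by simp
 have cg: "continuous_on UNIV g"
  by (rule lipschitz_on_continuous_on[of K], rule lipschitz_onI) (use g(3) K in \<open>auto simp: dist_real_def\<close>)
 \<comment> \<open>Chosen so that the step has Lipschitz constant K/n with L (K/n) at most
   1/2.\<close>
 obtain n :: nat where n: "2 * L * K < n" using reals_Archimedean2 by blast
 have n0: "real n > 0" using n L_pos K by (intro le_less_trans[OF _ n]) auto
 have "\<forall>h. integrable m h \<longrightarrow> (\<exists>z. solves (\<lambda>t. real k * (g t / n)) h z)" for k :: nat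
 proof (induction k)
  case 0
  have "AE x in m. G (\<lambda>x. 0) x = 0" using G_diff[of "\<lambda>_. 0" "\<lambda>_. 0"] by auto
  then show ?case by (auto simp: solves_def)
 next
  case (Suc k)
  show ?case
  proof (intro allI impI)
   fix h :: "'a => real" assume h: "integrable m h"
   have "\<exists>z. solves (\<lambda>t. real k * (g t / n) + g t / n) h z"
   proof (rule solvable_perturb[where \<kappa>="K / n"])
    show "mono (\<lambda>t. real k * (g t / n))"
     using n0 by (intro monoI mult_left_mono divide_right_mono monoD[OF g(1)]) auto
    show "continuous_on UNIV (\<lambda>t. real k * (g t / n))" using n0 by (intro continuous_intros cg) auto
    show "\<bar>g s / n - g t / n\<bar> \<le> K / n * \<bar>s - t\<bar>" for s t
     using divide_right_mono[OF g(3)[of s t], of "real n"] n0 by (simp add: diff_divide_distrib[symmetric] abs_divide)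
   qed (use Suc h n n0 K g in \<open>auto simp: field_simps\<close>)
   moreover have "(\<lambda>t. real k * (g t / n) + g t / n) = (\<lambda>t. real (Suc k) * (g t / n))"
    by (auto simp: algebra_simps add_divide_distrib)
   ultimately show "\<exists>z. solves (\<lambda>t. real (Suc k) * (g t / n)) h z" by simp
  qed
 qed
 from this[of n] h n0 show ?thesis by simp
qed

definition clamp_at :: "nat => real => real" where "clamp_at k t = max (- real k) (min (real k) t)"

lemma clamp_at_diff: "k \<le> i ==> \<bar>clamp_at i t - clamp_at k t\<bar> \<le> (if \<bar>t\<bar> > k then \<bar>t\<bar> else 0)"
 by (auto simp: clamp_at_def max_def min_def abs_if)

lemma clamp_at_id: "\<bar>t\<bar> \<le> k ==> clamp_at k t = t"
 by (auto simp: clamp_at_def)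

lemma clamp_at_abs: "\<bar>clamp_at k t\<bar> \<le> \<bar>t\<bar>" "\<bar>clamp_at k t\<bar> \<le> k"
 by (auto simp: clamp_at_def max_def min_def abs_if)

text \<open>Removes the truncation. A common integrable majorant of the nonlinear terms makes the
  errors between two truncation levels a tail of that majorant, so the truncated solutions are
  Cauchy, and dominated convergence handles the nonlinear term.\<close>

lemma solvable_dominated:
 assumes g: "mono g" "continuous_on UNIV g"
  and s: "\<And>k. solves (\<lambda>t. clamp_at k (g t)) h (u k)"
  and \<Gamma>: "integrable m \<Gamma>" "\<And>k. AE x in m. \<bar>g (u k x)\<bar> \<le> \<Gamma> x"
 shows "\<exists>v. solves g h v"
proof -
 have u: "integrable m (u k)" "integrable m (\<lambda>x. clamp_at k (g (u k x)))"
  "AE x in m. u k x + G (\<lambda>x. clamp_at k (g (u k x))) x = h x" for k using s[of k] by (auto simp: solves_def)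
 note [measurable] = borel_measurable_continuous_onI[OF g(2)] borel_measurable_integrable[OF u(1)] borel_measurable_integrable[OF \<Gamma>(1)]
 have [measurable]: "clamp_at k \<in> borel_measurable borel" for k unfolding clamp_at_def by measurable
 have ci: "integrable m (\<lambda>x. clamp_at k (g (u i x)))" for k i
  by (rule int_bound[OF \<Gamma>(1)])
   (use \<Gamma>(2)[of i] in \<open>auto elim!: eventually_mono intro: order_trans[OF clamp_at_abs(1)]\<close>)
 \<comment> \<open>The tail of the majorant: it dominates the difference of the truncations at any
   two levels not below \<open>k\<close>.\<close>
 define t where "t k x = (if \<Gamma> x > real k then \<Gamma> x else 0)" for k :: nat and x
 have ti: "integrable m (t k)" for k
  unfolding t_def by (rule int_bound[OF \<Gamma>(1)]) (auto split: if_split)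
 have tl: "(\<lambda>k. LINT x|m. t k x) \<longlonglongrightarrow> (LINT x|m. 0)"
 proof (rule integral_dominated_convergence[where w="\<lambda>x. \<bar>\<Gamma> x\<bar>"])
  show "AE x in m. (\<lambda>k. t k x) \<longlonglongrightarrow> 0"
  proof (rule AE_I2)
   fix x
   obtain N :: nat where "\<Gamma> x \<le> N" using real_arch_simple by blast
   then show "(\<lambda>k. t k x) \<longlonglongrightarrow> 0"
    by (intro tendsto_eventually) (auto simp: t_def eventually_sequentially intro!: exI[of _ N])
  qed
  show "AE x in m. norm (t k x) \<le> \<bar>\<Gamma> x\<bar>" for k by (auto simp: t_def)
 qed (use \<Gamma> ti in \<open>auto intro: borel_measurable_integrable\<close>)
 have mono_c: "mono (\<lambda>t. clamp_at k (g t))" for k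
  by (intro monoI) (use monoD[OF g(1)] in \<open>force simp: clamp_at_def max_def min_def\<close>)
 have est: "(LINT x|m. \<bar>u k x - u i x\<bar>) \<le> L * (LINT x|m. t k x)" if "k \<le> i" for k i
 proof -
  \<comment> \<open>Both functions solve the equation with nonlinearity truncated at the lower level
    \<open>k\<close>; for the solution at level \<open>i\<close> the missing part of the
    nonlinearity is treated as a perturbation.\<close>
  have "(LINT x|m. \<bar>u k x - u i x\<bar>) + (LINT x|m. \<bar>clamp_at k (g (u k x)) - clamp_at k (g (u i x))\<bar> * b x)
    \<le> (LINT x|m. \<bar>0 - (clamp_at i (g (u i x)) - clamp_at k (g (u i x)))\<bar> * b x)"
   by (rule contraction[OF mono_c u(1) u(1) ci ci, where h=h])
    (use u(3)[of i] u(3)[of k] in \<open>auto intro!: int_diff ci\<close>)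
  also have "... \<le> L * (LINT x|m. \<bar>0 - (clamp_at i (g (u i x)) - clamp_at k (g (u i x)))\<bar>)"
   by (rule integral_mult_b_le) (auto intro!: int_diff ci)
  also have "... \<le> L * (LINT x|m. t k x)"
  proof (intro mult_left_mono integral_mono_AE ti)
   show "AE x in m. \<bar>0 - (clamp_at i (g (u i x)) - clamp_at k (g (u i x)))\<bar> \<le> t k x"
    using \<Gamma>(2)[of i]
   proof eventually_elim
    case (elim x)
    then show ?case using clamp_at_diff[OF that, of "g (u i x)"] by (auto simp: t_def split: if_splits)
   qed
  qed (use L_pos in \<open>auto intro!: ci\<close>)
  finally have *: "(LINT x|m. \<bar>u k x - u i x\<bar>) + (LINT x|m. \<bar>clamp_at k (g (u k x)) - clamp_at k (g (u i x))\<bar> * b x) \<le> L * (LINT x|m. t k x)" .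
  have "0 \<le> (LINT x|m. \<bar>clamp_at k (g (u k x)) - clamp_at k (g (u i x))\<bar> * b x)"
   using b_bounds l_pos by (intro integral_nonneg_AE) (auto elim!: eventually_mono)
  with * show ?thesis by linarith
 qed
 have C: "\<exists>N. \<forall>i\<ge>N. \<forall>j\<ge>N. (LINT x|m. \<bar>u i x - u j x\<bar>) < e" if e: "e > 0" for e
 proof -
  have "(\<lambda>k. L * (LINT x|m. t k x)) \<longlonglongrightarrow> L * 0" using tl by (intro tendsto_intros) simp
  then have "\<forall>\<^sub>F k in sequentially. L * (LINT x|m. t k x) < e" using e by (intro order_tendstoD) auto
  then obtain N where N: "\<And>k. k \<ge> N ==> L * (LINT x|m. t k x) < e" by (auto simp: eventually_sequentially)
  have "(LINT x|m. \<bar>u i x - u j x\<bar>) < e" if "i \<ge> N" "j \<ge> N" for i j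
  proof (cases "i \<le> j")
   case True then show ?thesis using est[OF True] N[of i] that by linarith
  next
   case False
   then have "j \<le> i" by simp
   moreover have "(LINT x|m. \<bar>u i x - u j x\<bar>) = (LINT x|m. \<bar>u j x - u i x\<bar>)" by (simp add: abs_minus_commute)
   ultimately show ?thesis using est[of j i] N[of j] that by linarith
  qed
  then show ?thesis by blast
 qed
 obtain v r where v: "integrable m v" "(\<lambda>n. LINT x|m. \<bar>u n x - v x\<bar>) \<longlonglongrightarrow> 0"
  and r: "strict_mono r" and ae: "AE x in m. (\<lambda>i. u (r i) x) \<longlonglongrightarrow> v x"
  by (rule L1_Cauchy_converges[OF u(1) C])
 note [measurable] = borel_measurable_integrable[OF v(1)]
 have all\<Gamma>: "AE x in m. \<forall>k. \<bar>g (u k x)\<bar> \<le> \<Gamma> x" using \<Gamma>(2) by (simp add: AE_all_countable)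
 have gae: "AE x in m. (\<lambda>i. clamp_at (r i) (g (u (r i) x))) \<longlonglongrightarrow> g (v x)"
  using ae all\<Gamma>
 proof eventually_elim
  case (elim x)
  obtain N :: nat where N: "\<Gamma> x \<le> N" using real_arch_simple by blast
  \<comment> \<open>Since r(i) is at least i, the truncation is eventually inactive at a point where
    the majorant is finite.\<close>
  have "\<forall>\<^sub>F i in sequentially. g (u (r i) x) = clamp_at (r i) (g (u (r i) x))"
  proof (intro eventually_sequentiallyI[of N])
   fix i assume "N \<le> i"
   then have "real N \<le> real (r i)" using seq_suble[OF r, of i] by simp
   then show "g (u (r i) x) = clamp_at (r i) (g (u (r i) x))"
    using elim(2)[rule_format, of "r i"] N by (intro clamp_at_id[symmetric]) linarith
  qed
  moreover have "(\<lambda>i. g (u (r i) x)) \<longlonglongrightarrow> g (v x)"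
   by (rule continuous_on_tendsto_compose[OF g(2) elim(1)]) auto
  ultimately show ?case by (rule Lim_transform_eventually[rotated])
 qed
 have gvb: "AE x in m. \<bar>g (v x)\<bar> \<le> \<Gamma> x"
  using gae all\<Gamma>
 proof eventually_elim
  case (elim x)
  show ?case
   by (rule LIMSEQ_le_const2[OF tendsto_rabs[OF elim(1)]])
    (use elim(2) in \<open>auto intro: order_trans[OF clamp_at_abs(1)]\<close>)
 qed
 have gvi: "integrable m (\<lambda>x. g (v x))"
  by (rule int_bound[OF \<Gamma>(1)]) (use gvb in \<open>auto elim!: eventually_mono\<close>)
 have "(\<lambda>i. LINT x|m. \<bar>clamp_at (r i) (g (u (r i) x)) - g (v x)\<bar>) \<longlonglongrightarrow> (LINT x|m. 0)"
 proof (rule integral_dominated_convergence[where w="\<lambda>x. 2 * \<Gamma> x"])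
  show "AE x in m. (\<lambda>i. \<bar>clamp_at (r i) (g (u (r i) x)) - g (v x)\<bar>) \<longlonglongrightarrow> 0"
   using gae by eventually_elim (auto intro!: tendsto_rabs_zero LIM_zero)
  show "AE x in m. norm \<bar>clamp_at (r i) (g (u (r i) x)) - g (v x)\<bar> \<le> 2 * \<Gamma> x" for i
   using gvb all\<Gamma>
  proof eventually_elim
   case (elim x)
   then show ?case using clamp_at_abs(1)[of "r i" "g (u (r i) x)"] elim(2)[rule_format, of "r i"]
    abs_triangle_ineq4[of "clamp_at (r i) (g (u (r i) x))" "g (v x)"] unfolding real_norm_def abs_abs by linarith
  qed
 qed (use \<Gamma>(1) in auto)
 then have gl: "(\<lambda>i. LINT x|m. \<bar>clamp_at (r i) (g (u (r i) x)) - g (v x)\<bar>) \<longlonglongrightarrow> 0" by simp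
 \<comment> \<open>Integrability of \<open>h\<close> is not among the hypotheses; the left side of
   the equation at level 0 is an integrable representative of it.\<close>
 have hi: "integrable m (\<lambda>x. u 0 x + G (\<lambda>x. clamp_at 0 (g (u 0 x))) x)"
  by (intro int_add u G_int)
 have "AE x in m. v x + G (\<lambda>x. g (v x)) x = u 0 x + G (\<lambda>x. clamp_at 0 (g (u 0 x))) x"
 proof (rule solves_limit[OF u(1) u(2) hi _ v(1) gvi hi _ gl])
  show "AE x in m. u (r n) x + G (\<lambda>x. clamp_at (r n) (g (u (r n) x))) x = u 0 x + G (\<lambda>x. clamp_at 0 (g (u 0 x))) x" for n
   using u(3)[of "r n"] u(3)[of 0] by eventually_elim simp
  show "(\<lambda>n. LINT x|m. \<bar>u (r n) x - v x\<bar>) \<longlonglongrightarrow> 0"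
   using LIMSEQ_subseq_LIMSEQ[OF v(2) r] by (simp add: o_def)
 qed simp
 then have "AE x in m. v x + G (\<lambda>x. g (v x)) x = h x" using u(3)[of 0] by eventually_elim simp
 with v gvi show ?thesis by (auto simp: solves_def)
qed

end

section \<open>Gaussians and the Bessel kernel\<close>

lemma integral_lborel_prod:
 fixes f :: "'a::euclidean_space => real => complex"
 assumes "\<And>b. b \<in> Basis ==> integrable lborel (f b)"
 shows "integrable lborel (\<lambda>x. \<Prod>b\<in>Basis. f b (x \<bullet> b))"
  and "(LINT x|lborel. (\<Prod>b\<in>Basis. f b (x \<bullet> b))) = (\<Prod>b\<in>Basis. LINT x|lborel. f b x)"
proof -
 interpret product_sigma_finite "\<lambda>_::'a. lborel :: real measure"
  by standard
 have [measurable]: "b \<in> Basis ==> f b \<in> borel_measurable borel" for b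
  using borel_measurable_integrable[OF assms, of b] by simp
 have m: "(\<lambda>x. \<Prod>b\<in>Basis. f b (x \<bullet> b)) \<in> borel_measurable borel"
  by measurable
 have m2: "(\<lambda>g. \<Sum>b\<in>Basis. g b *\<^sub>R b) \<in> (\<Pi>\<^sub>M b\<in>(Basis::'a set). lborel) \<rightarrow>\<^sub>M borel"
  by measurable
 have e: "(\<Prod>b\<in>Basis. f b ((\<Sum>b\<in>Basis. g b *\<^sub>R b) \<bullet> b)) = (\<Prod>b\<in>Basis. f b (g b))" for g
  by (intro prod.cong refl) (simp add: inner_sum_left_Basis)
 show "integrable lborel (\<lambda>x. \<Prod>b\<in>Basis. f b (x \<bullet> b))"
  apply (subst lborel_eq, subst integrable_distr_eq[OF m2 m])
  unfolding e by (rule product_integrable_prod) (use assms in auto)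
 show "(LINT x|lborel. (\<Prod>b\<in>Basis. f b (x \<bullet> b))) = (\<Prod>b\<in>Basis. LINT x|lborel. f b x)"
  apply (subst lborel_eq, subst integral_distr[OF m2 m])
  unfolding e by (rule product_integral_prod) (use assms in auto)
qed

text \<open>Rescaling by c = 1/sqrt(2s) turns the integrand into a multiple of the standard normal
  density times exp(i c \<alpha> x), so the value is the known characteristic function at c
  \<alpha>.\<close>

lemma cgauss_integral_real:
 assumes s: "s > 0"
 shows "integrable lborel (\<lambda>y. exp (\<i> * complex_of_real (y * \<alpha>) - complex_of_real (s * (y * y))))" (is ?A)
  and "(LINT y|lborel. exp (\<i> * complex_of_real (y * \<alpha>) - complex_of_real (s * (y * y))))
   = complex_of_real (sqrt (pi / s) * exp (- \<alpha>\<^sup>2 / (4 * s)))" (is ?B)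
proof -
 define c where "c = 1 / sqrt (2 * s)"
 have c: "c > 0" "c * c = 1 / (2 * s)" using s by (auto simp: c_def)
 let ?f = "\<lambda>y. exp (\<i> * complex_of_real (y * \<alpha>) - complex_of_real (s * (y * y)))"
 have fc: "?f (0 + c * x) = complex_of_real (sqrt (2 * pi)) * (std_normal_density x *\<^sub>R iexp ((c * \<alpha>) * x))" for x
 proof -
  have *: "s * ((c * x) * (c * x)) = x\<^sup>2 / 2"
  proof -
   have "s * ((c * x) * (c * x)) = s * (c * c) * x\<^sup>2" by (simp add: power2_eq_square)
   then show ?thesis using s by (simp add: c(2))
  qed
  have "?f (0 + c * x) = iexp ((c * \<alpha>) * x) * exp (- complex_of_real (x\<^sup>2 / 2))"
  proof -
   have "\<i> * complex_of_real ((0 + c * x) * \<alpha>) - complex_of_real (x\<^sup>2 / 2)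
    = \<i> * complex_of_real ((c * \<alpha>) * x) + - complex_of_real (x\<^sup>2 / 2)"
    by (simp add: mult_ac)
   then show ?thesis unfolding add_0 * by (simp only: exp_add)
  qed
  also have "exp (- complex_of_real (x\<^sup>2 / 2)) = complex_of_real (exp (- (x\<^sup>2 / 2)))"
   by (simp add: exp_of_real[symmetric])
  also have "exp (- (x\<^sup>2 / 2)) = sqrt (2 * pi) * std_normal_density x"
   by (simp add: std_normal_density_def)
  finally show ?thesis by (simp add: scaleR_conv_of_real)
 qed
 interpret std: prob_space std_normal_distribution
  using prob_space_normal_density[of 1 0] by simp
 have i1: "integrable std_normal_distribution (\<lambda>x. iexp ((c * \<alpha>) * x))"
  by (rule std.integrable_const_bound[of _ 1]) auto
 then have i2: "integrable lborel (\<lambda>x. std_normal_density x *\<^sub>R iexp ((c * \<alpha>) * x))"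
  by (subst (asm) integrable_density) auto
 have i3: "integrable lborel (\<lambda>x. ?f (0 + c * x))"
  unfolding fc by (intro integrable_mult_right i2)
 show ?A using lborel_integrable_real_affine_iff[of c ?f 0] c i3 by simp
 have "(LINT x|lborel. std_normal_density x *\<^sub>R iexp ((c * \<alpha>) * x)) = char std_normal_distribution (c * \<alpha>)"
  unfolding char_def by (subst integral_density) auto
 also have "... = complex_of_real (exp (- (c * \<alpha>)\<^sup>2 / 2))"
  by (simp add: char_std_normal_distribution)
 finally have i4: "(LINT x|lborel. std_normal_density x *\<^sub>R iexp ((c * \<alpha>) * x)) = complex_of_real (exp (- (c * \<alpha>)\<^sup>2 / 2))" .
 have "(LINT y|lborel. ?f y) = \<bar>c\<bar> *\<^sub>R (LINT x|lborel. ?f (0 + c * x))"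
  by (rule lborel_integral_real_affine) (use c in auto)
 also have "... = complex_of_real (c * sqrt (2 * pi) * exp (- (c * \<alpha>)\<^sup>2 / 2))"
  unfolding fc using c i4 by (simp add: scaleR_conv_of_real)
 also have "c * sqrt (2 * pi) = sqrt (pi / s)" using s by (simp add: c_def real_sqrt_divide real_sqrt_mult)
 also have "- (c * \<alpha>)\<^sup>2 / 2 = - \<alpha>\<^sup>2 / (4 * s)"
 proof -
  have "(c * \<alpha>)\<^sup>2 = (c * c) * \<alpha>\<^sup>2" by (simp add: power2_eq_square)
  then show ?thesis by (simp add: c(2))
 qed
 finally show ?B .
qed

lemma cgauss_integral:
 fixes a :: "'a::euclidean_space"
 assumes s: "s > 0"
 shows "integrable lborel (cgauss s a)"
  and "(LINT x|lborel. cgauss s a x) = complex_of_real ((pi / s) powr (DIM('a) / 2) * exp (- (norm a)\<^sup>2 / (4 * s)))"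
proof -
 let ?g = "\<lambda>b y. exp (\<i> * complex_of_real (y * (a \<bullet> b)) - complex_of_real (s * (y * y)))"
 have e: "cgauss s a x = (\<Prod>b\<in>Basis. ?g b (x \<bullet> b))" for x
  unfolding cgauss_def euclidean_inner[of x a] euclidean_inner[of x x]
  by (simp add: exp_sum[symmetric] sum_subtractf sum_distrib_left)
 show "integrable lborel (cgauss s a)"
  unfolding e[abs_def] by (rule integral_lborel_prod) (rule cgauss_integral_real[OF s])
 have "(LINT x|lborel. cgauss s a x) = (\<Prod>b\<in>Basis. complex_of_real (sqrt (pi / s) * exp (- (a \<bullet> b)\<^sup>2 / (4 * s))))"
  unfolding e by (subst integral_lborel_prod) (simp_all only: cgauss_integral_real[OF s])
 also have "... = complex_of_real ((\<Prod>b\<in>(Basis::'a set). sqrt (pi / s)) * (\<Prod>b\<in>Basis. exp (- (a \<bullet> b)\<^sup>2 / (4 * s))))"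
  by (simp only: of_real_prod[symmetric] prod.distrib)
 also have "(\<Prod>b\<in>(Basis::'a set). sqrt (pi / s)) = (pi / s) powr (DIM('a) / 2)"
  using s by (simp add: powr_half_sqrt[symmetric] powr_realpow[symmetric] powr_powr)
 also have "(\<Prod>b\<in>Basis. exp (- (a \<bullet> b)\<^sup>2 / (4 * s))) = exp (- (norm a)\<^sup>2 / (4 * s))"
 proof -
  have n: "(norm a)\<^sup>2 = (\<Sum>b\<in>Basis. (a \<bullet> b)\<^sup>2)"
   by (simp only: power2_norm_eq_inner euclidean_inner[of a a]) (simp only: power2_eq_square)
  have "(\<Prod>b\<in>Basis. exp (- (a \<bullet> b)\<^sup>2 / (4 * s))) = exp (\<Sum>b\<in>Basis. - (a \<bullet> b)\<^sup>2 / (4 * s))"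
   by (rule exp_sum[symmetric]) simp
  also have "(\<Sum>b\<in>Basis. - (a \<bullet> b)\<^sup>2 / (4 * s)) = - (norm a)\<^sup>2 / (4 * s)"
   unfolding n by (simp add: sum_divide_distrib sum_negf)
  finally show ?thesis .
 qed
 finally show "(LINT x|lborel. cgauss s a x) = complex_of_real ((pi / s) powr (DIM('a) / 2) * exp (- (norm a)\<^sup>2 / (4 * s)))" .
qed

lemma gauss_nn_integral:
 assumes s: "s > 0"
 shows "(\<integral>\<^sup>+x. ennreal (exp (- s * (norm (x::'a::euclidean_space))\<^sup>2)) \<partial>lborel) = ennreal ((pi / s) powr (DIM('a) / 2))"
  and "integrable lborel (\<lambda>x::'a. exp (- s * (norm x)\<^sup>2))"
proof -
 have e: "cgauss s 0 x = complex_of_real (exp (- s * (norm x)\<^sup>2))" for x :: 'a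
  by (simp add: cgauss_def exp_of_real[symmetric] dot_square_norm)
 show i: "integrable lborel (\<lambda>x::'a. exp (- s * (norm x)\<^sup>2))"
  using cgauss_integral(1)[OF s, of "0::'a"] unfolding e[abs_def] complex_of_real_integrable_eq .
 have "(LINT x|lborel. exp (- s * (norm (x::'a))\<^sup>2)) = (pi / s) powr (DIM('a) / 2)"
  using cgauss_integral(2)[OF s, of "0::'a"] unfolding e by (simp del: of_real_mult of_real_exp)
 with i show "(\<integral>\<^sup>+x. ennreal (exp (- s * (norm (x::'a))\<^sup>2)) \<partial>lborel) = ennreal ((pi / s) powr (DIM('a) / 2))"
  by (subst nn_integral_eq_integral) auto
qed

lemma Gamma_nn_integral_scaled:
 assumes a: "a > 0" and c: "c > 0"
 shows "(\<integral>\<^sup>+t. ennreal (indicator {0<..} t * t powr (a - 1) * exp (- c * t)) \<partial>lborel) = ennreal (Gamma a * c powr (- a))"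
proof -
 have "(\<integral>\<^sup>+t. ennreal (indicator {0<..} t * t powr (a - 1) * exp (- t)) \<partial>lborel)
   = (\<integral>\<^sup>+t. ennreal (indicator {0..} t * t powr (a - 1) / exp t) \<partial>lborel)"
  by (intro nn_integral_cong) (auto simp: indicator_def exp_minus divide_inverse)
 also have "... = ennreal (Gamma a)" using Gamma_conv_nn_integral_real[OF a] by simp
 finally have G: "(\<integral>\<^sup>+t. ennreal (indicator {0<..} t * t powr (a - 1) * exp (- t)) \<partial>lborel) = ennreal (Gamma a)" .
 have "(\<integral>\<^sup>+t. ennreal (indicator {0<..} t * t powr (a - 1) * exp (- t)) \<partial>lborel)
   = ennreal \<bar>c\<bar> * (\<integral>\<^sup>+t. ennreal (indicator {0<..} (0 + c * t) * (0 + c * t) powr (a - 1) * exp (- (0 + c * t))) \<partial>lborel)"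
  by (rule nn_integral_real_affine) (use c in auto)
 also have "... = ennreal c * (\<integral>\<^sup>+t. ennreal (c powr (a - 1)) * ennreal (indicator {0<..} t * t powr (a - 1) * exp (- c * t)) \<partial>lborel)"
  using c by (intro arg_cong2[where f="(*)"] nn_integral_cong)
   (auto simp: indicator_def zero_less_mult_iff powr_mult ennreal_mult[symmetric] mult_ac)
 also have "... = ennreal c * (ennreal (c powr (a - 1)) * (\<integral>\<^sup>+t. ennreal (indicator {0<..} t * t powr (a - 1) * exp (- c * t)) \<partial>lborel))"
  by (subst nn_integral_cmult) auto
 also have "... = ennreal (c powr a) * (\<integral>\<^sup>+t. ennreal (indicator {0<..} t * t powr (a - 1) * exp (- c * t)) \<partial>lborel)" (is "_ = _ * ?I")
  using c by (simp add: mult.assoc[symmetric] ennreal_mult[symmetric] powr_diff)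
 finally have "ennreal (Gamma a) = ennreal (c powr a) * ?I" using G by simp
 then have "ennreal (c powr (- a)) * ennreal (Gamma a) = ennreal (c powr (- a)) * (ennreal (c powr a) * ?I)" by simp
 also have "... = ?I" using c by (simp add: mult.assoc[symmetric] ennreal_mult[symmetric] powr_add[symmetric])
 finally have "?I = ennreal (c powr (- a)) * ennreal (Gamma a)" by simp
 also have "... = ennreal (Gamma a * c powr (- a))" using Gamma_real_pos[OF a] by (simp add: ennreal_mult[symmetric] mult.commute)
 finally show ?thesis .
qed

lemma schwartz_continuous: "\<phi> \<in> schwartz ==> continuous_on UNIV \<phi>"
 by (auto simp: schwartz_def smooth_def intro: Ck_continuous)

lemma schwartz_measurable [measurable_dest]: "\<phi> \<in> schwartz ==> \<phi> \<in> borel_measurable borel"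
 by (intro borel_measurable_continuous_onI schwartz_continuous)

lemma schwartz_bounded_moment:
 assumes "\<phi> \<in> schwartz" obtains C where "\<And>x. norm x ^ m * norm (\<phi> x) \<le> C" "C \<ge> 0"
proof -
 have "bounded (range (\<lambda>x. norm x ^ m *\<^sub>R partials [] \<phi> x))"
  using assms unfolding schwartz_def mem_Collect_eq by (elim conjE allE[of _ m] allE[of _ "[]"]) auto
 then obtain C where "\<And>x. norm x ^ m * norm (\<phi> x) \<le> C" by (auto simp: bounded_iff)
 moreover from this[of 0] have "C \<ge> 0" by (metis (no_types, opaque_lifting) mult_nonneg_nonneg norm_ge_zero order_trans zero_le_power)
 ultimately show ?thesis using that by blast
qed

text \<open>Writes a negative power as an average of exponentials over a Gamma distribution. With r
  = |\<xi>|^2 it expresses the Bessel multiplier through heat multipliers; with r = |x|^2 it reduces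
  integrals of power decay to Gaussian ones.\<close>

lemma subordination:
 assumes a: "a > 0" and that: "r \<ge> 0"
 shows "(\<integral>\<^sup>+t. ennreal (indicator {0<..} t * t powr (a - 1) * exp (- t) / Gamma a) * ennreal (exp (- t * r)) \<partial>lborel)
  = ennreal ((1 + r) powr (- a))"
proof -
 have g: "Gamma a > 0" using a by (rule Gamma_real_pos)
 have "(\<integral>\<^sup>+t. ennreal (indicator {0<..} t * t powr (a - 1) * exp (- t) / Gamma a) * ennreal (exp (- t * r)) \<partial>lborel)
   = (\<integral>\<^sup>+t. ennreal (1 / Gamma a) * ennreal (indicator {0<..} t * t powr (a - 1) * exp (- (1 + r) * t)) \<partial>lborel)"
  using g by (intro nn_integral_cong) (auto simp: ennreal_mult[symmetric] algebra_simps exp_add[symmetric] exp_diff exp_minus divide_simps indicator_def)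
 also have "... = ennreal (1 / Gamma a) * ennreal (Gamma a * (1 + r) powr (- a))"
  using that by (subst nn_integral_cmult, simp, subst Gamma_nn_integral_scaled[OF a]) auto
 also have "... = ennreal ((1 + r) powr (- a))" using g by (simp add: ennreal_mult[symmetric])
 finally show ?thesis .
qed

text \<open>By subordination and Tonelli the integral becomes a Gamma integral with parameter M -
  N/2, where N is the dimension. This replaces polar coordinates.\<close>

lemma integrable_power_decay:
 assumes M: "M > DIM('a) / 2"
 shows "integrable lborel (\<lambda>x::'a::euclidean_space. (1 + (norm x)\<^sup>2) powr (- M))"
proof (rule integrableI_nonneg)
 have M0: "M > 0" using M by (intro le_less_trans[OF _ M]) auto
 then have g: "Gamma M > 0" by (rule Gamma_real_pos)
 let ?q = "\<lambda>t. indicator {0<..} t * t powr (M - 1) * exp (- t) / Gamma M"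
 have "(\<integral>\<^sup>+x. ennreal ((1 + (norm (x::'a))\<^sup>2) powr (- M)) \<partial>lborel)
   = (\<integral>\<^sup>+x. (\<integral>\<^sup>+t. ennreal (?q t) * ennreal (exp (- t * (norm (x::'a))\<^sup>2)) \<partial>lborel) \<partial>lborel)"
  by (subst subordination[OF M0]) auto
 also have "... = (\<integral>\<^sup>+t. (\<integral>\<^sup>+x. ennreal (?q t) * ennreal (exp (- t * (norm (x::'a))\<^sup>2)) \<partial>lborel) \<partial>lborel)"
  by (rule lborel_pair.Fubini') measurable
 also have "... = (\<integral>\<^sup>+t. ennreal (pi powr (DIM('a) / 2) / Gamma M) * ennreal (indicator {0<..} t * t powr ((M - DIM('a) / 2) - 1) * exp (- 1 * t)) \<partial>lborel)"
 proof (intro nn_integral_cong)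
  fix t :: real
  show "(\<integral>\<^sup>+x. ennreal (?q t) * ennreal (exp (- t * (norm (x::'a))\<^sup>2)) \<partial>lborel)
    = ennreal (pi powr (DIM('a) / 2) / Gamma M) * ennreal (indicator {0<..} t * t powr ((M - DIM('a) / 2) - 1) * exp (- 1 * t))"
  proof (cases "t > 0")
   case True
   have "(\<integral>\<^sup>+x. ennreal (?q t) * ennreal (exp (- t * (norm (x::'a))\<^sup>2)) \<partial>lborel) = ennreal (?q t) * ennreal ((pi / t) powr (DIM('a) / 2))"
    by (subst nn_integral_cmult, simp, subst gauss_nn_integral[OF True]) simp
   moreover have "?q t * (pi / t) powr (DIM('a) / 2)
     = pi powr (DIM('a) / 2) / Gamma M * (indicator {0<..} t * t powr ((M - DIM('a) / 2) - 1) * exp (- 1 * t))"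
   proof -
    have "t powr ((M - DIM('a) / 2) - 1) = t powr ((M - 1) - DIM('a) / 2)" by (simp add: algebra_simps)
    also have "... = t powr (M - 1) / t powr (DIM('a) / 2)" by (rule powr_diff)
    finally show ?thesis using True by (simp add: powr_divide)
   qed
   ultimately show ?thesis using True g by (simp add: ennreal_mult[symmetric])
  qed auto
 qed
 also have "... = ennreal (pi powr (DIM('a) / 2) / Gamma M) * ennreal (Gamma (M - DIM('a) / 2) * 1 powr (- (M - DIM('a) / 2)))"
  using M by (subst nn_integral_cmult, simp, subst Gamma_nn_integral_scaled) auto
 also have "... < \<infinity>" by (simp add: ennreal_mult_less_top)
 finally show "(\<integral>\<^sup>+x. ennreal ((1 + (norm (x::'a))\<^sup>2) powr (- M)) \<partial>lborel) < \<infinity>" .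
qed auto

text \<open>The moments of order 0 and 2N together give decay like (1 + |x|^2)^{-N}, which is
  integrable because N exceeds N/2.\<close>

lemma schwartz_integrable:
 fixes \<phi> :: "'a::euclidean_space => complex"
 assumes "\<phi> \<in> schwartz" shows "integrable lborel \<phi>"
proof -
 let ?N = "DIM('a)"
 obtain C0 where C0: "\<And>x. norm x ^ 0 * norm (\<phi> x) \<le> C0" "C0 \<ge> 0" using schwartz_bounded_moment[OF assms, of 0] by blast
 obtain C1 where C1: "\<And>x. norm x ^ (2 * ?N) * norm (\<phi> x) \<le> C1" "C1 \<ge> 0" using schwartz_bounded_moment[OF assms, of "2 * ?N"] by blast
 show ?thesis
 proof (rule int_bound)
  show "integrable lborel (\<lambda>x::'a. 2 ^ ?N * (C0 + C1) * (1 + (norm x)\<^sup>2) powr (- real ?N))"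
   by (intro integrable_mult_right integrable_power_decay) simp
  show "AE x in lborel. norm (\<phi> x) \<le> norm (2 ^ ?N * (C0 + C1) * (1 + (norm x)\<^sup>2) powr (- real ?N))"
  proof (intro AE_I2)
   fix x :: 'a
   have p: "1 + (norm x)\<^sup>2 > 0" by (simp add: add_pos_nonneg)
   have "(1 + (norm x)\<^sup>2) ^ ?N \<le> 2 ^ ?N * (1 + norm x ^ (2 * ?N))"
   proof (cases "norm x \<le> 1")
    case True
    then have "(norm x)\<^sup>2 \<le> 1" by (simp add: power_le_one)
    then have "(1 + (norm x)\<^sup>2) ^ ?N \<le> 2 ^ ?N" by (intro power_mono) auto
    also have "... \<le> 2 ^ ?N * (1 + norm x ^ (2 * ?N))" by simp
    finally show ?thesis .
   next
    case False
    then have "1 \<le> (norm x)\<^sup>2" by (simp add: one_le_power)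
    then have "(1 + (norm x)\<^sup>2) ^ ?N \<le> (2 * (norm x)\<^sup>2) ^ ?N" by (intro power_mono) auto
    also have "... = 2 ^ ?N * norm x ^ (2 * ?N)" by (simp add: power_mult_distrib power_mult)
    also have "... \<le> 2 ^ ?N * (1 + norm x ^ (2 * ?N))" by simp
    finally show ?thesis .
   qed
   then have "(1 + (norm x)\<^sup>2) ^ ?N * norm (\<phi> x) \<le> 2 ^ ?N * (1 + norm x ^ (2 * ?N)) * norm (\<phi> x)"
    by (intro mult_right_mono) auto
   also have "... = 2 ^ ?N * (norm x ^ 0 * norm (\<phi> x) + norm x ^ (2 * ?N) * norm (\<phi> x))" by (simp add: algebra_simps)
   also have "... \<le> 2 ^ ?N * (C0 + C1)" by (intro mult_left_mono add_mono C0 C1) auto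
   finally have "norm (\<phi> x) \<le> 2 ^ ?N * (C0 + C1) / (1 + (norm x)\<^sup>2) ^ ?N"
    using p by (simp add: field_simps)
   then show "norm (\<phi> x) \<le> norm (2 ^ ?N * (C0 + C1) * (1 + (norm x)\<^sup>2) powr (- real ?N))"
    using C0 C1 p by (simp add: powr_minus powr_realpow divide_inverse)
  qed
 qed (use assms in measurable)
qed

lemma fourier_cgauss:
 fixes a :: "'a::euclidean_space"
 assumes s: "s > 0"
 shows "fourier (cgauss s a) x = complex_of_real ((pi / s) powr (DIM('a) / 2) * exp (- (norm (x - a))\<^sup>2 / (4 * s)))"
proof -
 have "cis (- (y \<bullet> x)) * cgauss s a y = cgauss s (a - x) y" for y
  by (simp add: cgauss_def cis_conv_exp exp_add[symmetric] inner_diff_right algebra_simps)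
 then show ?thesis unfolding fourier_def by (simp add: cgauss_integral(2)[OF s] norm_minus_commute)
qed

lemma tempered_fun_bounded:
 fixes k :: "'a::euclidean_space => complex"
 assumes "k \<in> borel_measurable borel" "\<And>x. norm (k x) \<le> C"
 shows "tempered_fun k"
 unfolding tempered_fun_def
proof (intro conjI ballI)
 fix \<phi> :: "'a => complex" assume \<phi>: "\<phi> \<in> schwartz"
 show "integrable lborel (\<lambda>x. k x * \<phi> x)"
  by (rule int_bound[OF integrable_mult_right[OF schwartz_integrable[OF \<phi>], of "complex_of_real C"]])
   (use \<phi> assms in \<open>auto simp: norm_mult intro!: AE_I2 mult_right_mono intro: order_trans[OF _ abs_ge_self]\<close>)
qed fact

lemma tempered_fun_integrable:
 fixes k :: "'a::euclidean_space => complex"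
 assumes "integrable lborel k"
 shows "tempered_fun k"
 unfolding tempered_fun_def
proof (intro conjI ballI)
 fix \<phi> :: "'a => complex" assume \<phi>: "\<phi> \<in> schwartz"
 obtain C0 where C0: "\<And>x. norm x ^ 0 * norm (\<phi> x) \<le> C0" "C0 \<ge> 0" using schwartz_bounded_moment[OF \<phi>, of 0] by blast
 show "integrable lborel (\<lambda>x. k x * \<phi> x)"
  by (rule int_bound[OF integrable_mult_right[OF assms, of "complex_of_real C0"]])
   (use \<phi> C0 assms in \<open>auto simp: norm_mult mult.commute intro!: AE_I2 mult_right_mono\<close>)
qed (use assms in auto)

lemma integral_mult_fourier:
 fixes k \<phi> :: "'a::euclidean_space => complex"
 assumes k: "integrable lborel k" and p: "integrable lborel \<phi>"
 shows "(LINT x|lborel. k x * fourier \<phi> x) = (LINT \<xi>|lborel. fourier k \<xi> * \<phi> \<xi>)"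
proof -
 have [measurable]: "k \<in> borel_measurable borel" "\<phi> \<in> borel_measurable borel"
  using borel_measurable_integrable[OF k] borel_measurable_integrable[OF p] by auto
 have i: "integrable (lborel \<Otimes>\<^sub>M lborel) (\<lambda>(x, \<xi>). k x * (cis (- (\<xi> \<bullet> x)) * \<phi> \<xi>))"
 proof (rule int_bound)
  show "integrable (lborel \<Otimes>\<^sub>M lborel) (\<lambda>(x, \<xi>). norm (k x) * norm (\<phi> \<xi>))"
   by (rule lborel_pair.Fubini_integrable)
    (use k p in \<open>auto intro!: integrable_mult_left integrable_mult_right integrable_norm\<close>)
  show "(\<lambda>(x, \<xi>). k x * (cis (- (\<xi> \<bullet> x)) * \<phi> \<xi>)) \<in> borel_measurable (lborel \<Otimes>\<^sub>M lborel)"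
   unfolding cis_conv_exp by measurable
 qed (auto simp: norm_mult)
 have "(LINT x|lborel. k x * fourier \<phi> x) = (LINT x|lborel. (LINT \<xi>|lborel. k x * (cis (- (\<xi> \<bullet> x)) * \<phi> \<xi>)))"
  unfolding fourier_def by simp
 also have "... = (LINT \<xi>|lborel. (LINT x|lborel. k x * (cis (- (\<xi> \<bullet> x)) * \<phi> \<xi>)))"
  by (rule lborel_pair.Fubini_integral[OF i, symmetric])
 also have "... = (LINT \<xi>|lborel. fourier k \<xi> * \<phi> \<xi>)"
  unfolding fourier_def by (subst integral_mult_left_zero[symmetric]) (simp add: inner_commute mult_ac)
 finally show ?thesis .
qed

text \<open>Density of the Gamma distribution with shape \<alpha>/2 and rate 1.\<close>

definition subord :: "real => real => real" where
 "subord \<alpha> t = indicator {0<..} t * t powr (\<alpha> / 2 - 1) * exp (- t) / Gamma (\<alpha> / 2)"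

definition heat :: "real => 'a::euclidean_space => real" where
 "heat t x = (4 * pi * t) powr (- (DIM('a) / 2)) * exp (- (norm x)\<^sup>2 / (4 * t))"

text \<open>The Bessel kernel as a Gamma mixture of heat kernels. The integral is infinite at the
  origin when \<alpha> is at most the dimension; \<open>enn2real\<close> then returns 0, so
  identities with the integral hold only almost everywhere.\<close>

definition bk :: "real => 'a::euclidean_space => real" where
 "bk \<alpha> x = enn2real (\<integral>\<^sup>+t. ennreal (subord \<alpha> t * heat t x) \<partial>lborel)"

lemma subord_measurable[measurable]: "subord \<alpha> \<in> borel_measurable borel"
 unfolding subord_def by measurable

lemma heat_measurable[measurable]: "(\<lambda>(t, x). heat t x) \<in> borel_measurable (borel \<Otimes>\<^sub>M borel)"
 unfolding heat_def by measurable

lemma heat_measurable'[measurable (raw)]: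
 "f \<in> borel_measurable M ==> g \<in> borel_measurable M ==> (\<lambda>x. heat (f x) (g x)) \<in> borel_measurable M"
 by (rule measurable_Pair_compose_split[OF heat_measurable])

lemma subord_nonneg: "\<alpha> > 0 ==> 0 \<le> subord \<alpha> t"
 unfolding subord_def using Gamma_real_pos[of "\<alpha> / 2"] by (auto simp: indicator_def)

lemma heat_nonneg: "0 \<le> heat t x"
 unfolding heat_def by auto

lemma bk_nonneg: "0 \<le> bk \<alpha> x" by (simp add: bk_def)

lemma bk_measurable[measurable]: "bk \<alpha> \<in> borel_measurable borel"
 unfolding bk_def[abs_def] by measurable

lemma heat_nn_integral:
 assumes t: "t > 0" shows "(\<integral>\<^sup>+x. ennreal (heat t (x::'a::euclidean_space)) \<partial>lborel) = 1"
proof -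
 have "(\<integral>\<^sup>+x. ennreal (heat t (x::'a)) \<partial>lborel)
  = (\<integral>\<^sup>+x. ennreal ((4 * pi * t) powr (- (DIM('a) / 2))) * ennreal (exp (- (1 / (4 * t)) * (norm (x::'a))\<^sup>2)) \<partial>lborel)"
  unfolding heat_def by (intro nn_integral_cong) (simp add: ennreal_mult)
 also have "... = ennreal ((4 * pi * t) powr (- (DIM('a) / 2))) * ennreal ((pi / (1 / (4 * t))) powr (DIM('a) / 2))"
  using t by (subst nn_integral_cmult, simp, subst gauss_nn_integral) auto
 also have "... = 1" using t by (simp add: ennreal_mult[symmetric] powr_minus mult.commute mult.left_commute)
 finally show ?thesis .
qed

lemma subord_nn_integral:
 assumes "\<alpha> > 0" shows "(\<integral>\<^sup>+t. ennreal (subord \<alpha> t) \<partial>lborel) = 1"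
 using subordination[of "\<alpha> / 2" 0] assms by (simp add: subord_def)

lemma subord_heat_nn_integral:
 assumes a: "\<alpha> > 0"
 shows "(\<integral>\<^sup>+x. (\<integral>\<^sup>+t. ennreal (subord \<alpha> t * heat t (x::'a::euclidean_space)) \<partial>lborel) \<partial>lborel) = 1"
proof -
 have "(\<integral>\<^sup>+x. (\<integral>\<^sup>+t. ennreal (subord \<alpha> t * heat t (x::'a)) \<partial>lborel) \<partial>lborel)
   = (\<integral>\<^sup>+t. (\<integral>\<^sup>+x. ennreal (subord \<alpha> t * heat t (x::'a)) \<partial>lborel) \<partial>lborel)"
  by (rule lborel_pair.Fubini') measurable
 also have "... = (\<integral>\<^sup>+t. ennreal (subord \<alpha> t) \<partial>lborel)"
 proof (intro nn_integral_cong)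
  fix t
  show "(\<integral>\<^sup>+x. ennreal (subord \<alpha> t * heat t (x::'a)) \<partial>lborel) = ennreal (subord \<alpha> t)"
  proof (cases "t > 0")
   case True
   have "(\<integral>\<^sup>+x. ennreal (subord \<alpha> t * heat t (x::'a)) \<partial>lborel) = ennreal (subord \<alpha> t) * 1"
    by (simp add: ennreal_mult subord_nonneg[OF a] heat_nonneg nn_integral_cmult heat_nn_integral[OF True])
   then show ?thesis by simp
  qed (simp add: subord_def)
 qed
 finally show ?thesis using subord_nn_integral[OF a] by simp
qed

lemma bk_AE:
 assumes a: "\<alpha> > 0"
 shows "AE x in lborel. ennreal (bk \<alpha> (x::'a::euclidean_space)) = (\<integral>\<^sup>+t. ennreal (subord \<alpha> t * heat t x) \<partial>lborel)"
proof -
 have "AE x in lborel. (\<integral>\<^sup>+t. ennreal (subord \<alpha> t * heat t (x::'a)) \<partial>lborel) \<noteq> \<infinity>"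
  by (rule nn_integral_PInf_AE) (use subord_heat_nn_integral[OF a, where 'a='a] in auto)
 then show ?thesis by eventually_elim (auto simp: bk_def less_top)
qed

lemma bk_nn_integral:
 assumes a: "\<alpha> > 0" shows "(\<integral>\<^sup>+x. ennreal (bk \<alpha> (x::'a::euclidean_space)) \<partial>lborel) = 1"
 using nn_integral_cong_AE[OF bk_AE[OF a]] subord_heat_nn_integral[OF a] by metis

lemma bk_integrable: "\<alpha> > 0 ==> integrable lborel (bk \<alpha> :: 'a::euclidean_space => real)"
 by (rule integrableI_nonneg) (auto simp: bk_nonneg bk_nn_integral)

lemma fourier_heat:
 assumes t: "t > 0"
 shows "fourier (\<lambda>x. complex_of_real (heat t x)) \<xi> = complex_of_real (exp (- t * (norm (\<xi>::'a::euclidean_space))\<^sup>2))"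
proof -
 have "complex_of_real (heat t x) = complex_of_real ((4 * pi * t) powr (- (DIM('a) / 2))) * cgauss (1 / (4 * t)) 0 x" for x :: 'a
  by (simp add: heat_def cgauss_def exp_of_real[symmetric] dot_square_norm)
 then have "fourier (\<lambda>x::'a. complex_of_real (heat t x)) \<xi> = complex_of_real ((4 * pi * t) powr (- (DIM('a) / 2))) * fourier (cgauss (1 / (4 * t)) 0) \<xi>"
  unfolding fourier_def by (subst integral_mult_right_zero[symmetric]) (simp add: mult_ac)
 also have "... = complex_of_real ((4 * pi * t) powr (- (DIM('a) / 2)) * ((pi / (1 / (4 * t))) powr (DIM('a) / 2) * exp (- (norm (\<xi> - 0))\<^sup>2 / (4 * (1 / (4 * t))))))"
  using t by (subst fourier_cgauss) (simp_all only: of_real_mult, simp)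
 also have "(4 * pi * t) powr (- (DIM('a) / 2)) * ((pi / (1 / (4 * t))) powr (DIM('a) / 2) * exp (- (norm (\<xi> - 0))\<^sup>2 / (4 * (1 / (4 * t))))) = exp (- t * (norm \<xi>)\<^sup>2)"
  using t by (simp add: powr_minus mult.commute mult.left_commute)
 finally show ?thesis .
qed

text \<open>Fubini moves the transform onto the heat kernel, whose transform at time t is exp(-t
  |\<xi>|^2); subordination sums these up to the Bessel multiplier.\<close>

lemma fourier_bk:
 assumes a: "\<alpha> > 0"
 shows "fourier (\<lambda>x. complex_of_real (bk \<alpha> x)) \<xi> = complex_of_real ((1 + (norm (\<xi>::'a::euclidean_space))\<^sup>2) powr (- \<alpha> / 2))"
proof -
 have i: "integrable (lborel \<Otimes>\<^sub>M lborel) (\<lambda>(x::'a, t). cis (- (x \<bullet> \<xi>)) * complex_of_real (subord \<alpha> t * heat t x))"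
 proof (rule integrableI_bounded)
  show "(\<lambda>(x::'a, t). cis (- (x \<bullet> \<xi>)) * complex_of_real (subord \<alpha> t * heat t x)) \<in> borel_measurable (lborel \<Otimes>\<^sub>M lborel)"
   unfolding cis_conv_exp by measurable
  have "(\<integral>\<^sup>+z. ennreal (norm (case z of (x::'a, t) => cis (- (x \<bullet> \<xi>)) * complex_of_real (subord \<alpha> t * heat t x))) \<partial>(lborel \<Otimes>\<^sub>M lborel))
   = (\<integral>\<^sup>+z. (case z of (x::'a, t) => ennreal (subord \<alpha> t * heat t x)) \<partial>(lborel \<Otimes>\<^sub>M lborel))"
   by (intro nn_integral_cong) (auto simp: norm_mult abs_mult subord_nonneg[OF a] heat_nonneg)
  also have "... = 1"
   using subord_heat_nn_integral[OF a, where 'a='a] by (subst lborel.nn_integral_fst[symmetric]) auto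
  finally show "(\<integral>\<^sup>+z. ennreal (norm (case z of (x::'a, t) => cis (- (x \<bullet> \<xi>)) * complex_of_real (subord \<alpha> t * heat t x))) \<partial>(lborel \<Otimes>\<^sub>M lborel)) < \<infinity>" by simp
 qed
 have "fourier (\<lambda>x. complex_of_real (bk \<alpha> x)) \<xi> = (LINT x|lborel. (LINT t|lborel. cis (- (x \<bullet> \<xi>)) * complex_of_real (subord \<alpha> t * heat t x)))"
  unfolding fourier_def
 proof (rule integral_cong_AE)
  show "(\<lambda>x. cis (- (x \<bullet> \<xi>)) * complex_of_real (bk \<alpha> x)) \<in> borel_measurable lborel"
   unfolding cis_conv_exp by measurable
  show "(\<lambda>x. LINT t|lborel. cis (- (x \<bullet> \<xi>)) * complex_of_real (subord \<alpha> t * heat t x)) \<in> borel_measurable lborel"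
   unfolding cis_conv_exp by measurable
  show "AE x in lborel. cis (- (x \<bullet> \<xi>)) * complex_of_real (bk \<alpha> x) = (LINT t|lborel. cis (- (x \<bullet> \<xi>)) * complex_of_real (subord \<alpha> t * heat t x))"
  proof (rule AE_I2)
   fix x :: 'a
   have "bk \<alpha> x = (LINT t|lborel. subord \<alpha> t * heat t x)"
    unfolding bk_def by (subst integral_eq_nn_integral) (auto simp: subord_nonneg[OF a] heat_nonneg)
   then show "cis (- (x \<bullet> \<xi>)) * complex_of_real (bk \<alpha> x) = (LINT t|lborel. cis (- (x \<bullet> \<xi>)) * complex_of_real (subord \<alpha> t * heat t x))"
    by (simp only: integral_mult_right_zero integral_complex_of_real)
  qed
 qed
 also have "... = (LINT t|lborel. (LINT x|lborel. cis (- (x \<bullet> \<xi>)) * complex_of_real (subord \<alpha> t * heat t x)))"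
  by (rule lborel_pair.Fubini_integral[OF i, symmetric])
 also have "... = (LINT t|lborel. complex_of_real (subord \<alpha> t * exp (- t * (norm \<xi>)\<^sup>2)))"
 proof (intro LINT_cong refl)
  fix t
  show "(LINT x|lborel. cis (- (x \<bullet> \<xi>)) * complex_of_real (subord \<alpha> t * heat t x)) = complex_of_real (subord \<alpha> t * exp (- t * (norm \<xi>)\<^sup>2))"
  proof (cases "t > 0")
   case True
   have "(LINT x|lborel. cis (- (x \<bullet> \<xi>)) * complex_of_real (subord \<alpha> t * heat t x))
    = complex_of_real (subord \<alpha> t) * fourier (\<lambda>x. complex_of_real (heat t x)) \<xi>"
    unfolding fourier_def by (subst integral_mult_right_zero[symmetric]) (simp add: mult_ac)
   then show ?thesis unfolding fourier_heat[OF True] by simp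
  qed (simp add: subord_def)
 qed
 also have "... = complex_of_real (LINT t|lborel. subord \<alpha> t * exp (- t * (norm \<xi>)\<^sup>2))"
  by (rule integral_complex_of_real)
 also have "(LINT t|lborel. subord \<alpha> t * exp (- t * (norm \<xi>)\<^sup>2)) = (1 + (norm \<xi>)\<^sup>2) powr (- \<alpha> / 2)"
 proof -
  have "(\<integral>\<^sup>+t. ennreal (subord \<alpha> t * exp (- t * (norm \<xi>)\<^sup>2)) \<partial>lborel) = ennreal ((1 + (norm \<xi>)\<^sup>2) powr (- (\<alpha> / 2)))"
   using subordination[of "\<alpha> / 2" "(norm \<xi>)\<^sup>2"] a unfolding subord_def[symmetric] by (simp add: ennreal_mult subord_nonneg[OF a])
  then show ?thesis
   by (subst integral_eq_nn_integral) (auto simp: subord_nonneg[OF a])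
 qed
 finally show ?thesis .
qed

lemma bk_has_tempered_fourier:
 assumes a: "\<alpha> > 0"
 shows "has_tempered_fourier (\<lambda>x::'a::euclidean_space. complex_of_real (bk \<alpha> x)) (\<lambda>\<xi>. complex_of_real ((1 + (norm \<xi>)\<^sup>2) powr (- \<alpha> / 2)))"
 unfolding has_tempered_fourier_def
proof (intro conjI ballI)
 have bi: "integrable lborel (\<lambda>x::'a. complex_of_real (bk \<alpha> x))" using bk_integrable[OF a, where 'a='a] by simp
 show "tempered_fun (\<lambda>x::'a. complex_of_real (bk \<alpha> x))" by (rule tempered_fun_integrable[OF bi])
 show "tempered_fun (\<lambda>\<xi>::'a. complex_of_real ((1 + (norm \<xi>)\<^sup>2) powr (- \<alpha> / 2)))"
 proof (rule tempered_fun_bounded[where C=1])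
  fix x :: 'a
  have "(1 + (norm x)\<^sup>2) powr (- \<alpha> / 2) \<le> 1 powr (- \<alpha> / 2)" using a by (intro powr_mono2') auto
  then show "norm (complex_of_real ((1 + (norm x)\<^sup>2) powr (- \<alpha> / 2))) \<le> 1" by simp
 qed measurable
 fix \<phi> :: "'a => complex" assume "\<phi> \<in> schwartz"
 from integral_mult_fourier[OF bi schwartz_integrable[OF this]]
 show "(LINT x|lborel. complex_of_real (bk \<alpha> x) * fourier \<phi> x) = (LINT \<xi>|lborel. complex_of_real ((1 + (norm \<xi>)\<^sup>2) powr (- \<alpha> / 2)) * \<phi> \<xi>)"
  unfolding fourier_bk[OF a] .
qed

text \<open>A nonnegative tempered function is integrable against every centred Gaussian, and by
  duality its convolution with Gaussians is determined by \<open>m\<close> alone: the test function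
  is the modulated Gaussian whose transform is a multiple of exp(-s |x-a|^2).\<close>

lemma tempered_fourier_gauss:
 fixes k :: "'a::euclidean_space => real"
 assumes k: "has_tempered_fourier (\<lambda>x. complex_of_real (k x)) m" "\<And>x. 0 \<le> k x" and s: "s > 0"
 shows "integrable lborel (\<lambda>x. k x * exp (- s * (norm x)\<^sup>2))"
  and "complex_of_real (LINT x|lborel. k x * exp (- s * (norm (x - a))\<^sup>2)) = complex_of_real ((pi * (4 * s)) powr (- (DIM('a) / 2))) * (LINT x|lborel. m x * cgauss (1 / (4 * s)) a x)"
proof -
 have e: "cgauss s 0 x = complex_of_real (exp (- s * (norm x)\<^sup>2))" for x :: 'a
  by (simp add: cgauss_def exp_of_real[symmetric] dot_square_norm)
 have "integrable lborel (\<lambda>x. complex_of_real (k x) * cgauss s 0 x)"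
  using k(1) cgauss_schwartz[OF s, of 0] unfolding has_tempered_fourier_def tempered_fun_def by blast
 then have "integrable lborel (\<lambda>x. complex_of_real (k x * exp (- s * (norm x)\<^sup>2)))" unfolding e by simp
 then show "integrable lborel (\<lambda>x. k x * exp (- s * (norm x)\<^sup>2))" unfolding complex_of_real_integrable_eq .
 have p: "1 / (4 * s) > 0" using s by simp
 have "(LINT x|lborel. complex_of_real (k x) * fourier (cgauss (1 / (4 * s)) a) x) = (LINT x|lborel. m x * cgauss (1 / (4 * s)) a x)"
  using k(1) cgauss_schwartz[OF p, of a] unfolding has_tempered_fourier_def by blast
 moreover have "complex_of_real (k x) * fourier (cgauss (1 / (4 * s)) a) x
   = complex_of_real ((pi * (4 * s)) powr (DIM('a) / 2)) * complex_of_real (k x * exp (- s * (norm (x - a))\<^sup>2))" for x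
  unfolding fourier_cgauss[OF p] using s by simp
 ultimately have "complex_of_real ((pi * (4 * s)) powr (DIM('a) / 2)) * complex_of_real (LINT x|lborel. k x * exp (- s * (norm (x - a))\<^sup>2)) = (LINT x|lborel. m x * cgauss (1 / (4 * s)) a x)"
  by (simp only: integral_mult_right_zero integral_complex_of_real)
 then show "complex_of_real (LINT x|lborel. k x * exp (- s * (norm (x - a))\<^sup>2)) = complex_of_real ((pi * (4 * s)) powr (- (DIM('a) / 2))) * (LINT x|lborel. m x * cgauss (1 / (4 * s)) a x)"
  using s by (simp add: powr_minus field_simps flip: of_real_mult)
qed

lemma nn_integral_lborel_affine:
 fixes f :: "'a::euclidean_space => ennreal"
 assumes [measurable]: "f \<in> borel_measurable borel" and c: "c \<noteq> 0"
 shows "(\<integral>\<^sup>+x. f x \<partial>lborel) = ennreal (\<bar>c\<bar> ^ DIM('a)) * (\<integral>\<^sup>+x. f (t + c *\<^sub>R x) \<partial>lborel)"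
proof -
 have [measurable]: "(\<lambda>x. t + c *\<^sub>R x) \<in> borel \<rightarrow>\<^sub>M (borel::'a measure)" by measurable
 show ?thesis
  by (subst lborel_affine[OF c, of t])
   (simp add: nn_integral_density nn_integral_distr nn_integral_cmult)
qed

text \<open>Testing with Gaussians determines the convolution of \<open>k\<close> with every Gaussian. Letting the
 Gaussians concentrate determines the integral of \<open>k\<close> over every box.\<close>

lemma gauss_smoothing_limit:
 fixes k :: "'a::euclidean_space => real"
 assumes [measurable]: "k \<in> borel_measurable borel" and k0: "\<And>x. 0 \<le> k x"
  and ki: "\<And>s. s > 0 ==> integrable lborel (\<lambda>x. k x * exp (- s * (norm x)\<^sup>2))"
 shows "(\<lambda>n. \<integral>\<^sup>+x. ennreal (k x) * (\<integral>\<^sup>+w. ennreal (exp (- (norm w)\<^sup>2 / 4)) * indicator (box a b) (x + (1 / real (Suc n)) *\<^sub>R w) \<partial>lborel) \<partial>lborel)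
   \<longlonglongrightarrow> (\<integral>\<^sup>+x. ennreal (k x) * ((\<integral>\<^sup>+w. ennreal (exp (- (norm (w::'a))\<^sup>2 / 4)) \<partial>lborel) * indicator (box a b) x) \<partial>lborel)"
proof -
 define g where "g w = ennreal (exp (- (norm (w::'a))\<^sup>2 / 4))" for w
 define I where "I = (\<integral>\<^sup>+w. g w \<partial>lborel)"
 define J where "J = (\<integral>\<^sup>+w. ennreal (exp ((norm w)\<^sup>2 / 8)) * g w \<partial>lborel)"
 define h where "h n x = (\<integral>\<^sup>+w. g w * indicator (box a b) (x + (1 / real (Suc n)) *\<^sub>R w) \<partial>lborel)" for n x
 have [measurable]: "g \<in> borel_measurable borel" unfolding g_def by measurable
 have hm[measurable]: "h n \<in> borel_measurable borel" for n unfolding h_def by measurable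
 have I: "I < \<infinity>" using gauss_nn_integral(1)[of "1/4", where 'a='a] by (simp add: I_def g_def)
 have J: "J < \<infinity>"
 proof -
  have "J = (\<integral>\<^sup>+w. ennreal (exp (- (1/8) * (norm (w::'a))\<^sup>2)) \<partial>lborel)"
   unfolding J_def g_def by (intro nn_integral_cong) (simp add: ennreal_mult[symmetric] exp_add[symmetric])
  then show ?thesis using gauss_nn_integral(1)[of "1/8", where 'a='a] by simp
 qed
 obtain R where R: "R > 0" "box a b \<subseteq> ball 0 R"
  using bounded_box[of a b] bounded_subset_ballD by blast
 \<comment> \<open>A majorant uniform in n. It has to be Gaussian in x, because \<open>k\<close> is
   integrable only against Gaussians.\<close>
 define W where "W x = (ennreal (exp (R\<^sup>2 / 8)) * I + J) * ennreal (exp (- (1/32) * (norm x)\<^sup>2))" for x :: 'a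
 have hb: "h n x \<le> W x" for n x
 proof (cases "norm x < 2 * R")
  case True
  have "h n x \<le> I" unfolding h_def I_def by (intro nn_integral_mono) (auto simp: indicator_def)
  also have "... = ennreal (exp (R\<^sup>2 / 8) * exp (- R\<^sup>2 / 8)) * I" by (simp add: exp_add[symmetric])
  also have "... \<le> ennreal (exp (R\<^sup>2 / 8) * exp (- (1/32) * (norm x)\<^sup>2)) * I"
  proof (intro mult_right_mono ennreal_leI mult_left_mono)
   have "(norm x)\<^sup>2 \<le> (2 * R)\<^sup>2" using True by (intro power_mono) auto
   then show "exp (- R\<^sup>2 / 8) \<le> exp (- (1/32) * (norm x)\<^sup>2)" by (simp add: power_mult_distrib)
  qed auto
  also have "... = (ennreal (exp (R\<^sup>2 / 8)) * I) * ennreal (exp (- (1/32) * (norm x)\<^sup>2))"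
   by (simp add: ennreal_mult mult_ac)
  also have "... \<le> W x" unfolding W_def by (intro mult_right_mono) auto
  finally show ?thesis .
 next
  case False
  have "h n x \<le> (\<integral>\<^sup>+w. ennreal (exp (- (1/32) * (norm x)\<^sup>2)) * (ennreal (exp ((norm w)\<^sup>2 / 8)) * g w) \<partial>lborel)"
   unfolding h_def
  proof (intro nn_integral_mono)
   fix w :: 'a
   show "g w * indicator (box a b) (x + (1 / real (Suc n)) *\<^sub>R w)
    \<le> ennreal (exp (- (1/32) * (norm x)\<^sup>2)) * (ennreal (exp ((norm w)\<^sup>2 / 8)) * g w)"
   proof (cases "x + (1 / real (Suc n)) *\<^sub>R w \<in> box a b")
    case True
    then have "norm (x + (1 / real (Suc n)) *\<^sub>R w) < R" using R by auto
    then have "norm x - norm ((1 / real (Suc n)) *\<^sub>R w) < R"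
     using norm_triangle_ineq2[of x "- (1 / real (Suc n)) *\<^sub>R w"] by simp
    moreover have "norm ((1 / real (Suc n)) *\<^sub>R w) \<le> norm w"
     by (simp add: divide_le_eq mult_le_cancel_left1)
    \<comment> \<open>If |x| is at least 2R and x + w/(n+1) lies in the box, then |w| is at least
      |x|/2. Half of the exponent |w|^2/4 therefore pays for exp(-|x|^2/32), and the other half
      stays integrable.\<close>
    ultimately have "norm x / 2 \<le> norm w" using False by linarith
    then have "(norm x / 2)\<^sup>2 \<le> (norm w)\<^sup>2" by (intro power_mono) auto
    then have "1 \<le> exp (- (1/32) * (norm x)\<^sup>2) * exp ((norm w)\<^sup>2 / 8)"
     by (simp add: exp_add[symmetric] power_divide)
    then have "1 * g w \<le> ennreal (exp (- (1/32) * (norm x)\<^sup>2) * exp ((norm w)\<^sup>2 / 8)) * g w"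
     by (intro mult_right_mono) (auto simp del: mult_1_left)
    then show ?thesis using True by (simp add: ennreal_mult mult.assoc)
   qed auto
  qed
  also have "... = J * ennreal (exp (- (1/32) * (norm x)\<^sup>2))"
   unfolding J_def by (subst nn_integral_cmult) (auto simp: mult.commute)
  also have "... \<le> W x" unfolding W_def by (intro mult_right_mono) auto
  finally show ?thesis .
 qed
 have hl: "(\<lambda>n. h n x) \<longlonglongrightarrow> I * indicator (box a b) x" if x: "x \<notin> frontier (box a b)" for x
 proof -
  have "(\<lambda>n. \<integral>\<^sup>+w. g w * indicator (box a b) (x + (1 / real (Suc n)) *\<^sub>R w) \<partial>lborel) \<longlonglongrightarrow> (\<integral>\<^sup>+w. g w * indicator (box a b) x \<partial>lborel)"
  proof (rule nn_integral_dominated_convergence[where w=g])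
   show "AE w in lborel. (\<lambda>n. g w * indicator (box a b) (x + (1 / real (Suc n)) *\<^sub>R w)) \<longlonglongrightarrow> g w * indicator (box a b) x"
   proof (rule AE_I2)
    fix w
    have "(\<lambda>n. x + (1 / real (Suc n)) *\<^sub>R w) \<longlonglongrightarrow> x + 0 *\<^sub>R w"
     by (intro tendsto_intros LIMSEQ_Suc[OF lim_1_over_n])
    then have t: "(\<lambda>n. x + (1 / real (Suc n)) *\<^sub>R w) \<longlonglongrightarrow> x" by simp
    have "\<forall>\<^sub>F n in sequentially. indicator (box a b) (x + (1 / real (Suc n)) *\<^sub>R w) = (indicator (box a b) x :: ennreal)"
    proof (cases "x \<in> box a b")
     case True
     have "\<forall>\<^sub>F n in sequentially. x + (1 / real (Suc n)) *\<^sub>R w \<in> box a b"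
      by (rule topological_tendstoD[OF t]) (use True in auto)
     then show ?thesis using True by (auto elim!: eventually_mono)
    next
     case False
     then have "x \<in> - closure (box a b)" using x interior_subset[of "box a b"] by (auto simp: frontier_def)
     then have "\<forall>\<^sub>F n in sequentially. x + (1 / real (Suc n)) *\<^sub>R w \<in> - closure (box a b)"
      by (intro topological_tendstoD[OF t]) auto
     then show ?thesis
     proof eventually_elim
      case (elim n)
      then have "x + (1 / real (Suc n)) *\<^sub>R w \<notin> box a b" using closure_subset[of "box a b"] by blast
      with False show ?case unfolding indicator_def by simp
     qed
    qed
    then have "\<forall>\<^sub>F n in sequentially. g w * indicator (box a b) x = g w * indicator (box a b) (x + (1 / real (Suc n)) *\<^sub>R w)"
     by eventually_elim simp
    then show "(\<lambda>n. g w * indicator (box a b) (x + (1 / real (Suc n)) *\<^sub>R w)) \<longlonglongrightarrow> g w * indicator (box a b) x"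
     by (rule Lim_transform_eventually[rotated]) simp
   qed
  qed (use I in \<open>auto simp: I_def indicator_def\<close>)
  then show ?thesis unfolding h_def I_def by (simp add: nn_integral_multc)
 qed
 have "(\<lambda>n. \<integral>\<^sup>+x. ennreal (k x) * h n x \<partial>lborel) \<longlonglongrightarrow> (\<integral>\<^sup>+x. ennreal (k x) * (I * indicator (box a b) x) \<partial>lborel)"
 proof (rule nn_integral_dominated_convergence[where w="\<lambda>x. ennreal (k x) * W x"])
  have fr: "AE x in lborel. x \<notin> frontier (box a b)"
  proof -
   have "negligible (frontier (box a b))" by (intro negligible_convex_frontier convex_box)
   then have "frontier (box a b) \<in> null_sets lborel"
    by (simp add: negligible_iff_null_sets null_sets_completion_iff)
   then show ?thesis by (rule AE_not_in)
  qed
  show "AE x in lborel. (\<lambda>n. ennreal (k x) * h n x) \<longlonglongrightarrow> ennreal (k x) * (I * indicator (box a b) x)"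
   using fr by eventually_elim (intro ennreal_tendsto_cmult hl, auto)
  have "(\<integral>\<^sup>+x. ennreal (k x) * W x \<partial>lborel) = (\<integral>\<^sup>+x. (ennreal (exp (R\<^sup>2 / 8)) * I + J) * ennreal (k x * exp (- (1/32) * (norm x)\<^sup>2)) \<partial>lborel)"
   unfolding W_def by (intro nn_integral_cong) (simp add: ennreal_mult k0 mult_ac)
  also have "... = (ennreal (exp (R\<^sup>2 / 8)) * I + J) * (\<integral>\<^sup>+x. ennreal (k x * exp (- (1/32) * (norm x)\<^sup>2)) \<partial>lborel)"
   by (subst nn_integral_cmult) auto
  also have "... = (ennreal (exp (R\<^sup>2 / 8)) * I + J) * ennreal (LINT x|lborel. k x * exp (- (1/32) * (norm x)\<^sup>2))"
   by (subst nn_integral_eq_integral[OF ki]) (auto simp: k0)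
  also have "... < \<infinity>" using I J by (auto simp: ennreal_mult_less_top)
  finally show "(\<integral>\<^sup>+x. ennreal (k x) * W x \<partial>lborel) < \<infinity>" .
  show "AE x in lborel. ennreal (k x) * h n x \<le> ennreal (k x) * W x" for n
   by (intro AE_I2 mult_left_mono hb) auto
 qed (auto simp: W_def)
 then show ?thesis unfolding h_def I_def g_def .
qed

text \<open>The substitution w = (n+1)(y - x) turns the smoothed indicator of the box into a
  Gaussian around y; after Tonelli, \<open>k\<close> occurs only in its convolutions with
  Gaussians.\<close>

lemma gauss_convolution_box:
 fixes k :: "'a::euclidean_space => real"
 assumes [measurable]: "k \<in> borel_measurable borel" and k0: "\<And>x. 0 \<le> k x"
 shows "(\<integral>\<^sup>+x. ennreal (k x) * (\<integral>\<^sup>+w. ennreal (exp (- (norm w)\<^sup>2 / 4)) * indicator (box a b) (x + (1 / real (Suc n)) *\<^sub>R w) \<partial>lborel) \<partial>lborel)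
  = ennreal (real (Suc n) ^ DIM('a)) * (\<integral>\<^sup>+y. indicator (box a b) y * (\<integral>\<^sup>+x. ennreal (k x * exp (- ((real (Suc n))\<^sup>2 / 4) * (norm (x - y))\<^sup>2)) \<partial>lborel) \<partial>lborel)"
proof -
 let ?c = "real (Suc n)"
 have "(\<integral>\<^sup>+w. ennreal (exp (- (norm w)\<^sup>2 / 4)) * indicator (box a b) (x + (1 / ?c) *\<^sub>R w) \<partial>lborel)
   = ennreal (\<bar>?c\<bar> ^ DIM('a)) * (\<integral>\<^sup>+y. ennreal (exp (- (norm (- ?c *\<^sub>R x + ?c *\<^sub>R y))\<^sup>2 / 4)) * indicator (box a b) (x + (1 / ?c) *\<^sub>R (- ?c *\<^sub>R x + ?c *\<^sub>R y)) \<partial>lborel)" for x :: 'a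
 proof (rule nn_integral_lborel_affine)
  have [measurable]: "(\<lambda>w. x + (1 / ?c) *\<^sub>R w) \<in> borel \<rightarrow>\<^sub>M borel" "box a b \<in> sets borel"
   by (auto intro!: borel_measurable_continuous_onI continuous_intros)
  have "(\<lambda>w. indicator (box a b) (x + (1 / ?c) *\<^sub>R w) :: ennreal) \<in> borel_measurable borel"
   by (rule measurable_compose[of _ borel borel]) auto
  then show "(\<lambda>w. ennreal (exp (- (norm w)\<^sup>2 / 4)) * indicator (box a b) (x + (1 / ?c) *\<^sub>R w)) \<in> borel_measurable borel"
   by (intro borel_measurable_times_ennreal) auto
 qed simp
 also have "... x = ennreal (?c ^ DIM('a)) * (\<integral>\<^sup>+y. ennreal (exp (- (?c\<^sup>2 / 4) * (norm (x - y))\<^sup>2)) * indicator (box a b) y \<partial>lborel)" for x :: 'a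
 proof -
  have 1: "- ?c *\<^sub>R x + ?c *\<^sub>R y = ?c *\<^sub>R (y - x)" for y by (simp add: algebra_simps)
  have 2: "(norm (?c *\<^sub>R (y - x)))\<^sup>2 = ?c\<^sup>2 * (norm (x - y))\<^sup>2" for y by (simp add: power_mult_distrib norm_minus_commute)
  have 3: "x + (1 / ?c) *\<^sub>R (?c *\<^sub>R (y - x)) = y" for y by simp
  show ?thesis unfolding 1 2 3 by (simp add: algebra_simps)
 qed
 finally have e: "(\<integral>\<^sup>+w. ennreal (exp (- (norm w)\<^sup>2 / 4)) * indicator (box a b) (x + (1 / ?c) *\<^sub>R w) \<partial>lborel)
  = ennreal (?c ^ DIM('a)) * (\<integral>\<^sup>+y. ennreal (exp (- (?c\<^sup>2 / 4) * (norm (x - y))\<^sup>2)) * indicator (box a b) y \<partial>lborel)" for x :: 'a .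
 have "(\<integral>\<^sup>+x. ennreal (k x) * (\<integral>\<^sup>+w. ennreal (exp (- (norm w)\<^sup>2 / 4)) * indicator (box a b) (x + (1 / ?c) *\<^sub>R w) \<partial>lborel) \<partial>lborel)
  = (\<integral>\<^sup>+x. ennreal (?c ^ DIM('a)) * (\<integral>\<^sup>+y. ennreal (k x) * (ennreal (exp (- (?c\<^sup>2 / 4) * (norm (x - y))\<^sup>2)) * indicator (box a b) y) \<partial>lborel) \<partial>lborel)"
  unfolding e by (subst nn_integral_cmult) (auto simp: mult_ac)
 also have "... = ennreal (?c ^ DIM('a)) * (\<integral>\<^sup>+x. (\<integral>\<^sup>+y. ennreal (k x) * (ennreal (exp (- (?c\<^sup>2 / 4) * (norm (x - y))\<^sup>2)) * indicator (box a b) y) \<partial>lborel) \<partial>lborel)"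
  by (rule nn_integral_cmult) measurable
 also have "(\<integral>\<^sup>+x. (\<integral>\<^sup>+y. ennreal (k x) * (ennreal (exp (- (?c\<^sup>2 / 4) * (norm (x - y))\<^sup>2)) * indicator (box a b) y) \<partial>lborel) \<partial>lborel)
   = (\<integral>\<^sup>+y. (\<integral>\<^sup>+x. ennreal (k x) * (ennreal (exp (- (?c\<^sup>2 / 4) * (norm (x - y))\<^sup>2)) * indicator (box a b) y) \<partial>lborel) \<partial>lborel)"
  by (rule lborel_pair.Fubini') measurable
 also have "... = (\<integral>\<^sup>+y. indicator (box a b) y * (\<integral>\<^sup>+x. ennreal (k x * exp (- (?c\<^sup>2 / 4) * (norm (x - y))\<^sup>2)) \<partial>lborel) \<partial>lborel)"
  by (intro nn_integral_cong, subst nn_integral_cmult[symmetric]) (auto simp: ennreal_mult k0 mult_ac)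
 finally show ?thesis .
qed

text \<open>Nonnegativity makes both functions densities of measures that are finite on boxes.
  Equality on boxes, an intersection-stable generator, then gives equality of the measures and
  almost everywhere of the densities.\<close>

lemma tempered_fourier_unique:
 fixes k1 k2 :: "'a::euclidean_space => real"
 assumes k1: "has_tempered_fourier (\<lambda>x. complex_of_real (k1 x)) m" "\<And>x. 0 \<le> k1 x"
  and k2: "has_tempered_fourier (\<lambda>x. complex_of_real (k2 x)) m" "\<And>x. 0 \<le> k2 x"
 shows "k1 \<in> borel_measurable borel" "AE x in lborel. k1 x = k2 x"
proof -
 have m: "k \<in> borel_measurable borel" if "has_tempered_fourier (\<lambda>x. complex_of_real (k x)) m" for k :: "'a => real"
 proof -
  have [measurable]: "(\<lambda>x. complex_of_real (k x)) \<in> borel_measurable borel"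
   using that unfolding has_tempered_fourier_def tempered_fun_def by blast
  have "(\<lambda>x. Re (complex_of_real (k x))) \<in> borel_measurable borel" by measurable
  then show ?thesis by simp
 qed
 show km: "k1 \<in> borel_measurable borel" by (rule m[OF k1(1)])
 have [measurable]: "k1 \<in> borel_measurable borel" "k2 \<in> borel_measurable borel" using m k1 k2 by auto
 define I where "I = (\<integral>\<^sup>+w. ennreal (exp (- (norm (w::'a))\<^sup>2 / 4)) \<partial>lborel)"
 have I: "0 < I" "I < \<infinity>" using gauss_nn_integral(1)[of "1/4", where 'a='a] by (auto simp: I_def)
 \<comment> \<open>From |x|^2 at most 2|x-y|^2 + 2|y|^2, a Gaussian centred at y is dominated by a
   centred one of half the rate.\<close>
 have int: "integrable lborel (\<lambda>x. k x * exp (- s * (norm (x - y))\<^sup>2))"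
  if k: "has_tempered_fourier (\<lambda>x. complex_of_real (k x)) m" "\<And>x. 0 \<le> k x" and s: "s > 0" for k :: "'a => real" and s y
 proof (rule int_bound)
  have s2: "s / 2 > 0" using s by simp
  show "integrable lborel (\<lambda>x. exp (s * (norm y)\<^sup>2) * (k x * exp (- (s / 2) * (norm x)\<^sup>2)))"
   by (intro integrable_mult_right tempered_fourier_gauss(1)[OF k s2])
  show "AE x in lborel. norm (k x * exp (- s * (norm (x - y))\<^sup>2)) \<le> norm (exp (s * (norm y)\<^sup>2) * (k x * exp (- (s / 2) * (norm x)\<^sup>2)))"
  proof (intro AE_I2)
   fix x
   have "(norm x)\<^sup>2 \<le> (norm (x - y) + norm y)\<^sup>2" using norm_triangle_sub[of x y] by (intro power_mono) auto
   also have "... \<le> 2 * (norm (x - y))\<^sup>2 + 2 * (norm y)\<^sup>2"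
    using sum_squares_bound[of "norm (x - y)" "norm y"] by (simp add: power2_sum)
   finally have "s * (norm x)\<^sup>2 \<le> s * (2 * (norm (x - y))\<^sup>2 + 2 * (norm y)\<^sup>2)" using s by (intro mult_left_mono) auto
   then have "exp (- s * (norm (x - y))\<^sup>2) \<le> exp (s * (norm y)\<^sup>2 + - (s / 2) * (norm x)\<^sup>2)" by (simp add: algebra_simps)
   then have "k x * exp (- s * (norm (x - y))\<^sup>2) \<le> k x * exp (s * (norm y)\<^sup>2 + - (s / 2) * (norm x)\<^sup>2)"
    by (rule mult_left_mono) (rule k)
   then show "norm (k x * exp (- s * (norm (x - y))\<^sup>2)) \<le> norm (exp (s * (norm y)\<^sup>2) * (k x * exp (- (s / 2) * (norm x)\<^sup>2)))"
    using k(2)[of x] unfolding exp_add by (simp add: mult_ac)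
  qed
 qed (use m[OF k(1)] in measurable)
 have conv: "(\<integral>\<^sup>+x. ennreal (k1 x * exp (- s * (norm (x - y))\<^sup>2)) \<partial>lborel) = (\<integral>\<^sup>+x. ennreal (k2 x * exp (- s * (norm (x - y))\<^sup>2)) \<partial>lborel)"
  if s: "s > 0" for s y
 proof -
  have "complex_of_real (LINT x|lborel. k1 x * exp (- s * (norm (x - y))\<^sup>2)) = complex_of_real (LINT x|lborel. k2 x * exp (- s * (norm (x - y))\<^sup>2))"
   using tempered_fourier_gauss(2)[OF k1 s] tempered_fourier_gauss(2)[OF k2 s] by metis
  then show ?thesis
   by (subst (1 2) nn_integral_eq_integral[OF int]) (use k1 k2 s in auto)
 qed
 have box: "(\<integral>\<^sup>+x. ennreal (k1 x) * indicator (box a b) x \<partial>lborel) = (\<integral>\<^sup>+x. ennreal (k2 x) * indicator (box a b) x \<partial>lborel)" for a b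
 proof -
  let ?A = "\<lambda>k n. (\<integral>\<^sup>+x. ennreal (k x) * (\<integral>\<^sup>+w. ennreal (exp (- (norm w)\<^sup>2 / 4)) * indicator (box a b) (x + (1 / real (Suc n)) *\<^sub>R w) \<partial>lborel) \<partial>lborel)"
  have "?A k1 n = ?A k2 n" for n
   unfolding gauss_convolution_box[OF \<open>k1 \<in> _\<close> k1(2)] gauss_convolution_box[OF \<open>k2 \<in> _\<close> k2(2)]
   by (subst conv) auto
  moreover have "?A k1 \<longlonglongrightarrow> (\<integral>\<^sup>+x. ennreal (k1 x) * (I * indicator (box a b) x) \<partial>lborel)"
   unfolding I_def by (rule gauss_smoothing_limit) (use k1 tempered_fourier_gauss(1)[OF k1] in auto)
  moreover have "?A k2 \<longlonglongrightarrow> (\<integral>\<^sup>+x. ennreal (k2 x) * (I * indicator (box a b) x) \<partial>lborel)"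
   unfolding I_def by (rule gauss_smoothing_limit) (use k2 tempered_fourier_gauss(1)[OF k2] in auto)
  ultimately have "(\<integral>\<^sup>+x. ennreal (k1 x) * (I * indicator (box a b) x) \<partial>lborel) = (\<integral>\<^sup>+x. ennreal (k2 x) * (I * indicator (box a b) x) \<partial>lborel)"
   using LIMSEQ_unique by (metis (no_types, lifting) ext)
  moreover have "(\<integral>\<^sup>+x. ennreal (k x) * (I * indicator (box a b) x) \<partial>lborel) = I * (\<integral>\<^sup>+x. ennreal (k x) * indicator (box a b) x \<partial>lborel)"
   if [measurable]: "k \<in> borel_measurable borel" for k :: "'a => real"
   by (subst nn_integral_cmult[symmetric]) (auto simp: mult_ac)
  ultimately have "I * (\<integral>\<^sup>+x. ennreal (k1 x) * indicator (box a b) x \<partial>lborel) = I * (\<integral>\<^sup>+x. ennreal (k2 x) * indicator (box a b) x \<partial>lborel)"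
   by simp
  then show ?thesis using I by (auto simp: ennreal_mult_cancel_left)
 qed
 \<comment> \<open>Finiteness on an exhausting sequence of boxes is required for uniqueness of
   measures.\<close>
 have fin: "(\<integral>\<^sup>+x. ennreal (k1 x) * indicator (box a b) x \<partial>lborel) \<noteq> \<infinity>" for a b :: 'a
 proof -
  obtain R where R: "R > 0" "box a b \<subseteq> ball 0 R"
   using bounded_box[of a b] bounded_subset_ballD by blast
  have "(\<integral>\<^sup>+x. ennreal (k1 x) * indicator (box a b) x \<partial>lborel) \<le> (\<integral>\<^sup>+x. ennreal (exp (R\<^sup>2)) * ennreal (k1 x * exp (- 1 * (norm x)\<^sup>2)) \<partial>lborel)"
  proof (intro nn_integral_mono)
   fix x :: 'a
   show "ennreal (k1 x) * indicator (box a b) x \<le> ennreal (exp (R\<^sup>2)) * ennreal (k1 x * exp (- 1 * (norm x)\<^sup>2))"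
   proof (cases "x \<in> box a b")
    case True
    then have "(norm x)\<^sup>2 \<le> R\<^sup>2" using R by (intro power_mono) auto
    then have "1 \<le> exp (R\<^sup>2 + - 1 * (norm x)\<^sup>2)" by simp
    then have "k1 x * 1 \<le> k1 x * exp (R\<^sup>2 + - 1 * (norm x)\<^sup>2)" by (intro mult_left_mono k1)
    then show ?thesis using True unfolding exp_add by (simp add: ennreal_mult[symmetric] k1(2) mult_ac)
   qed auto
  qed
  also have "... = ennreal (exp (R\<^sup>2)) * ennreal (LINT x|lborel. k1 x * exp (- 1 * (norm x)\<^sup>2))"
   by (subst nn_integral_cmult, simp, subst nn_integral_eq_integral)
    (use tempered_fourier_gauss(1)[OF k1, of 1] k1 in auto)
  also have "... < \<infinity>" by (simp add: ennreal_mult_less_top)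
  finally show ?thesis by simp
 qed
 have "density lborel (\<lambda>x. ennreal (k1 x)) = density lborel (\<lambda>x. ennreal (k2 x))"
 proof (rule measure_eqI_generator_eq[where E="range (\<lambda>(a, b). box a b :: 'a set)" and \<Omega>=UNIV and A="\<lambda>n::nat. box (- (real n *\<^sub>R One)) (real n *\<^sub>R One)"])
  show "Int_stable (range (\<lambda>(a, b). box a b :: 'a set))"
  proof (rule Int_stableI)
   fix A B :: "'a set" assume "A \<in> range (\<lambda>(a, b). box a b)" "B \<in> range (\<lambda>(a, b). box a b)"
   then obtain p q p' q' where "A = box p q" "B = box p' q'" by auto
   then have "A \<inter> B = (\<lambda>(a, b). box a b) (\<Sum>i\<in>Basis. max (p \<bullet> i) (p' \<bullet> i) *\<^sub>R i, \<Sum>i\<in>Basis. min (q \<bullet> i) (q' \<bullet> i) *\<^sub>R i)"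
    by (auto simp: set_eq_iff mem_box)
   then show "A \<inter> B \<in> range (\<lambda>(a, b). box a b)" by blast
  qed
  show "sets (density lborel (\<lambda>x. ennreal (k1 x))) = sigma_sets UNIV (range (\<lambda>(a, b). box a b))"
   "sets (density lborel (\<lambda>x. ennreal (k2 x))) = sigma_sets UNIV (range (\<lambda>(a, b). box a b))"
   by (auto simp: borel_eq_box)
  show "(\<Union>i::nat. box (- (real i *\<^sub>R One)) (real i *\<^sub>R One)) = (UNIV :: 'a set)"
   by (rule UN_box_eq_UNIV)
  show "emeasure (density lborel (\<lambda>x. ennreal (k1 x))) (box (- (real i *\<^sub>R One)) (real i *\<^sub>R One)) \<noteq> \<infinity>" for i
   using fin by (subst emeasure_density) auto
  show "emeasure (density lborel (\<lambda>x. ennreal (k1 x))) X = emeasure (density lborel (\<lambda>x. ennreal (k2 x))) X"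
   if "X \<in> range (\<lambda>(a, b). box a b)" for X
   using that by (auto simp: emeasure_density box)
 qed auto
 then have "AE x in lborel. ennreal (k1 x) = ennreal (k2 x)"
  by (intro sigma_finite_measure.density_unique[OF sigma_finite_lborel]) auto
 then show "AE x in lborel. k1 x = k2 x"
  by eventually_elim (use k1 k2 in auto)
qed

text \<open>Only times between |z|^2 and 2|z|^2 are kept. There the heat kernel is at least a
  multiple of |z|^{-N}, the Gamma density at least a multiple of |z|^{\<alpha>-2}, and the time
  interval has length |z|^2.\<close>

lemma bk_lower_bound:
 fixes \<alpha> R :: real
 assumes a: "\<alpha> > 0" and R: "R > 0"
 shows "\<exists>c>0. \<forall>z::'a::euclidean_space. norm z \<le> R \<longrightarrow>
  ennreal (c * norm z powr (\<alpha> - DIM('a))) \<le> (\<integral>\<^sup>+t. ennreal (subord \<alpha> t * heat t z) \<partial>lborel)"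
proof -
 let ?N = "real DIM('a)"
 have g: "Gamma (\<alpha> / 2) > 0" using a by (intro Gamma_real_pos) simp
 \<comment> \<open>The minimum covers both signs of the exponent \<alpha>/2 - 1: a nonnegative power
   of t is smallest at the left end of the time interval, a negative one at the right end.\<close>
 define c0 where "c0 = min 1 (2 powr (\<alpha> / 2 - 1))"
 define c where "c = c0 * exp (- (2 * R\<^sup>2)) / Gamma (\<alpha> / 2) * ((8 * pi) powr (- (?N / 2)) * exp (- (1 / 4)))"
 have c0: "c0 > 0" by (simp add: c0_def)
 then have c: "c > 0" unfolding c_def using g by (intro mult_pos_pos divide_pos_pos) auto
 show ?thesis
 proof (intro exI[of _ c] conjI c allI impI)
  fix z :: 'a assume z: "norm z \<le> R"
  show "ennreal (c * norm z powr (\<alpha> - ?N)) \<le> (\<integral>\<^sup>+t. ennreal (subord \<alpha> t * heat t z) \<partial>lborel)"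
  proof (cases "z = 0")
   case False
   define r where "r = norm z"
   have r: "r > 0" "r \<le> R" using False z by (auto simp: r_def)
   have rsq: "r powr 2 = r\<^sup>2" using powr_realpow[OF r(1), of 2] by simp
   have rp: "(r\<^sup>2) powr e = r powr (2 * e)" for e unfolding rsq[symmetric] powr_powr ..
   have r2: "r\<^sup>2 > 0" "r\<^sup>2 \<le> R\<^sup>2" using r by (auto intro: power_mono)
   have lb: "c * r powr (\<alpha> - 2 - ?N) \<le> subord \<alpha> t * heat t z" if t: "r\<^sup>2 \<le> t" "t \<le> 2 * r\<^sup>2" for t
   proof -
    have t0: "t > 0" using t r2 by linarith
    have p: "c0 * r powr (\<alpha> - 2) \<le> t powr (\<alpha> / 2 - 1)"
    proof (cases "\<alpha> / 2 - 1 \<ge> 0")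
     case True
     have "c0 * r powr (\<alpha> - 2) \<le> 1 * (r\<^sup>2) powr (\<alpha> / 2 - 1)"
      using r by (intro mult_mono) (auto simp: c0_def rp right_diff_distrib)
     also have "... \<le> t powr (\<alpha> / 2 - 1)" using True t r2 by (simp add: powr_mono2)
     finally show ?thesis .
    next
     case F: False
     have "c0 * r powr (\<alpha> - 2) \<le> 2 powr (\<alpha> / 2 - 1) * (r\<^sup>2) powr (\<alpha> / 2 - 1)"
      using r by (intro mult_mono) (auto simp: c0_def rp right_diff_distrib)
     also have "... = (2 * r\<^sup>2) powr (\<alpha> / 2 - 1)" by (simp add: powr_mult)
     also have "... \<le> t powr (\<alpha> / 2 - 1)" using F t t0 by (intro powr_mono2') auto
     finally show ?thesis .
    qed
    have e: "exp (- (2 * R\<^sup>2)) \<le> exp (- t)" using t r2 by simp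
    have s: "c0 * r powr (\<alpha> - 2) * exp (- (2 * R\<^sup>2)) / Gamma (\<alpha> / 2) \<le> subord \<alpha> t"
     using p e g t0 c0 by (auto simp: subord_def intro!: divide_right_mono mult_mono)
    have h1: "(8 * pi) powr (- (?N / 2)) * r powr (- ?N) \<le> (4 * pi * t) powr (- (?N / 2))"
    proof -
     have "(8 * pi) powr (- (?N / 2)) * r powr (- ?N) = (8 * pi) powr (- (?N / 2)) * (r\<^sup>2) powr (- (?N / 2))"
      by (simp add: rp)
     also have "... = (8 * pi * r\<^sup>2) powr (- (?N / 2))" by (simp add: powr_mult)
     also have "... \<le> (4 * pi * t) powr (- (?N / 2))" using t t0 by (intro powr_mono2') auto
     finally show ?thesis .
    qed
    have h2: "exp (- (1 / 4)) \<le> exp (- (norm z)\<^sup>2 / (4 * t))"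
     using t t0 by (simp add: r_def[symmetric] divide_simps)
    have h: "((8 * pi) powr (- (?N / 2)) * r powr (- ?N)) * exp (- (1 / 4)) \<le> heat t z"
     unfolding heat_def using h1 h2 by (intro mult_mono) auto
    have "(c0 * r powr (\<alpha> - 2) * exp (- (2 * R\<^sup>2)) / Gamma (\<alpha> / 2)) * (((8 * pi) powr (- (?N / 2)) * r powr (- ?N)) * exp (- (1 / 4))) \<le> subord \<alpha> t * heat t z"
     using s h c0 g by (intro mult_mono) (auto simp: subord_nonneg[OF a] intro!: divide_nonneg_pos mult_nonneg_nonneg)
    moreover have "r powr (\<alpha> - 2 - ?N) = r powr (\<alpha> - 2) * r powr (- ?N)" by (simp add: powr_add[symmetric])
    ultimately show ?thesis by (simp add: c_def mult_ac)
   qed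
   have "ennreal (c * norm z powr (\<alpha> - ?N)) = ennreal (c * r powr (\<alpha> - 2 - ?N)) * emeasure lborel {r\<^sup>2..2 * r\<^sup>2}"
   proof -
    have "r powr (\<alpha> - ?N) = r powr (\<alpha> - 2 - ?N) * r\<^sup>2"
     unfolding rsq[symmetric] powr_add[symmetric] by simp
    then show ?thesis using c r2 by (simp add: r_def[symmetric] ennreal_mult[symmetric] mult_ac)
   qed
   also have "... = (\<integral>\<^sup>+t. ennreal (c * r powr (\<alpha> - 2 - ?N)) * indicator {r\<^sup>2..2 * r\<^sup>2} t \<partial>lborel)"
    by (subst nn_integral_cmult_indicator) auto
   also have "... \<le> (\<integral>\<^sup>+t. ennreal (subord \<alpha> t * heat t z) \<partial>lborel)"
    by (intro nn_integral_mono) (auto simp: indicator_def intro!: ennreal_leI lb)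
   finally show ?thesis .
  qed auto
 qed
qed

text \<open>\<open>bessel_kernel\<close> is an arbitrary choice among nonnegative functions with the
  right transform. Existence comes from \<open>bk\<close>, and uniqueness identifies the chosen
  function with \<open>bk\<close> almost everywhere.\<close>

lemma bessel_kernel_bounds:
 assumes a: "\<alpha> > 0" and R: "R > 0"
 shows "bessel_kernel \<alpha> \<in> borel_measurable (borel :: 'a::euclidean_space measure)"
  and "\<exists>c>0. AE z in lborel. norm (z::'a) \<le> R \<longrightarrow> c * norm z powr (\<alpha> - DIM('a)) \<le> bessel_kernel \<alpha> z"
proof -
 let ?P = "\<lambda>k::'a => real. (\<forall>x. 0 \<le> k x) \<and> has_tempered_fourier (\<lambda>x. complex_of_real (k x))
    (\<lambda>\<xi>. complex_of_real ((1 + (norm \<xi>)\<^sup>2) powr (- \<alpha> / 2)))"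
 have b: "?P (bk \<alpha>)" using bk_has_tempered_fourier[OF a, where 'a='a] bk_nonneg by auto
 then have k: "?P (bessel_kernel \<alpha>)" unfolding bessel_kernel_def using someI[of ?P, OF b] by simp
 note u = tempered_fourier_unique[OF conjunct2[OF k] _ conjunct2[OF b]]
 show "bessel_kernel \<alpha> \<in> borel_measurable (borel :: 'a measure)" by (rule u(1)) (use b k in auto)
 have eq: "AE x in lborel. bessel_kernel \<alpha> x = bk \<alpha> (x::'a)" by (rule u(2)) (use b k in auto)
 obtain c where c: "c > 0" "\<And>z::'a. norm z \<le> R ==>
  ennreal (c * norm z powr (\<alpha> - DIM('a))) \<le> (\<integral>\<^sup>+t. ennreal (subord \<alpha> t * heat t z) \<partial>lborel)"
  using bk_lower_bound[OF a R, where 'a='a] by blast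
 have "AE z in lborel. norm (z::'a) \<le> R \<longrightarrow> c * norm z powr (\<alpha> - DIM('a)) \<le> bessel_kernel \<alpha> z"
  using eq bk_AE[OF a]
 proof eventually_elim
  case (elim z)
  show ?case
  proof
   assume "norm z \<le> R"
   from c(2)[OF this] elim show "c * norm z powr (\<alpha> - DIM('a)) \<le> bessel_kernel \<alpha> z"
    using bk_nonneg[of \<alpha> z] by (metis ennreal_le_iff)
  qed
 qed
 with c(1) show "\<exists>c>0. AE z in lborel. norm (z::'a) \<le> R \<longrightarrow> c * norm z powr (\<alpha> - DIM('a)) \<le> bessel_kernel \<alpha> z" by blast
qed

text \<open>On a ball the Riesz kernel is dominated by a multiple of the subordinated heat kernel,
  which has total mass 1.\<close>

lemma Riesz_kernel_integrable:
 fixes \<alpha> R :: real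
 assumes a: "\<alpha> > 0"
 shows "integrable lborel (\<lambda>z::'a::euclidean_space. indicator (cball 0 R) z * norm z powr (\<alpha> - DIM('a)))"
proof (cases "R > 0")
 case R: True
 obtain c where c: "c > 0" "\<And>z::'a. norm z \<le> R ==>
  ennreal (c * norm z powr (\<alpha> - DIM('a))) \<le> (\<integral>\<^sup>+t. ennreal (subord \<alpha> t * heat t z) \<partial>lborel)"
  using bk_lower_bound[OF a R, where 'a='a] by blast
 show ?thesis
 proof (rule integrableI_nonneg)
  have "(\<integral>\<^sup>+z. ennreal (indicator (cball 0 R) z * norm (z::'a) powr (\<alpha> - DIM('a))) \<partial>lborel)
   \<le> (\<integral>\<^sup>+z. ennreal (1 / c) * (\<integral>\<^sup>+t. ennreal (subord \<alpha> t * heat t (z::'a)) \<partial>lborel) \<partial>lborel)"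
  proof (intro nn_integral_mono)
   fix z :: 'a
   show "ennreal (indicator (cball 0 R) z * norm z powr (\<alpha> - DIM('a))) \<le> ennreal (1 / c) * (\<integral>\<^sup>+t. ennreal (subord \<alpha> t * heat t z) \<partial>lborel)"
   proof (cases "norm z \<le> R")
    case True
    have "ennreal (1 / c) * ennreal (c * norm z powr (\<alpha> - DIM('a))) \<le> ennreal (1 / c) * (\<integral>\<^sup>+t. ennreal (subord \<alpha> t * heat t z) \<partial>lborel)"
     by (intro mult_left_mono c True) auto
    then show ?thesis using c(1) True by (simp add: ennreal_mult[symmetric])
   qed auto
  qed
  also have "... = ennreal (1 / c)"
   using subord_heat_nn_integral[OF a, where 'a='a] by (subst nn_integral_cmult) auto
  finally show "(\<integral>\<^sup>+z. ennreal (indicator (cball 0 R) z * norm (z::'a) powr (\<alpha> - DIM('a))) \<partial>lborel) < \<infinity>"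
   by (rule le_less_trans) simp
  have [measurable]: "cball 0 R \<in> sets (borel::'a measure)" by simp
  show "(\<lambda>z::'a. indicator (cball 0 R) z * norm z powr (\<alpha> - DIM('a))) \<in> borel_measurable lborel" by measurable
 qed auto
next
 case False
 have "(\<lambda>z::'a. indicator (cball 0 R) z * norm z powr (\<alpha> - DIM('a))) = (\<lambda>_. 0)"
  using False by (auto simp: fun_eq_iff indicator_def) (metis norm_le_zero_iff not_less order_trans)
 then show ?thesis by simp
qed

section \<open>Kato inequality for the energy form\<close>

lemma asgn_eq: "asgn e t = t / sqrt (t\<^sup>2 + e\<^sup>2)"
proof -
 have "(t\<^sup>2 + e\<^sup>2) powr (- 1 / 2) = inverse (sqrt (t\<^sup>2 + e\<^sup>2))"
  unfolding minus_divide_left[symmetric] powr_minus by (subst powr_half_sqrt) auto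
 then show ?thesis unfolding asgn_def by (simp only: divide_inverse)
qed

lemma aabs_eq: "aabs e t = sqrt (t\<^sup>2 + e\<^sup>2) - e"
 by (simp add: aabs_def powr_half_sqrt)

lemma sq_add_pos: "e > 0 ==> 0 < t\<^sup>2 + (e::real)\<^sup>2" by (simp add: add_nonneg_pos)

lemma asgn_abs_le: "e > 0 ==> \<bar>asgn e t\<bar> \<le> 1"
 unfolding asgn_eq using sq_add_pos[of e t] by (simp add: abs_divide divide_le_eq real_le_rsqrt)

lemma aabs_nonneg: "e > 0 ==> 0 \<le> aabs e t"
 unfolding aabs_eq by (simp add: real_le_rsqrt)

lemma aabs_bounds: "e > 0 ==> \<bar>t\<bar> - e \<le> aabs e t" "e > 0 ==> aabs e t \<le> \<bar>t\<bar>"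
 unfolding aabs_eq using sqrt_sum_squares_le_sum_abs[of t e] by (auto simp: real_le_rsqrt)

text \<open>The tangent inequality for the convex function \<open>aabs e\<close>, with derivative
  \<open>asgn e\<close>. It is the pointwise source of Kato's inequality.\<close>

lemma aabs_convex:
 assumes e: "e > 0" shows "aabs e a - aabs e b \<le> asgn e a * (a - b)"
proof -
 let ?A = "sqrt (a\<^sup>2 + e\<^sup>2)" and ?B = "sqrt (b\<^sup>2 + e\<^sup>2)"
 have p: "?A > 0" "?B > 0" using sq_add_pos[OF e] by auto
 \<comment> \<open>Cauchy-Schwarz for the plane vectors (a, e) and (b, e).\<close>
 have "a * b + e * e \<le> ?A * ?B"
 proof (rule power2_le_imp_le)
  have "0 \<le> (a * e - b * e)\<^sup>2" by simp
  then have "(a * b + e * e)\<^sup>2 \<le> (a\<^sup>2 + e\<^sup>2) * (b\<^sup>2 + e\<^sup>2)" by (simp add: power2_eq_square algebra_simps)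
  then show "(a * b + e * e)\<^sup>2 \<le> (?A * ?B)\<^sup>2" by (simp add: power_mult_distrib)
 qed (use p in auto)
 moreover have "?A * ?A = a\<^sup>2 + e\<^sup>2" by simp
 ultimately have "?A * (?A - ?B) \<le> a * (a - b)" by (simp add: power2_eq_square algebra_simps)
 then have "?A - ?B \<le> a * (a - b) / ?A"
  by (subst pos_le_divide_eq[OF p(1)]) (simp only: mult.commute)
 then show ?thesis by (simp add: aabs_eq asgn_eq)
qed

lemma aabs_Lipschitz:
 assumes e: "e > 0" shows "\<bar>aabs e a - aabs e b\<bar> \<le> \<bar>a - b\<bar>"
proof -
 have "asgn e s * t \<le> \<bar>t\<bar>" for s t
  using mult_right_mono[OF asgn_abs_le[OF e, of s], of "\<bar>t\<bar>"] by (simp add: abs_mult[symmetric])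
 from order_trans[OF aabs_convex[OF e] this] show ?thesis
  by (metis abs_le_iff abs_minus_commute minus_diff_eq)
qed

lemma asgn_Lipschitz:
 assumes e: "e > 0" shows "\<bar>asgn e a - asgn e b\<bar> \<le> 1 / e * \<bar>a - b\<bar>"
proof -
 have d: "(asgn e has_real_derivative e\<^sup>2 / (sqrt (t\<^sup>2 + e\<^sup>2) * (t\<^sup>2 + e\<^sup>2))) (at t)" for t
 proof -
  let ?s = "sqrt (t\<^sup>2 + e\<^sup>2)"
  have p: "?s > 0" "?s * ?s = t\<^sup>2 + e\<^sup>2" using sq_add_pos[OF e, of t] by auto
  have "((\<lambda>t. t / sqrt (t\<^sup>2 + e\<^sup>2)) has_real_derivative (1 * ?s - t * (2 * t * inverse ?s / 2)) / (?s * ?s)) (at t)"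
   using p sq_add_pos[OF e, of t] by (auto intro!: derivative_eq_intros simp: power2_eq_square)
  moreover have "(1 * ?s - t * (2 * t * inverse ?s / 2)) / (?s * ?s) = e\<^sup>2 / (?s * (t\<^sup>2 + e\<^sup>2))"
  proof -
   have "1 * ?s - t * (2 * t * inverse ?s / 2) = (?s * ?s - t\<^sup>2) / ?s"
   proof -
    have "1 * s - t * (2 * t * inverse s / 2) = (s * s - t\<^sup>2) / s" if "s > 0" for s
     using that by (simp add: field_simps power2_eq_square)
    from this[OF p(1)] show ?thesis .
   qed
   also have "... = e\<^sup>2 / ?s" by (simp add: p(2))
   finally show ?thesis by (simp add: p(2))
  qed
  ultimately show ?thesis unfolding asgn_eq[abs_def] by simp
 qed
 have "norm (asgn e a - asgn e b) \<le> 1 / e * norm (a - b)"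
 proof (rule field_differentiable_bound[of UNIV])
  show "(asgn e has_field_derivative e\<^sup>2 / (sqrt (t\<^sup>2 + e\<^sup>2) * (t\<^sup>2 + e\<^sup>2))) (at t within UNIV)" for t using d by simp
  show "norm (e\<^sup>2 / (sqrt (t\<^sup>2 + e\<^sup>2) * (t\<^sup>2 + e\<^sup>2))) \<le> 1 / e" for t
  proof -
   have "e * e\<^sup>2 \<le> sqrt (t\<^sup>2 + e\<^sup>2) * (t\<^sup>2 + e\<^sup>2)"
    using e by (intro mult_mono) (auto simp: real_le_rsqrt)
   then show ?thesis using e sq_add_pos[OF e, of t] by (simp add: divide_le_eq mult.commute pos_le_divide_eq)
  qed
 qed auto
 then show ?thesis by simp
qed

lemma asgn_tendsto: "((\<lambda>e. asgn e t) \<longlongrightarrow> sgn t) (at_right 0)"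
proof (cases "t = 0")
 case False
 have "((\<lambda>e. t / sqrt (t\<^sup>2 + e\<^sup>2)) \<longlongrightarrow> t / sqrt (t\<^sup>2 + 0\<^sup>2)) (at_right 0)"
  using False by (intro tendsto_intros) auto
 moreover have "t / sqrt (t\<^sup>2 + 0\<^sup>2) = sgn t" using False by (simp add: sgn_if)
 ultimately show ?thesis unfolding asgn_eq by simp
qed (simp add: asgn_eq)

lemma measurable_asgn[measurable]: "asgn e \<in> borel_measurable borel" unfolding asgn_def by measurable
lemma measurable_aabs[measurable]: "aabs e \<in> borel_measurable borel" unfolding aabs_def by measurable

section \<open>Weighted L^2 pairings\<close>

definition wL2 :: "'b measure => ('b => real) => ('b => real) => bool" where
 "wL2 M j a \<longleftrightarrow> a \<in> borel_measurable M \<and> integrable M (\<lambda>x. j x * (a x)\<^sup>2)"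

text \<open>One theory for three weights: the constant 1 and the killing term \<open>B\<close> on
  \<Omega>, and the jump kernel on the product of \<Omega> with itself.\<close>

locale weight =
 fixes M :: "'b measure" and j :: "'b => real"
 assumes jm[measurable]: "j \<in> borel_measurable M" and j0: "\<And>x. x \<in> space M ==> 0 \<le> j x"
begin

lemma wL2_bound:
 assumes "wL2 M j a" "b \<in> borel_measurable M" "\<And>x. x \<in> space M ==> \<bar>b x\<bar> \<le> C * \<bar>a x\<bar>"
 shows "wL2 M j b"
proof -
 have [measurable]: "a \<in> borel_measurable M" "b \<in> borel_measurable M" and i: "integrable M (\<lambda>x. j x * (a x)\<^sup>2)" using assms by (auto simp: wL2_def)
 have "integrable M (\<lambda>x. j x * (b x)\<^sup>2)"
 proof (rule int_bound[OF integrable_mult_right[OF i, of "C\<^sup>2"]])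
  show "AE x in M. norm (j x * (b x)\<^sup>2) \<le> norm (C\<^sup>2 * (j x * (a x)\<^sup>2))"
  proof (rule AE_I2)
   fix x assume x: "x \<in> space M"
   have "\<bar>b x\<bar>\<^sup>2 \<le> (C * \<bar>a x\<bar>)\<^sup>2" using assms(3)[OF x] by (intro power_mono) auto
   then have "j x * (b x)\<^sup>2 \<le> j x * (C\<^sup>2 * (a x)\<^sup>2)" using j0[OF x] by (intro mult_left_mono) (auto simp: power_mult_distrib)
   then show "norm (j x * (b x)\<^sup>2) \<le> norm (C\<^sup>2 * (j x * (a x)\<^sup>2))" using j0[OF x] by (simp add: abs_mult mult_ac)
  qed
 qed measurable
 then show ?thesis by (simp add: wL2_def)
qed

lemma wL2_mult_integrable:
 assumes "wL2 M j a" "wL2 M j b" shows "integrable M (\<lambda>x. j x * a x * b x)"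
proof -
 have [measurable]: "a \<in> borel_measurable M" "b \<in> borel_measurable M" and i: "integrable M (\<lambda>x. j x * (a x)\<^sup>2)" "integrable M (\<lambda>x. j x * (b x)\<^sup>2)"
  using assms by (auto simp: wL2_def)
 show ?thesis
 proof (rule int_bound[OF int_add[OF i]])
  show "AE x in M. norm (j x * a x * b x) \<le> norm (j x * (a x)\<^sup>2 + j x * (b x)\<^sup>2)"
  proof (rule AE_I2)
   fix x assume x: "x \<in> space M"
   have "\<bar>a x * b x\<bar> \<le> (a x)\<^sup>2 + (b x)\<^sup>2"
    using sum_squares_bound[of "\<bar>a x\<bar>" "\<bar>b x\<bar>"] mult_nonneg_nonneg[of "\<bar>a x\<bar>" "\<bar>b x\<bar>"]
    unfolding abs_mult power2_abs by linarith
   from mult_left_mono[OF this j0[OF x]] show "norm (j x * a x * b x) \<le> norm (j x * (a x)\<^sup>2 + j x * (b x)\<^sup>2)"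
    using j0[OF x] by (simp add: abs_mult distrib_left mult.assoc)
  qed
 qed measurable
qed

lemma wL2_add:
 assumes "wL2 M j a" "wL2 M j b" shows "wL2 M j (\<lambda>x. a x + t * b x)"
  and "(LINT x|M. j x * (a x + t * b x)\<^sup>2) = (LINT x|M. j x * (a x)\<^sup>2) + 2 * t * (LINT x|M. j x * a x * b x) + t\<^sup>2 * (LINT x|M. j x * (b x)\<^sup>2)"
proof -
 have [measurable]: "a \<in> borel_measurable M" "b \<in> borel_measurable M" and i: "integrable M (\<lambda>x. j x * (a x)\<^sup>2)" "integrable M (\<lambda>x. j x * (b x)\<^sup>2)"
  using assms by (auto simp: wL2_def)
 note m = wL2_mult_integrable[OF assms]
 have e: "j x * (a x + t * b x)\<^sup>2 = j x * (a x)\<^sup>2 + 2 * t * (j x * a x * b x) + t\<^sup>2 * (j x * (b x)\<^sup>2)" for x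
  by (simp add: power2_eq_square algebra_simps)
 show "wL2 M j (\<lambda>x. a x + t * b x)" unfolding wL2_def e
  by (intro conjI int_add integrable_mult_right i m) measurable
 show "(LINT x|M. j x * (a x + t * b x)\<^sup>2) = (LINT x|M. j x * (a x)\<^sup>2) + 2 * t * (LINT x|M. j x * a x * b x) + t\<^sup>2 * (LINT x|M. j x * (b x)\<^sup>2)"
  unfolding e using i m by simp
qed

lemma wL2_nonneg: "0 \<le> (LINT x|M. j x * (a x)\<^sup>2)"
 by (rule integral_nonneg_AE) (auto intro!: AE_I2 mult_nonneg_nonneg j0)

lemma wL2_Cauchy_Schwarz:
 assumes "wL2 M j a" "wL2 M j b"
 shows "\<bar>\<integral>x. j x * a x * b x \<partial>M\<bar> \<le> sqrt (LINT x|M. j x * (a x)\<^sup>2) * sqrt (LINT x|M. j x * (b x)\<^sup>2)"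
proof -
 let ?A = "\<integral>x. j x * (a x)\<^sup>2 \<partial>M" and ?B = "\<integral>x. j x * (b x)\<^sup>2 \<partial>M" and ?I = "\<integral>x. j x * a x * b x \<partial>M"
 have q: "0 \<le> ?A + 2 * t * ?I + t\<^sup>2 * ?B" for t
  using wL2_nonneg[of "\<lambda>x. a x + t * b x"] unfolding wL2_add(2)[OF assms] .
 have nn: "0 \<le> ?A" "0 \<le> ?B" by (rule wL2_nonneg)+
 have "?I\<^sup>2 \<le> ?A * ?B"
 proof (cases "?B = 0")
  case True
  have "?I = 0"
  proof (rule ccontr)
   assume I: "?I \<noteq> 0"
   \<comment> \<open>With vanishing quadratic coefficient the expression \<open>q\<close> is affine
     in t; this t would give it the value -1.\<close>
   have "2 * (- (?A + 1) / (2 * ?I)) * ?I = - (?A + 1)" using I by (simp add: field_simps)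
   with q[of "- (?A + 1) / (2 * ?I)"] True show False by simp
  qed
  then show ?thesis using True by simp
 next
  case False
  then have B: "?B > 0" using nn by simp
  have "0 \<le> ?A + 2 * (- ?I / ?B) * ?I + (- ?I / ?B)\<^sup>2 * ?B" by (rule q)
  also have "... = ?A - ?I\<^sup>2 / ?B" using B by (simp add: power2_eq_square field_simps)
  finally show ?thesis using B by (simp add: field_simps)
 qed
 then have "sqrt (?I\<^sup>2) \<le> sqrt (?A * ?B)" by (rule real_sqrt_le_mono)
 then show ?thesis by (simp add: real_sqrt_mult)
qed

lemma wL2_pairing_tendsto:
 assumes a: "\<And>n. wL2 M j (a n)" "\<And>n. (LINT x|M. j x * (a n x)\<^sup>2) \<le> K"
  and d: "\<And>n. wL2 M j (d n)" "(\<lambda>n. LINT x|M. j x * (d n x)\<^sup>2) \<longlonglongrightarrow> 0"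
 shows "(\<lambda>n. LINT x|M. j x * a n x * d n x) \<longlonglongrightarrow> 0"
proof (rule Lim_null_comparison)
 show "\<forall>\<^sub>F n in sequentially. norm (LINT x|M. j x * a n x * d n x) \<le> sqrt K * sqrt (LINT x|M. j x * (d n x)\<^sup>2)"
 proof (intro always_eventually allI)
  fix n
  have "norm (LINT x|M. j x * a n x * d n x) \<le> sqrt (LINT x|M. j x * (a n x)\<^sup>2) * sqrt (LINT x|M. j x * (d n x)\<^sup>2)"
   unfolding real_norm_def by (rule wL2_Cauchy_Schwarz[OF a(1) d(1)])
  also have "... \<le> sqrt K * sqrt (LINT x|M. j x * (d n x)\<^sup>2)"
   by (intro mult_right_mono real_sqrt_le_mono a) (auto intro: wL2_nonneg)
  finally show "norm (LINT x|M. j x * a n x * d n x) \<le> sqrt K * sqrt (LINT x|M. j x * (d n x)\<^sup>2)" .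
 qed
 show "(\<lambda>n. sqrt K * sqrt (LINT x|M. j x * (d n x)\<^sup>2)) \<longlonglongrightarrow> 0"
 proof -
  have "(\<lambda>n. sqrt K * sqrt (LINT x|M. j x * (d n x)\<^sup>2)) \<longlonglongrightarrow> sqrt K * sqrt 0"
   by (intro tendsto_intros d(2))
  then show ?thesis by simp
 qed
qed

text \<open>Where the weight is at most \<open>k\<close>, unweighted convergence controls the pairing; where it
 exceeds \<open>k\<close>, the fixed function \<open>a\<close> has small weighted norm.\<close>

lemma wL2_weak_tendsto:
 assumes a: "wL2 M j a" and d: "\<And>n. wL2 M j (d n)" "\<And>n. (LINT x|M. j x * (d n x)\<^sup>2) \<le> K"
  and d2: "\<And>n. integrable M (\<lambda>x. (d n x)\<^sup>2)" "(\<lambda>n. LINT x|M. (d n x)\<^sup>2) \<longlonglongrightarrow> 0"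
 shows "(\<lambda>n. LINT x|M. j x * a x * d n x) \<longlonglongrightarrow> 0"
proof -
 define j1 where "j1 k x = (if j x \<le> real k then j x else 0)" for k x
 define j2 where "j2 k x = (if j x \<le> real k then 0 else j x)" for k x
 have [measurable]: "j1 k \<in> borel_measurable M" "j2 k \<in> borel_measurable M" for k
  unfolding j1_def[abs_def] j2_def[abs_def] by measurable
 have w1: "weight M (j1 k)" and w2: "weight M (j2 k)" for k
  by unfold_locales (auto simp: j1_def j2_def j0)
 have am[measurable]: "a \<in> borel_measurable M" and dm[measurable]: "\<And>n. d n \<in> borel_measurable M"
  and ai: "integrable M (\<lambda>x. j x * (a x)\<^sup>2)" and di: "\<And>n. integrable M (\<lambda>x. j x * (d n x)\<^sup>2)"
  using a d by (auto simp: wL2_def)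
 have sub: "wL2 M (j1 k) b" "wL2 M (j2 k) b" "(LINT x|M. j1 k x * (b x)\<^sup>2) \<le> (LINT x|M. j x * (b x)\<^sup>2)"
   "(LINT x|M. j2 k x * (b x)\<^sup>2) \<le> (LINT x|M. j x * (b x)\<^sup>2)" if b: "wL2 M j b" for b k
 proof -
  have [measurable]: "b \<in> borel_measurable M" and bi: "integrable M (\<lambda>x. j x * (b x)\<^sup>2)" using b by (auto simp: wL2_def)
  have i1: "integrable M (\<lambda>x. j1 k x * (b x)\<^sup>2)" "integrable M (\<lambda>x. j2 k x * (b x)\<^sup>2)"
   by (rule int_bound[OF bi]; auto simp: j1_def j2_def)+
  then show "wL2 M (j1 k) b" "wL2 M (j2 k) b" by (auto simp: wL2_def)
  show "(LINT x|M. j1 k x * (b x)\<^sup>2) \<le> (LINT x|M. j x * (b x)\<^sup>2)"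
   by (rule integral_mono[OF i1(1) bi]) (auto simp: j1_def j0)
  show "(LINT x|M. j2 k x * (b x)\<^sup>2) \<le> (LINT x|M. j x * (b x)\<^sup>2)"
   by (rule integral_mono[OF i1(2) bi]) (auto simp: j2_def j0)
 qed
 have t: "(\<lambda>k. LINT x|M. j2 k x * (a x)\<^sup>2) \<longlonglongrightarrow> (LINT x|M. 0)"
 proof (rule integral_dominated_convergence[where w="\<lambda>x. j x * (a x)\<^sup>2"])
  show "AE x in M. (\<lambda>k. j2 k x * (a x)\<^sup>2) \<longlonglongrightarrow> 0"
  proof (rule AE_I2)
   fix x
   obtain N :: nat where "j x \<le> N" using real_arch_simple by blast
   then show "(\<lambda>k. j2 k x * (a x)\<^sup>2) \<longlonglongrightarrow> 0"
    by (intro tendsto_eventually) (auto simp: j2_def eventually_sequentially intro!: exI[of _ N])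
  qed
  show "AE x in M. norm (j2 k x * (a x)\<^sup>2) \<le> j x * (a x)\<^sup>2" for k
   by (rule AE_I2) (auto simp: j2_def j0)
 qed (use ai in auto)
 let ?A = "\<integral>x. j x * (a x)\<^sup>2 \<partial>M"
 have split: "\<bar>\<integral>x. j x * a x * d n x \<partial>M\<bar> \<le> sqrt (?A * (real k * (LINT x|M. (d n x)\<^sup>2))) + sqrt ((LINT x|M. j2 k x * (a x)\<^sup>2) * K)" for n k
 proof -
  have "(LINT x|M. j x * a x * d n x) = (LINT x|M. j1 k x * a x * d n x + j2 k x * a x * d n x)"
   by (intro LINT_cong) (auto simp: j1_def j2_def)
  also have "... = (LINT x|M. j1 k x * a x * d n x) + (LINT x|M. j2 k x * a x * d n x)"
   by (intro Bochner_Integration.integral_add weight.wL2_mult_integrable[OF w1] weight.wL2_mult_integrable[OF w2] sub a d)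
  also have "\<bar>...\<bar> \<le> \<bar>\<integral>x. j1 k x * a x * d n x \<partial>M\<bar> + \<bar>\<integral>x. j2 k x * a x * d n x \<partial>M\<bar>" by simp
  also have "... \<le> sqrt (LINT x|M. j1 k x * (a x)\<^sup>2) * sqrt (LINT x|M. j1 k x * (d n x)\<^sup>2)
    + sqrt (LINT x|M. j2 k x * (a x)\<^sup>2) * sqrt (LINT x|M. j2 k x * (d n x)\<^sup>2)"
   by (intro add_mono weight.wL2_Cauchy_Schwarz[OF w1] weight.wL2_Cauchy_Schwarz[OF w2] sub a d)
  also have "... \<le> sqrt ?A * sqrt (real k * (LINT x|M. (d n x)\<^sup>2)) + sqrt (LINT x|M. j2 k x * (a x)\<^sup>2) * sqrt K"
  proof (intro add_mono mult_mono real_sqrt_le_mono sub a)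
   have "(LINT x|M. j1 k x * (d n x)\<^sup>2) \<le> (LINT x|M. real k * (d n x)\<^sup>2)"
   proof (rule integral_mono)
    show "integrable M (\<lambda>x. j1 k x * (d n x)\<^sup>2)" using sub(1)[OF d(1)] by (simp add: wL2_def)
   qed (use d2 in \<open>auto simp: j1_def intro!: mult_right_mono\<close>)
   then show "(LINT x|M. j1 k x * (d n x)\<^sup>2) \<le> real k * (LINT x|M. (d n x)\<^sup>2)" by simp
   show "(LINT x|M. j2 k x * (d n x)\<^sup>2) \<le> K" using sub(4)[OF d(1)] d(2) by (rule order_trans)
  qed (auto simp: wL2_nonneg weight.wL2_nonneg[OF w1] weight.wL2_nonneg[OF w2] integral_nonneg_AE)
  finally show ?thesis by (simp add: real_sqrt_mult)
 qed
 show ?thesis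
 proof (rule LIMSEQ_I)
  fix e :: real assume e: "e > 0"
  \<comment> \<open>The level \<open>k\<close> is fixed first, from the tail of \<open>a\<close>;
    only then is \<open>n\<close> chosen, since the unweighted term carries the factor
    \<open>k\<close>.\<close>
  have "(\<lambda>k. sqrt ((LINT x|M. j2 k x * (a x)\<^sup>2) * K)) \<longlonglongrightarrow> sqrt (0 * K)"
   using t by (intro tendsto_intros) simp
  then have "\<forall>\<^sub>F k in sequentially. sqrt ((LINT x|M. j2 k x * (a x)\<^sup>2) * K) < e / 2" using e by (intro order_tendstoD) auto
  then obtain k where k: "sqrt ((LINT x|M. j2 k x * (a x)\<^sup>2) * K) < e / 2" by (auto simp: eventually_sequentially)
  have "(\<lambda>n. sqrt (?A * (real k * (LINT x|M. (d n x)\<^sup>2)))) \<longlonglongrightarrow> sqrt (?A * (real k * 0))"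
   by (intro tendsto_intros d2)
  then have "\<forall>\<^sub>F n in sequentially. sqrt (?A * (real k * (LINT x|M. (d n x)\<^sup>2))) < e / 2" using e by (intro order_tendstoD) auto
  then obtain N where N: "\<And>n. n \<ge> N ==> sqrt (?A * (real k * (LINT x|M. (d n x)\<^sup>2))) < e / 2" by (auto simp: eventually_sequentially)
  have "norm ((LINT x|M. j x * a x * d n x) - 0) < e" if "n \<ge> N" for n
   using split[of n k] N[OF that] k by simp
  then show "\<exists>N. \<forall>n\<ge>N. norm ((LINT x|M. j x * a x * d n x) - 0) < e" by blast
 qed
qed

end

section \<open>Lebesgue measure on the product of the domain with itself\<close>

lemma null_sets_Times_UNIV:
 assumes "N \<in> null_sets (lborel :: 'a::euclidean_space measure)"
 shows "N \<times> UNIV \<in> null_sets (lborel :: ('a \<times> 'a) measure)" "UNIV \<times> N \<in> null_sets (lborel :: ('a \<times> 'a) measure)"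
proof -
 have N: "N \<in> sets borel" "emeasure lborel N = 0" using assms by auto
 have "emeasure (lborel \<Otimes>\<^sub>M lborel) (N \<times> (UNIV::'a set)) = 0" "emeasure (lborel \<Otimes>\<^sub>M lborel) ((UNIV::'a set) \<times> N) = 0"
  using N by (subst lborel.emeasure_pair_measure_Times; auto)+
 moreover have "N \<times> (UNIV::'a set) \<in> sets (lborel \<Otimes>\<^sub>M lborel)" "(UNIV::'a set) \<times> N \<in> sets (lborel \<Otimes>\<^sub>M lborel)"
  using N by (auto intro!: pair_measureI)
 ultimately show "N \<times> UNIV \<in> null_sets (lborel :: ('a \<times> 'a) measure)" "UNIV \<times> N \<in> null_sets (lborel :: ('a \<times> 'a) measure)"
  unfolding lborel_prod by (auto simp: null_sets_def)
qed

text \<open>Lebesgue measure on the product is completed, so Borel measurability of the projections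
  is not enough: they must also pull null sets back to null sets, which are then products of a null
  set with the whole space.\<close>

lemma measurable_lebesgue_fst_snd:
 "fst \<in> (lebesgue :: ('a::euclidean_space \<times> 'a) measure) \<rightarrow>\<^sub>M lebesgue"
 "snd \<in> (lebesgue :: ('a::euclidean_space \<times> 'a) measure) \<rightarrow>\<^sub>M lebesgue"
proof -
 have f: "fst \<in> (lebesgue :: ('a \<times> 'a) measure) \<rightarrow>\<^sub>M lborel" "snd \<in> (lebesgue :: ('a \<times> 'a) measure) \<rightarrow>\<^sub>M lborel"
  by (auto intro!: measurable_completion borel_measurable_continuous_onI continuous_intros)
 have "N \<in> null_sets (distr lebesgue lborel (fst :: 'a \<times> 'a => 'a))" "N \<in> null_sets (distr lebesgue lborel (snd :: 'a \<times> 'a => 'a))"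
  if "N \<in> null_sets lborel" for N :: "'a set"
 proof -
  have e: "fst -` N \<inter> UNIV = N \<times> (UNIV::'a set)" "snd -` N \<inter> UNIV = (UNIV::'a set) \<times> N" by auto
  show "N \<in> null_sets (distr lebesgue lborel (fst :: 'a \<times> 'a => 'a))"
   using that null_sets_Times_UNIV(1)[OF that]
   by (simp add: null_sets_def emeasure_distr[OF f(1)] vimage_fst)
  show "N \<in> null_sets (distr lebesgue lborel (snd :: 'a \<times> 'a => 'a))"
   using that null_sets_Times_UNIV(2)[OF that]
   by (simp add: null_sets_def emeasure_distr[OF f(2)] vimage_snd)
 qed
 then show "fst \<in> (lebesgue :: ('a \<times> 'a) measure) \<rightarrow>\<^sub>M lebesgue" "snd \<in> (lebesgue :: ('a \<times> 'a) measure) \<rightarrow>\<^sub>M lebesgue"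
  by (intro completion.measurable_completion2 f subsetI; blast)+
qed

lemma lebesgue_on_Times_measurable:
 fixes f :: "'a::euclidean_space => real"
 assumes f: "f \<in> borel_measurable (lebesgue_on \<Omega>)" and \<Omega>: "\<Omega> \<in> sets borel"
 shows "(\<lambda>z. f (fst z)) \<in> borel_measurable (lebesgue_on (\<Omega> \<times> \<Omega>))" "(\<lambda>z. f (snd z)) \<in> borel_measurable (lebesgue_on (\<Omega> \<times> \<Omega>))"
proof -
 have \<Omega>': "\<Omega> \<in> sets lebesgue" using \<Omega> by auto
 have f': "(\<lambda>x. if x \<in> \<Omega> then f x else 0) \<in> borel_measurable lebesgue"
  using f borel_measurable_if[OF \<Omega>'] by blast
 have "(\<lambda>z. if fst z \<in> \<Omega> then f (fst z) else 0) \<in> borel_measurable (lebesgue_on (\<Omega> \<times> \<Omega>))"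
  "(\<lambda>z. if snd z \<in> \<Omega> then f (snd z) else 0) \<in> borel_measurable (lebesgue_on (\<Omega> \<times> \<Omega>))"
  using measurable_compose[OF measurable_lebesgue_fst_snd(1) f'] measurable_compose[OF measurable_lebesgue_fst_snd(2) f']
  by (auto intro: measurable_restrict_space1)
 note m = this
 show "(\<lambda>z. f (fst z)) \<in> borel_measurable (lebesgue_on (\<Omega> \<times> \<Omega>))"
  by (rule measurable_cong[THEN iffD1, OF _ m(1)]) (auto simp: space_restrict_space)
 show "(\<lambda>z. f (snd z)) \<in> borel_measurable (lebesgue_on (\<Omega> \<times> \<Omega>))"
  by (rule measurable_cong[THEN iffD1, OF _ m(2)]) (auto simp: space_restrict_space)
qed

text \<open>Tonelli is applied to a Borel representative \<open>g\<close> of \<open>f\<close>; they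
  differ on a null set N only, hence on the product off a null strip.\<close>

lemma nn_integral_lebesgue_on_Times:
 fixes f :: "'a::euclidean_space => ennreal"
 assumes f: "f \<in> borel_measurable (lebesgue_on \<Omega>)" and \<Omega>[measurable]: "\<Omega> \<in> sets borel"
 shows "(\<integral>\<^sup>+z. f (fst z) \<partial>lebesgue_on (\<Omega> \<times> \<Omega>)) = emeasure lborel \<Omega> * (\<integral>\<^sup>+x. f x \<partial>lebesgue_on \<Omega>)"
  "(\<integral>\<^sup>+z. f (snd z) \<partial>lebesgue_on (\<Omega> \<times> \<Omega>)) = emeasure lborel \<Omega> * (\<integral>\<^sup>+x. f x \<partial>lebesgue_on \<Omega>)"
proof -
 have \<Omega>': "\<Omega> \<in> sets lebesgue" using \<Omega> by auto
 have P: "\<Omega> \<times> \<Omega> \<in> sets (borel :: ('a \<times> 'a) measure)"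
  unfolding borel_prod[symmetric] by (intro pair_measureI \<Omega>)
 have "(\<lambda>x. f x * indicator \<Omega> x) \<in> borel_measurable lebesgue"
  using f borel_measurable_restrict_space_iff_ennreal[of \<Omega> lebesgue f] \<Omega>' by (simp add: mult.commute)
 from completion_ex_borel_measurable[OF this] obtain g where g[measurable]: "g \<in> borel_measurable lborel"
  and ae: "AE x in lborel. f x * indicator \<Omega> x = g x" by blast
 obtain N where N: "N \<in> null_sets lborel" "\<And>x. x \<notin> N ==> f x * indicator \<Omega> x = g x"
  using ae unfolding eventually_ae_filter by auto
 have gI: "(\<integral>\<^sup>+x. g x \<partial>lborel) = (\<integral>\<^sup>+x. f x \<partial>lebesgue_on \<Omega>)"
  using \<Omega>' ae by (subst nn_integral_restrict_space) (auto simp: nn_integral_completion intro!: nn_integral_cong_AE)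
 have [measurable]: "g \<in> borel_measurable borel" using g by simp
 have "(\<integral>\<^sup>+z. f (fst z) \<partial>lebesgue_on (\<Omega> \<times> \<Omega>)) = (\<integral>\<^sup>+z. f (fst z) * indicator (\<Omega> \<times> \<Omega>) z \<partial>lborel)"
  using P by (subst nn_integral_restrict_space) (auto simp: nn_integral_completion)
 also have "... = (\<integral>\<^sup>+z. g (fst z) * indicator \<Omega> (snd z) \<partial>lborel)"
 proof (rule nn_integral_cong_AE)
  show "AE z in lborel. f (fst z) * indicator (\<Omega> \<times> \<Omega>) z = g (fst z) * indicator \<Omega> (snd z)"
   using AE_not_in[OF null_sets_Times_UNIV(1)[OF N(1)]]
  proof eventually_elim
   case (elim z)
   then have "fst z \<notin> N" by (cases z) auto
   from N(2)[OF this, symmetric] show ?case by (cases z) (auto simp: indicator_def)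
  qed
 qed
 also have "... = (\<integral>\<^sup>+z. g (fst z) * indicator \<Omega> (snd z) \<partial>(lborel \<Otimes>\<^sub>M lborel))" by (simp only: lborel_prod)
 also have "... = (\<integral>\<^sup>+x. (\<integral>\<^sup>+y. g x * indicator \<Omega> y \<partial>lborel) \<partial>lborel)"
  by (subst lborel.nn_integral_fst[symmetric]) auto
 also have "... = emeasure lborel \<Omega> * (\<integral>\<^sup>+x. f x \<partial>lebesgue_on \<Omega>)"
  by (simp add: nn_integral_cmult_indicator nn_integral_multc gI mult.commute)
 finally show "(\<integral>\<^sup>+z. f (fst z) \<partial>lebesgue_on (\<Omega> \<times> \<Omega>)) = emeasure lborel \<Omega> * (\<integral>\<^sup>+x. f x \<partial>lebesgue_on \<Omega>)" .
 have "(\<integral>\<^sup>+z. f (snd z) \<partial>lebesgue_on (\<Omega> \<times> \<Omega>)) = (\<integral>\<^sup>+z. f (snd z) * indicator (\<Omega> \<times> \<Omega>) z \<partial>lborel)"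
  using P by (subst nn_integral_restrict_space) (auto simp: nn_integral_completion)
 also have "... = (\<integral>\<^sup>+z. g (snd z) * indicator \<Omega> (fst z) \<partial>lborel)"
 proof (rule nn_integral_cong_AE)
  show "AE z in lborel. f (snd z) * indicator (\<Omega> \<times> \<Omega>) z = g (snd z) * indicator \<Omega> (fst z)"
   using AE_not_in[OF null_sets_Times_UNIV(2)[OF N(1)]]
  proof eventually_elim
   case (elim z)
   then have "snd z \<notin> N" by (cases z) auto
   from N(2)[OF this, symmetric] show ?case by (cases z) (auto simp: indicator_def)
  qed
 qed
 also have "... = (\<integral>\<^sup>+z. g (snd z) * indicator \<Omega> (fst z) \<partial>(lborel \<Otimes>\<^sub>M lborel))" by (simp only: lborel_prod)
 also have "... = (\<integral>\<^sup>+x. (\<integral>\<^sup>+y. indicator \<Omega> x * g y \<partial>lborel) \<partial>lborel)"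
  by (subst lborel.nn_integral_fst[symmetric]) (auto simp: mult.commute)
 also have "... = emeasure lborel \<Omega> * (\<integral>\<^sup>+x. f x \<partial>lebesgue_on \<Omega>)"
  by (simp add: nn_integral_cmult nn_integral_multc gI)
 finally show "(\<integral>\<^sup>+z. f (snd z) \<partial>lebesgue_on (\<Omega> \<times> \<Omega>)) = emeasure lborel \<Omega> * (\<integral>\<^sup>+x. f x \<partial>lebesgue_on \<Omega>)" .
qed

lemma integrable_iff_nn_integral_finite:
 fixes f :: "'b => real"
 assumes "f \<in> borel_measurable M" "\<And>x. x \<in> space M ==> 0 \<le> f x"
 shows "integrable M f \<longleftrightarrow> (\<integral>\<^sup>+x. ennreal (f x) \<partial>M) < \<infinity>"
proof -
 have "(\<integral>\<^sup>+x. ennreal (norm (f x)) \<partial>M) = (\<integral>\<^sup>+x. ennreal (f x) \<partial>M)"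
  by (intro nn_integral_cong) (use assms(2) in auto)
 then show ?thesis using assms(1) by (simp add: integrable_iff_bounded)
qed

section \<open>The energy form and its domain\<close>

locale energy_form =
 fixes \<Omega> :: "'a::euclidean_space set" and J :: "'a => 'a => real" and B :: "'a => real"
 assumes op: "open \<Omega>" and bd: "bounded \<Omega>" and L1: "cond_L1 \<Omega> J B"
begin

abbreviation "M1 \<equiv> lebesgue_on \<Omega>"
abbreviation "M2 \<equiv> lebesgue_on (\<Omega> \<times> \<Omega>)"

text \<open>Nothing is known about \<open>J\<close> on the diagonal. Setting it to 0 there restores
  measurability and nonnegativity on the full product, and no energy changes because the differences
  vanish on the diagonal.\<close>

definition JJ :: "'a \<times> 'a => real" where
 "JJ z = (if fst z = snd z then 0 else J (fst z) (snd z))"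

definition dif :: "('a => real) => 'a \<times> 'a => real" where
 "dif u z = u (fst z) - u (snd z)"

lemma sets_\<Omega>: "\<Omega> \<in> sets borel" "\<Omega> \<in> sets lebesgue" "\<Omega> \<times> \<Omega> \<in> sets lebesgue"
 using op by (auto simp: open_Times)

lemma space_M: "space M1 = \<Omega>" "space M2 = \<Omega> \<times> \<Omega>" by (simp_all add: space_restrict_space)

lemma emeasure_\<Omega>: "emeasure lborel \<Omega> < \<infinity>"
 by (rule emeasure_bounded_finite[OF bd])

lemma JJ_measurable: "JJ \<in> borel_measurable M2"
proof -
 have e: "off_diag \<Omega> = (\<Omega> \<times> \<Omega>) \<inter> {z. fst z \<noteq> snd z}" by auto
 have "open {z :: 'a \<times> 'a. fst z \<noteq> snd z}" by (intro open_Collect_neq continuous_intros)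
 then have o: "off_diag \<Omega> \<in> sets lebesgue" unfolding e using op by (auto intro!: sets_completionI_sets borel_open open_Int open_Times)
 have "(\<lambda>(x, y). J x y) \<in> borel_measurable (lebesgue_on (off_diag \<Omega>))" using L1 by (simp add: cond_L1_def)
 then have "(\<lambda>z. if z \<in> off_diag \<Omega> then (\<lambda>(x, y). J x y) z else 0) \<in> borel_measurable M2"
  by (subst borel_measurable_if_lebesgue_on[OF o sets_\<Omega>(3)]) auto
 then show ?thesis
  by (subst measurable_cong[where g="\<lambda>z. if z \<in> off_diag \<Omega> then (\<lambda>(x, y). J x y) z else 0"]) (auto simp: space_M JJ_def)
qed

sublocale W2: weight M2 JJ
proof
 show "JJ \<in> borel_measurable M2" by (rule JJ_measurable)
 show "0 \<le> JJ z" if "z \<in> space M2" for z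
  using L1 that unfolding cond_L1_def JJ_def space_M by (cases z) auto
qed

sublocale W1: weight M1 B
 using L1 by unfold_locales (auto simp: cond_L1_def space_M)

sublocale WU: weight M1 "\<lambda>_. 1"
 by unfold_locales auto

definition dom :: "('a => real) => bool" where
 "dom u \<longleftrightarrow> wL2 M1 (\<lambda>_. 1) u \<and> wL2 M2 JJ (dif u) \<and> wL2 M1 B u"

abbreviation E :: "('a => real) => ('a => real) => real" where "E \<equiv> energy \<Omega> J B"

lemma energy_eq: "E u v = 1 / 2 * (LINT z|M2. JJ z * dif u z * dif v z) + (LINT x|M1. B x * u x * v x)"
 unfolding energy_def
 by (intro arg_cong2[where f="(+)"] arg_cong2[where f="(*)"] refl LINT_cong)
  (auto simp: JJ_def dif_def)

lemma energy_sq: "E u u = 1 / 2 * (LINT z|M2. JJ z * (dif u z)\<^sup>2) + (LINT x|M1. B x * (u x)\<^sup>2)"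
 unfolding energy_eq by (simp add: power2_eq_square mult.assoc)

lemma quad_energy_eq': "quad_energy \<Omega> J B u = ennreal (1 / 2) * (\<integral>\<^sup>+z. ennreal (JJ z * (dif u z)\<^sup>2) \<partial>M2) + (\<integral>\<^sup>+x. ennreal (B x * (u x)\<^sup>2) \<partial>M1)"
 unfolding quad_energy_def
 by (intro arg_cong2[where f="(+)"] arg_cong2[where f="(*)"] refl nn_integral_cong)
  (auto simp: JJ_def dif_def)

lemma dif_measurable: "u \<in> borel_measurable M1 ==> dif u \<in> borel_measurable M2"
 unfolding dif_def[abs_def] using lebesgue_on_Times_measurable[OF _ sets_\<Omega>(1)] by (intro borel_measurable_diff) auto

lemma energy_dom_iff: "u \<in> energy_dom \<Omega> J B \<longleftrightarrow> dom u"
proof (cases "u \<in> borel_measurable M1")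
 case True
 note [measurable] = True dif_measurable[OF True] W2.jm W1.jm
 have "integrable M2 (\<lambda>z. JJ z * (dif u z)\<^sup>2) \<longleftrightarrow> (\<integral>\<^sup>+z. ennreal (JJ z * (dif u z)\<^sup>2) \<partial>M2) < \<infinity>"
  by (intro integrable_iff_nn_integral_finite mult_nonneg_nonneg W2.j0 zero_le_power2) measurable
 moreover have "integrable M1 (\<lambda>x. B x * (u x)\<^sup>2) \<longleftrightarrow> (\<integral>\<^sup>+x. ennreal (B x * (u x)\<^sup>2) \<partial>M1) < \<infinity>"
  by (intro integrable_iff_nn_integral_finite mult_nonneg_nonneg W1.j0 zero_le_power2) measurable
 ultimately show ?thesis using True dif_measurable[OF True]
  by (auto simp: energy_dom_def L2_def dom_def wL2_def quad_energy_eq' ennreal_mult_less_top top.not_eq_extremum[symmetric] ennreal_mult_eq_top_iff)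
qed (auto simp: energy_dom_def L2_def dom_def wL2_def)

lemma quad_energy_eq:
 assumes "dom u" shows "quad_energy \<Omega> J B u = ennreal (E u u)"
proof -
 have i: "integrable M2 (\<lambda>z. JJ z * (dif u z)\<^sup>2)" "integrable M1 (\<lambda>x. B x * (u x)\<^sup>2)"
  using assms by (auto simp: dom_def wL2_def)
 have "(\<integral>\<^sup>+z. ennreal (JJ z * (dif u z)\<^sup>2) \<partial>M2) = ennreal (LINT z|M2. JJ z * (dif u z)\<^sup>2)"
  by (rule nn_integral_eq_integral[OF i(1)]) (auto intro!: AE_I2 mult_nonneg_nonneg W2.j0)
 moreover have "(\<integral>\<^sup>+x. ennreal (B x * (u x)\<^sup>2) \<partial>M1) = ennreal (LINT x|M1. B x * (u x)\<^sup>2)"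
  by (rule nn_integral_eq_integral[OF i(2)]) (auto intro!: AE_I2 mult_nonneg_nonneg W1.j0)
 ultimately show ?thesis unfolding quad_energy_eq' energy_sq
  using W2.wL2_nonneg[of "dif u"] W1.wL2_nonneg[of u] ennreal_mult[of "1 / 2" "\<integral>z. JJ z * (dif u z)\<^sup>2 \<partial>M2"]
   ennreal_plus[of "1 / 2 * (LINT z|M2. JJ z * (dif u z)\<^sup>2)" "\<integral>x. B x * (u x)\<^sup>2 \<partial>M1"]
  by (simp del: ennreal_plus)
qed

lemma energy_nonneg: "0 \<le> E u u"
 unfolding energy_sq using W2.wL2_nonneg[of "dif u"] W1.wL2_nonneg[of u] by simp

lemma energy_comm: "E u v = E v u"
 unfolding energy_eq by (simp add: mult_ac)

lemma dom_lin:
 assumes "dom u" "dom v"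
 shows "dom (\<lambda>x. u x + t * v x)" and "dom w ==> E (\<lambda>x. u x + t * v x) w = E u w + t * E v w"
proof -
 have d: "dif (\<lambda>x. u x + t * v x) = (\<lambda>z. dif u z + t * dif v z)"
  by (auto simp: dif_def fun_eq_iff algebra_simps)
 show "dom (\<lambda>x. u x + t * v x)"
  using assms unfolding dom_def d by (auto intro!: W2.wL2_add W1.wL2_add WU.wL2_add)
 assume w: "dom w"
 have i: "integrable M2 (\<lambda>z. JJ z * dif u z * dif w z)" "integrable M2 (\<lambda>z. JJ z * dif v z * dif w z)"
  "integrable M1 (\<lambda>x. B x * u x * w x)" "integrable M1 (\<lambda>x. B x * v x * w x)"
  using assms w by (auto simp: dom_def intro!: W2.wL2_mult_integrable W1.wL2_mult_integrable)
 have e: "JJ z * (dif u z + t * dif v z) * dif w z = JJ z * dif u z * dif w z + t * (JJ z * dif v z * dif w z)"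
   "B x * (u x + t * v x) * w x = B x * u x * w x + t * (B x * v x * w x)" for z x
  by (simp_all add: algebra_simps)
 show "E (\<lambda>x. u x + t * v x) w = E u w + t * E v w"
  unfolding energy_eq d e using i by (simp add: algebra_simps)
qed

lemma dom_diff:
 assumes "dom u" "dom v"
 shows "dom (\<lambda>x. u x - v x)" and "dom w ==> E (\<lambda>x. u x - v x) w = E u w - E v w"
 using dom_lin[OF assms, where t="-1"] by auto

text \<open>The parallelogram identity with the nonnegative energy of u + v dropped.\<close>

lemma energy_diff_le:
 assumes "dom u" "dom v"
 shows "E (\<lambda>x. u x - v x) (\<lambda>x. u x - v x) \<le> 2 * E u u + 2 * E v v"
proof -
 have "dom (\<lambda>x. u x + 1 * v x)" "dom (\<lambda>x. u x - v x)" by (rule dom_lin[OF assms], rule dom_diff[OF assms])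
 note d = this
 have "E (\<lambda>x. u x - v x) (\<lambda>x. u x - v x) = E u (\<lambda>x. u x - v x) - E v (\<lambda>x. u x - v x)" by (rule dom_diff(2)[OF assms d(2)])
 also have "... = (E u u - E v u) - (E u v - E v v)"
  using dom_diff(2)[OF assms assms(1)] dom_diff(2)[OF assms assms(2)] energy_comm[of u "\<lambda>x. u x - v x"] energy_comm[of v "\<lambda>x. u x - v x"] by simp
 finally have 1: "E (\<lambda>x. u x - v x) (\<lambda>x. u x - v x) = E u u - E v u - E u v + E v v" by simp
 have "E (\<lambda>x. u x + 1 * v x) (\<lambda>x. u x + 1 * v x) = E u (\<lambda>x. u x + 1 * v x) + 1 * E v (\<lambda>x. u x + 1 * v x)"
  by (rule dom_lin(2)[OF assms d(1)])
 also have "... = (E u u + E v u) + (E u v + E v v)"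
  using dom_lin(2)[OF assms assms(1), where t=1] dom_lin(2)[OF assms assms(2), where t=1] energy_comm[of u "\<lambda>x. u x + 1 * v x"] energy_comm[of v "\<lambda>x. u x + 1 * v x"] by simp
 finally show ?thesis using 1 energy_nonneg[of "\<lambda>x. u x + 1 * v x"] by linarith
qed

lemma dom_Lipschitz:
 assumes "dom u" "F \<in> borel_measurable borel" "F 0 = 0" "\<And>s t. \<bar>F s - F t\<bar> \<le> C * \<bar>s - t\<bar>"
 shows "dom (\<lambda>x. F (u x))"
proof -
 have um: "u \<in> borel_measurable M1" using assms by (simp add: dom_def wL2_def)
 have Fm: "(\<lambda>x. F (u x)) \<in> borel_measurable M1" by (rule measurable_compose[OF um assms(2)])
 have b: "\<bar>F s\<bar> \<le> C * \<bar>s\<bar>" for s using assms(4)[of s 0] assms(3) by simp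
 show ?thesis unfolding dom_def
 proof (intro conjI)
  show "wL2 M1 (\<lambda>_. 1) (\<lambda>x. F (u x))" by (rule WU.wL2_bound[of u _ C]) (use assms Fm b in \<open>auto simp: dom_def\<close>)
  show "wL2 M2 JJ (dif (\<lambda>x. F (u x)))" by (rule W2.wL2_bound[of "dif u" _ C])
    (use assms dif_measurable[OF Fm] in \<open>auto simp: dom_def dif_def\<close>)
  show "wL2 M1 B (\<lambda>x. F (u x))" by (rule W1.wL2_bound[of u _ C]) (use assms Fm b in \<open>auto simp: dom_def\<close>)
 qed
qed

lemma energy_le:
 assumes v: "dom v" and u: "dom u" and w: "dom w"
  and 1: "\<And>x y. x \<in> \<Omega> ==> y \<in> \<Omega> ==> (v x - v y)\<^sup>2 \<le> a * (u x - u y)\<^sup>2 + b * (w x - w y)\<^sup>2"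
  and 2: "\<And>x. x \<in> \<Omega> ==> (v x)\<^sup>2 \<le> a * (u x)\<^sup>2 + b * (w x)\<^sup>2"
 shows "E v v \<le> a * E u u + b * E w w"
proof -
 have i: "integrable M2 (\<lambda>z. JJ z * (dif g z)\<^sup>2)" "integrable M1 (\<lambda>x. B x * (g x)\<^sup>2)" if "dom g" for g
  using that by (auto simp: dom_def wL2_def)
 have "(LINT z|M2. JJ z * (dif v z)\<^sup>2) \<le> (LINT z|M2. a * (JJ z * (dif u z)\<^sup>2) + b * (JJ z * (dif w z)\<^sup>2))"
 proof (rule integral_mono)
  fix z assume z: "z \<in> space M2"
  have "(dif v z)\<^sup>2 \<le> a * (dif u z)\<^sup>2 + b * (dif w z)\<^sup>2" using z 1 by (auto simp: dif_def space_M)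
  from mult_left_mono[OF this W2.j0[OF z]] show "JJ z * (dif v z)\<^sup>2 \<le> a * (JJ z * (dif u z)\<^sup>2) + b * (JJ z * (dif w z)\<^sup>2)"
   by (simp add: algebra_simps)
 qed (intro i v u w int_add integrable_mult_right)+
 also have "... = a * (LINT z|M2. JJ z * (dif u z)\<^sup>2) + b * (LINT z|M2. JJ z * (dif w z)\<^sup>2)"
  using i(1)[OF u] i(1)[OF w] by simp
 finally have A: "(LINT z|M2. JJ z * (dif v z)\<^sup>2) \<le> a * (LINT z|M2. JJ z * (dif u z)\<^sup>2) + b * (LINT z|M2. JJ z * (dif w z)\<^sup>2)" .
 have "(LINT x|M1. B x * (v x)\<^sup>2) \<le> (LINT x|M1. a * (B x * (u x)\<^sup>2) + b * (B x * (w x)\<^sup>2))"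
 proof (rule integral_mono)
  fix x assume x: "x \<in> space M1"
  have "(v x)\<^sup>2 \<le> a * (u x)\<^sup>2 + b * (w x)\<^sup>2" using x 2 by (auto simp: space_M)
  from mult_left_mono[OF this W1.j0[OF x]] show "B x * (v x)\<^sup>2 \<le> a * (B x * (u x)\<^sup>2) + b * (B x * (w x)\<^sup>2)"
   by (simp add: algebra_simps)
 qed (intro i v u w int_add integrable_mult_right)+
 also have "... = a * (LINT x|M1. B x * (u x)\<^sup>2) + b * (LINT x|M1. B x * (w x)\<^sup>2)"
  using i(2)[OF u] i(2)[OF w] by simp
 finally show ?thesis using A unfolding energy_sq by (simp add: algebra_simps)
qed

lemma Cc_smooth_measurable: "\<phi> \<in> Cc_smooth \<Omega> ==> \<phi> \<in> borel_measurable M1"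
 by (intro measurable_restrict_space1 measurable_completion)
  (auto simp: Cc_smooth_def smooth_def intro!: borel_measurable_continuous_onI intro: Ck_continuous)

lemma finite_M1: "finite_measure M1"
 using emeasure_\<Omega> sets_\<Omega> by (intro finite_measureI) (auto simp: space_M emeasure_restrict_space)

text \<open>The jump part is finite by the Lipschitz bound and the second moment of
  \<open>J\<close>, the killing part because \<open>B\<close> is bounded on the compact support, and
  the L^2 part because \<Omega> has finite measure.\<close>

lemma Cc_dom:
 assumes \<phi>: "\<phi> \<in> Cc_smooth \<Omega>" shows "dom \<phi>"
proof -
 interpret finite_measure M1 by (rule finite_M1)
 note m[measurable] = Cc_smooth_measurable[OF \<phi>]
 obtain K where K: "\<And>x. \<bar>\<phi> x\<bar> \<le> K" "K > 0" using Cc_smooth_bounded[OF \<phi>] by blast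
 obtain L where L: "\<And>x y. \<bar>\<phi> x - \<phi> y\<bar> \<le> L * norm (x - y)" "L > 0" using Cc_smooth_Lipschitz[OF \<phi>] by blast
 have K2: "(\<phi> x)\<^sup>2 \<le> K\<^sup>2" for x using power_mono[OF K(1)[of x], of 2] by simp
 have "integrable M1 (\<lambda>x. (\<phi> x)\<^sup>2)"
  by (rule integrable_const_bound[of _ "K\<^sup>2"]) (use K2 in auto)
 then have 1: "wL2 M1 (\<lambda>_. 1) \<phi>" by (simp add: wL2_def)
 have fin: "(\<integral>\<^sup>+z. ennreal ((norm (fst z - snd z))\<^sup>2 * JJ z) \<partial>M2) < \<infinity>"
 proof -
  have "(\<integral>\<^sup>+z. ennreal ((norm (fst z - snd z))\<^sup>2 * JJ z) \<partial>M2) = (\<integral>\<^sup>+(x, y). ennreal ((norm (x - y))\<^sup>2 * J x y) \<partial>M2)"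
   by (intro nn_integral_cong) (auto simp: JJ_def)
  then show ?thesis using L1 by (simp add: cond_L1_def)
 qed
 have dm[measurable]: "dif \<phi> \<in> borel_measurable M2" by (rule dif_measurable[OF m])
 note [measurable] = W2.jm
 have "(\<integral>\<^sup>+z. ennreal (JJ z * (dif \<phi> z)\<^sup>2) \<partial>M2) \<le> (\<integral>\<^sup>+z. ennreal (L\<^sup>2) * ennreal ((norm (fst z - snd z))\<^sup>2 * JJ z) \<partial>M2)"
 proof (intro nn_integral_mono)
  fix z assume z: "z \<in> space M2"
  have "\<bar>dif \<phi> z\<bar>\<^sup>2 \<le> (L * norm (fst z - snd z))\<^sup>2" using L(1) by (intro power_mono) (auto simp: dif_def)
  then have "(dif \<phi> z)\<^sup>2 \<le> L\<^sup>2 * (norm (fst z - snd z))\<^sup>2" by (simp add: power_mult_distrib)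
  from mult_left_mono[OF this W2.j0[OF z]] show "ennreal (JJ z * (dif \<phi> z)\<^sup>2) \<le> ennreal (L\<^sup>2) * ennreal ((norm (fst z - snd z))\<^sup>2 * JJ z)"
   using W2.j0[OF z] by (simp add: ennreal_mult[symmetric] mult_ac ennreal_leI)
 qed
 also have "... = ennreal (L\<^sup>2) * (\<integral>\<^sup>+z. ennreal ((norm (fst z - snd z))\<^sup>2 * JJ z) \<partial>M2)"
 proof (rule nn_integral_cmult)
  have "(\<lambda>z::'a\<times>'a. (norm (fst z - snd z))\<^sup>2) \<in> borel_measurable borel"
   by (intro borel_measurable_continuous_onI continuous_intros)
  then have [measurable]: "(\<lambda>z::'a\<times>'a. (norm (fst z - snd z))\<^sup>2) \<in> borel_measurable M2"
   by (intro measurable_restrict_space1 measurable_completion) simp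
  show "(\<lambda>z. ennreal ((norm (fst z - snd z))\<^sup>2 * JJ z)) \<in> borel_measurable M2" by measurable
 qed
 also have "... < \<infinity>" using fin by (simp add: ennreal_mult_less_top)
 finally have 2: "wL2 M2 JJ (dif \<phi>)" unfolding wL2_def
  by (subst integrable_iff_nn_integral_finite) (auto intro!: mult_nonneg_nonneg W2.j0)
 let ?S = "closure {x. \<phi> x \<noteq> 0}"
 have "compact ?S" "?S \<subseteq> \<Omega>" using \<phi> by (auto simp: Cc_smooth_def)
 then have "bounded (B ` ?S)" using L1 by (auto simp: cond_L1_def)
 then obtain b where b: "\<And>x. x \<in> ?S ==> \<bar>B x\<bar> \<le> b" by (auto simp: bounded_iff)
 note [measurable] = W1.jm
 have "integrable M1 (\<lambda>x. B x * (\<phi> x)\<^sup>2)"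
 proof (rule integrable_const_bound[of _ "\<bar>b\<bar> * K\<^sup>2"])
  show "AE x in M1. norm (B x * (\<phi> x)\<^sup>2) \<le> \<bar>b\<bar> * K\<^sup>2"
  proof (rule AE_I2)
   fix x
   show "norm (B x * (\<phi> x)\<^sup>2) \<le> \<bar>b\<bar> * K\<^sup>2"
   proof (cases "\<phi> x = 0")
    case False
    then have "x \<in> ?S" using closure_subset[of "{x. \<phi> x \<noteq> 0}"] by auto
    from b[OF this] have "\<bar>B x\<bar> \<le> \<bar>b\<bar>" by simp
    then show ?thesis unfolding norm_mult by (intro mult_mono) (use K2 in auto)
   qed auto
  qed
 qed measurable
 then have 3: "wL2 M1 B \<phi>" by (simp add: wL2_def)
 show ?thesis using 1 2 3 by (simp add: dom_def)
qed

lemma Cc_H: "\<phi> \<in> Cc_smooth \<Omega> ==> \<phi> \<in> H_space \<Omega> J B"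
 unfolding H_space_def using Cc_dom[of \<phi>]
 by (auto simp: energy_dom_iff quad_energy_eq' dif_def intro!: bexI[of _ \<phi>])

lemma energy_pairing_tendsto:
 assumes a: "\<And>n. dom (a n)" "\<And>n. E (a n) (a n) \<le> K" and d: "\<And>n. dom (d n)" "(\<lambda>n. E (d n) (d n)) \<longlonglongrightarrow> 0"
 shows "(\<lambda>n. E (d n) (a n)) \<longlonglongrightarrow> 0"
proof -
 have s: "(LINT z|M2. JJ z * (dif u z)\<^sup>2) \<le> 2 * E u u" "(LINT x|M1. B x * (u x)\<^sup>2) \<le> E u u" for u
  unfolding energy_sq using W2.wL2_nonneg[of "dif u"] W1.wL2_nonneg[of u] by auto
 have "(\<lambda>n. LINT z|M2. JJ z * dif (a n) z * dif (d n) z) \<longlonglongrightarrow> 0"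
 proof (rule W2.wL2_pairing_tendsto)
  show "(LINT z|M2. JJ z * (dif (a n) z)\<^sup>2) \<le> 2 * K" for n using s(1)[of "a n"] a(2)[of n] by linarith
  show "(\<lambda>n. LINT z|M2. JJ z * (dif (d n) z)\<^sup>2) \<longlonglongrightarrow> 0"
   by (rule tendsto_sandwich[OF _ _ tendsto_const tendsto_mult_right_zero[OF d(2), of 2]])
    (use s W2.wL2_nonneg in auto)
 qed (use a d in \<open>auto simp: dom_def\<close>)
 moreover have "(\<lambda>n. LINT x|M1. B x * a n x * d n x) \<longlonglongrightarrow> 0"
 proof (rule W1.wL2_pairing_tendsto)
  show "(LINT x|M1. B x * (a n x)\<^sup>2) \<le> K" for n using s(2)[of "a n"] a(2)[of n] by linarith
  show "(\<lambda>n. LINT x|M1. B x * (d n x)\<^sup>2) \<longlonglongrightarrow> 0"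
   by (rule tendsto_sandwich[OF _ _ tendsto_const d(2)]) (use s W1.wL2_nonneg in auto)
 qed (use a d in \<open>auto simp: dom_def\<close>)
 ultimately have "(\<lambda>n. 1 / 2 * (LINT z|M2. JJ z * dif (a n) z * dif (d n) z) + (LINT x|M1. B x * a n x * d n x)) \<longlonglongrightarrow> 1 / 2 * 0 + 0"
  by (intro tendsto_intros)
 moreover have "E (d n) (a n) = 1 / 2 * (LINT z|M2. JJ z * dif (a n) z * dif (d n) z) + (LINT x|M1. B x * a n x * d n x)" for n
  using energy_comm[of "d n" "a n"] energy_eq[of "a n" "d n"] by simp
 ultimately show ?thesis by simp
qed

text \<open>A bound on the energies and convergence in L^2 suffice for convergence against a fixed
  \<open>F\<close>. This is what is available after composing an approximating sequence with
  \<open>aabs\<close>: Lipschitz maps keep energies bounded, but energy convergence of the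
  compositions is not at hand.\<close>

lemma energy_weak_tendsto:
 assumes F: "dom F" and g: "\<And>n. dom (g n)" "\<And>n. E (g n) (g n) \<le> K" "dom g'"
  and l: "(\<lambda>n. LINT x|M1. (g n x - g' x)\<^sup>2) \<longlonglongrightarrow> 0"
 shows "(\<lambda>n. E F (g n)) \<longlonglongrightarrow> E F g'"
proof -
 define d where "d n x = g n x - g' x" for n x
 let ?d = "\<lambda>n. \<integral>x. (d n x)\<^sup>2 \<partial>M1"
 have dd: "dom (d n)" for n unfolding d_def[abs_def] by (rule dom_diff[OF g(1) g(3)])
 have "E (d n) (d n) \<le> 2 * K + 2 * E g' g'" for n
  using energy_diff_le[OF g(1)[of n] g(3)] g(2)[of n] unfolding d_def[abs_def] by linarith
 note dK = this
 have s: "(LINT z|M2. JJ z * (dif u z)\<^sup>2) \<le> 2 * E u u" "(LINT x|M1. B x * (u x)\<^sup>2) \<le> E u u" for u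
  unfolding energy_sq using W2.wL2_nonneg[of "dif u"] W1.wL2_nonneg[of u] by auto
 have dm[measurable]: "d n \<in> borel_measurable M1" and di: "integrable M1 (\<lambda>x. (d n x)\<^sup>2)" for n
  using dd[of n] by (auto simp: dom_def wL2_def)
 \<comment> \<open>The finite volume of \<Omega> turns L^2 convergence on \<Omega> into L^2
   convergence of the differences on the product, with factor 4V.\<close>
 define V where "V = enn2real (emeasure lborel \<Omega>)"
 have V: "emeasure lborel \<Omega> = ennreal V" "V \<ge> 0" using emeasure_\<Omega> by (auto simp: V_def)
 have fs: "integrable M2 (\<lambda>z. (d n (fst z))\<^sup>2)" "integrable M2 (\<lambda>z. (d n (snd z))\<^sup>2)"
   "(LINT z|M2. (d n (fst z))\<^sup>2) = V * (?d n)" "(LINT z|M2. (d n (snd z))\<^sup>2) = V * (?d n)" for n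
 proof -
  have [measurable]: "(\<lambda>z. d n (fst z)) \<in> borel_measurable M2" "(\<lambda>z. d n (snd z)) \<in> borel_measurable M2"
   by (rule lebesgue_on_Times_measurable[OF dm sets_\<Omega>(1)])+
  have nn: "(\<integral>\<^sup>+x. ennreal ((d n x)\<^sup>2) \<partial>M1) = ennreal (?d n)" by (rule nn_integral_eq_integral[OF di]) auto
  have e: "(\<integral>\<^sup>+z. ennreal ((d n (fst z))\<^sup>2) \<partial>M2) = ennreal (V * (?d n))"
   "(\<integral>\<^sup>+z. ennreal ((d n (snd z))\<^sup>2) \<partial>M2) = ennreal (V * (?d n))"
   using nn_integral_lebesgue_on_Times[of "\<lambda>x. ennreal ((d n x)\<^sup>2)" \<Omega>, OF _ sets_\<Omega>(1)] V nn by (simp_all add: ennreal_mult)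
  show "integrable M2 (\<lambda>z. (d n (fst z))\<^sup>2)" "integrable M2 (\<lambda>z. (d n (snd z))\<^sup>2)"
   by (rule integrableI_nonneg; use e in auto)+
  show "(LINT z|M2. (d n (fst z))\<^sup>2) = V * (?d n)" "(LINT z|M2. (d n (snd z))\<^sup>2) = V * (?d n)"
   by (subst integral_eq_nn_integral; use e V in \<open>auto simp: integral_nonneg_AE\<close>)+
 qed
 have i2: "integrable M2 (\<lambda>z. (dif (d n) z)\<^sup>2)" for n
 proof (rule int_bound)
  show "integrable M2 (\<lambda>z. 2 * (d n (fst z))\<^sup>2 + 2 * (d n (snd z))\<^sup>2)" using fs by auto
  show "(\<lambda>z. (dif (d n) z)\<^sup>2) \<in> borel_measurable M2" using dif_measurable[OF dm] by measurable
  show "AE z in M2. norm ((dif (d n) z)\<^sup>2) \<le> norm (2 * (d n (fst z))\<^sup>2 + 2 * (d n (snd z))\<^sup>2)"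
  proof (rule AE_I2)
   fix z
   have "0 \<le> (d n (fst z) + d n (snd z))\<^sup>2" by simp
   then have "(dif (d n) z)\<^sup>2 \<le> 2 * (d n (fst z))\<^sup>2 + 2 * (d n (snd z))\<^sup>2"
    by (simp add: dif_def power2_eq_square algebra_simps)
   then show "norm ((dif (d n) z)\<^sup>2) \<le> norm (2 * (d n (fst z))\<^sup>2 + 2 * (d n (snd z))\<^sup>2)" by simp
  qed
 qed
 have l2: "(\<lambda>n. LINT z|M2. (dif (d n) z)\<^sup>2) \<longlonglongrightarrow> 0"
 proof (rule tendsto_sandwich[OF _ _ tendsto_const])
  show "(\<lambda>n. 4 * V * (?d n)) \<longlonglongrightarrow> 0" using l unfolding d_def by (intro tendsto_mult_right_zero)
  show "\<forall>\<^sub>F n in sequentially. (LINT z|M2. (dif (d n) z)\<^sup>2) \<le> 4 * V * (?d n)"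
  proof (intro always_eventually allI)
   fix n
   have "(LINT z|M2. (dif (d n) z)\<^sup>2) \<le> (LINT z|M2. 2 * (d n (fst z))\<^sup>2 + 2 * (d n (snd z))\<^sup>2)"
   proof (rule integral_mono[OF i2])
    fix z
    have "0 \<le> (d n (fst z) + d n (snd z))\<^sup>2" by simp
    then show "(dif (d n) z)\<^sup>2 \<le> 2 * (d n (fst z))\<^sup>2 + 2 * (d n (snd z))\<^sup>2"
     by (simp add: dif_def power2_eq_square algebra_simps)
   qed (use fs in auto)
   also have "... = 4 * V * (?d n)" using fs[of n] by simp
   finally show "(LINT z|M2. (dif (d n) z)\<^sup>2) \<le> 4 * V * (?d n)" .
  qed
 qed (auto intro!: always_eventually)
 have "(\<lambda>n. LINT z|M2. JJ z * dif F z * dif (d n) z) \<longlonglongrightarrow> 0"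
 proof (rule W2.wL2_weak_tendsto[OF _ _ _ i2 l2])
  show "(LINT z|M2. JJ z * (dif (d n) z)\<^sup>2) \<le> 2 * (2 * K + 2 * E g' g')" for n
   using dK[of n] by (intro order_trans[OF s(1)] mult_left_mono) auto
 qed (use F dd in \<open>auto simp: dom_def\<close>)
 moreover have "(\<lambda>n. LINT x|M1. B x * F x * d n x) \<longlonglongrightarrow> 0"
 proof (rule W1.wL2_weak_tendsto[OF _ _ _ di])
  show "(LINT x|M1. B x * (d n x)\<^sup>2) \<le> 2 * K + 2 * E g' g'" for n using s(2)[of "d n"] dK[of n] by linarith
  show "(\<lambda>n. LINT x|M1. (d n x)\<^sup>2) \<longlonglongrightarrow> 0" using l by (simp add: d_def)
 qed (use F dd in \<open>auto simp: dom_def\<close>)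
 ultimately have "(\<lambda>n. 1 / 2 * (LINT z|M2. JJ z * dif F z * dif (d n) z) + (LINT x|M1. B x * F x * d n x)) \<longlonglongrightarrow> 1 / 2 * 0 + 0"
  by (intro tendsto_intros)
 then have "(\<lambda>n. E F (d n)) \<longlonglongrightarrow> 0" unfolding energy_eq by simp
 moreover have "E F (d n) = E F (g n) - E F g'" for n
  using dom_diff(2)[OF g(1)[of n] g(3) F] unfolding d_def[abs_def] energy_comm[of F] by simp
 ultimately show ?thesis by (simp add: LIM_zero_iff)
qed

end

context energy_form begin

lemma L2_iff: "f \<in> L2 \<Omega> \<longleftrightarrow> wL2 M1 (\<lambda>_. 1) f"
 by (simp add: L2_def wL2_def)

lemma dom_L2: "dom u ==> wL2 M1 (\<lambda>_. 1) u" by (simp add: dom_def)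

lemma dom_sq_integrable: "dom u ==> integrable M1 (\<lambda>x. (u x)\<^sup>2)"
 by (simp add: dom_def wL2_def)

lemma H_approx:
 assumes "u \<in> H_space \<Omega> J B"
 shows "dom u"
  and "\<exists>\<phi>. (\<forall>n. \<phi> n \<in> Cc_smooth \<Omega>) \<and> (\<lambda>n. LINT x|M1. (\<phi> n x - u x)\<^sup>2) \<longlonglongrightarrow> 0 \<and>
   (\<lambda>n. E (\<lambda>x. u x - \<phi> n x) (\<lambda>x. u x - \<phi> n x)) \<longlonglongrightarrow> 0 \<and> (\<forall>n. E (\<phi> n) (\<phi> n) \<le> 2 * E u u + 2)"
proof -
 show du: "dom u" using assms by (simp add: H_space_def energy_dom_iff)
 have "\<exists>\<phi>\<in>Cc_smooth \<Omega>. (\<integral>\<^sup>+ x. ennreal ((u x - \<phi> x)\<^sup>2) \<partial>M1) + quad_energy \<Omega> J B (\<lambda>x. u x - \<phi> x) < ennreal (1 / real (Suc n))" for n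
  using assms unfolding H_space_def by simp
 then obtain \<phi> where \<phi>: "\<And>n. \<phi> n \<in> Cc_smooth \<Omega>"
  and s: "\<And>n. (\<integral>\<^sup>+ x. ennreal ((u x - \<phi> n x)\<^sup>2) \<partial>M1) + quad_energy \<Omega> J B (\<lambda>x. u x - \<phi> n x) < ennreal (1 / real (Suc n))"
  by metis
 let ?I = "\<lambda>n. \<integral>x. (u x - \<phi> n x)\<^sup>2 \<partial>M1" and ?E = "\<lambda>n. E (\<lambda>x. u x - \<phi> n x) (\<lambda>x. u x - \<phi> n x)"
 have d: "dom (\<lambda>x. u x - \<phi> n x)" for n by (rule dom_diff[OF du Cc_dom[OF \<phi>]])
 have b: "(?I n) \<le> 1 / real (Suc n)" "?E n \<le> 1 / real (Suc n)" for n
 proof -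
  have "(\<integral>\<^sup>+ x. ennreal ((u x - \<phi> n x)\<^sup>2) \<partial>M1) = ennreal (?I n)"
   by (rule nn_integral_eq_integral[OF dom_sq_integrable[OF d]]) auto
  then have "ennreal (?I n) + ennreal (?E n) < ennreal (1 / real (Suc n))"
   using s[of n] quad_energy_eq[OF d[of n]] by simp
  then have "(?I n) + ?E n < 1 / real (Suc n)"
   by (subst (asm) ennreal_plus[symmetric]) (auto simp: energy_nonneg ennreal_less_iff simp del: ennreal_plus)
  moreover have "0 \<le> (?I n)" by simp
  ultimately show "(?I n) \<le> 1 / real (Suc n)" "?E n \<le> 1 / real (Suc n)"
   using energy_nonneg[of "\<lambda>x. u x - \<phi> n x"] by linarith+
 qed
 have l: "(\<lambda>n. 1 / real (Suc n)) \<longlonglongrightarrow> 0" by (rule LIMSEQ_Suc[OF lim_1_over_n])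
 have "(\<lambda>n. LINT x|M1. (u x - \<phi> n x)\<^sup>2) \<longlonglongrightarrow> 0"
  by (rule tendsto_sandwich[OF _ _ tendsto_const l]) (use b in auto)
 moreover have "(LINT x|M1. (\<phi> n x - u x)\<^sup>2) = (?I n)" for n by (simp add: power2_commute)
 moreover have "(\<lambda>n. ?E n) \<longlonglongrightarrow> 0"
  by (rule tendsto_sandwich[OF _ _ tendsto_const l]) (use b energy_nonneg in auto)
 moreover have "E (\<phi> n) (\<phi> n) \<le> 2 * E u u + 2" for n
 proof -
  have "E (\<phi> n) (\<phi> n) \<le> 2 * E u u + 2 * ?E n"
   using energy_diff_le[OF du d[of n]] by simp
  moreover have "1 / real (Suc n) \<le> 1" by simp
  ultimately show ?thesis using b(2)[of n] by linarith
 qed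
 ultimately show "\<exists>\<phi>. (\<forall>n. \<phi> n \<in> Cc_smooth \<Omega>) \<and> (\<lambda>n. LINT x|M1. (\<phi> n x - u x)\<^sup>2) \<longlonglongrightarrow> 0 \<and>
   (\<lambda>n. E (\<lambda>x. u x - \<phi> n x) (\<lambda>x. u x - \<phi> n x)) \<longlonglongrightarrow> 0 \<and> (\<forall>n. E (\<phi> n) (\<phi> n) \<le> 2 * E u u + 2)"
  using \<phi> by (intro exI[of _ \<phi>]) simp
qed

lemma L2_pairing_tendsto:
 assumes f: "f \<in> L2 \<Omega>" and a: "\<And>n. wL2 M1 (\<lambda>_. 1) (a n)" "wL2 M1 (\<lambda>_. 1) a'"
  and l: "(\<lambda>n. LINT x|M1. (a n x - a' x)\<^sup>2) \<longlonglongrightarrow> 0"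
 shows "(\<lambda>n. LINT x|M1. f x * a n x) \<longlonglongrightarrow> (LINT x|M1. f x * a' x)"
proof -
 have d: "wL2 M1 (\<lambda>_. 1) (\<lambda>x. a n x - a' x)" for n using WU.wL2_add(1)[OF a(1) a(2), where t="-1"] by simp
 have "(\<lambda>n. LINT x|M1. 1 * f x * (a n x - a' x)) \<longlonglongrightarrow> 0"
  by (rule WU.wL2_pairing_tendsto[where K="\<integral>x. 1 * (f x)\<^sup>2 \<partial>M1"]) (use f d l in \<open>auto simp: L2_iff\<close>)
 moreover have "(LINT x|M1. 1 * f x * (a n x - a' x)) = (LINT x|M1. f x * a n x) - (LINT x|M1. f x * a' x)" for n
  using WU.wL2_mult_integrable[OF f[unfolded L2_iff] a(1)] WU.wL2_mult_integrable[OF f[unfolded L2_iff] a(2)]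
  by (simp add: right_diff_distrib)
 ultimately show ?thesis by (simp add: LIM_zero_iff)
qed

lemma integral_sq_tendsto_Lipschitz:
 fixes a b :: "nat => 'a => real"
 assumes l: "(\<lambda>n. LINT x|M1. (a n x - a' x)\<^sup>2) \<longlonglongrightarrow> 0" and i: "\<And>n. integrable M1 (\<lambda>x. (a n x - a' x)\<^sup>2)"
  and m: "\<And>n. b n \<in> borel_measurable M1" "b' \<in> borel_measurable M1"
  and C: "\<And>n x. x \<in> \<Omega> ==> \<bar>b n x - b' x\<bar> \<le> C * \<bar>a n x - a' x\<bar>"
 shows "(\<lambda>n. LINT x|M1. (b n x - b' x)\<^sup>2) \<longlonglongrightarrow> 0"
proof (rule tendsto_sandwich[OF _ _ tendsto_const tendsto_mult_right_zero[OF l, of "C\<^sup>2"]])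
 show "\<forall>\<^sub>F n in sequentially. (LINT x|M1. (b n x - b' x)\<^sup>2) \<le> C\<^sup>2 * (LINT x|M1. (a n x - a' x)\<^sup>2)"
 proof (intro always_eventually allI)
  fix n
  have p: "(b n x - b' x)\<^sup>2 \<le> C\<^sup>2 * (a n x - a' x)\<^sup>2" if "x \<in> \<Omega>" for x
   using power_mono[OF C[OF that, of n], of 2] by (simp add: power_mult_distrib)
  have "integrable M1 (\<lambda>x. (b n x - b' x)\<^sup>2)"
  proof (rule int_bound[OF integrable_mult_right[OF i, of "C\<^sup>2" n]])
   show "AE x in M1. norm ((b n x - b' x)\<^sup>2) \<le> norm (C\<^sup>2 * (a n x - a' x)\<^sup>2)"
    using p by (intro AE_I2) (auto simp: space_M)
  qed (use m in measurable)
  from integral_mono[OF this integrable_mult_right[OF i, of "C\<^sup>2" n]] p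
  show "(LINT x|M1. (b n x - b' x)\<^sup>2) \<le> C\<^sup>2 * (LINT x|M1. (a n x - a' x)\<^sup>2)" by (auto simp: space_M)
 qed
qed (auto intro!: always_eventually)

text \<open>Kato's inequality for smooth functions: the convexity inequality at x is weighted by
  \<eta>(x), the one at y by \<eta>(y), and the sum is integrated against the kernel. The killing
  part is the convexity inequality at the points \<phi>(x) and 0.\<close>

lemma energy_convexity:
 assumes \<phi>: "\<phi> \<in> Cc_smooth \<Omega>" and \<eta>: "\<eta> \<in> Cc_smooth \<Omega>" "\<And>x. 0 \<le> \<eta> x" and e: "e > 0"
 shows "E (\<lambda>x. aabs e (\<phi> x)) \<eta> \<le> E \<phi> (\<lambda>x. asgn e (\<phi> x) * \<eta> x)"
proof -
 have d: "dom (\<lambda>x. aabs e (\<phi> x))" "dom \<eta>" "dom \<phi>" "dom (\<lambda>x. asgn e (\<phi> x) * \<eta> x)"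
  by (intro Cc_dom aabs_Cc_smooth asgn_Cc_smooth \<phi> \<eta> e)+
 have "(LINT z|M2. JJ z * dif (\<lambda>x. aabs e (\<phi> x)) z * dif \<eta> z) \<le> (LINT z|M2. JJ z * dif \<phi> z * dif (\<lambda>x. asgn e (\<phi> x) * \<eta> x) z)"
 proof (rule integral_mono)
  fix z assume z: "z \<in> space M2"
  let ?a = "\<phi> (fst z)" and ?b = "\<phi> (snd z)" and ?s = "\<eta> (fst z)" and ?t = "\<eta> (snd z)"
  have "?s * (aabs e ?a - aabs e ?b) \<le> ?s * (asgn e ?a * (?a - ?b))" by (intro mult_left_mono aabs_convex e \<eta>)
  moreover have "?t * (aabs e ?b - aabs e ?a) \<le> ?t * (asgn e ?b * (?b - ?a))" by (intro mult_left_mono aabs_convex e \<eta>)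
  ultimately have "(aabs e ?a - aabs e ?b) * (?s - ?t) \<le> (?a - ?b) * (asgn e ?a * ?s - asgn e ?b * ?t)"
   by (simp add: algebra_simps)
  from mult_left_mono[OF this W2.j0[OF z]]
  show "JJ z * dif (\<lambda>x. aabs e (\<phi> x)) z * dif \<eta> z \<le> JJ z * dif \<phi> z * dif (\<lambda>x. asgn e (\<phi> x) * \<eta> x) z"
   by (simp add: dif_def mult.assoc)
 qed (use d in \<open>auto simp: dom_def intro!: W2.wL2_mult_integrable\<close>)
 moreover have "(LINT x|M1. B x * aabs e (\<phi> x) * \<eta> x) \<le> (LINT x|M1. B x * \<phi> x * (asgn e (\<phi> x) * \<eta> x))"
 proof (rule integral_mono)
  fix x assume x: "x \<in> space M1"
  have "aabs e 0 = 0" using e by (simp add: aabs_eq)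
  then have "aabs e (\<phi> x) \<le> asgn e (\<phi> x) * \<phi> x" using aabs_convex[OF e, of "\<phi> x" 0] by simp
  then have "B x * (aabs e (\<phi> x) * \<eta> x) \<le> B x * ((asgn e (\<phi> x) * \<phi> x) * \<eta> x)"
   by (intro mult_left_mono mult_right_mono \<eta> W1.j0 x)
  then show "B x * aabs e (\<phi> x) * \<eta> x \<le> B x * \<phi> x * (asgn e (\<phi> x) * \<eta> x)" by (simp add: mult_ac)
 qed (use d in \<open>auto simp: dom_def intro!: W1.wL2_mult_integrable\<close>)
 ultimately show ?thesis unfolding energy_eq by simp
qed

lemma dom_aabs: "dom u ==> e > 0 ==> dom (\<lambda>x. aabs e (u x))"
 by (rule dom_Lipschitz[where F="aabs e" and C=1]) (auto simp: aabs_Lipschitz, simp add: aabs_eq)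

lemma energy_aabs_le: "dom u ==> e > 0 ==> E (\<lambda>x. aabs e (u x)) (\<lambda>x. aabs e (u x)) \<le> E u u"
proof -
 assume u: "dom u" and e: "e > 0"
 have "aabs e 0 = 0" using e by (simp add: aabs_eq)
 then have a: "\<bar>aabs e t\<bar> \<le> \<bar>t\<bar>" for t using aabs_Lipschitz[OF e, of t 0] by simp
 have "E (\<lambda>x. aabs e (u x)) (\<lambda>x. aabs e (u x)) \<le> 1 * E u u + 0 * E u u"
 proof (rule energy_le[OF dom_aabs[OF u e] u u])
  show "(aabs e (u x) - aabs e (u y))\<^sup>2 \<le> 1 * (u x - u y)\<^sup>2 + 0 * (u x - u y)\<^sup>2" for x y
   using power_mono[OF aabs_Lipschitz[OF e, of "u x" "u y"], of 2] by simp
  show "(aabs e (u x))\<^sup>2 \<le> 1 * (u x)\<^sup>2 + 0 * (u x)\<^sup>2" for x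
   using power_mono[OF a[of "u x"], of 2] by simp
 qed
 then show ?thesis by simp
qed

text \<open>The sign is taken of a smooth approximation \<phi> n of z, so that the test function is
  smooth and lies in the energy space. The price is the energy pairing of z - \<phi> n with it,
  which vanishes in the limit because the test functions have bounded energy for fixed
  \<open>e\<close>.\<close>

lemma kato_test_function:
 assumes f: "f \<in> L2 \<Omega>" "is_green_op \<Omega> J B f z" and \<eta>: "\<eta> \<in> Cc_smooth \<Omega>" "\<And>x. 0 \<le> \<eta> x" and e: "e > 0"
 shows "E (\<lambda>x. aabs e (z x)) \<eta> \<le> (LINT x|M1. f x * (asgn e (z x) * \<eta> x))"
proof -
 have zH: "z \<in> H_space \<Omega> J B" and zE: "\<And>v. v \<in> H_space \<Omega> J B ==> E z v = (LINT x|M1. f x * v x)"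
  using f(2) by (auto simp: is_green_op_def)
 note dz = H_approx(1)[OF zH]
 obtain \<phi> where \<phi>: "\<And>n. \<phi> n \<in> Cc_smooth \<Omega>" and l: "(\<lambda>n. LINT x|M1. (\<phi> n x - z x)\<^sup>2) \<longlonglongrightarrow> 0"
  and El: "(\<lambda>n. E (\<lambda>x. z x - \<phi> n x) (\<lambda>x. z x - \<phi> n x)) \<longlonglongrightarrow> 0" and EK: "\<And>n. E (\<phi> n) (\<phi> n) \<le> 2 * E z z + 2"
  using H_approx(2)[OF zH] by auto
 let ?v = "\<lambda>n x. asgn e (\<phi> n x) * \<eta> x"
 obtain M where M: "\<And>x. \<bar>\<eta> x\<bar> \<le> M" "M > 0" using Cc_smooth_bounded[OF \<eta>(1)] by blast
 have d\<phi>: "dom (\<phi> n)" "dom (\<lambda>x. aabs e (\<phi> n x))" "dom (?v n)" "dom \<eta>" for n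
  by (intro Cc_dom aabs_Cc_smooth asgn_Cc_smooth \<phi> \<eta> e)+
 have mz[measurable]: "z \<in> borel_measurable M1" "\<And>n. \<phi> n \<in> borel_measurable M1" "\<eta> \<in> borel_measurable M1"
  using dz d\<phi> by (auto simp: dom_def wL2_def)
 have i: "integrable M1 (\<lambda>x. (\<phi> n x - z x)\<^sup>2)" for n by (rule dom_sq_integrable[OF dom_diff(1)[OF d\<phi>(1) dz]])
 \<comment> \<open>A discrete product rule: one part is controlled by the increments of \<eta>, the
   other by those of \<phi> n through the Lipschitz constant 1/e of \<open>asgn e\<close> and the
   bound M of \<eta>.\<close>
 have Eb: "E (?v n) (?v n) \<le> 2 * (M / e)\<^sup>2 * (2 * E z z + 2) + 2 * E \<eta> \<eta>" for n
 proof -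
  have "E (?v n) (?v n) \<le> (2 * (M / e)\<^sup>2) * E (\<phi> n) (\<phi> n) + 2 * E \<eta> \<eta>"
  proof (rule energy_le[OF d\<phi>(3) d\<phi>(1) d\<phi>(4)])
   fix x y
   let ?p = "asgn e (\<phi> n x) * (\<eta> x - \<eta> y)" and ?q = "\<eta> y * (asgn e (\<phi> n x) - asgn e (\<phi> n y))"
   have "\<bar>?p\<bar> \<le> 1 * \<bar>\<eta> x - \<eta> y\<bar>" unfolding abs_mult by (intro mult_right_mono asgn_abs_le e) auto
   then have p: "?p\<^sup>2 \<le> (\<eta> x - \<eta> y)\<^sup>2" using power_mono[of "\<bar>?p\<bar>" "\<bar>\<eta> x - \<eta> y\<bar>" 2] by simp
   have "\<bar>?q\<bar> \<le> M * (1 / e * \<bar>\<phi> n x - \<phi> n y\<bar>)" unfolding abs_mult by (intro mult_mono M asgn_Lipschitz e) (use M in auto)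
   then have q: "?q\<^sup>2 \<le> (M / e)\<^sup>2 * (\<phi> n x - \<phi> n y)\<^sup>2"
    using power_mono[of "\<bar>?q\<bar>" "M * (1 / e * \<bar>\<phi> n x - \<phi> n y\<bar>)" 2] by (simp add: power_mult_distrib power_divide)
   have "asgn e (\<phi> n x) * \<eta> x - asgn e (\<phi> n y) * \<eta> y = ?p + ?q" by (simp add: algebra_simps)
   moreover have "(?p + ?q)\<^sup>2 \<le> 2 * ?p\<^sup>2 + 2 * ?q\<^sup>2"
    using sum_squares_bound[of ?p ?q] unfolding power2_sum by linarith
   ultimately have "(asgn e (\<phi> n x) * \<eta> x - asgn e (\<phi> n y) * \<eta> y)\<^sup>2 \<le> 2 * ?p\<^sup>2 + 2 * ?q\<^sup>2" by simp
   also have "... \<le> 2 * (\<eta> x - \<eta> y)\<^sup>2 + 2 * ((M / e)\<^sup>2 * (\<phi> n x - \<phi> n y)\<^sup>2)"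
    by (intro add_mono mult_left_mono p q) auto
   finally show "(asgn e (\<phi> n x) * \<eta> x - asgn e (\<phi> n y) * \<eta> y)\<^sup>2 \<le> 2 * (M / e)\<^sup>2 * (\<phi> n x - \<phi> n y)\<^sup>2 + 2 * (\<eta> x - \<eta> y)\<^sup>2" by simp
   have "\<bar>asgn e (\<phi> n x) * \<eta> x\<bar> \<le> 1 * \<bar>\<eta> x\<bar>" unfolding abs_mult by (intro mult_right_mono asgn_abs_le e) auto
   then have "(asgn e (\<phi> n x) * \<eta> x)\<^sup>2 \<le> (\<eta> x)\<^sup>2" using power_mono[of "\<bar>asgn e (\<phi> n x) * \<eta> x\<bar>" "\<bar>\<eta> x\<bar>" 2] by simp
   then show "(asgn e (\<phi> n x) * \<eta> x)\<^sup>2 \<le> 2 * (M / e)\<^sup>2 * (\<phi> n x)\<^sup>2 + 2 * (\<eta> x)\<^sup>2"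
   proof -
    have "0 \<le> 2 * (M / e)\<^sup>2 * (\<phi> n x)\<^sup>2" "0 \<le> (\<eta> x)\<^sup>2" by simp_all
    with \<open>(asgn e (\<phi> n x) * \<eta> x)\<^sup>2 \<le> (\<eta> x)\<^sup>2\<close> show ?thesis by linarith
   qed
  qed
  moreover have "(2 * (M / e)\<^sup>2) * E (\<phi> n) (\<phi> n) \<le> (2 * (M / e)\<^sup>2) * (2 * E z z + 2)" by (intro mult_left_mono EK) auto
  ultimately show ?thesis by simp
 qed
 have s1: "E (\<lambda>x. aabs e (\<phi> n x)) \<eta> \<le> (LINT x|M1. f x * (asgn e (\<phi> n x) * \<eta> x)) - E (\<lambda>x. z x - \<phi> n x) (?v n)" for n
 proof -
  have "E (\<lambda>x. z x - \<phi> n x) (?v n) = E z (?v n) - E (\<phi> n) (?v n)"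
   by (rule dom_diff(2)[OF dz d\<phi>(1) d\<phi>(3)])
  moreover have "E z (?v n) = (LINT x|M1. f x * (asgn e (\<phi> n x) * \<eta> x))"
   by (intro zE Cc_H asgn_Cc_smooth \<phi> \<eta> e)
  ultimately show ?thesis using energy_convexity[OF \<phi>[of n] \<eta> e] by simp
 qed
 have l1: "(\<lambda>n. E \<eta> (\<lambda>x. aabs e (\<phi> n x))) \<longlonglongrightarrow> E \<eta> (\<lambda>x. aabs e (z x))"
 proof (rule energy_weak_tendsto[OF d\<phi>(4) d\<phi>(2) _ dom_aabs[OF dz e]])
  show "E (\<lambda>x. aabs e (\<phi> n x)) (\<lambda>x. aabs e (\<phi> n x)) \<le> 2 * E z z + 2" for n
   using energy_aabs_le[OF d\<phi>(1) e] EK by (rule order_trans)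
  show "(\<lambda>n. LINT x|M1. (aabs e (\<phi> n x) - aabs e (z x))\<^sup>2) \<longlonglongrightarrow> 0"
   by (rule integral_sq_tendsto_Lipschitz[OF l i, where C=1]) (auto simp: aabs_Lipschitz e)
 qed
 have wz: "wL2 M1 (\<lambda>_. 1) (\<lambda>x. asgn e (z x) * \<eta> x)"
 proof (rule WU.wL2_bound[OF dom_L2[OF d\<phi>(4)], where C=1])
  show "\<bar>asgn e (z x) * \<eta> x\<bar> \<le> 1 * \<bar>\<eta> x\<bar>" for x unfolding abs_mult by (intro mult_right_mono asgn_abs_le e) auto
 qed measurable
 have l2: "(\<lambda>n. LINT x|M1. f x * (asgn e (\<phi> n x) * \<eta> x)) \<longlonglongrightarrow> (LINT x|M1. f x * (asgn e (z x) * \<eta> x))"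
 proof (rule L2_pairing_tendsto[OF f(1) dom_L2[OF d\<phi>(3)] wz])
  show "(\<lambda>n. LINT x|M1. (asgn e (\<phi> n x) * \<eta> x - asgn e (z x) * \<eta> x)\<^sup>2) \<longlonglongrightarrow> 0"
  proof (rule integral_sq_tendsto_Lipschitz[OF l i, where C="1 / e * M"])
   fix n x
   have "\<bar>asgn e (\<phi> n x) * \<eta> x - asgn e (z x) * \<eta> x\<bar> = \<bar>asgn e (\<phi> n x) - asgn e (z x)\<bar> * \<bar>\<eta> x\<bar>"
    by (simp add: left_diff_distrib[symmetric] abs_mult)
   also have "... \<le> (1 / e * \<bar>\<phi> n x - z x\<bar>) * M" by (intro mult_mono asgn_Lipschitz M e) (use e in auto)
   finally show "\<bar>asgn e (\<phi> n x) * \<eta> x - asgn e (z x) * \<eta> x\<bar> \<le> 1 / e * M * \<bar>\<phi> n x - z x\<bar>" by (simp add: mult_ac)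
  qed measurable
 qed
 have l3: "(\<lambda>n. E (\<lambda>x. z x - \<phi> n x) (?v n)) \<longlonglongrightarrow> 0"
  by (rule energy_pairing_tendsto[OF d\<phi>(3) Eb dom_diff(1)[OF dz d\<phi>(1)] El])
 have "E \<eta> (\<lambda>x. aabs e (z x)) \<le> (LINT x|M1. f x * (asgn e (z x) * \<eta> x)) - 0"
  by (rule LIMSEQ_le[OF l1 tendsto_diff[OF l2 l3]]) (use s1 in \<open>auto simp: energy_comm[of \<eta>]\<close>)
 then show ?thesis by (simp add: energy_comm[of \<eta>])
qed

text \<open>Passing from smooth \<eta> to the solution \<open>g\<close> with datum \<xi> allows the
  left side to be evaluated: the energy pairing of \<open>g\<close> with \<open>aabs e z\<close>
  equals the integral of \<xi> against it.\<close>

lemma kato_L2: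
 assumes f: "f \<in> L2 \<Omega>" "is_green_op \<Omega> J B f z"
  and \<xi>: "\<xi> \<in> L2 \<Omega>" "is_green_op \<Omega> J B \<xi> g" "\<And>x. x \<in> \<Omega> ==> 0 \<le> g x" and e: "e > 0"
 shows "(LINT x|M1. \<xi> x * aabs e (z x)) \<le> (LINT x|M1. f x * (asgn e (z x) * g x))"
proof -
 interpret finite_measure M1 by (rule finite_M1)
 have zH: "z \<in> H_space \<Omega> J B" and gH: "g \<in> H_space \<Omega> J B"
  and gE: "\<And>v. v \<in> H_space \<Omega> J B ==> E g v = (LINT x|M1. \<xi> x * v x)"
  using f(2) \<xi>(2) by (auto simp: is_green_op_def)
 note dz = H_approx(1)[OF zH] and dg = H_approx(1)[OF gH]
 obtain \<phi> where \<phi>: "\<And>n. \<phi> n \<in> Cc_smooth \<Omega>" and l: "(\<lambda>n. LINT x|M1. (\<phi> n x - z x)\<^sup>2) \<longlonglongrightarrow> 0"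
  and EK: "\<And>n. E (\<phi> n) (\<phi> n) \<le> 2 * E z z + 2"
  using H_approx(2)[OF zH] by auto
 obtain \<psi> where \<psi>: "\<And>n. \<psi> n \<in> Cc_smooth \<Omega>" and lc: "(\<lambda>n. LINT x|M1. (\<psi> n x - g x)\<^sup>2) \<longlonglongrightarrow> 0"
  and EKc: "\<And>n. E (\<psi> n) (\<psi> n) \<le> 2 * E g g + 2"
  using H_approx(2)[OF gH] by auto
 define r where "r n = 1 / real (Suc n)" for n
 have r: "r n > 0" for n by (simp add: r_def)
 \<comment> \<open>A smooth approximation of g need not be nonnegative. Applying \<open>aabs\<close>
   with parameters tending to 0 makes it so, keeps it smooth, does not raise its energy, and costs
   an L^2 error that vanishes since \<Omega> has finite measure.\<close>
 define \<eta> where "\<eta> n x = aabs (r n) (\<psi> n x)" for n x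
 have \<eta>: "\<eta> n \<in> Cc_smooth \<Omega>" "0 \<le> \<eta> n x" for n x
  unfolding \<eta>_def[abs_def] by (intro aabs_Cc_smooth \<psi> r aabs_nonneg)+
 have d: "dom (\<phi> n)" "dom (\<lambda>x. aabs e (\<phi> n x))" "dom (\<eta> n)" "dom (\<psi> n)" for n
  by (intro Cc_dom aabs_Cc_smooth \<phi> \<eta> \<psi> e)+
 have mz[measurable]: "z \<in> borel_measurable M1" "\<And>n. \<phi> n \<in> borel_measurable M1" "\<And>n. \<eta> n \<in> borel_measurable M1" "g \<in> borel_measurable M1"
  using dz dg d by (auto simp: dom_def wL2_def)
 have i: "integrable M1 (\<lambda>x. (\<phi> n x - z x)\<^sup>2)" "integrable M1 (\<lambda>x. (\<psi> n x - g x)\<^sup>2)" "integrable M1 (\<lambda>x. (\<eta> n x - g x)\<^sup>2)" for n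
  by (rule dom_sq_integrable[OF dom_diff(1)[OF d(1) dz]] dom_sq_integrable[OF dom_diff(1)[OF d(4) dg]] dom_sq_integrable[OF dom_diff(1)[OF d(3) dg]])+
 have leta: "(\<lambda>n. LINT x|M1. (\<eta> n x - g x)\<^sup>2) \<longlonglongrightarrow> 0"
 proof (rule tendsto_sandwich[OF _ _ tendsto_const])
  show "\<forall>\<^sub>F n in sequentially. (LINT x|M1. (\<eta> n x - g x)\<^sup>2) \<le> 2 * (r n)\<^sup>2 * measure M1 (space M1) + 2 * (LINT x|M1. (\<psi> n x - g x)\<^sup>2)"
  proof (intro always_eventually allI)
   fix n
   have "(LINT x|M1. (\<eta> n x - g x)\<^sup>2) \<le> (LINT x|M1. 2 * (r n)\<^sup>2 + 2 * (\<psi> n x - g x)\<^sup>2)"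
   proof (rule integral_mono[OF i(3)])
    show "integrable M1 (\<lambda>x. 2 * (r n)\<^sup>2 + 2 * (\<psi> n x - g x)\<^sup>2)" using i by auto
    fix x assume "x \<in> space M1"
    then have g0: "0 \<le> g x" using \<xi>(3) by (simp add: space_M)
    have "\<bar>\<eta> n x - g x\<bar> \<le> r n + \<bar>\<psi> n x - g x\<bar>"
     using aabs_bounds[OF r[of n], of "\<psi> n x"] g0 unfolding \<eta>_def by linarith
    then have "\<bar>\<eta> n x - g x\<bar>\<^sup>2 \<le> (r n + \<bar>\<psi> n x - g x\<bar>)\<^sup>2" by (intro power_mono) auto
    also have "... \<le> 2 * (r n)\<^sup>2 + 2 * \<bar>\<psi> n x - g x\<bar>\<^sup>2"
     using sum_squares_bound[of "r n" "\<bar>\<psi> n x - g x\<bar>"] unfolding power2_sum by linarith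
    finally show "(\<eta> n x - g x)\<^sup>2 \<le> 2 * (r n)\<^sup>2 + 2 * (\<psi> n x - g x)\<^sup>2" by simp
   qed
   also have "... = 2 * (r n)\<^sup>2 * measure M1 (space M1) + 2 * (LINT x|M1. (\<psi> n x - g x)\<^sup>2)"
    using i(2)[of n] by (simp add: mult.commute)
   finally show "(LINT x|M1. (\<eta> n x - g x)\<^sup>2) \<le> 2 * (r n)\<^sup>2 * measure M1 (space M1) + 2 * (LINT x|M1. (\<psi> n x - g x)\<^sup>2)" .
  qed
  have "r \<longlonglongrightarrow> 0" unfolding r_def[abs_def] by (rule LIMSEQ_Suc[OF lim_1_over_n])
  then have "(\<lambda>n. 2 * (r n)\<^sup>2 * measure M1 (space M1) + 2 * (LINT x|M1. (\<psi> n x - g x)\<^sup>2)) \<longlonglongrightarrow> 2 * 0\<^sup>2 * measure M1 (space M1) + 2 * 0"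
   by (intro tendsto_intros lc)
  then show "(\<lambda>n. 2 * (r n)\<^sup>2 * measure M1 (space M1) + 2 * (LINT x|M1. (\<psi> n x - g x)\<^sup>2)) \<longlonglongrightarrow> 0" by simp
 qed (auto intro!: always_eventually)
 have "(\<lambda>n. E (\<lambda>x. aabs e (z x)) (\<eta> n)) \<longlonglongrightarrow> E (\<lambda>x. aabs e (z x)) g"
 proof (rule energy_weak_tendsto[OF dom_aabs[OF dz e] d(3) _ dg leta])
  show "E (\<eta> n) (\<eta> n) \<le> 2 * E g g + 2" for n
   using energy_aabs_le[OF d(4)[of n] r[of n]] EKc[of n] unfolding \<eta>_def[abs_def] by (rule order_trans)
 qed
 moreover have "(\<lambda>n. LINT x|M1. (f x * asgn e (z x)) * \<eta> n x) \<longlonglongrightarrow> (LINT x|M1. (f x * asgn e (z x)) * g x)"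
 proof (rule L2_pairing_tendsto[OF _ dom_L2[OF d(3)] dom_L2[OF dg] leta])
  have [measurable]: "f \<in> borel_measurable M1" using f(1) by (simp add: L2_def)
  show "(\<lambda>x. f x * asgn e (z x)) \<in> L2 \<Omega>" unfolding L2_iff
  proof (rule WU.wL2_bound[OF f(1)[unfolded L2_iff], where C=1])
   show "\<bar>f x * asgn e (z x)\<bar> \<le> 1 * \<bar>f x\<bar>" for x
    unfolding abs_mult using mult_left_mono[OF asgn_abs_le[OF e, of "z x"], of "\<bar>f x\<bar>"] by simp
  qed measurable
 qed
 ultimately have "E (\<lambda>x. aabs e (z x)) g \<le> (LINT x|M1. (f x * asgn e (z x)) * g x)"
  by (rule LIMSEQ_le) (use kato_test_function[OF f \<eta> e] in \<open>auto simp: mult.assoc\<close>)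
 moreover have "E (\<lambda>x. aabs e (z x)) g = (LINT x|M1. \<xi> x * aabs e (z x))"
 \<comment> \<open>The defining equation of g is used only with the smooth functions
   \<open>aabs e (\<phi> n)\<close>; the same pairing has a second limit by weak
   convergence.\<close>
 proof (rule LIMSEQ_unique)
  have sq: "(\<lambda>n. LINT x|M1. (aabs e (\<phi> n x) - aabs e (z x))\<^sup>2) \<longlonglongrightarrow> 0"
   by (rule integral_sq_tendsto_Lipschitz[OF l i(1), where C=1]) (auto simp: aabs_Lipschitz e)
  have "(\<lambda>n. E g (\<lambda>x. aabs e (\<phi> n x))) \<longlonglongrightarrow> E g (\<lambda>x. aabs e (z x))"
  proof (rule energy_weak_tendsto[OF dg d(2) _ dom_aabs[OF dz e] sq])
   show "E (\<lambda>x. aabs e (\<phi> n x)) (\<lambda>x. aabs e (\<phi> n x)) \<le> 2 * E z z + 2" for n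
    using energy_aabs_le[OF d(1) e] EK by (rule order_trans)
  qed
  then show "(\<lambda>n. E g (\<lambda>x. aabs e (\<phi> n x))) \<longlonglongrightarrow> E (\<lambda>x. aabs e (z x)) g" by (simp add: energy_comm[of g])
  have "E g (\<lambda>x. aabs e (\<phi> n x)) = (LINT x|M1. \<xi> x * aabs e (\<phi> n x))" for n
   by (intro gE Cc_H aabs_Cc_smooth \<phi> e)
  then show "(\<lambda>n. E g (\<lambda>x. aabs e (\<phi> n x))) \<longlonglongrightarrow> (LINT x|M1. \<xi> x * aabs e (z x))"
   using L2_pairing_tendsto[OF \<xi>(1) dom_L2[OF d(2)] dom_L2[OF dom_aabs[OF dz e]] sq] by simp
 qed
 ultimately show ?thesis by (simp add: mult.assoc)
qed

end

section \<open>Potentials of measures\<close>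

text \<open>Abstracts the kernel G(x,y) / \<delta>(y)^\<gamma>. The two-sided bound
  \<open>kb\<close> on the column masses is the only quantitative information carried along, and all
  later constants are built from \<open>l\<close> and \<open>L\<close>.\<close>

locale kern =
 fixes \<Omega> :: "'a::euclidean_space set" and m :: "'a measure" and k :: "'a => 'a => real" and l L :: real
 assumes fin: "finite_measure m" and idm: "(\<lambda>x. x) \<in> m \<rightarrow>\<^sub>M borel" and sp: "space m = \<Omega>"
  and km: "(\<lambda>(x, y). k x y) \<in> borel_measurable (borel \<Otimes>\<^sub>M borel)" and k0: "\<And>x y. 0 \<le> k x y"
  and kb: "\<And>y. y \<in> \<Omega> ==> ennreal l \<le> (\<integral>\<^sup>+x. ennreal (k x y) \<partial>m) \<and> (\<integral>\<^sup>+x. ennreal (k x y) \<partial>m) \<le> ennreal L"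
  and lpos: "0 < l" and Lpos: "0 < L"
begin

text \<open>Measurability of the identity only asks that Borel sets be measurable. This admits both
  the measure \<open>m\<close>, whose sigma-algebra is Lebesgue, and Borel measures on
  \<Omega>.\<close>

definition adm :: "'a measure => bool" where
 "adm n \<longleftrightarrow> finite_measure n \<and> (\<lambda>x. x) \<in> n \<rightarrow>\<^sub>M borel \<and> space n = \<Omega>"

definition P :: "'a measure => ('a => real) => 'a => real" where
 "P n h x = (LINT y|n. k x y * h y)"

text \<open>The column mass of the kernel, that is, the potential of \<delta>^\<gamma> divided by
  \<delta>^\<gamma>.\<close>

definition b :: "'a => real" where "b y = enn2real (\<integral>\<^sup>+x. ennreal (k x y) \<partial>m)"

lemma adm_m: "adm m" using fin idm sp by (simp add: adm_def)

lemma k_measurable: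
 assumes "(\<lambda>x. x) \<in> m1 \<rightarrow>\<^sub>M borel" "(\<lambda>x. x) \<in> n1 \<rightarrow>\<^sub>M borel"
 shows "(\<lambda>(x, y). k x y) \<in> borel_measurable (m1 \<Otimes>\<^sub>M n1)"
proof -
 have "(\<lambda>z. (fst z, snd z)) \<in> m1 \<Otimes>\<^sub>M n1 \<rightarrow>\<^sub>M borel \<Otimes>\<^sub>M borel"
  using measurable_compose[OF measurable_fst assms(1), of n1] measurable_compose[OF measurable_snd assms(2), of m1]
  by (intro measurable_Pair) auto
 from measurable_compose[OF this km] show ?thesis by (simp add: case_prod_beta)
qed

lemma b_eq: "y \<in> \<Omega> ==> (\<integral>\<^sup>+x. ennreal (k x y) \<partial>m) = ennreal (b y)"
 unfolding b_def using le_less_trans[OF conjunct2[OF kb[of y]] ennreal_less_top] by simp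

lemma b_bounds: "y \<in> \<Omega> ==> l \<le> b y \<and> b y \<le> L"
proof -
 assume y: "y \<in> \<Omega>"
 have "0 \<le> b y" by (simp add: b_def)
 then show ?thesis using kb[OF y] Lpos unfolding b_eq[OF y] by (simp add: ennreal_le_iff)
qed

lemma adm_pair: "adm n ==> pair_sigma_finite m n"
 using fin unfolding adm_def pair_sigma_finite_def
 by (auto intro: finite_measure.axioms)

lemma b_measurable:
 assumes "adm n" shows "b \<in> borel_measurable n"
proof -
 interpret pair_sigma_finite m n by (rule adm_pair[OF assms])
 have "(\<lambda>(y, x). k x y) \<in> borel_measurable (n \<Otimes>\<^sub>M m)"
  using measurable_compose[OF measurable_pair_swap' k_measurable[of m n]] assms idm
  by (simp add: case_prod_beta adm_def)
 then have "(\<lambda>y. \<integral>\<^sup>+x. ennreal (k x y) \<partial>m) \<in> borel_measurable n" by measurable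
 then show ?thesis unfolding b_def[abs_def] by measurable
qed

text \<open>By Tonelli the double integral of the kernel against |h| equals the integral of |h| b,
  which is finite because b is at most L. The other claims are consequences of Fubini.\<close>

lemma P_basic:
 assumes n: "adm n" and h: "integrable n h"
 shows P_pair: "integrable (m \<Otimes>\<^sub>M n) (\<lambda>(x, y). k x y * h y)"
  and P_int: "integrable m (P n h)"
  and P_AE: "AE x in m. integrable n (\<lambda>y. k x y * h y)"
  and P_abs: "(LINT x|m. \<bar>P n h x\<bar>) \<le> (LINT y|n. \<bar>h y\<bar> * b y)"
  and P_abs': "(LINT x|m. \<bar>P n h x\<bar>) \<le> L * (LINT y|n. \<bar>h y\<bar>)"
  and hb_int: "integrable n (\<lambda>y. h y * b y)"
  and P_b: "(LINT x|m. P n h x) = (LINT y|n. h y * b y)"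
proof -
 interpret pair_sigma_finite m n by (rule adm_pair[OF n])
 have ns: "space n = \<Omega>" using n by (simp add: adm_def)
 have km'[measurable]: "(\<lambda>(x, y). k x y) \<in> borel_measurable (m \<Otimes>\<^sub>M n)"
  using k_measurable[of m n] n idm by (simp add: adm_def)
 have hm[measurable]: "h \<in> borel_measurable n" using h by auto
 note [measurable] = b_measurable[OF n]
 show hb: "integrable n (\<lambda>y. h y * b y)"
 proof (rule int_bound[OF integrable_mult_right[OF h, of L]])
  show "AE y in n. norm (h y * b y) \<le> norm (L * h y)"
  proof (rule AE_I2)
   fix y assume "y \<in> space n"
   then show "norm (h y * b y) \<le> norm (L * h y)"
    using b_bounds[of y] ns lpos Lpos by (auto simp: abs_mult mult.commute[of L] intro!: mult_left_mono)
  qed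
 qed measurable
 have nn: "(\<integral>\<^sup>+z. ennreal (norm (case z of (x, y) => k x y * h y)) \<partial>(m \<Otimes>\<^sub>M n)) = ennreal (LINT y|n. \<bar>h y\<bar> * b y)"
 proof -
  have "(\<integral>\<^sup>+z. ennreal (norm (case z of (x, y) => k x y * h y)) \<partial>(m \<Otimes>\<^sub>M n))
   = (\<integral>\<^sup>+z. (case z of (x, y) => ennreal (k x y) * ennreal \<bar>h y\<bar>) \<partial>(m \<Otimes>\<^sub>M n))"
   by (intro nn_integral_cong) (simp add: case_prod_beta abs_mult k0 ennreal_mult)
  also have "... = (\<integral>\<^sup>+y. (\<integral>\<^sup>+x. ennreal (k x y) * ennreal \<bar>h y\<bar> \<partial>m) \<partial>n)"
   by (subst nn_integral_snd[symmetric]) auto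
  also have "... = (\<integral>\<^sup>+y. ennreal (\<bar>h y\<bar> * b y) \<partial>n)"
  proof (rule nn_integral_cong)
   fix y assume y: "y \<in> space n"
   have "(\<lambda>x. k x y) \<in> borel_measurable m" using measurable_Pair1[OF km' y] by simp
   then have "(\<integral>\<^sup>+x. ennreal (k x y) * ennreal \<bar>h y\<bar> \<partial>m) = (\<integral>\<^sup>+x. ennreal (k x y) \<partial>m) * ennreal \<bar>h y\<bar>"
    by (intro nn_integral_multc) auto
   then show "(\<integral>\<^sup>+x. ennreal (k x y) * ennreal \<bar>h y\<bar> \<partial>m) = ennreal (\<bar>h y\<bar> * b y)"
    using b_eq[of y] b_bounds[of y] y ns lpos by (simp add: ennreal_mult mult.commute[of "ennreal (b y)"])
  qed
  also have "... = ennreal (LINT y|n. \<bar>h y\<bar> * b y)"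
  proof (rule nn_integral_eq_integral)
   show "integrable n (\<lambda>y. \<bar>h y\<bar> * b y)"
    by (rule int_bound[OF hb]) (auto simp: abs_mult)
   show "AE y in n. 0 \<le> \<bar>h y\<bar> * b y" using b_bounds ns lpos by (intro AE_I2 mult_nonneg_nonneg) force+
  qed
  finally show ?thesis .
 qed
 show i: "integrable (m \<Otimes>\<^sub>M n) (\<lambda>(x, y). k x y * h y)"
  by (rule integrableI_bounded) (use nn in auto)
 show "integrable m (P n h)" using integrable_fst'[OF i] unfolding P_def[abs_def] by simp
 show "AE x in m. integrable n (\<lambda>y. k x y * h y)" using AE_integrable_fst'[OF i] by simp
 have "ennreal (LINT x|m. \<bar>P n h x\<bar>) = (\<integral>\<^sup>+x. ennreal \<bar>P n h x\<bar> \<partial>m)"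
  using \<open>integrable m (P n h)\<close> by (intro nn_integral_eq_integral[symmetric]) auto
 also have "... \<le> (\<integral>\<^sup>+x. (\<integral>\<^sup>+y. ennreal (norm (k x y * h y)) \<partial>n) \<partial>m)"
 proof (intro nn_integral_mono)
  fix x
  show "ennreal \<bar>P n h x\<bar> \<le> (\<integral>\<^sup>+y. ennreal (norm (k x y * h y)) \<partial>n)"
  \<comment> \<open>Where the section is not integrable, \<open>P\<close> takes the default value 0
    and the bound is trivial.\<close>
  proof (cases "integrable n (\<lambda>y. k x y * h y)")
   case True
   from integral_norm_bound_ennreal[OF this] show ?thesis by (simp add: P_def)
  qed (simp add: P_def not_integrable_integral_eq)
 qed
 also have "... = (\<integral>\<^sup>+z. ennreal (norm (case z of (x, y) => k x y * h y)) \<partial>(m \<Otimes>\<^sub>M n))"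
  by (subst M2.nn_integral_fst[symmetric]) (auto simp: case_prod_beta)
 finally have "ennreal (LINT x|m. \<bar>P n h x\<bar>) \<le> ennreal (LINT y|n. \<bar>h y\<bar> * b y)" unfolding nn .
 moreover have "0 \<le> (LINT y|n. \<bar>h y\<bar> * b y)" using b_bounds ns lpos by (intro integral_nonneg_AE AE_I2 mult_nonneg_nonneg) force+
 ultimately show A: "(LINT x|m. \<bar>P n h x\<bar>) \<le> (LINT y|n. \<bar>h y\<bar> * b y)" by (simp add: ennreal_le_iff)
 also have "... \<le> (LINT y|n. L * \<bar>h y\<bar>)"
 proof (rule integral_mono)
  show "integrable n (\<lambda>y. \<bar>h y\<bar> * b y)"
   by (rule int_bound[OF hb]) (auto simp: abs_mult)
  show "\<bar>h y\<bar> * b y \<le> L * \<bar>h y\<bar>" if "y \<in> space n" for y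
   using b_bounds[of y] that ns by (auto simp: mult.commute[of L] intro!: mult_left_mono)
 qed (use h in auto)
 finally show "(LINT x|m. \<bar>P n h x\<bar>) \<le> L * (LINT y|n. \<bar>h y\<bar>)" by simp
 have "(LINT x|m. P n h x) = (LINT y|n. (LINT x|m. k x y * h y))"
  unfolding P_def by (rule Fubini_integral[OF i, symmetric])
 also have "... = (LINT y|n. h y * b y)"
 proof (rule LINT_cong[OF refl])
  fix y assume y: "y \<in> space n"
  have "(LINT x|m. k x y) = b y" unfolding b_def
   using measurable_Pair1[OF km' y] by (intro integral_eq_nn_integral) (auto simp: k0)
  then show "(LINT x|m. k x y * h y) = h y * b y" by (simp add: mult.commute)
 qed
 finally show "(LINT x|m. P n h x) = (LINT y|n. h y * b y)" .
qed

lemma mult_b_le: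
 assumes n: "adm n" and g: "integrable n g" and g0: "\<And>x. x \<in> \<Omega> ==> 0 \<le> g x"
 shows "(LINT x|n. g x * b x) \<le> L * (LINT x|n. g x)"
proof -
 have ns: "space n = \<Omega>" using n by (simp add: adm_def)
 have p: "g x * b x \<le> L * g x" if "x \<in> space n" for x
 proof -
  have x: "x \<in> \<Omega>" using that ns by simp
  have "b x * g x \<le> L * g x" using b_bounds[OF x] g0[OF x] by (intro mult_right_mono) auto
  then show ?thesis by (simp add: mult.commute)
 qed
 have "(LINT x|n. g x * b x) \<le> (LINT x|n. L * g x)"
  by (rule integral_mono[OF hb_int[OF n g] integrable_mult_right[OF g] p])
 then show ?thesis by simp
qed

text \<open>The adjoint relation for bounded \<xi>, which is the class of test functions in the
  weak-dual formulation after division by \<delta>^\<gamma>.\<close>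

lemma P_pairing:
 assumes n: "adm n" and h: "integrable n h" and \<xi>: "\<xi> \<in> borel_measurable m" "AE x in m. \<bar>\<xi> x\<bar> \<le> C"
 shows "(LINT x|m. \<xi> x * P n h x) = (LINT y|n. h y * (LINT x|m. k x y * \<xi> x))"
proof -
 interpret pair_sigma_finite m n by (rule adm_pair[OF n])
 interpret fin: finite_measure m by (rule fin)
 have [measurable]: "h \<in> borel_measurable n" "\<xi> \<in> borel_measurable m" using h \<xi>(1) by auto
 have km'[measurable]: "(\<lambda>(x, y). k x y) \<in> borel_measurable (m \<Otimes>\<^sub>M n)"
  using k_measurable[of m n] n idm by (simp add: adm_def)
 have i: "integrable (m \<Otimes>\<^sub>M n) (\<lambda>(x, y). \<xi> x * (k x y * h y))"
 proof (rule int_bound[OF integrable_mult_right[OF P_pair[OF n h], of C]])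
  have "AE z in m \<Otimes>\<^sub>M n. \<bar>\<xi> (fst z)\<bar> \<le> C"
  proof (rule AE_pair_measure)
   show "{z \<in> space (m \<Otimes>\<^sub>M n). \<bar>\<xi> (fst z)\<bar> \<le> C} \<in> sets (m \<Otimes>\<^sub>M n)" by measurable
   show "AE x in m. AE y in n. \<bar>\<xi> (fst (x, y))\<bar> \<le> C" using \<xi>(2) by eventually_elim simp
  qed
  then show "AE z in m \<Otimes>\<^sub>M n. norm (case z of (x, y) => \<xi> x * (k x y * h y)) \<le> norm (C * (case z of (x, y) => k x y * h y))"
   by eventually_elim (auto simp: case_prod_beta abs_mult intro!: mult_right_mono)
 qed measurable
 have "(LINT x|m. \<xi> x * P n h x) = (LINT x|m. (LINT y|n. \<xi> x * (k x y * h y)))" unfolding P_def by simp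
 also have "... = (LINT y|n. (LINT x|m. \<xi> x * (k x y * h y)))" by (rule Fubini_integral[OF i, symmetric])
 also have "... = (LINT y|n. h y * (LINT x|m. k x y * \<xi> x))"
 proof (rule LINT_cong[OF refl])
  fix y
  have "(LINT x|m. \<xi> x * (k x y * h y)) = (LINT x|m. h y * (k x y * \<xi> x))" by (simp add: mult_ac)
  then show "(LINT x|m. \<xi> x * (k x y * h y)) = h y * (LINT x|m. k x y * \<xi> x)" by simp
 qed
 finally show ?thesis .
qed

lemma P_diff:
 assumes n: "adm n" and h: "integrable n h" "integrable n g"
 shows "AE x in m. P n (\<lambda>y. h y - g y) x = P n h x - P n g x"
 using P_AE[OF n h(1)] P_AE[OF n h(2)]
 by eventually_elim (simp add: P_def right_diff_distrib)

lemma P_L1_tendsto: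
 assumes "adm n" "\<And>j. integrable n (f j)" "integrable n f'" "(\<lambda>j. LINT x|n. \<bar>f j x - f' x\<bar>) \<longlonglongrightarrow> 0"
 shows "(\<lambda>j. LINT x|m. \<bar>P n (f j) x - P n f' x\<bar>) \<longlonglongrightarrow> 0"
proof (rule tendsto_sandwich[OF _ _ tendsto_const tendsto_mult_right_zero[OF assms(4), of L]])
 have "(LINT x|m. \<bar>P n (f j) x - P n f' x\<bar>) \<le> L * (LINT x|n. \<bar>f j x - f' x\<bar>)" for j
 proof -
  have "(LINT x|m. \<bar>P n (f j) x - P n f' x\<bar>) = (LINT x|m. \<bar>P n (\<lambda>x. f j x - f' x) x\<bar>)"
   using P_diff[OF assms(1) assms(2)[of j] assms(3)] P_int[OF assms(1) assms(2)[of j]] P_int[OF assms(1) assms(3)]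
     P_int[OF assms(1) int_diff[OF assms(2)[of j] assms(3)]]
   by (intro integral_cong_AE) auto
  also have "... \<le> L * (LINT x|n. \<bar>f j x - f' x\<bar>)" by (intro P_abs' assms int_diff)
  finally show ?thesis .
 qed
 then show "\<forall>\<^sub>F j in sequentially. (LINT x|m. \<bar>P n (f j) x - P n f' x\<bar>) \<le> L * (LINT x|n. \<bar>f j x - f' x\<bar>)" by simp
qed (auto intro: always_eventually)

lemma b_nonneg: "y \<in> \<Omega> ==> 0 \<le> b y" using b_bounds[of y] lpos by linarith

end

lemma continuous_asgn: "e > 0 ==> continuous_on UNIV (asgn e)"
 by (rule lipschitz_on_continuous_on[of "1 / e"], rule lipschitz_onI)
  (use asgn_Lipschitz in \<open>auto simp: dist_real_def\<close>)

lemma aabs_abs_le: "e > 0 ==> \<bar>aabs e t\<bar> \<le> \<bar>t\<bar>"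
 using aabs_bounds(2)[of e t] aabs_nonneg[of e t] by simp

text \<open>Kato's inequality is postulated for bounded densities only, because the energy argument
  works in L^2. \<open>smoothing\<close> carries it over to measures; its factor 2 allows for the
  variation of the weight over a mollifying ball.\<close>

locale kern_kato = kern +
 assumes katob: "\<And>f C e. f \<in> borel_measurable m ==> (\<And>x. x \<in> \<Omega> ==> \<bar>f x\<bar> \<le> C) ==> e > 0 ==>
   (LINT x|m. aabs e (P m f x)) \<le> (LINT x|m. asgn e (P m f x) * (f x * b x))"
  and smoothing: "\<And>n h. adm n ==> integrable n h ==> (\<And>y. y \<in> \<Omega> ==> 0 \<le> h y) ==>
   \<exists>f. (\<forall>j. integrable m (f j) \<and> (\<forall>x\<in>\<Omega>. 0 \<le> f j x) \<and> (LINT x|m. f j x) \<le> 2 * (LINT y|n. h y)) \<and>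
    (\<lambda>j. LINT x|m. \<bar>P m (f j) x - P n h x\<bar>) \<longlonglongrightarrow> 0"
begin

lemma aabs_integrable: "integrable m z ==> e > 0 ==> integrable m (\<lambda>x. aabs e (z x))"
 by (rule int_bound[of m z]) (auto simp: aabs_abs_le)

lemma asgn_mult_integrable: "integrable m f ==> z \<in> borel_measurable m ==> e > 0 ==> integrable m (\<lambda>x. asgn e (z x) * f x)"
 by (rule int_bound[of m f])
  (auto simp: abs_mult intro!: mult_left_le_one_le asgn_abs_le)

lemma aabs_tendsto_L1:
 assumes "\<And>j. integrable m (z j)" "integrable m z'" "(\<lambda>j. LINT x|m. \<bar>z j x - z' x\<bar>) \<longlonglongrightarrow> 0" "e > 0"
 shows "(\<lambda>j. LINT x|m. aabs e (z j x)) \<longlonglongrightarrow> (LINT x|m. aabs e (z' x))"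
proof (rule LIM_zero_cancel, rule Lim_null_comparison[OF _ assms(3)], intro always_eventually allI)
 fix j
 have "norm ((LINT x|m. aabs e (z j x)) - (LINT x|m. aabs e (z' x))) = \<bar>\<integral>x. aabs e (z j x) - aabs e (z' x) \<partial>m\<bar>"
  using aabs_integrable assms by simp
 also have "... \<le> (LINT x|m. \<bar>aabs e (z j x) - aabs e (z' x)\<bar>)" by (rule integral_abs_bound)
 also have "... \<le> (LINT x|m. \<bar>z j x - z' x\<bar>)"
  by (intro integral_mono integrable_abs int_diff aabs_integrable aabs_Lipschitz assms)
 finally show "norm ((LINT x|m. aabs e (z j x)) - (LINT x|m. aabs e (z' x))) \<le> (LINT x|m. \<bar>z j x - z' x\<bar>)" .
qed

lemma integral_tendsto_L1:
 fixes z :: "nat => 'a => real"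
 assumes "\<And>j. integrable m (z j)" "integrable m z'" "(\<lambda>j. LINT x|m. \<bar>z j x - z' x\<bar>) \<longlonglongrightarrow> 0"
 shows "(\<lambda>j. LINT x|m. z j x) \<longlonglongrightarrow> (LINT x|m. z' x)"
proof (rule LIM_zero_cancel, rule Lim_null_comparison[OF _ assms(3)], intro always_eventually allI)
 fix j
 have "norm ((LINT x|m. z j x) - (LINT x|m. z' x)) = \<bar>\<integral>x. z j x - z' x \<partial>m\<bar>" using assms by simp
 also have "... \<le> (LINT x|m. \<bar>z j x - z' x\<bar>)" by (rule integral_abs_bound)
 finally show "norm ((LINT x|m. z j x) - (LINT x|m. z' x)) \<le> (LINT x|m. \<bar>z j x - z' x\<bar>)" .
qed

lemma asgn_tendsto_AE:
 assumes f: "integrable m f" and z: "\<And>j. z j \<in> borel_measurable m" "z' \<in> borel_measurable m" "AE x in m. (\<lambda>j. z j x) \<longlonglongrightarrow> z' x" and e: "e > 0"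
 shows "(\<lambda>j. LINT x|m. asgn e (z j x) * f x) \<longlonglongrightarrow> (LINT x|m. asgn e (z' x) * f x)"
proof (rule integral_dominated_convergence[where w="\<lambda>x. \<bar>f x\<bar>"])
 have [measurable]: "f \<in> borel_measurable m" using f by auto
 note [measurable] = z(1) z(2)
 show "(\<lambda>x. asgn e (z' x) * f x) \<in> borel_measurable m" "(\<lambda>x. asgn e (z j x) * f x) \<in> borel_measurable m" for j by measurable
 show "integrable m (\<lambda>x. \<bar>f x\<bar>)" using f by auto
 show "AE x in m. (\<lambda>j. asgn e (z j x) * f x) \<longlonglongrightarrow> asgn e (z' x) * f x"
  using z(3) by eventually_elim (intro tendsto_intros continuous_on_tendsto_compose[OF continuous_asgn[OF e]], auto)
 show "AE x in m. norm (asgn e (z j x) * f x) \<le> \<bar>f x\<bar>" for j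
  by (intro AE_I2) (auto simp: abs_mult intro!: mult_left_le_one_le asgn_abs_le e)
qed

lemma m_hb: "integrable m f ==> integrable m (\<lambda>x. f x * b x)" by (rule hb_int[OF adm_m])

lemma kato_e:
 assumes f: "integrable m f" and e: "e > 0"
 shows "(LINT x|m. aabs e (P m f x)) \<le> (LINT x|m. asgn e (P m f x) * (f x * b x))"
proof -
 have [measurable]: "f \<in> borel_measurable m" using f by auto
 define g where "g j x = (if \<bar>f x\<bar> \<le> real j then f x else 0)" for j x
 have gm[measurable]: "g j \<in> borel_measurable m" for j unfolding g_def[abs_def] by measurable
 have gi: "integrable m (g j)" for j by (rule int_bound[OF f]) (auto simp: g_def)
 have "(\<lambda>j. LINT x|m. \<bar>g j x - f x\<bar>) \<longlonglongrightarrow> (LINT x|m. 0)"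
 proof (rule integral_dominated_convergence[where w="\<lambda>x. \<bar>f x\<bar>"])
  show "AE x in m. (\<lambda>j. \<bar>g j x - f x\<bar>) \<longlonglongrightarrow> 0"
  proof (rule AE_I2)
   fix x
   obtain N :: nat where "\<bar>f x\<bar> \<le> N" using real_arch_simple by blast
   then show "(\<lambda>j. \<bar>g j x - f x\<bar>) \<longlonglongrightarrow> 0"
    by (intro tendsto_eventually) (auto simp: g_def eventually_sequentially intro!: exI[of _ N])
  qed
 qed (use f in \<open>auto simp: g_def\<close>)
 then have gl: "(\<lambda>j. LINT x|m. \<bar>g j x - f x\<bar>) \<longlonglongrightarrow> 0" by simp
 note zl = P_L1_tendsto[OF adm_m gi f gl]
 note zi = P_int[OF adm_m gi] P_int[OF adm_m f]
 obtain r where r: "strict_mono r" and ae: "AE x in m. (\<lambda>i. P m (g (r i)) x) \<longlonglongrightarrow> P m f x"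
  by (rule tendsto_L1_AE_subseq'[OF zi zl])
 have zl': "(\<lambda>j. LINT x|m. \<bar>P m (g (r j)) x - P m f x\<bar>) \<longlonglongrightarrow> 0"
  using LIMSEQ_subseq_LIMSEQ[OF zl r] by (simp add: o_def)
 have gl': "(\<lambda>j. LINT x|m. \<bar>g (r j) x - f x\<bar>) \<longlonglongrightarrow> 0"
  using LIMSEQ_subseq_LIMSEQ[OF gl r] by (simp add: o_def)
 have A: "(\<lambda>j. LINT x|m. aabs e (P m (g (r j)) x)) \<longlonglongrightarrow> (LINT x|m. aabs e (P m f x))"
  by (rule aabs_tendsto_L1[OF zi zl' e])
 have B: "(\<lambda>j. LINT x|m. asgn e (P m (g (r j)) x) * (f x * b x)) \<longlonglongrightarrow> (LINT x|m. asgn e (P m f x) * (f x * b x))"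
  by (rule asgn_tendsto_AE[OF m_hb[OF f] _ _ ae e]) (use zi in auto)
 have C: "(\<lambda>j. (LINT x|m. asgn e (P m (g (r j)) x) * (f x * b x)) + L * (LINT x|m. \<bar>g (r j) x - f x\<bar>)) \<longlonglongrightarrow> (LINT x|m. asgn e (P m f x) * (f x * b x)) + L * 0"
  by (intro tendsto_intros B gl')
 \<comment> \<open>The sign of the truncated potential is kept and only the density is replaced by
   \<open>f\<close>, at the cost of L |g j - f|. The sign then converges almost everywhere along a
   subsequence, under the majorant |f b|.\<close>
 have "(LINT x|m. aabs e (P m (g j) x)) \<le> (LINT x|m. asgn e (P m (g j) x) * (f x * b x)) + L * (LINT x|m. \<bar>g j x - f x\<bar>)" for j
 proof -
  have [measurable]: "P m (g j) \<in> borel_measurable m" using zi by auto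
  have i1: "integrable m (\<lambda>x. asgn e (P m (g j) x) * (f x * b x))" "integrable m (\<lambda>x. asgn e (P m (g j) x) * (g j x * b x))"
   by (intro asgn_mult_integrable m_hb f gi e; measurable)+
  have i2: "integrable m (\<lambda>x. \<bar>g j x - f x\<bar>)" using gi f by auto
  have "(LINT x|m. aabs e (P m (g j) x)) \<le> (LINT x|m. asgn e (P m (g j) x) * (g j x * b x))"
   by (rule katob[where C="real j"]) (auto simp: g_def[of j] e gm)
  also have "... \<le> (LINT x|m. asgn e (P m (g j) x) * (f x * b x) + L * \<bar>g j x - f x\<bar>)"
  proof (rule integral_mono[OF i1(2)])
   fix x assume "x \<in> space m"
   then have x: "x \<in> \<Omega>" by (simp add: sp)
   have "asgn e (P m (g j) x) * ((g j x - f x) * b x) \<le> \<bar>asgn e (P m (g j) x)\<bar> * (\<bar>g j x - f x\<bar> * \<bar>b x\<bar>)"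
    unfolding abs_mult[symmetric] by (rule abs_ge_self)
   also have "... \<le> 1 * (\<bar>g j x - f x\<bar> * L)"
    using b_bounds[OF x] lpos by (intro mult_mono asgn_abs_le e) auto
   finally show "asgn e (P m (g j) x) * (g j x * b x) \<le> asgn e (P m (g j) x) * (f x * b x) + L * \<bar>g j x - f x\<bar>"
    by (simp add: algebra_simps)
  qed (use i1 i2 in auto)
  also have "... = (LINT x|m. asgn e (P m (g j) x) * (f x * b x)) + L * (LINT x|m. \<bar>g j x - f x\<bar>)"
   using i1 i2 by simp
  finally show ?thesis .
 qed
 then show ?thesis by (intro LIMSEQ_le[OF A C, simplified]) auto
qed

text \<open>For \<open>a = 0\<close> this bounds \<open>|z|\<close>, for \<open>a = 1\<close> and \<open>a = -1\<close> twice the positive and negative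
 part of \<open>z\<close>; a measure on the side that is not being bounded costs nothing.\<close>

lemma kato_measure_e:
 assumes f: "integrable m f" and n1: "adm n1" "integrable n1 h1" "\<And>y. y \<in> \<Omega> ==> 0 \<le> h1 y"
  and n2: "adm n2" "integrable n2 h2" "\<And>y. y \<in> \<Omega> ==> 0 \<le> h2 y"
  and z: "z \<in> borel_measurable m" "AE x in m. z x = P m f x + P n1 h1 x - P n2 h2 x" and a: "\<bar>a\<bar> \<le> 1" and e: "e > 0"
 shows "(LINT x|m. aabs e (z x)) + a * (LINT x|m. z x) \<le> (LINT x|m. asgn e (z x) * (f x * b x)) + a * (LINT x|m. f x * b x)
   + (1 + a) * (2 * L * (LINT y|n1. h1 y)) + (1 - a) * (2 * L * (LINT y|n2. h2 y))"
proof -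
 have "\<exists>f. (\<forall>j. integrable m (f j) \<and> (\<forall>x\<in>\<Omega>. 0 \<le> f j x) \<and> (LINT x|m. f j x) \<le> 2 * (LINT y|n1. h1 y)) \<and>
    (\<lambda>j. LINT x|m. \<bar>P m (f j) x - P n1 h1 x\<bar>) \<longlonglongrightarrow> 0"
  by (rule smoothing[OF n1(1,2)]) (rule n1(3))
 then obtain g1 where g1':
  "\<forall>j. integrable m (g1 j) \<and> (\<forall>x\<in>\<Omega>. 0 \<le> g1 j x) \<and> (LINT x|m. g1 j x) \<le> 2 * (LINT y|n1. h1 y)"
  "(\<lambda>j. LINT x|m. \<bar>P m (g1 j) x - P n1 h1 x\<bar>) \<longlonglongrightarrow> 0" by (elim exE conjE)
 then have g1: "\<And>j. integrable m (g1 j)" "\<And>j x. x \<in> \<Omega> ==> 0 \<le> g1 j x" "\<And>j. (LINT x|m. g1 j x) \<le> 2 * (LINT y|n1. h1 y)"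
  and g1l: "(\<lambda>j. LINT x|m. \<bar>P m (g1 j) x - P n1 h1 x\<bar>) \<longlonglongrightarrow> 0" by auto
 have "\<exists>f. (\<forall>j. integrable m (f j) \<and> (\<forall>x\<in>\<Omega>. 0 \<le> f j x) \<and> (LINT x|m. f j x) \<le> 2 * (LINT y|n2. h2 y)) \<and>
    (\<lambda>j. LINT x|m. \<bar>P m (f j) x - P n2 h2 x\<bar>) \<longlonglongrightarrow> 0"
  by (rule smoothing[OF n2(1,2)]) (rule n2(3))
 then obtain g2 where g2':
  "\<forall>j. integrable m (g2 j) \<and> (\<forall>x\<in>\<Omega>. 0 \<le> g2 j x) \<and> (LINT x|m. g2 j x) \<le> 2 * (LINT y|n2. h2 y)"
  "(\<lambda>j. LINT x|m. \<bar>P m (g2 j) x - P n2 h2 x\<bar>) \<longlonglongrightarrow> 0" by (elim exE conjE)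
 then have g2: "\<And>j. integrable m (g2 j)" "\<And>j x. x \<in> \<Omega> ==> 0 \<le> g2 j x" "\<And>j. (LINT x|m. g2 j x) \<le> 2 * (LINT y|n2. h2 y)"
  and g2l: "(\<lambda>j. LINT x|m. \<bar>P m (g2 j) x - P n2 h2 x\<bar>) \<longlonglongrightarrow> 0" by auto
 \<comment> \<open>The measures are replaced by their mollifications, so that the inequality for
   densities applies to the whole right-hand side.\<close>
 define F where "F j x = f x - (g2 j x - g1 j x)" for j x
 have Fi: "integrable m (F j)" for j unfolding F_def[abs_def] by (intro int_diff f g1 g2)
 have PF: "AE x in m. P m (F j) x = P m f x - (P m (g2 j) x - P m (g1 j) x)" for j
  using P_diff[OF adm_m f int_diff[OF g2(1)[of j] g1(1)[of j]]] P_diff[OF adm_m g2(1)[of j] g1(1)[of j]]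
  unfolding F_def[abs_def] by eventually_elim simp
 note zi = P_int[OF adm_m Fi] P_int[OF adm_m f] P_int[OF n1(1,2)] P_int[OF n2(1,2)] P_int[OF adm_m g1(1)] P_int[OF adm_m g2(1)]
 have z'i: "integrable m z"
 proof (rule integrable_cong_AE_imp)
  show "integrable m (\<lambda>x. P m f x + P n1 h1 x - P n2 h2 x)" using zi by auto
 qed (use z(1) z(2) in \<open>auto elim!: eventually_mono\<close>)
 have zl: "(\<lambda>j. LINT x|m. \<bar>P m (F j) x - z x\<bar>) \<longlonglongrightarrow> 0"
 proof (rule tendsto_sandwich[OF _ _ tendsto_const])
  show "(\<lambda>j. (LINT x|m. \<bar>P m (g1 j) x - P n1 h1 x\<bar>) + (LINT x|m. \<bar>P m (g2 j) x - P n2 h2 x\<bar>)) \<longlonglongrightarrow> 0"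
   using tendsto_add[OF g1l g2l] by simp
  have "(LINT x|m. \<bar>P m (F j) x - z x\<bar>) \<le> (LINT x|m. \<bar>P m (g1 j) x - P n1 h1 x\<bar>) + (LINT x|m. \<bar>P m (g2 j) x - P n2 h2 x\<bar>)" for j
  proof -
   have "(LINT x|m. \<bar>P m (F j) x - z x\<bar>) \<le> (LINT x|m. \<bar>P m (g1 j) x - P n1 h1 x\<bar> + \<bar>P m (g2 j) x - P n2 h2 x\<bar>)"
   proof (rule integral_mono_AE)
    show "AE x in m. \<bar>P m (F j) x - z x\<bar> \<le> \<bar>P m (g1 j) x - P n1 h1 x\<bar> + \<bar>P m (g2 j) x - P n2 h2 x\<bar>"
     using PF[of j] z(2) by eventually_elim simp
   qed (use zi z'i in auto)
   then show ?thesis using zi by simp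
  qed
  then show "\<forall>\<^sub>F j in sequentially. (LINT x|m. \<bar>P m (F j) x - z x\<bar>) \<le> (LINT x|m. \<bar>P m (g1 j) x - P n1 h1 x\<bar>) + (LINT x|m. \<bar>P m (g2 j) x - P n2 h2 x\<bar>)" by simp
 qed (auto intro: always_eventually)
 obtain r where r: "strict_mono r" and ae: "AE x in m. (\<lambda>i. P m (F (r i)) x) \<longlonglongrightarrow> z x"
  by (rule tendsto_L1_AE_subseq'[OF zi(1) z'i zl])
 have zl': "(\<lambda>j. LINT x|m. \<bar>P m (F (r j)) x - z x\<bar>) \<longlonglongrightarrow> 0"
  using LIMSEQ_subseq_LIMSEQ[OF zl r] by (simp add: o_def)
 have A: "(\<lambda>j. (LINT x|m. aabs e (P m (F (r j)) x)) + a * (LINT x|m. P m (F (r j)) x)) \<longlonglongrightarrow> (LINT x|m. aabs e (z x)) + a * (LINT x|m. z x)"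
  by (intro tendsto_intros aabs_tendsto_L1[OF zi(1) z'i zl' e] integral_tendsto_L1[OF zi(1) z'i zl'])
 let ?S = "a * (LINT x|m. f x * b x) + ((1 + a) * (2 * L * (LINT y|n1. h1 y)) + (1 - a) * (2 * L * (LINT y|n2. h2 y)))"
 have B: "(\<lambda>j. (LINT x|m. asgn e (P m (F (r j)) x) * (f x * b x)) + ?S) \<longlonglongrightarrow> (LINT x|m. asgn e (z x) * (f x * b x)) + ?S"
  by (intro tendsto_intros asgn_tendsto_AE[OF m_hb[OF f] _ _ ae e]) (use zi z in auto)
 have "(LINT x|m. aabs e (P m (F j) x)) + a * (LINT x|m. P m (F j) x) \<le> (LINT x|m. asgn e (P m (F j) x) * (f x * b x)) + ?S" for j
 proof -
  have [measurable]: "P m (F j) \<in> borel_measurable m" using zi by auto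
  have ii: "integrable m (\<lambda>x. asgn e (P m (F j) x) * (u x * b x))" "integrable m (\<lambda>x. u x * b x)" if "integrable m u" for u
   by (intro asgn_mult_integrable m_hb that e; measurable)+
  have "(LINT x|m. aabs e (P m (F j) x)) + a * (LINT x|m. P m (F j) x) \<le> (LINT x|m. asgn e (P m (F j) x) * (F j x * b x)) + a * (LINT x|m. F j x * b x)"
   using kato_e[OF Fi[of j] e] P_b[OF adm_m Fi[of j]] by simp
  also have "... = (LINT x|m. asgn e (P m (F j) x) * (F j x * b x) + a * (F j x * b x))"
   using ii[OF Fi[of j]] by simp
  also have "... \<le> (LINT x|m. asgn e (P m (F j) x) * (f x * b x) + a * (f x * b x) + (1 + a) * (g1 j x * b x) + (1 - a) * (g2 j x * b x))"
  proof (rule integral_mono)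
   fix x assume "x \<in> space m"
   then have x: "x \<in> \<Omega>" by (simp add: sp)
   let ?s = "asgn e (P m (F j) x)"
   have s: "\<bar>?s\<bar> \<le> 1" by (rule asgn_abs_le[OF e])
   \<comment> \<open>Since the regularised sign lies in [-1, 1], the density g1 receives a factor at
     most 1 + a and g2 a factor at most 1 - a. This is where the one-sided cases a = 1 and a = -1
     become free of one measure.\<close>
   have "(?s + a) * (g1 j x * b x) \<le> (1 + a) * (g1 j x * b x)"
    using s g1(2)[OF x] b_nonneg[OF x] by (intro mult_right_mono) auto
   moreover have "- (?s + a) * (g2 j x * b x) \<le> (1 - a) * (g2 j x * b x)"
    using s g2(2)[OF x] b_nonneg[OF x] by (intro mult_right_mono) auto
   ultimately show "?s * (F j x * b x) + a * (F j x * b x) \<le> ?s * (f x * b x) + a * (f x * b x) + (1 + a) * (g1 j x * b x) + (1 - a) * (g2 j x * b x)"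
    by (simp add: F_def algebra_simps)
  qed (use ii[OF Fi[of j]] ii[OF f] ii[OF g1(1)[of j]] ii[OF g2(1)[of j]] in auto)
  also have "... = (LINT x|m. asgn e (P m (F j) x) * (f x * b x)) + a * (LINT x|m. f x * b x) + (1 + a) * (LINT x|m. g1 j x * b x) + (1 - a) * (LINT x|m. g2 j x * b x)"
   using ii[OF f] ii[OF g1(1)[of j]] ii[OF g2(1)[of j]] by simp
  also have "... \<le> (LINT x|m. asgn e (P m (F j) x) * (f x * b x)) + a * (LINT x|m. f x * b x) + (1 + a) * (2 * L * (LINT y|n1. h1 y)) + (1 - a) * (2 * L * (LINT y|n2. h2 y))"
  proof -
   have "(LINT x|m. g1 j x * b x) \<le> L * (2 * (LINT y|n1. h1 y))"
    by (rule order_trans[OF mult_b_le[OF adm_m g1(1)[of j] g1(2)] mult_left_mono[OF g1(3)[of j]]]) (use Lpos in auto)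
   moreover have "(LINT x|m. g2 j x * b x) \<le> L * (2 * (LINT y|n2. h2 y))"
    by (rule order_trans[OF mult_b_le[OF adm_m g2(1)[of j] g2(2)] mult_left_mono[OF g2(3)[of j]]]) (use Lpos in auto)
   ultimately have "(1 + a) * (LINT x|m. g1 j x * b x) \<le> (1 + a) * (L * (2 * (LINT y|n1. h1 y)))"
    "(1 - a) * (LINT x|m. g2 j x * b x) \<le> (1 - a) * (L * (2 * (LINT y|n2. h2 y)))"
    using a by (auto intro!: mult_left_mono)
   then show ?thesis by (simp add: mult.assoc mult.left_commute)
  qed
  finally show ?thesis by simp
 qed
 then have "(LINT x|m. aabs e (z x)) + a * (LINT x|m. z x) \<le> (LINT x|m. asgn e (z x) * (f x * b x)) + ?S"
  by (intro LIMSEQ_le[OF A B]) auto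
 then show ?thesis by simp
qed

text \<open>The limit e to 0 by dominated convergence. It is kept separate from the mollification,
  since for fixed \<open>e\<close> the regularised sign is continuous and passes through almost
  everywhere limits.\<close>

lemma kato_measure:
 assumes f: "integrable m f" and n1: "adm n1" "integrable n1 h1" "\<And>y. y \<in> \<Omega> ==> 0 \<le> h1 y"
  and n2: "adm n2" "integrable n2 h2" "\<And>y. y \<in> \<Omega> ==> 0 \<le> h2 y"
  and z: "integrable m z" "AE x in m. z x = P m f x + P n1 h1 x - P n2 h2 x" and a: "\<bar>a\<bar> \<le> 1"
 shows "(LINT x|m. \<bar>z x\<bar> + a * z x) \<le> (LINT x|m. (sgn (z x) + a) * (f x * b x))
   + (1 + a) * (2 * L * (LINT y|n1. h1 y)) + (1 - a) * (2 * L * (LINT y|n2. h2 y))"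
proof -
 define e where "e j = 1 / real (Suc j)" for j
 have e: "e j > 0" for j by (simp add: e_def)
 have el: "filterlim e (at_right 0) sequentially"
  unfolding filterlim_at using LIMSEQ_Suc[OF lim_1_over_n] e by (auto simp: e_def[abs_def])
 have [measurable]: "z \<in> borel_measurable m" "f \<in> borel_measurable m" using z(1) f by auto
 note [measurable] = b_measurable[OF adm_m]
 have A: "(\<lambda>j. LINT x|m. aabs (e j) (z x)) \<longlonglongrightarrow> (LINT x|m. \<bar>z x\<bar>)"
 proof (rule integral_dominated_convergence[where w="\<lambda>x. \<bar>z x\<bar>"])
  show "AE x in m. (\<lambda>j. aabs (e j) (z x)) \<longlonglongrightarrow> \<bar>z x\<bar>"
  proof (rule AE_I2)
   fix x
   have "(\<lambda>j. \<bar>z x\<bar> - e j) \<longlonglongrightarrow> \<bar>z x\<bar> - 0"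
    unfolding e_def by (intro tendsto_intros LIMSEQ_Suc[OF lim_1_over_n])
   then have lim: "(\<lambda>j. \<bar>z x\<bar> - e j) \<longlonglongrightarrow> \<bar>z x\<bar>" by simp
   show "(\<lambda>j. aabs (e j) (z x)) \<longlonglongrightarrow> \<bar>z x\<bar>"
    by (rule tendsto_sandwich[OF _ _ lim tendsto_const])
     (intro always_eventually allI aabs_bounds e)+
  qed
  show "AE x in m. norm (aabs (e j) (z x)) \<le> \<bar>z x\<bar>" for j
   unfolding real_norm_def by (intro AE_I2 aabs_abs_le e)
  show "integrable m (\<lambda>x. \<bar>z x\<bar>)" using z(1) by (rule integrable_abs)
 qed measurable
 have B: "(\<lambda>j. LINT x|m. asgn (e j) (z x) * (f x * b x)) \<longlonglongrightarrow> (LINT x|m. sgn (z x) * (f x * b x))"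
 proof (rule integral_dominated_convergence[where w="\<lambda>x. \<bar>f x * b x\<bar>"])
  show "AE x in m. (\<lambda>j. asgn (e j) (z x) * (f x * b x)) \<longlonglongrightarrow> sgn (z x) * (f x * b x)"
   by (intro AE_I2 tendsto_intros filterlim_compose[OF asgn_tendsto el])
  show "AE x in m. norm (asgn (e j) (z x) * (f x * b x)) \<le> \<bar>f x * b x\<bar>" for j
   unfolding real_norm_def abs_mult by (intro AE_I2 mult_left_le_one_le asgn_abs_le e) auto
 qed (use m_hb[OF f] in auto)
 have i: "integrable m (\<lambda>x. sgn (z x) * (f x * b x))"
  by (rule int_bound[OF m_hb[OF f]]) (auto simp: abs_mult abs_sgn_eq)
 have "(LINT x|m. \<bar>z x\<bar>) + a * (LINT x|m. z x) \<le> (LINT x|m. sgn (z x) * (f x * b x)) + (a * (LINT x|m. f x * b x)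
   + (1 + a) * (2 * L * (LINT y|n1. h1 y)) + (1 - a) * (2 * L * (LINT y|n2. h2 y)))"
 proof (rule LIMSEQ_le[OF tendsto_add[OF A tendsto_const] tendsto_add[OF B tendsto_const]], intro exI allI impI)
  fix j :: nat
  show "(LINT x|m. aabs (e j) (z x)) + a * (LINT x|m. z x) \<le> (LINT x|m. asgn (e j) (z x) * (f x * b x)) + (a * (LINT x|m. f x * b x)
   + (1 + a) * (2 * L * (LINT y|n1. h1 y)) + (1 - a) * (2 * L * (LINT y|n2. h2 y)))"
   using kato_measure_e[OF f n1 n2 borel_measurable_integrable[OF z(1)] z(2) a e[of j]] by (simp add: add.assoc)
 qed
 moreover have "(LINT x|m. \<bar>z x\<bar> + a * z x) = (LINT x|m. \<bar>z x\<bar>) + a * (LINT x|m. z x)" using z(1) by simp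
 moreover have "(LINT x|m. (sgn (z x) + a) * (f x * b x)) = (LINT x|m. sgn (z x) * (f x * b x)) + a * (LINT x|m. f x * b x)"
  using i m_hb[OF f] by (simp add: distrib_right)
 ultimately show ?thesis by simp
qed

lemma L1_kato_P: "L1_kato m (P m) b l L"
proof
 show "b \<in> borel_measurable m" by (rule b_measurable[OF adm_m])
 show "AE x in m. l \<le> b x \<and> b x \<le> L" using b_bounds by (intro AE_I2) (simp add: sp)
 fix f :: "'a => real" assume f: "integrable m f"
 show "integrable m (P m f)" by (rule P_int[OF adm_m f])
 show "(LINT x|m. \<bar>P m f x\<bar>) \<le> L * (LINT x|m. \<bar>f x\<bar>)" by (rule P_abs'[OF adm_m f])
 show "AE x in m. P m (\<lambda>x. f x - g x) x = P m f x - P m g x" if "integrable m g" for g :: "'a => real"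
  by (rule P_diff[OF adm_m f that])
 have "AE x in m. P m f x = P m f x + P m (\<lambda>_. 0) x - P m (\<lambda>_. 0) x" by simp
 from kato_measure[OF f adm_m _ _ adm_m _ _ P_int[OF adm_m f] this, of 0]
 show "(LINT x|m. \<bar>P m f x\<bar>) \<le> (LINT x|m. sgn (P m f x) * (f x * b x))" by simp
qed (use lpos Lpos in auto)

sublocale L1_kato m "P m" b l L by (rule L1_kato_P)

end

section \<open>The Green kernel\<close>

locale domain_setting =
 fixes \<Omega> :: "'a::euclidean_space set" and s \<gamma> c :: real
 assumes op: "open \<Omega>" and bd: "bounded \<Omega>" and ne: "\<Omega> \<noteq> {}"
  and s0: "0 < s" and g0: "0 < \<gamma>" and g1: "\<gamma> \<le> 1" and N2s: "real DIM('a) > 2 * s" and c0: "c > 0"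
begin

abbreviation "M1 \<equiv> lebesgue_on \<Omega>"

abbreviation "\<delta> \<equiv> bdist \<Omega>"

definition w :: "'a => real" where "w x = \<delta> x powr \<gamma>"

lemma compl_ne: "- \<Omega> \<noteq> {}"
 using bd by (metis Compl_empty_eq double_complement not_bounded_UNIV)

lemma \<delta>_pos: "x \<in> \<Omega> ==> 0 < \<delta> x"
 using in_closed_iff_infdist_zero[of "- \<Omega>" x] op compl_ne infdist_nonneg[of x "- \<Omega>"]
 unfolding bdist_def by (force simp: closed_def)

lemma \<delta>_outside: "x \<notin> \<Omega> ==> \<delta> x = 0"
 unfolding bdist_def by simp

lemma \<delta>_nonneg: "0 \<le> \<delta> x" unfolding bdist_def by (rule infdist_nonneg)

lemma \<delta>_Lipschitz: "\<delta> x \<le> \<delta> y + norm (x - y)"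
 unfolding bdist_def using infdist_triangle[of x "- \<Omega>" y] by (simp add: dist_norm)

lemma \<delta>_continuous: "continuous_on UNIV \<delta>"
 unfolding bdist_def[abs_def] by (intro continuous_intros)

lemma w_continuous: "continuous_on UNIV w"
 unfolding w_def[abs_def] by (intro continuous_on_powr' \<delta>_continuous continuous_on_const) (use \<delta>_nonneg g0 in auto)

lemma w_measurable[measurable]: "w \<in> borel_measurable borel"
 by (rule borel_measurable_continuous_onI[OF w_continuous])

lemma w_pos: "x \<in> \<Omega> ==> 0 < w x" using \<delta>_pos[of x] by (auto simp: w_def)
lemma w_nonneg: "0 \<le> w x" by (simp add: w_def)
lemma w_outside: "x \<notin> \<Omega> ==> w x = 0" by (simp add: w_def \<delta>_outside)

text \<open>Bounds both the diameter and the distance function. It is fixed by choice so that it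
  depends on \<Omega> alone: the constant of the theorem has to be found before the operator and its
  Green function are introduced.\<close>

definition D :: real where "D = (SOME D. 1 \<le> D \<and> (\<forall>x\<in>\<Omega>. \<delta> x \<le> D \<and> (\<forall>y\<in>\<Omega>. norm (x - y) \<le> D)))"

lemma D: "1 \<le> D" "\<And>x. x \<in> \<Omega> ==> \<delta> x \<le> D" "\<And>x y. x \<in> \<Omega> ==> y \<in> \<Omega> ==> norm (x - y) \<le> D"
proof -
 obtain R where R: "\<And>x. x \<in> \<Omega> ==> norm x \<le> R" using bd by (auto simp: bounded_iff)
 obtain p where p: "p \<in> - \<Omega>" using compl_ne by auto
 have "\<delta> x \<le> max 1 (2 * R + norm p)" if x: "x \<in> \<Omega>" for x
 proof -
  have "\<delta> x \<le> dist x p" unfolding bdist_def by (rule infdist_le[OF p])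
  also have "... \<le> norm x + norm p" by (simp add: dist_norm norm_triangle_ineq4)
  also have "... \<le> 2 * R + norm p" using R[OF x] norm_ge_zero[of x] by linarith
  finally show ?thesis by simp
 qed
 moreover have "norm (x - y) \<le> max 1 (2 * R + norm p)" if "x \<in> \<Omega>" "y \<in> \<Omega>" for x y
  using norm_triangle_ineq4[of x y] R[OF that(1)] R[OF that(2)] norm_ge_zero[of p] by linarith
 ultimately have "\<exists>D\<ge>1. \<forall>x\<in>\<Omega>. \<delta> x \<le> D \<and> (\<forall>y\<in>\<Omega>. norm (x - y) \<le> D)"
  by (intro exI[of _ "max 1 (2 * R + norm p)"]) auto
 from someI_ex[OF this] show "1 \<le> D" "\<And>x. x \<in> \<Omega> ==> \<delta> x \<le> D" "\<And>x y. x \<in> \<Omega> ==> y \<in> \<Omega> ==> norm (x - y) \<le> D"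
  unfolding D_def by blast+
qed

definition riesz :: "'a => real" where
 "riesz z = indicator (cball 0 D) z * norm z powr (2 * s - DIM('a))"

lemma riesz_integrable: "integrable lborel riesz"
 unfolding riesz_def[abs_def] using s0 by (intro Riesz_kernel_integrable) simp

lemma riesz_nonneg: "0 \<le> riesz z" by (simp add: riesz_def)

text \<open>Upper bound for the column masses: \<open>c\<close> from the two-sided Green bound,
  2^\<gamma> from moving the weight between the two points, and the mass of the Riesz kernel on the
  ball of radius \<open>D\<close>. The summand 1 makes it visibly positive.\<close>

definition Lc :: real where "Lc = c * 2 powr \<gamma> * ((LINT z|lborel. riesz z) + 1)"

text \<open>Lower bound for the column masses: on the bounded domain the Green function is at least
  a multiple of w(x) w(y), and integration against w(x) leaves the integral of the squared
  weight.\<close>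

definition lc :: real where "lc = inverse c * D powr (2 * s - DIM('a) - 2 * \<gamma>) * (LINT x|M1. (w x)\<^sup>2)"

lemma sets_\<Omega>: "\<Omega> \<in> sets borel" "\<Omega> \<in> sets lebesgue" using op by auto

lemma id_M1: "(\<lambda>x. x) \<in> M1 \<rightarrow>\<^sub>M borel"
 by (intro measurable_restrict_space1 measurable_completion) auto

lemma finite_M1: "finite_measure M1"
 using emeasure_bounded_finite[OF bd] sets_\<Omega> by (intro finite_measureI) (auto simp: emeasure_restrict_space)

lemma w_le: "x \<in> \<Omega> ==> w x \<le> D powr \<gamma>"
 unfolding w_def using D(2)[of x] \<delta>_nonneg[of x] g0 by (intro powr_mono2) auto

lemma w_M1[measurable]: "w \<in> borel_measurable M1"
 using measurable_compose[OF id_M1 w_measurable] by simp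

lemma w_bounded_integrable:
 "integrable M1 w" "integrable M1 (\<lambda>x. (w x)\<^sup>2)"
proof -
 interpret finite_measure M1 by (rule finite_M1)
 show "integrable M1 w"
  by (rule integrable_const_bound[of _ "D powr \<gamma>"]) (use w_le w_nonneg in \<open>auto intro!: AE_I2\<close>)
 show "integrable M1 (\<lambda>x. (w x)\<^sup>2)"
  by (rule integrable_const_bound[of _ "(D powr \<gamma>)\<^sup>2"]) (use w_le w_nonneg in \<open>auto intro!: AE_I2 power_mono\<close>)
qed

lemma Lc_pos: "0 < Lc"
 unfolding Lc_def using c0 riesz_nonneg by (intro mult_pos_pos add_nonneg_pos integral_nonneg_AE) auto

lemma lc_pos: "0 < lc"
proof -
 have "(LINT x|M1. (w x)\<^sup>2) \<noteq> 0"
 proof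
  assume "(LINT x|M1. (w x)\<^sup>2) = 0"
  then have "AE x in M1. (w x)\<^sup>2 = 0"
   using integral_nonneg_eq_0_iff_AE[OF w_bounded_integrable(2)] by simp
  then have "AE x in M1. False"
  proof (rule AE_mp, intro AE_I2 impI)
   fix x assume "x \<in> space M1" "(w x)\<^sup>2 = 0"
   then show False using w_pos[of x] by simp
  qed
  then have "emeasure M1 \<Omega> = 0"
   using AE_iff_measurable[of \<Omega> M1 "\<lambda>_. False"] sets_\<Omega> by (auto simp: sets_restrict_space_iff)
  then have "emeasure lborel \<Omega> = 0" using sets_\<Omega> by (simp add: emeasure_restrict_space)
  moreover obtain x r where "r > 0" "ball x r \<subseteq> \<Omega>" using op ne open_contains_ball by blast
  then have "emeasure lborel (ball x r) \<le> emeasure lborel \<Omega>" by (intro emeasure_mono) (auto simp: sets_\<Omega>)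
  moreover have "0 < emeasure lborel (ball x r)"
  proof -
   have "emeasure lborel (ball x r) = ennreal (measure lborel (ball x r))"
    using emeasure_lborel_ball_finite[of x r] by (intro emeasure_eq_ennreal_measure) auto
   then show ?thesis using content_ball_pos[OF \<open>r > 0\<close>, of x] by simp
  qed
  ultimately show False by simp
 qed
 then have "0 < (LINT x|M1. (w x)\<^sup>2)" by (simp add: less_le)
 moreover have "0 < D powr (2 * s - DIM('a) - 2 * \<gamma>)" using D(1) by simp
 ultimately show ?thesis unfolding lc_def using c0 by (intro mult_pos_pos) auto
qed

lemma min_div_le: "d > 0 ==> 0 \<le> a ==> 0 \<le> min (a / d) 1 powr \<gamma> \<and> min (a / d) 1 powr \<gamma> \<le> 1"
 using g0 powr_mono2[of \<gamma> "min (a / d) 1" 1] by auto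

lemma green_bound_le_riesz:
 assumes "x \<in> \<Omega>" "y \<in> \<Omega>" "x \<noteq> y" shows "green_bound \<Omega> s \<gamma> x y \<le> riesz (x - y)"
proof -
 let ?d = "norm (x - y)"
 have d: "?d > 0" using assms by simp
 have "green_bound \<Omega> s \<gamma> x y \<le> 1 / ?d powr (real DIM('a) - 2 * s) * 1 * 1"
  unfolding green_bound_def using min_div_le[OF d \<delta>_nonneg] by (intro mult_mono) auto
 also have "... = riesz (x - y)" using D(3)[OF assms(1,2)] by (simp add: riesz_def powr_minus_divide[symmetric])
 finally show ?thesis .
qed

text \<open>If y is within distance 2|x-y| of the complement, the quotient absorbs \<delta>(y).
  Otherwise x is so close to y that \<delta>(y) is at most 2\<delta>(x), by the Lipschitz
  property.\<close>

lemma min_mult_le: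
 assumes "x \<noteq> y" shows "min (\<delta> x / norm (x - y)) 1 * \<delta> y \<le> 2 * \<delta> x"
proof (cases "\<delta> y \<le> 2 * norm (x - y)")
 case True
 have "min (\<delta> x / norm (x - y)) 1 * \<delta> y \<le> (\<delta> x / norm (x - y)) * (2 * norm (x - y))"
  using True \<delta>_nonneg by (intro mult_mono) auto
 then show ?thesis using assms by simp
next
 case False
 have "min (\<delta> x / norm (x - y)) 1 * \<delta> y \<le> 1 * \<delta> y" using \<delta>_nonneg by (intro mult_right_mono) auto
 also have "... \<le> 2 * \<delta> x" using False \<delta>_Lipschitz[of y x] by (simp add: norm_minus_commute)
 finally show ?thesis .
qed

text \<open>Moves the weight from one variable to the other, so that integrating the Green function
  against the weight reproduces the weight up to a constant.\<close>

lemma green_bound_weight: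
 assumes "x \<in> \<Omega>" "y \<in> \<Omega>" "x \<noteq> y"
 shows "green_bound \<Omega> s \<gamma> x y * w y \<le> 2 powr \<gamma> * w x * riesz (x - y)"
proof -
 let ?d = "norm (x - y)"
 have d: "?d > 0" using assms by simp
 have r: "1 / ?d powr (real DIM('a) - 2 * s) = riesz (x - y)"
  using D(3)[OF assms(1,2)] by (simp add: riesz_def powr_minus_divide[symmetric])
 have "min (\<delta> x / ?d) 1 powr \<gamma> * w y = (min (\<delta> x / ?d) 1 * \<delta> y) powr \<gamma>"
  unfolding w_def using \<delta>_nonneg d by (simp add: powr_mult)
 also have "... \<le> (2 * \<delta> x) powr \<gamma>" using min_mult_le[OF assms(3)] \<delta>_nonneg g0 d by (intro powr_mono2) auto
 also have "... = 2 powr \<gamma> * w x" unfolding w_def using \<delta>_nonneg by (simp add: powr_mult)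
 finally have m: "min (\<delta> x / ?d) 1 powr \<gamma> * w y \<le> 2 powr \<gamma> * w x" .
 have "green_bound \<Omega> s \<gamma> x y * w y = riesz (x - y) * (min (\<delta> x / ?d) 1 powr \<gamma> * w y) * min (\<delta> y / ?d) 1 powr \<gamma>"
  unfolding green_bound_def r by (simp add: mult_ac)
 also have "... \<le> riesz (x - y) * (2 powr \<gamma> * w x) * 1"
  by (rule mult_mono[OF mult_left_mono[OF m riesz_nonneg]])
   (use min_div_le[OF d \<delta>_nonneg] riesz_nonneg w_nonneg in auto)
 finally show ?thesis by (simp add: mult_ac)
qed

lemma green_bound_lower:
 assumes "x \<in> \<Omega>" "y \<in> \<Omega>" "x \<noteq> y"
 shows "D powr (2 * s - DIM('a) - 2 * \<gamma>) * w x * w y \<le> green_bound \<Omega> s \<gamma> x y"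
proof -
 let ?d = "norm (x - y)"
 have d: "?d > 0" using assms by simp
 have D0: "D > 0" using D(1) by simp
 have "\<delta> z / D \<le> min (\<delta> z / ?d) 1" if "z \<in> \<Omega>" for z
 proof -
  have "\<delta> z / D \<le> \<delta> z / ?d"
   by (intro divide_left_mono mult_pos_pos D0 d \<delta>_nonneg D(3) assms)
  moreover have "\<delta> z / D \<le> 1" using D(2)[OF that] D0 by simp
  ultimately show ?thesis by simp
 qed
 then have m: "w z / D powr \<gamma> \<le> min (\<delta> z / ?d) 1 powr \<gamma>" if "z \<in> \<Omega>" for z
  using that powr_mono2[of \<gamma> "\<delta> z / D" "min (\<delta> z / ?d) 1"] g0 D0 \<delta>_nonneg[of z] by (simp add: w_def powr_divide)
 have "1 / D powr (real DIM('a) - 2 * s) \<le> 1 / ?d powr (real DIM('a) - 2 * s)"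
  using D(3)[OF assms(1,2)] d N2s by (intro divide_left_mono powr_mono2 mult_pos_pos) auto
 then have "1 / D powr (real DIM('a) - 2 * s) * (w x / D powr \<gamma>) * (w y / D powr \<gamma>) \<le> green_bound \<Omega> s \<gamma> x y"
  unfolding green_bound_def using m assms w_nonneg by (intro mult_mono) auto
 moreover have "1 / D powr (real DIM('a) - 2 * s) * (w x / D powr \<gamma>) * (w y / D powr \<gamma>) = D powr (2 * s - DIM('a) - 2 * \<gamma>) * w x * w y"
 proof -
  have "D powr (2 * s - DIM('a) - 2 * \<gamma>) = D powr (2 * s - DIM('a)) / (D powr \<gamma> * D powr \<gamma>)"
   by (simp add: powr_diff powr_add[symmetric])
  moreover have "1 / D powr (real DIM('a) - 2 * s) = D powr (2 * s - DIM('a))" by (simp add: powr_minus_divide[symmetric])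
  ultimately show ?thesis by simp
 qed
 ultimately show ?thesis by simp
qed

text \<open>The origin of the order of the capacity; it is applied with \<open>q\<close> equal to
  1/p'. Part of the weight at x is exchanged for the power -\<gamma>q of |x-y|, which lowers the
  order of the Riesz kernel from 2s to 2s - \<gamma>q.\<close>

lemma green_bound_capacity:
 assumes "x \<in> \<Omega>" "y \<in> \<Omega>" "x \<noteq> y" and q: "0 < q" "q < 1"
 shows "green_bound \<Omega> s \<gamma> x y / w y * \<delta> x powr (\<gamma> * (1 - q)) \<le> 2 powr \<gamma> * norm (x - y) powr (2 * s - \<gamma> * q - DIM('a))"
proof -
 let ?d = "norm (x - y)"
 let ?A = "min (\<delta> x / ?d) 1 * (min (\<delta> y / ?d) 1 / \<delta> y)"
 have d: "?d > 0" using assms by simp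
 have p: "\<delta> x > 0" "\<delta> y > 0" using assms \<delta>_pos by auto
 have A1: "?A \<le> 1 / ?d"
 proof -
  have "?A \<le> 1 * ((\<delta> y / ?d) / \<delta> y)" using p d by (intro mult_mono divide_right_mono) auto
  then show ?thesis using p by simp
 qed
 have A2: "?A \<le> 1 / \<delta> y"
 proof -
  have "?A \<le> 1 * (1 / \<delta> y)" using p d by (intro mult_mono divide_right_mono) auto
  then show ?thesis by simp
 qed
 have A0: "0 \<le> ?A" using p d by simp
 \<comment> \<open>The inequality before taking the power \<gamma>. If \<delta>(x) is at most
   2|x-y|, the bound 1/|x-y| for the product of the minima decides. Otherwise \<delta>(x) is at most
   2\<delta>(y), the bound 1/\<delta>(y) applies, and |x-y| is less than \<delta>(x).\<close>
 have key: "?A * \<delta> x powr (1 - q) \<le> 2 * ?d powr (- q)"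
 proof (cases "\<delta> x \<le> 2 * ?d")
  case True
  have "?A * \<delta> x powr (1 - q) \<le> 1 / ?d * (2 * ?d) powr (1 - q)"
   using A1 True p q d by (intro mult_mono powr_mono2) auto
  also have "... = 2 powr (1 - q) * ?d powr (- q)"
   using d by (simp add: powr_mult powr_diff powr_minus field_simps)
  also have "... \<le> 2 powr 1 * ?d powr (- q)" using q by (intro mult_right_mono powr_mono) auto
  finally show ?thesis by simp
 next
  case False
  have "\<delta> x \<le> 2 * \<delta> y" using False \<delta>_Lipschitz[of x y] by simp
  then have "?A \<le> 2 / \<delta> x" using A2 p by (intro order_trans[OF A2]) (simp add: field_simps)
  then have "?A * \<delta> x powr (1 - q) \<le> 2 / \<delta> x * \<delta> x powr (1 - q)" by (intro mult_right_mono) auto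
  also have "... = 2 * \<delta> x powr (- q)" using p by (simp add: powr_diff powr_minus field_simps)
  also have "... \<le> 2 * ?d powr (- q)"
  proof -
   have "?d \<le> \<delta> x" using False d by linarith
   then show ?thesis using d q by (intro mult_left_mono powr_mono2') auto
  qed
  finally show ?thesis .
 qed
 have "green_bound \<Omega> s \<gamma> x y / w y * \<delta> x powr (\<gamma> * (1 - q)) = ?d powr (2 * s - DIM('a)) * (?A * \<delta> x powr (1 - q)) powr \<gamma>"
 proof -
  have "(?A * \<delta> x powr (1 - q)) powr \<gamma> = min (\<delta> x / ?d) 1 powr \<gamma> * (min (\<delta> y / ?d) 1 powr \<gamma> / w y) * \<delta> x powr (\<gamma> * (1 - q))"
   unfolding w_def using p d by (simp add: powr_mult powr_divide powr_powr mult.commute)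
  then show ?thesis unfolding green_bound_def by (simp add: powr_minus_divide[symmetric])
 qed
 also have "... \<le> ?d powr (2 * s - DIM('a)) * (2 * ?d powr (- q)) powr \<gamma>"
  by (intro mult_left_mono powr_mono2 key mult_nonneg_nonneg[OF A0]) (use g0 in auto)
 also have "... = 2 powr \<gamma> * ?d powr (2 * s - \<gamma> * q - DIM('a))"
  by (simp add: powr_mult powr_powr powr_add[symmetric] algebra_simps)
 finally show ?thesis .
qed

end

locale green_setting = domain_setting \<Omega> s \<gamma> c for \<Omega> :: "'a::euclidean_space set" and s \<gamma> c :: real +
 fixes J :: "'a => 'a => real" and B :: "'a => real" and G :: "'a => 'a => real"
 assumes L1: "cond_L1 \<Omega> J B" and G1: "cond_G1 \<Omega> s \<gamma> c J B G" and G2: "cond_G2 \<Omega> G"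
begin

text \<open>The Green function made total by 0 on the diagonal and outside \<Omega>, hence Borel on
  the whole product and accessible to Tonelli's theorem for arbitrary measures.\<close>

definition K :: "'a => 'a => real" where "K x y = (if x \<in> \<Omega> \<and> y \<in> \<Omega> \<and> x \<noteq> y then G x y else 0)"

definition k :: "'a => 'a => real" where "k x y = K x y / w y"

definition m :: "'a measure" where "m = density M1 (\<lambda>x. ennreal (w x))"

lemma G_off: "x \<in> \<Omega> ==> y \<in> \<Omega> ==> x \<noteq> y ==> 0 < G x y \<and> G x y = G y x \<and>
  inverse c * green_bound \<Omega> s \<gamma> x y \<le> G x y \<and> G x y \<le> c * green_bound \<Omega> s \<gamma> x y"
 using G1 unfolding cond_G1_def by auto

lemma K_sym: "K x y = K y x"
 unfolding K_def using G_off[of x y] by auto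

lemma K_nonneg: "0 \<le> K x y"
 unfolding K_def using G_off[of x y] by (auto intro: less_imp_le)

lemma K_measurable: "(\<lambda>(x, y). K x y) \<in> borel_measurable (borel \<Otimes>\<^sub>M borel)"
proof -
 have e: "off_diag \<Omega> = (\<Omega> \<times> \<Omega>) \<inter> {z. fst z \<noteq> snd z}" by auto
 have "open {z :: 'a \<times> 'a. fst z \<noteq> snd z}" by (intro open_Collect_neq continuous_intros)
 then have o: "off_diag \<Omega> \<in> sets borel" unfolding e using op by (auto intro!: borel_open open_Int open_Times)
 have "(\<lambda>(x, y). G x y) \<in> borel_measurable (restrict_space borel (off_diag \<Omega>))" using G1 by (simp add: cond_G1_def)
 then have "(\<lambda>z. indicator (off_diag \<Omega>) z *\<^sub>R (\<lambda>(x, y). G x y) z) \<in> borel_measurable borel"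
  using o by (subst (asm) borel_measurable_restrict_space_iff) auto
 moreover have "(\<lambda>z. indicator (off_diag \<Omega>) z *\<^sub>R (\<lambda>(x, y). G x y) z) = (\<lambda>(x, y). K x y)"
  by (auto simp: fun_eq_iff K_def indicator_def)
 ultimately show ?thesis by (simp add: borel_prod)
qed

lemma k_measurable_borel: "(\<lambda>(x, y). k x y) \<in> borel_measurable (borel \<Otimes>\<^sub>M borel)"
proof -
 note [measurable] = K_measurable
 show ?thesis unfolding k_def by measurable
qed

lemma k_nonneg: "0 \<le> k x y" unfolding k_def using K_nonneg w_nonneg by simp

lemma K_section_measurable: "(\<lambda>x. K x y) \<in> borel_measurable M1" "(\<lambda>y. K x y) \<in> borel_measurable M1"
proof -
 have "(\<lambda>y. K x y) \<in> borel_measurable M1" for x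
  using measurable_compose[OF measurable_Pair[OF measurable_const id_M1] K_measurable, of x] by simp
 then show "(\<lambda>x. K x y) \<in> borel_measurable M1" "(\<lambda>y. K x y) \<in> borel_measurable M1"
  by (simp_all add: K_sym[of _ y])
qed

lemma K_le: "K x y \<le> c * riesz (x - y)"
proof (cases "x \<in> \<Omega> \<and> y \<in> \<Omega> \<and> x \<noteq> y")
 case True
 then have "G x y \<le> c * green_bound \<Omega> s \<gamma> x y" "green_bound \<Omega> s \<gamma> x y \<le> riesz (x - y)"
  using G_off[of x y] green_bound_le_riesz[of x y] by auto
 then have "G x y \<le> c * riesz (x - y)"
  using mult_left_mono[of "green_bound \<Omega> s \<gamma> x y" "riesz (x - y)" c] c0 by linarith
 with True show ?thesis by (simp add: K_def)
next
 case False
 then have "K x y = 0" unfolding K_def by (simp only: if_False)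
 then show ?thesis using c0 riesz_nonneg[of "x - y"] by simp
qed

lemma K_weight: "y \<in> \<Omega> ==> K x y * w x \<le> c * 2 powr \<gamma> * w y * riesz (x - y)"
proof (cases "x \<in> \<Omega> \<and> x \<noteq> y")
 case True
 assume y: "y \<in> \<Omega>"
 have "K x y * w x \<le> c * green_bound \<Omega> s \<gamma> y x * w x"
  using G_off[of y x] y True w_nonneg[of x] by (auto simp: K_def intro!: mult_right_mono)
 also have "... \<le> c * (2 powr \<gamma> * w y * riesz (y - x))"
 proof -
  have "green_bound \<Omega> s \<gamma> y x * w x \<le> 2 powr \<gamma> * w y * riesz (y - x)"
   using y True by (intro green_bound_weight) auto
  from mult_left_mono[OF this, of c] c0 show ?thesis by (simp add: mult.assoc)
 qed
 also have "riesz (y - x) = riesz (x - y)" by (simp add: riesz_def norm_minus_commute indicator_def)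
 finally show ?thesis by (simp add: mult_ac)
qed (use w_nonneg riesz_nonneg c0 in \<open>auto simp: K_def\<close>)

lemma K_weight_lower: "x \<in> \<Omega> ==> y \<in> \<Omega> ==> x \<noteq> y ==> inverse c * (D powr (2 * s - DIM('a) - 2 * \<gamma>) * w x * w y) \<le> K x y"
proof -
 assume xy: "x \<in> \<Omega>" "y \<in> \<Omega>" "x \<noteq> y"
 have "inverse c * (D powr (2 * s - DIM('a) - 2 * \<gamma>) * w x * w y) \<le> inverse c * green_bound \<Omega> s \<gamma> x y"
  using c0 by (intro mult_left_mono green_bound_lower xy) auto
 also have "... \<le> G x y" using G_off[OF xy] by simp
 finally show ?thesis using xy by (simp add: K_def)
qed

lemma nn_integral_M1:
 assumes [measurable]: "f \<in> borel_measurable borel" shows "(\<integral>\<^sup>+x. f x \<partial>M1) = (\<integral>\<^sup>+x. f x * indicator \<Omega> x \<partial>lborel)"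
 using sets_\<Omega> by (subst nn_integral_restrict_space) (auto simp: nn_integral_completion)

lemma riesz_measurable[measurable]: "riesz \<in> borel_measurable borel"
 using riesz_integrable by auto

lemma riesz_nn_M1: "(\<integral>\<^sup>+x. ennreal (riesz (x - y)) \<partial>M1) \<le> ennreal (LINT z|lborel. riesz z)"
proof -
 have "(\<integral>\<^sup>+x. ennreal (riesz (x - y)) \<partial>M1) \<le> (\<integral>\<^sup>+x. ennreal (riesz (x - y)) \<partial>lborel)"
  by (subst nn_integral_M1) (auto intro!: nn_integral_mono simp: indicator_def)
 also have "... = (\<integral>\<^sup>+x. ennreal (riesz x) \<partial>lborel)"
  using nn_integral_lborel_affine[of "\<lambda>x. ennreal (riesz (x - y))" 1 y] by simp
 also have "... = ennreal (LINT z|lborel. riesz z)"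
  by (rule nn_integral_eq_integral[OF riesz_integrable]) (auto simp: riesz_nonneg)
 finally show ?thesis .
qed

lemma K_w_nn:
 assumes y: "y \<in> \<Omega>"
 shows "(\<integral>\<^sup>+x. ennreal (K x y * w x) \<partial>M1) \<le> ennreal (Lc * w y)" "ennreal (lc * w y) \<le> (\<integral>\<^sup>+x. ennreal (K x y * w x) \<partial>M1)"
proof -
 note [measurable] = K_section_measurable
 have "(\<integral>\<^sup>+x. ennreal (K x y * w x) \<partial>M1) \<le> (\<integral>\<^sup>+x. ennreal (c * 2 powr \<gamma> * w y) * ennreal (riesz (x - y)) \<partial>M1)"
  using K_weight[OF y] c0 w_nonneg riesz_nonneg by (intro nn_integral_mono) (simp add: ennreal_mult[symmetric] ennreal_leI)
 also have "... = ennreal (c * 2 powr \<gamma> * w y) * (\<integral>\<^sup>+x. ennreal (riesz (x - y)) \<partial>M1)"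
 proof (rule nn_integral_cmult)
  show "(\<lambda>x. ennreal (riesz (x - y))) \<in> borel_measurable M1"
   by (rule measurable_compose[OF id_M1]) measurable
 qed
 also have "... \<le> ennreal (c * 2 powr \<gamma> * w y) * ennreal ((LINT z|lborel. riesz z) + 1)"
  by (intro mult_left_mono order_trans[OF riesz_nn_M1] ennreal_leI) auto
 also have "... = ennreal (Lc * w y)"
 proof -
  have n: "0 \<le> (LINT z|lborel. riesz z) + 1" by (intro add_nonneg_nonneg integral_nonneg_AE) (auto simp: riesz_nonneg)
  have "ennreal (c * 2 powr \<gamma> * w y) * ennreal ((LINT z|lborel. riesz z) + 1) = ennreal ((c * 2 powr \<gamma> * w y) * ((LINT z|lborel. riesz z) + 1))"
   by (rule ennreal_mult[symmetric, OF _ n]) (use c0 w_nonneg[of y] in auto)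
  also have "(c * 2 powr \<gamma> * w y) * ((LINT z|lborel. riesz z) + 1) = Lc * w y" by (simp add: Lc_def mult_ac)
  finally show ?thesis .
 qed
 finally show "(\<integral>\<^sup>+x. ennreal (K x y * w x) \<partial>M1) \<le> ennreal (Lc * w y)" .
 let ?C = "inverse c * D powr (2 * s - DIM('a) - 2 * \<gamma>) * w y"
 have "ennreal (lc * w y) = ennreal (LINT x|M1. ?C * (w x)\<^sup>2)"
  by (simp add: lc_def mult_ac)
 also have "... = (\<integral>\<^sup>+x. ennreal (?C * (w x)\<^sup>2) \<partial>M1)"
  using c0 w_nonneg[of y] w_bounded_integrable by (intro nn_integral_eq_integral[symmetric]) auto
 also have "... \<le> (\<integral>\<^sup>+x. ennreal (K x y * w x) \<partial>M1)"
 proof (rule nn_integral_mono_AE)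
  have "AE x in lborel. x \<noteq> y" by (rule AE_lborel_singleton)
  then have "AE x in lebesgue. x \<noteq> y" by (rule AE_completion)
  then have "AE x in M1. x \<noteq> y" using sets_\<Omega> by (auto simp: AE_restrict_space_iff)
  then show "AE x in M1. ennreal (?C * (w x)\<^sup>2) \<le> ennreal (K x y * w x)"
  proof (rule AE_mp, intro AE_I2 impI ennreal_leI)
   fix x assume "x \<in> space M1" "x \<noteq> y"
   then have "inverse c * (D powr (2 * s - DIM('a) - 2 * \<gamma>) * w x * w y) * w x \<le> K x y * w x"
    using y by (intro mult_right_mono K_weight_lower w_nonneg) auto
   then show "?C * (w x)\<^sup>2 \<le> K x y * w x" by (simp add: power2_eq_square mult_ac)
  qed
 qed
 finally show "ennreal (lc * w y) \<le> (\<integral>\<^sup>+x. ennreal (K x y * w x) \<partial>M1)" .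
qed

lemma sets_m: "sets m = sets M1" "space m = \<Omega>" by (simp_all add: m_def)

lemma k_nn:
 assumes y: "y \<in> \<Omega>"
 shows "(\<integral>\<^sup>+x. ennreal (k x y) \<partial>m) = ennreal (1 / w y) * (\<integral>\<^sup>+x. ennreal (K x y * w x) \<partial>M1)"
proof -
 note [measurable] = K_section_measurable
 have "(\<integral>\<^sup>+x. ennreal (k x y) \<partial>m) = (\<integral>\<^sup>+x. ennreal (w x) * ennreal (k x y) \<partial>M1)"
  unfolding m_def k_def by (rule nn_integral_density) measurable
 also have "... = (\<integral>\<^sup>+x. ennreal (1 / w y) * ennreal (K x y * w x) \<partial>M1)"
  using w_nonneg K_nonneg by (intro nn_integral_cong) (simp add: ennreal_mult[symmetric] k_def mult_ac)
 also have "... = ennreal (1 / w y) * (\<integral>\<^sup>+x. ennreal (K x y * w x) \<partial>M1)" by (rule nn_integral_cmult) measurable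
 finally show ?thesis .
qed

sublocale kern \<Omega> m k lc Lc
proof (rule kern.intro)
 show "finite_measure m"
 proof (rule finite_measureI)
  have "emeasure m (space m) = (\<integral>\<^sup>+x. ennreal (w x) \<partial>M1)"
   unfolding m_def using nn_integral_indicator[of "space M1" M1]
   by (simp add: emeasure_density del: space_restrict_space) (auto intro!: nn_integral_cong)
  also have "... = ennreal (LINT x|M1. w x)" using w_bounded_integrable w_nonneg by (intro nn_integral_eq_integral) auto
  finally show "emeasure m (space m) \<noteq> \<infinity>" by simp
 qed
 show "(\<lambda>x. x) \<in> m \<rightarrow>\<^sub>M borel" using id_M1 measurable_cong_sets[OF sets_m(1) refl] by blast
 show "space m = \<Omega>" by (rule sets_m)
 show "(\<lambda>(x, y). k x y) \<in> borel_measurable (borel \<Otimes>\<^sub>M borel)" by (rule k_measurable_borel)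
 show "0 \<le> k x y" for x y by (rule k_nonneg)
 show "0 < lc" "0 < Lc" by (rule lc_pos Lc_pos)+
 fix y assume y: "y \<in> \<Omega>"
 have "ennreal lc = ennreal (1 / w y) * ennreal (lc * w y)"
  using w_pos[OF y] lc_pos by (simp add: ennreal_mult[symmetric])
 also have "... \<le> (\<integral>\<^sup>+x. ennreal (k x y) \<partial>m)" unfolding k_nn[OF y] by (intro mult_left_mono K_w_nn y) auto
 finally have 1: "ennreal lc \<le> (\<integral>\<^sup>+x. ennreal (k x y) \<partial>m)" .
 have "(\<integral>\<^sup>+x. ennreal (k x y) \<partial>m) \<le> ennreal (1 / w y) * ennreal (Lc * w y)"
  unfolding k_nn[OF y] by (intro mult_left_mono K_w_nn y) auto
 also have "... = ennreal Lc" using w_pos[OF y] Lc_pos by (simp add: ennreal_mult[symmetric])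
 finally show "ennreal lc \<le> (\<integral>\<^sup>+x. ennreal (k x y) \<partial>m) \<and> (\<integral>\<^sup>+x. ennreal (k x y) \<partial>m) \<le> ennreal Lc" using 1 by simp
qed

lemma AE_M1_neq: "AE x in M1. x \<noteq> y"
proof -
 have "AE x in lborel. x \<noteq> y" by (rule AE_lborel_singleton)
 then have "AE x in lebesgue. x \<noteq> y" by (rule AE_completion)
 then show ?thesis using sets_\<Omega> by (auto simp: AE_restrict_space_iff)
qed

text \<open>The weight in \<open>m\<close> cancels the division by the weight in \<open>k\<close>.
  The diagonal, where G has an unspecified value, contributes a single point and hence
  nothing.\<close>

lemma green_fun_eq_P:
 assumes f: "f \<in> borel_measurable M1" and x: "x \<in> \<Omega>"
 shows "green_fun \<Omega> G f x = P m f x" "P m f x = (LINT y|M1. K x y * f y)"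
proof -
 note [measurable] = K_section_measurable f
 have "P m f x = (LINT y|M1. w y *\<^sub>R (k x y * f y))"
  unfolding P_def m_def k_def using w_nonneg by (intro integral_density) auto
 also have "... = (LINT y|M1. K x y * f y)"
  by (intro LINT_cong refl) (use w_pos in \<open>force simp: k_def\<close>)
 finally show e: "P m f x = (LINT y|M1. K x y * f y)" .
 have ae: "AE y in M1. K x y * f y = G x y * f y"
  using AE_M1_neq[of x] by (rule AE_mp) (intro AE_I2 impI, use x in \<open>auto simp: K_def\<close>)
 have meas: "(\<lambda>y. G x y * f y) \<in> borel_measurable M1"
 proof -
  have [measurable]: "(\<lambda>y. y = x) \<in> measurable M1 (count_space UNIV)"
   using measurable_compose[OF id_M1, of "\<lambda>y. y = x" "count_space UNIV"] by (simp add: pred_def)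
  have "(\<lambda>y. if y = x then G x x * f y else K x y * f y) \<in> borel_measurable M1" by measurable
  then show ?thesis by (rule measurable_cong[THEN iffD1, rotated]) (use x in \<open>auto simp: K_def\<close>)
 qed
 show "green_fun \<Omega> G f x = P m f x" unfolding green_fun_def e
  by (rule integral_cong_AE[symmetric, OF _ meas ae]) measurable
qed

lemma integrable_m: "f \<in> borel_measurable M1 ==> integrable m f \<longleftrightarrow> integrable M1 (\<lambda>x. f x * w x)"
 for f :: "'a => real"
 unfolding m_def using w_nonneg by (subst integrable_density) (auto simp: mult.commute)

lemma integral_m: "f \<in> borel_measurable M1 ==> (LINT x|m. f x) = (LINT x|M1. f x * w x)"
 for f :: "'a => real"
 unfolding m_def using w_nonneg by (subst integral_density) (auto simp: mult.commute)

lemma borel_measurable_m: "borel_measurable m = borel_measurable M1"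
 using measurable_cong_sets[OF sets_m(1) refl] .

text \<open>Identifies the column mass: w b is the Green potential of w. This is the form in which
  the energy inequality produces \<open>b\<close>.\<close>

lemma K_w_eq_b: "y \<in> \<Omega> ==> (LINT x|M1. K y x * w x) = w y * b y"
proof -
 assume y: "y \<in> \<Omega>"
 note [measurable] = K_section_measurable
 have "ennreal (b y) = ennreal (1 / w y) * (\<integral>\<^sup>+x. ennreal (K x y * w x) \<partial>M1)"
  using b_eq[OF y] k_nn[OF y] by simp
 then have "ennreal (w y) * ennreal (b y) = (ennreal (w y) * ennreal (1 / w y)) * (\<integral>\<^sup>+x. ennreal (K x y * w x) \<partial>M1)" by (simp add: mult.assoc)
 also have "ennreal (w y) * ennreal (1 / w y) = 1" using w_pos[OF y] by (simp add: ennreal_mult[symmetric])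
 finally have "(\<integral>\<^sup>+x. ennreal (K x y * w x) \<partial>M1) = ennreal (w y * b y)"
  using w_pos[OF y] b_nonneg[OF y] by (simp add: ennreal_mult)
 moreover have "(LINT x|M1. K x y * w x) = enn2real (\<integral>\<^sup>+x. ennreal (K x y * w x) \<partial>M1)"
  using K_nonneg w_nonneg by (intro integral_eq_nn_integral) auto
 ultimately show ?thesis using w_pos[OF y] b_nonneg[OF y] by (simp add: K_sym[of y])
qed

text \<open>The energy inequality with datum \<xi> = w, whose solution is w b and in particular
  nonnegative. The factors w turn the Lebesgue integrals into integrals with respect to
  \<open>m\<close>.\<close>

lemma kato_bounded:
 assumes f: "f \<in> borel_measurable m" "\<And>x. x \<in> \<Omega> ==> \<bar>f x\<bar> \<le> C" and e: "e > 0"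
 shows "(LINT x|m. aabs e (P m f x)) \<le> (LINT x|m. asgn e (P m f x) * (f x * b x))"
proof -
 interpret EF: energy_form \<Omega> J B using op bd L1 by unfold_locales
 interpret fM: finite_measure M1 by (rule finite_M1)
 have fm[measurable]: "f \<in> borel_measurable M1" using f(1) by (simp add: borel_measurable_m)
 have L2I: "g \<in> L2 \<Omega>" if [measurable]: "g \<in> borel_measurable M1" and "\<And>x. x \<in> \<Omega> ==> \<bar>g x\<bar> \<le> C'" for g C'
 proof -
  have "integrable M1 (\<lambda>x. (g x)\<^sup>2)"
  proof (rule fM.integrable_const_bound[of _ "C'\<^sup>2"])
   show "AE x in M1. norm ((g x)\<^sup>2) \<le> C'\<^sup>2"
    using that(2) power_mono[OF that(2), of _ 2] by (intro AE_I2) auto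
  qed measurable
  then show ?thesis by (simp add: L2_def)
 qed
 have fL: "f \<in> L2 \<Omega>" by (rule L2I[OF fm f(2)])
 have wL: "w \<in> L2 \<Omega>" by (rule L2I[of _ "D powr \<gamma>"]) (use w_le w_nonneg in auto)
 have g1: "is_green_op \<Omega> J B f (green_fun \<Omega> G f)" "is_green_op \<Omega> J B w (green_fun \<Omega> G w)"
  using G1 fL wL by (auto simp: cond_G1_def)
 have gw: "green_fun \<Omega> G w x = w x * b x" if "x \<in> \<Omega>" for x
  using green_fun_eq_P[OF w_M1 that] K_w_eq_b[OF that] by simp
 have kk: "(LINT x|M1. w x * aabs e (green_fun \<Omega> G f x)) \<le> (LINT x|M1. f x * (asgn e (green_fun \<Omega> G f x) * green_fun \<Omega> G w x))"
  by (rule EF.kato_L2[OF fL g1(1) wL g1(2) _ e]) (simp add: gw w_nonneg b_nonneg)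
 have Pm[measurable]: "P m f \<in> borel_measurable M1"
 proof -
  have "integrable m f"
   using f(2) by (intro finite_measure.integrable_const_bound[OF fin, of _ C]) (auto simp: sets_m borel_measurable_m)
  from P_int[OF adm_m this] show ?thesis by (simp add: borel_measurable_m[symmetric])
 qed
 have [measurable]: "b \<in> borel_measurable M1" using b_measurable[OF adm_m] by (simp add: borel_measurable_m)
 have "(LINT x|m. aabs e (P m f x)) = (LINT x|M1. w x * aabs e (green_fun \<Omega> G f x))"
  by (subst integral_m, measurable) (auto intro!: LINT_cong simp: green_fun_eq_P(1)[OF fm] mult.commute)
 moreover have "(LINT x|m. asgn e (P m f x) * (f x * b x)) = (LINT x|M1. f x * (asgn e (green_fun \<Omega> G f x) * green_fun \<Omega> G w x))"
  by (subst integral_m, measurable) (auto intro!: LINT_cong simp: green_fun_eq_P(1)[OF fm] gw mult_ac)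
 ultimately show ?thesis using kk by simp
qed

end

section \<open>Mollification of measures at the scale of the boundary distance\<close>

context green_setting begin

lemma K_measurable_comp[measurable (raw)]:
 "f \<in> M \<rightarrow>\<^sub>M borel ==> g \<in> M \<rightarrow>\<^sub>M borel ==> (\<lambda>z. K (f z) (g z)) \<in> borel_measurable M"
 by (rule measurable_Pair_compose_split[OF K_measurable])

lemma G_continuous: "continuous_on (off_diag \<Omega>) (\<lambda>(x, y). G x y)"
 using G2 by (simp add: cond_G2_def)

lemma K_tendsto:
 assumes x: "x \<in> \<Omega>" and y: "y \<in> \<Omega>" "x \<noteq> y" and X: "X \<longlonglongrightarrow> x" "Y \<longlonglongrightarrow> y"
 shows "(\<lambda>k. K (X k) (Y k)) \<longlonglongrightarrow> K x y"
proof -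
 have ev: "\<forall>\<^sub>F k in sequentially. X k \<in> \<Omega> \<and> Y k \<in> \<Omega> \<and> X k \<noteq> Y k"
 proof (intro eventually_conj)
  show "\<forall>\<^sub>F k in sequentially. X k \<in> \<Omega>" by (rule topological_tendstoD[OF X(1) op x])
  show "\<forall>\<^sub>F k in sequentially. Y k \<in> \<Omega>" by (rule topological_tendstoD[OF X(2) op y(1)])
  have "(\<lambda>k. norm (X k - Y k)) \<longlonglongrightarrow> norm (x - y)" by (intro tendsto_intros X)
  then have "\<forall>\<^sub>F k in sequentially. norm (X k - Y k) > 0" by (rule order_tendstoD) (use y in auto)
  then show "\<forall>\<^sub>F k in sequentially. X k \<noteq> Y k" by eventually_elim auto
 qed
 have "(\<lambda>k. (\<lambda>(x, y). G x y) (X k, Y k)) \<longlonglongrightarrow> (\<lambda>(x, y). G x y) (x, y)"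
  by (rule continuous_on_tendsto_compose[OF G_continuous tendsto_Pair[OF X]])
   (use x y ev in \<open>auto elim!: eventually_mono\<close>)
 then have l: "(\<lambda>k. G (X k) (Y k)) \<longlonglongrightarrow> K x y" using x y by (simp add: K_def)
 show ?thesis by (rule Lim_transform_eventually[OF l]) (use ev in eventually_elim, simp add: K_def)
qed

text \<open>The singularity moves with the base point. After a translation it sits at the origin,
  where one Riesz kernel dominates all terms.\<close>

lemma rho_tendsto:
 assumes y: "y \<in> \<Omega>" and X: "\<And>k. X k \<in> \<Omega>" "X \<longlonglongrightarrow> y"
 shows "(\<lambda>k. \<integral>\<^sup>+x. ennreal (K x (X k) * w x) \<partial>lborel) \<longlonglongrightarrow> (\<integral>\<^sup>+x. ennreal (K x y * w x) \<partial>lborel)"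
proof -
 have tr: "(\<integral>\<^sup>+x. ennreal (K x v * w x) \<partial>lborel) = (\<integral>\<^sup>+z. ennreal (K (v + z) v * w (v + z)) \<partial>lborel)" for v
  using nn_integral_lborel_affine[of "\<lambda>x. ennreal (K x v * w x)" 1 v] by simp
 show ?thesis unfolding tr
 proof (rule nn_integral_dominated_convergence[where w="\<lambda>z. ennreal (c * 2 powr \<gamma> * D powr \<gamma>) * ennreal (riesz z)"])
  show "AE z in lborel. ennreal (K (X j + z) (X j) * w (X j + z)) \<le> ennreal (c * 2 powr \<gamma> * D powr \<gamma>) * ennreal (riesz z)" for j
  proof (rule AE_I2)
   fix z
   have "K (X j + z) (X j) * w (X j + z) \<le> c * 2 powr \<gamma> * w (X j) * riesz (X j + z - X j)" by (rule K_weight[OF X(1)])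
   also have "... \<le> c * 2 powr \<gamma> * D powr \<gamma> * riesz z"
    using c0 riesz_nonneg w_le[OF X(1)] w_nonneg by (intro mult_mono) auto
   finally show "ennreal (K (X j + z) (X j) * w (X j + z)) \<le> ennreal (c * 2 powr \<gamma> * D powr \<gamma>) * ennreal (riesz z)"
    using c0 riesz_nonneg[of z] by (simp add: ennreal_mult[symmetric] ennreal_leI)
  qed
  have "(\<integral>\<^sup>+z. ennreal (riesz z) \<partial>lborel) = ennreal (LINT z|lborel. riesz z)"
   by (rule nn_integral_eq_integral[OF riesz_integrable]) (auto simp: riesz_nonneg)
  then show "(\<integral>\<^sup>+z. ennreal (c * 2 powr \<gamma> * D powr \<gamma>) * ennreal (riesz z) \<partial>lborel) < \<infinity>"
   by (subst nn_integral_cmult) (auto simp: ennreal_mult_less_top)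
  show "AE z in lborel. (\<lambda>j. ennreal (K (X j + z) (X j) * w (X j + z))) \<longlonglongrightarrow> ennreal (K (y + z) y * w (y + z))"
   using AE_lborel_singleton[of 0]
  proof eventually_elim
   case (elim z)
   have Xz: "(\<lambda>j. X j + z) \<longlonglongrightarrow> y + z" by (intro tendsto_intros X)
   have wl: "(\<lambda>j. w (X j + z)) \<longlonglongrightarrow> w (y + z)"
    by (rule continuous_on_tendsto_compose[OF w_continuous Xz]) auto
   show ?case
   proof (cases "y + z \<in> \<Omega>")
    case True
    show ?thesis by (intro tendsto_ennrealI tendsto_mult wl K_tendsto[OF True y _ Xz X(2)]) (use elim in auto)
   next
    case False
    \<comment> \<open>When the limit point y + z is outside \<Omega>, the kernel itself is merely
      bounded by the Riesz kernel, but the weight tends to 0 by continuity.\<close>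
    have "(\<lambda>j. c * riesz z * w (X j + z)) \<longlonglongrightarrow> c * riesz z * w (y + z)" by (intro tendsto_intros wl)
    then have l: "(\<lambda>j. c * riesz z * w (X j + z)) \<longlonglongrightarrow> 0" using w_outside[OF False] by simp
    have "(\<lambda>j. K (X j + z) (X j) * w (X j + z)) \<longlonglongrightarrow> 0"
    proof (rule tendsto_sandwich[OF _ _ tendsto_const l]; intro always_eventually allI)
     show "0 \<le> K (X j + z) (X j) * w (X j + z)" for j by (intro mult_nonneg_nonneg K_nonneg w_nonneg)
     show "K (X j + z) (X j) * w (X j + z) \<le> c * riesz z * w (X j + z)" for j
      using K_le[of "X j + z" "X j"] w_nonneg by (intro mult_right_mono) auto
    qed
    from tendsto_ennrealI[OF this] show ?thesis using w_outside[OF False] by simp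
   qed
  qed
 qed measurable
qed

text \<open>The L^1(m) distance between two columns of the Green function.\<close>

definition om :: "'a => 'a => ennreal" where
 "om x' y = (\<integral>\<^sup>+x. ennreal (\<bar>K x x' - K x y\<bar> * w x) \<partial>lborel)"

lemma nn_M1_lborel:
 "(\<integral>\<^sup>+x. ennreal (K x y * w x) \<partial>lborel) = (\<integral>\<^sup>+x. ennreal (K x y * w x) \<partial>M1)"
 by (subst nn_integral_M1) (auto intro!: nn_integral_cong simp: indicator_def w_outside)

lemma K_w_integrable: "y \<in> \<Omega> ==> integrable lborel (\<lambda>x. K x y * w x)"
 using K_w_nn(1)[of y] K_nonneg w_nonneg unfolding nn_M1_lborel[symmetric]
 by (intro integrableI_nonneg) (auto intro: le_less_trans)

text \<open>Scheffe's lemma: the columns converge pointwise off one point by joint continuity of G,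
  and their masses converge by \<open>rho_tendsto\<close>.\<close>

lemma om_tendsto:
 assumes y: "y \<in> \<Omega>" and X: "\<And>k. X k \<in> \<Omega>" "X \<longlonglongrightarrow> y"
 shows "(\<lambda>k. om (X k) y) \<longlonglongrightarrow> 0"
proof -
 have "(\<lambda>k. \<integral>\<^sup>+x. norm (K x (X k) * w x - K x y * w x) \<partial>lborel) \<longlonglongrightarrow> 0"
 proof (rule Scheffe_lemma1)
  show "integrable lborel (\<lambda>x. K x (X k) * w x)" "integrable lborel (\<lambda>x. K x y * w x)" for k
   by (rule K_w_integrable, fact)+
  show "AE x in lborel. (\<lambda>k. K x (X k) * w x) \<longlonglongrightarrow> K x y * w x"
   using AE_lborel_singleton[of y]
  proof eventually_elim
   case (elim x)
   show ?case
   proof (cases "x \<in> \<Omega>")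
    case True
    show ?thesis by (intro tendsto_mult tendsto_const K_tendsto[OF True y] X(2)) (use elim in auto)
   qed (simp add: w_outside)
  qed
  have "limsup (\<lambda>k. \<integral>\<^sup>+x. ennreal (K x (X k) * w x) \<partial>lborel) = (\<integral>\<^sup>+x. ennreal (K x y * w x) \<partial>lborel)"
   by (rule lim_imp_Limsup[OF _ rho_tendsto[OF y X]]) simp
  then show "limsup (\<lambda>k. \<integral>\<^sup>+x. ennreal (norm (K x (X k) * w x)) \<partial>lborel) \<le> (\<integral>\<^sup>+x. ennreal (norm (K x y * w x)) \<partial>lborel)"
   using K_nonneg w_nonneg by simp
 qed
 moreover have "norm (K x (X k) * w x - K x y * w x) = \<bar>K x (X k) - K x y\<bar> * w x" for x k
  using w_nonneg[of x] by (simp add: left_diff_distrib[symmetric] abs_mult)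
 ultimately show ?thesis by (simp add: om_def)
qed

lemma om_small:
 assumes y: "y \<in> \<Omega>" and e: "e > 0"
 shows "\<exists>r>0. \<forall>x'\<in>\<Omega>. dist y x' < r \<longrightarrow> om x' y \<le> ennreal e"
proof (rule ccontr)
 assume "\<not> ?thesis"
 then have "\<exists>x'\<in>\<Omega>. dist y x' < 1 / real (Suc n) \<and> \<not> om x' y \<le> ennreal e" for n by force
 then obtain X where X: "\<And>n. X n \<in> \<Omega>" "\<And>n. dist y (X n) < 1 / real (Suc n)" "\<And>n. \<not> om (X n) y \<le> ennreal e"
  by metis
 have "X \<longlonglongrightarrow> y"
 proof (rule metric_LIMSEQ_I)
  fix r :: real assume "r > 0"
  then obtain N where N: "inverse (real (Suc N)) < r" using reals_Archimedean by blast
  have "dist (X n) y < r" if "n \<ge> N" for n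
  proof -
   have "1 / real (Suc n) \<le> inverse (real (Suc N))" using that by (simp add: field_simps)
   then show ?thesis using X(2)[of n] N by (simp add: dist_commute)
  qed
  then show "\<exists>no. \<forall>n\<ge>no. dist (X n) y < r" by blast
 qed
 from om_tendsto[OF y X(1) this] have "\<forall>\<^sub>F n in sequentially. om (X n) y < ennreal e"
  by (rule order_tendstoD) (use e in simp)
 then obtain n where "om (X n) y < ennreal e" by (auto simp: eventually_sequentially)
 then show False using X(3)[of n] by simp
qed

lemma om_bound:
 assumes "x' \<in> \<Omega>" "y \<in> \<Omega>" shows "om x' y \<le> ennreal (Lc * (w x' + w y))"
proof -
 have "om x' y \<le> (\<integral>\<^sup>+x. ennreal (K x x' * w x) + ennreal (K x y * w x) \<partial>lborel)"
  unfolding om_def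
 proof (rule nn_integral_mono)
  fix x
  have "\<bar>K x x' - K x y\<bar> * w x \<le> (K x x' + K x y) * w x"
   using K_nonneg[of x x'] K_nonneg[of x y] w_nonneg by (intro mult_right_mono) auto
  then show "ennreal (\<bar>K x x' - K x y\<bar> * w x) \<le> ennreal (K x x' * w x) + ennreal (K x y * w x)"
   using K_nonneg w_nonneg by (subst ennreal_plus[symmetric]) (auto simp: distrib_right intro: ennreal_leI simp del: ennreal_plus)
 qed
 also have "... = (\<integral>\<^sup>+x. ennreal (K x x' * w x) \<partial>lborel) + (\<integral>\<^sup>+x. ennreal (K x y * w x) \<partial>lborel)"
  by (rule nn_integral_add) measurable
 also have "... \<le> ennreal (Lc * w x') + ennreal (Lc * w y)"
  unfolding nn_M1_lborel by (intro add_mono K_w_nn assms)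
 also have "... = ennreal (Lc * (w x' + w y))"
  using Lc_pos w_nonneg by (subst ennreal_plus[symmetric]) (auto simp: distrib_left simp del: ennreal_plus)
 finally show ?thesis .
qed

lemma om_measurable[measurable (raw)]:
 assumes "f \<in> M \<rightarrow>\<^sub>M borel" "g \<in> M \<rightarrow>\<^sub>M borel"
 shows "(\<lambda>z. om (f z) (g z)) \<in> borel_measurable M"
proof (rule measurable_Pair_compose_split[OF _ assms])
 show "(\<lambda>(x', y). om x' y) \<in> borel_measurable (borel \<Otimes>\<^sub>M borel)" unfolding om_def by measurable
qed

text \<open>At most half the distance to the complement, so that the mollifying ball stays inside
  \<Omega> and the weight at most doubles on it; it tends to 0 at each point as \<open>j\<close>
  grows.\<close>

definition rad :: "nat => 'a => real" where "rad j y = \<delta> y / (real j + 2)"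

definition mol :: "nat => 'a => 'a => real" where
 "mol j x y = (if dist y x < rad j y then 1 / (unit_ball_vol (real DIM('a)) * rad j y ^ DIM('a)) else 0)"

lemma \<delta>_measurable[measurable]: "\<delta> \<in> borel_measurable borel"
 by (rule borel_measurable_continuous_onI[OF \<delta>_continuous])

lemma mol_measurable[measurable (raw)]:
 assumes [measurable]: "f \<in> M \<rightarrow>\<^sub>M borel" "g \<in> M \<rightarrow>\<^sub>M borel"
 shows "(\<lambda>z. mol j (f z) (g z)) \<in> borel_measurable M"
 unfolding mol_def rad_def by measurable

lemma mol_nonneg: "0 \<le> mol j x y"
 unfolding mol_def rad_def using \<delta>_nonneg[of y] by (auto intro!: divide_nonneg_nonneg mult_nonneg_nonneg zero_le_power)

lemma mol_support:
 assumes y: "y \<in> \<Omega>" and d: "dist y x < rad j y"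
 shows "x \<in> \<Omega>" "w x \<le> 2 * w y"
proof -
 have p: "\<delta> y > 0" by (rule \<delta>_pos[OF y])
 have r: "rad j y \<le> \<delta> y / 2" unfolding rad_def using p by (intro divide_left_mono) auto
 have "\<delta> y \<le> \<delta> x + norm (y - x)" by (rule \<delta>_Lipschitz)
 then have "\<delta> x > 0" using d r p by (simp add: dist_norm)
 then show "x \<in> \<Omega>" using \<delta>_outside[of x] by force
 have "\<delta> x \<le> \<delta> y + norm (x - y)" by (rule \<delta>_Lipschitz)
 then have "\<delta> x \<le> 2 * \<delta> y" using d r p by (simp add: dist_norm norm_minus_commute)
 then have "w x \<le> (2 * \<delta> y) powr \<gamma>" unfolding w_def using \<delta>_nonneg g0 by (intro powr_mono2) auto
 also have "... = 2 powr \<gamma> * w y" unfolding w_def using p by (simp add: powr_mult)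
 also have "... \<le> 2 powr 1 * w y" using g1 w_nonneg by (intro mult_right_mono powr_mono) auto
 finally show "w x \<le> 2 * w y" by simp
qed

lemma mol_integral:
 assumes y: "y \<in> \<Omega>" shows "(\<integral>\<^sup>+x. ennreal (mol j x y) \<partial>lborel) = 1"
proof -
 let ?V = "unit_ball_vol (real DIM('a)) * rad j y ^ DIM('a)"
 have r: "rad j y > 0" using \<delta>_pos[OF y] by (simp add: rad_def)
 have V: "?V > 0" using r by (intro mult_pos_pos zero_less_power) auto
 have "(\<integral>\<^sup>+x. ennreal (mol j x y) \<partial>lborel) = (\<integral>\<^sup>+x. ennreal (1 / ?V) * indicator (ball y (rad j y)) x \<partial>lborel)"
  by (intro nn_integral_cong) (auto simp: mol_def indicator_def)
 also have "... = ennreal (1 / ?V) * emeasure lborel (ball y (rad j y))" by (rule nn_integral_cmult_indicator) simp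
 also have "emeasure lborel (ball y (rad j y)) = ennreal ?V"
  using emeasure_lborel_ball_finite[of y "rad j y"] content_ball[of "rad j y" y] r
  by (subst emeasure_eq_ennreal_measure) auto
 also have "ennreal (1 / ?V) * ennreal ?V = ennreal (1 / ?V * ?V)" using V by (intro ennreal_mult[symmetric]) auto
 also have "1 / x * x = 1" if "x > 0" for x :: real using that by simp
 note this[OF V]
 finally show ?thesis by simp
qed

text \<open>\<open>f j\<close> spreads each point mass over its ball and divides by the weight at
  the centre. \<open>R j\<close> is the error of replacing K(x,x') by K(x,y) on that ball. Its
  weighted integral averages \<open>om\<close>, and it vanishes by dominated convergence, with bound
  3 Lc since the weight at most doubles.\<close>

lemma smoothing_borel:
 assumes N: "finite_measure N" "sets N = sets borel" "AE y in N. y \<in> \<Omega>"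
 defines "f \<equiv> \<lambda>j x. \<integral>\<^sup>+y. ennreal (mol j x y / w y) \<partial>N"
  and "R \<equiv> \<lambda>j x. \<integral>\<^sup>+y. (\<integral>\<^sup>+x'. ennreal (\<bar>K x x' - K x y\<bar> * (mol j x' y / w y)) \<partial>lborel) \<partial>N"
 shows "f j \<in> borel_measurable borel" "R j \<in> borel_measurable borel"
  and "(\<integral>\<^sup>+x. f j x * ennreal (w x) \<partial>lborel) \<le> 2 * emeasure N (space N)"
  and "(\<integral>\<^sup>+x'. ennreal (K x x') * f j x' \<partial>lborel) \<le> (\<integral>\<^sup>+y. ennreal (k x y) \<partial>N) + R j x"
  and "(\<integral>\<^sup>+y. ennreal (k x y) \<partial>N) \<le> (\<integral>\<^sup>+x'. ennreal (K x x') * f j x' \<partial>lborel) + R j x"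
  and "(\<lambda>j. \<integral>\<^sup>+x. R j x * ennreal (w x) \<partial>lborel) \<longlonglongrightarrow> 0"
proof -
 interpret N: finite_measure N by (rule N)
 interpret NP: pair_sigma_finite lborel N ..
 note [measurable_cong] = N(2)
 have [measurable]: "(\<lambda>x. x) \<in> N \<rightarrow>\<^sub>M borel" using N(2) by (simp add: measurable_cong_sets[OF N(2) refl])
 let ?m = "\<lambda>j x y. mol j x y / w y" and ?r = "\<lambda>x x' y. \<bar>K x x' - K x y\<bar>"
 show fm[measurable]: "f j \<in> borel_measurable borel" for j unfolding f_def by measurable
 show Rm[measurable]: "R j \<in> borel_measurable borel" for j unfolding R_def by measurable
 have "(\<integral>\<^sup>+x. f j x * ennreal (w x) \<partial>lborel) = (\<integral>\<^sup>+x. (\<integral>\<^sup>+y. ennreal (?m j x y) * ennreal (w x) \<partial>N) \<partial>lborel)"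
  unfolding f_def by (subst nn_integral_multc) auto
 also have "... = (\<integral>\<^sup>+y. (\<integral>\<^sup>+x. ennreal (?m j x y) * ennreal (w x) \<partial>lborel) \<partial>N)"
  by (rule NP.Fubini'[symmetric]) measurable
 also have "... \<le> (\<integral>\<^sup>+y. 2 \<partial>N)"
 proof (rule nn_integral_mono_AE)
  show "AE y in N. (\<integral>\<^sup>+x. ennreal (?m j x y) * ennreal (w x) \<partial>lborel) \<le> 2"
   using N(3)
  proof eventually_elim
   case (elim y)
   have "(\<integral>\<^sup>+x. ennreal (?m j x y) * ennreal (w x) \<partial>lborel) \<le> (\<integral>\<^sup>+x. 2 * ennreal (mol j x y) \<partial>lborel)"
   proof (rule nn_integral_mono)
    fix x
    show "ennreal (?m j x y) * ennreal (w x) \<le> 2 * ennreal (mol j x y)"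
    proof (cases "dist y x < rad j y")
     case True
     have "?m j x y * w x \<le> ?m j x y * (2 * w y)"
      by (intro mult_left_mono mol_support[OF elim True] divide_nonneg_nonneg mol_nonneg w_nonneg)
     also have "... = 2 * mol j x y" using w_pos[OF elim] by simp
     finally have "ennreal (?m j x y * w x) \<le> ennreal (2 * mol j x y)" by (rule ennreal_leI)
     then show ?thesis
      by (subst (asm) (1 2) ennreal_mult) (auto intro: mol_nonneg w_nonneg divide_nonneg_nonneg)
    qed (simp add: mol_def)
   qed
   also have "... = 2" by (subst nn_integral_cmult) (auto simp: mol_integral[OF elim])
   finally show ?case .
  qed
 qed
 also have "... = 2 * emeasure N (space N)" by simp
 finally show "(\<integral>\<^sup>+x. f j x * ennreal (w x) \<partial>lborel) \<le> 2 * emeasure N (space N)" .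
 have A: "(\<integral>\<^sup>+x'. ennreal (K x x') * f j x' \<partial>lborel) = (\<integral>\<^sup>+y. (\<integral>\<^sup>+x'. ennreal (K x x' * (?m j x' y)) \<partial>lborel) \<partial>N)" for x j
 proof -
  have "(\<integral>\<^sup>+x'. ennreal (K x x') * f j x' \<partial>lborel) = (\<integral>\<^sup>+x'. (\<integral>\<^sup>+y. ennreal (K x x') * ennreal (?m j x' y) \<partial>N) \<partial>lborel)"
   unfolding f_def by (subst nn_integral_cmult) auto
  also have "... = (\<integral>\<^sup>+y. (\<integral>\<^sup>+x'. ennreal (K x x') * ennreal (?m j x' y) \<partial>lborel) \<partial>N)"
   by (rule NP.Fubini'[symmetric]) measurable
  also have "... = (\<integral>\<^sup>+y. (\<integral>\<^sup>+x'. ennreal (K x x' * (?m j x' y)) \<partial>lborel) \<partial>N)"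
   by (intro nn_integral_cong ennreal_mult[symmetric] K_nonneg divide_nonneg_nonneg mol_nonneg w_nonneg)
  finally show ?thesis .
 qed
 have B: "(\<integral>\<^sup>+y. ennreal (k x y) \<partial>N) = (\<integral>\<^sup>+y. (\<integral>\<^sup>+x'. ennreal (K x y * (?m j x' y)) \<partial>lborel) \<partial>N)" for x j
 proof (rule nn_integral_cong_AE)
  show "AE y in N. ennreal (k x y) = (\<integral>\<^sup>+x'. ennreal (K x y * (?m j x' y)) \<partial>lborel)"
   using N(3)
  proof eventually_elim
   case (elim y)
   have "(\<integral>\<^sup>+x'. ennreal (K x y * (?m j x' y)) \<partial>lborel) = (\<integral>\<^sup>+x'. ennreal (k x y) * ennreal (mol j x' y) \<partial>lborel)"
    using k_nonneg[of x y] mol_nonneg by (intro nn_integral_cong) (simp add: ennreal_mult[symmetric] k_def)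
   also have "... = ennreal (k x y)" by (subst nn_integral_cmult) (auto simp: mol_integral[OF elim])
   finally show ?case by simp
  qed
 qed
 \<comment> \<open>Covers both one-sided comparisons: \<open>p\<close> and \<open>q\<close> are the
   kernel at the mollified point and at the centre, in either order.\<close>
 have tri: "(\<integral>\<^sup>+y. (\<integral>\<^sup>+x'. ennreal (p x' y * (?m j x' y)) \<partial>lborel) \<partial>N)
  \<le> (\<integral>\<^sup>+y. (\<integral>\<^sup>+x'. ennreal (q x' y * (?m j x' y)) \<partial>lborel) \<partial>N) + R j x"
  if "\<And>x' y. p x' y \<le> q x' y + ?r x x' y" "\<And>x' y. 0 \<le> q x' y"
   and [measurable]: "(\<lambda>(x', y). q x' y) \<in> borel_measurable (borel \<Otimes>\<^sub>M borel)" for p q x j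
 proof -
  have qm: "(\<lambda>(y, x'). q x' y) \<in> borel_measurable (N \<Otimes>\<^sub>M lborel)"
   unfolding case_prod_beta by (rule measurable_Pair_compose_split[OF that(3)]) measurable
  have qm': "(\<lambda>x'. q x' y) \<in> borel_measurable borel" for y
   using measurable_Pair1[OF that(3), of y] by simp
  note [measurable] = qm qm'
  have "(\<integral>\<^sup>+y. (\<integral>\<^sup>+x'. ennreal (p x' y * (?m j x' y)) \<partial>lborel) \<partial>N)
   \<le> (\<integral>\<^sup>+y. (\<integral>\<^sup>+x'. ennreal (q x' y * (?m j x' y)) \<partial>lborel) + (\<integral>\<^sup>+x'. ennreal (?r x x' y * (?m j x' y)) \<partial>lborel) \<partial>N)"
  proof (rule nn_integral_mono)
   fix y
   have nn: "0 \<le> ?m j x' y" for x' by (intro divide_nonneg_nonneg mol_nonneg w_nonneg)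
   have "(\<integral>\<^sup>+x'. ennreal (p x' y * (?m j x' y)) \<partial>lborel)
    \<le> (\<integral>\<^sup>+x'. ennreal (q x' y * (?m j x' y)) + ennreal (?r x x' y * (?m j x' y)) \<partial>lborel)"
   proof (rule nn_integral_mono)
    fix x'
    have "p x' y * (?m j x' y) \<le> (q x' y + ?r x x' y) * (?m j x' y)"
     by (intro mult_right_mono that nn)
    then have "ennreal (p x' y * (?m j x' y)) \<le> ennreal (q x' y * (?m j x' y) + ?r x x' y * (?m j x' y))"
     by (intro ennreal_leI) (simp only: distrib_right)
    also have "... = ennreal (q x' y * (?m j x' y)) + ennreal (?r x x' y * (?m j x' y))"
     by (intro ennreal_plus mult_nonneg_nonneg nn that) auto
    finally show "ennreal (p x' y * (?m j x' y)) \<le> ennreal (q x' y * (?m j x' y)) + ennreal (?r x x' y * (?m j x' y))" .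
   qed
   also have "... = (\<integral>\<^sup>+x'. ennreal (q x' y * (?m j x' y)) \<partial>lborel) + (\<integral>\<^sup>+x'. ennreal (?r x x' y * (?m j x' y)) \<partial>lborel)"
    by (rule nn_integral_add) measurable
   finally show "(\<integral>\<^sup>+x'. ennreal (p x' y * (?m j x' y)) \<partial>lborel)
    \<le> (\<integral>\<^sup>+x'. ennreal (q x' y * (?m j x' y)) \<partial>lborel) + (\<integral>\<^sup>+x'. ennreal (?r x x' y * (?m j x' y)) \<partial>lborel)" .
  qed
  also have "... = (\<integral>\<^sup>+y. (\<integral>\<^sup>+x'. ennreal (q x' y * (?m j x' y)) \<partial>lborel) \<partial>N) + R j x"
   unfolding R_def by (rule nn_integral_add) (measurable)
  finally show ?thesis .
 qed
 show "(\<integral>\<^sup>+x'. ennreal (K x x') * f j x' \<partial>lborel) \<le> (\<integral>\<^sup>+y. ennreal (k x y) \<partial>N) + R j x"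
  unfolding A B[of x j] by (rule tri) (auto simp: K_nonneg)
 show "(\<integral>\<^sup>+y. ennreal (k x y) \<partial>N) \<le> (\<integral>\<^sup>+x'. ennreal (K x x') * f j x' \<partial>lborel) + R j x"
  unfolding A B[of x j] by (rule tri) (auto simp: K_nonneg)
 define e where "e j y = (\<integral>\<^sup>+x'. om x' y * ennreal (?m j x' y) \<partial>lborel)" for j y
 have em[measurable]: "e j \<in> borel_measurable N" for j unfolding e_def by measurable
 have Re: "(\<integral>\<^sup>+x. R j x * ennreal (w x) \<partial>lborel) = (\<integral>\<^sup>+y. e j y \<partial>N)" for j
 proof -
  have "(\<integral>\<^sup>+x. R j x * ennreal (w x) \<partial>lborel) = (\<integral>\<^sup>+x. (\<integral>\<^sup>+y. (\<integral>\<^sup>+x'. ennreal (?r x x' y * (?m j x' y)) \<partial>lborel) * ennreal (w x) \<partial>N) \<partial>lborel)"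
   unfolding R_def by (intro nn_integral_cong, subst nn_integral_multc) auto
  also have "... = (\<integral>\<^sup>+y. (\<integral>\<^sup>+x. (\<integral>\<^sup>+x'. ennreal (?r x x' y * (?m j x' y)) \<partial>lborel) * ennreal (w x) \<partial>lborel) \<partial>N)"
   by (rule NP.Fubini'[symmetric]) measurable
  also have "... = (\<integral>\<^sup>+y. e j y \<partial>N)"
  proof (rule nn_integral_cong)
   fix y
   have nn: "0 \<le> ?m j x' y" for x' by (intro divide_nonneg_nonneg mol_nonneg w_nonneg)
   have "(\<integral>\<^sup>+x. (\<integral>\<^sup>+x'. ennreal (?r x x' y * (?m j x' y)) \<partial>lborel) * ennreal (w x) \<partial>lborel)
    = (\<integral>\<^sup>+x. (\<integral>\<^sup>+x'. ennreal (?r x x' y * (?m j x' y)) * ennreal (w x) \<partial>lborel) \<partial>lborel)"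
    by (intro nn_integral_cong, subst nn_integral_multc) auto
   also have "... = (\<integral>\<^sup>+x'. (\<integral>\<^sup>+x. ennreal (?r x x' y * (?m j x' y)) * ennreal (w x) \<partial>lborel) \<partial>lborel)"
    by (rule lborel_pair.Fubini') measurable
   also have "... = (\<integral>\<^sup>+x'. (\<integral>\<^sup>+x. ennreal (?r x x' y * w x) * ennreal (?m j x' y) \<partial>lborel) \<partial>lborel)"
    using nn w_nonneg by (intro nn_integral_cong, subst (1 2) ennreal_mult[symmetric]) (auto simp only: mult_ac intro: mult_nonneg_nonneg)
   also have "... = e j y"
    unfolding e_def om_def by (intro nn_integral_cong, subst nn_integral_multc) auto
   finally show "(\<integral>\<^sup>+x. (\<integral>\<^sup>+x'. ennreal (?r x x' y * (?m j x' y)) \<partial>lborel) * ennreal (w x) \<partial>lborel) = e j y" .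
  qed
  finally show ?thesis .
 qed
 have e_le: "e j y \<le> ennreal C" if y: "y \<in> \<Omega>" and C: "\<And>x'. dist y x' < rad j y ==> om x' y \<le> ennreal (C * w y)" "0 \<le> C" for j y C
 proof -
  have "e j y \<le> (\<integral>\<^sup>+x'. ennreal C * ennreal (mol j x' y) \<partial>lborel)"
   unfolding e_def
  proof (rule nn_integral_mono)
   fix x'
   show "om x' y * ennreal (?m j x' y) \<le> ennreal C * ennreal (mol j x' y)"
   proof (cases "dist y x' < rad j y")
    case True
    have "om x' y * ennreal (?m j x' y) \<le> ennreal (C * w y) * ennreal (?m j x' y)"
     by (intro mult_right_mono C True) auto
    also have "... = ennreal (C * w y * (?m j x' y))"
     by (intro ennreal_mult[symmetric] mult_nonneg_nonneg C w_nonneg divide_nonneg_nonneg mol_nonneg)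
    also have "C * w y * (?m j x' y) = C * mol j x' y" using w_pos[OF y] by simp
    finally show ?thesis by (simp add: ennreal_mult C mol_nonneg)
   qed (simp add: mol_def)
  qed
  also have "... = ennreal C" by (subst nn_integral_cmult) (auto simp: mol_integral[OF y])
  finally show ?thesis .
 qed
 have "(\<lambda>j. \<integral>\<^sup>+y. e j y \<partial>N) \<longlonglongrightarrow> (\<integral>\<^sup>+y. 0 \<partial>N)"
 proof (rule nn_integral_dominated_convergence[where w="\<lambda>_. ennreal (Lc * 3)"])
  show "AE y in N. e j y \<le> ennreal (Lc * 3)" for j
   using N(3)
  proof eventually_elim
   case (elim y)
   show ?case
   proof (rule e_le[OF elim])
    fix x' assume d: "dist y x' < rad j y"
    have "om x' y \<le> ennreal (Lc * (w x' + w y))" by (rule om_bound[OF mol_support(1)[OF elim d] elim])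
    also have "... \<le> ennreal (Lc * 3 * w y)"
     using mol_support(2)[OF elim d] Lc_pos by (intro ennreal_leI) (simp add: mult.assoc)
    finally show "om x' y \<le> ennreal (Lc * 3 * w y)" .
   qed (use Lc_pos in simp)
  qed
  show "(\<integral>\<^sup>+y. ennreal (Lc * 3) \<partial>N) < \<infinity>" using N.emeasure_finite[of "space N"] by (simp add: ennreal_mult_less_top less_top[symmetric] ennreal_mult_eq_top_iff)
  show "AE y in N. (\<lambda>j. e j y) \<longlonglongrightarrow> 0"
   using N(3)
  proof eventually_elim
   case (elim y)
   show ?case
   proof (rule order_tendstoI)
    fix a :: ennreal assume a: "0 < a"
    obtain t where t: "0 < t" "ennreal t < a"
    proof (cases a)
     case (real u)
     then show ?thesis using a that[of "u / 2"] by (simp add: ennreal_less_iff)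
    qed (use that[of 1] in simp)
    have "t * w y > 0" using t w_pos[OF elim] by simp
    from om_small[OF elim this] obtain r where r: "r > 0" "\<And>x'. x' \<in> \<Omega> ==> dist y x' < r ==> om x' y \<le> ennreal (t * w y)" by blast
    \<comment> \<open>From this index on, the mollifying radius at y is at most r, where the columns
      are close.\<close>
    obtain n :: nat where n: "\<delta> y / r < n" using reals_Archimedean2 by blast
    have "e j y < a" if "j \<ge> n" for j
    proof -
     have "rad j y \<le> r"
     proof -
      have "\<delta> y / r \<le> real j + 2" using n that by linarith
      then have "\<delta> y \<le> r * (real j + 2)" using r(1) by (simp add: field_simps)
      then show ?thesis unfolding rad_def by (simp add: divide_le_eq)
     qed
     then have "e j y \<le> ennreal t" using r(2) mol_support(1)[OF elim, of _ j] t by (intro e_le[OF elim]) force+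
     then show ?thesis using t by (rule_tac le_less_trans)
    qed
    then show "\<forall>\<^sub>F j in sequentially. e j y < a" by (auto simp: eventually_sequentially)
   qed auto
  qed
 qed measurable
 then show "(\<lambda>j. \<integral>\<^sup>+x. R j x * ennreal (w x) \<partial>lborel) \<longlonglongrightarrow> 0" unfolding Re by simp
qed

lemma nn_integral_m:
 assumes [measurable]: "f \<in> borel_measurable borel"
 shows "(\<integral>\<^sup>+x. f x \<partial>m) = (\<integral>\<^sup>+x. f x * ennreal (w x) \<partial>lborel)"
proof -
 have [measurable]: "f \<in> borel_measurable M1" using measurable_compose[OF id_M1 assms] by simp
 have "(\<integral>\<^sup>+x. f x \<partial>m) = (\<integral>\<^sup>+x. f x * ennreal (w x) \<partial>M1)"
  unfolding m_def by (subst nn_integral_density) (auto simp: mult.commute)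
 also have "... = (\<integral>\<^sup>+x. f x * ennreal (w x) \<partial>lborel)"
  by (subst nn_integral_M1) (auto intro!: nn_integral_cong simp: indicator_def w_outside)
 finally show ?thesis .
qed

lemma K_eq_k: "K x y = k x y * w y"
 unfolding k_def using w_pos[of y] by (auto simp: K_def)

lemma smoothing:
 assumes n: "adm n" and h: "integrable n h" and h0: "\<And>y. y \<in> \<Omega> ==> 0 \<le> h y"
 shows "\<exists>f. (\<forall>j. integrable m (f j) \<and> (\<forall>x\<in>\<Omega>. 0 \<le> f j x) \<and> (LINT x|m. f j x) \<le> 2 * (LINT y|n. h y)) \<and>
  (\<lambda>j. LINT x|m. \<bar>P m (f j) x - P n h x\<bar>) \<longlonglongrightarrow> 0"
proof -
 have ns: "space n = \<Omega>" and idn: "(\<lambda>x. x) \<in> n \<rightarrow>\<^sub>M borel" using n by (auto simp: adm_def)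
 have [measurable]: "h \<in> borel_measurable n" using h by auto
 let ?H = "\<integral>y. h y \<partial>n"
 have H0: "0 \<le> ?H" by (rule integral_nonneg_AE) (use h0 ns in \<open>auto intro!: AE_I2\<close>)
 \<comment> \<open>The weighted measure is pushed forward to the Borel sets of the whole space, on
   which the mollifier and the kernel are jointly measurable.\<close>
 define N where "N = distr (density n (\<lambda>y. ennreal (h y))) borel (\<lambda>x. x)"
 have idd: "(\<lambda>x. x) \<in> density n (\<lambda>y. ennreal (h y)) \<rightarrow>\<^sub>M borel" using idn by simp
 have Nnn: "(\<integral>\<^sup>+y. g y \<partial>N) = (\<integral>\<^sup>+y. ennreal (h y) * g y \<partial>n)" if g: "g \<in> borel_measurable borel" for g
 proof -
  have [measurable]: "g \<in> borel_measurable n" using measurable_compose[OF idn g] by simp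
  show ?thesis unfolding N_def by (subst nn_integral_distr[OF idd]) (use g in \<open>simp_all add: nn_integral_density\<close>)
 qed
 have Ns: "emeasure N (space N) = ennreal ?H"
 proof -
  have "emeasure N (space N) = (\<integral>\<^sup>+y. 1 \<partial>N)" by simp
  also have "... = (\<integral>\<^sup>+y. ennreal (h y) \<partial>n)" by (subst Nnn) auto
  also have "... = ennreal ?H" using h0 ns by (intro nn_integral_eq_integral h AE_I2) auto
  finally show ?thesis .
 qed
 have N1: "finite_measure N" by (rule finite_measureI) (simp add: Ns)
 have N2: "sets N = sets borel" by (simp add: N_def)
 have N3: "AE y in N. y \<in> \<Omega>"
  unfolding N_def using sets_\<Omega>(1) ns by (subst AE_distr_iff[OF idd]) (auto intro!: AE_I2)
 define F where "F j x = (\<integral>\<^sup>+y. ennreal (mol j x y / w y) \<partial>N)" for j x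
 define R where "R j x = (\<integral>\<^sup>+y. (\<integral>\<^sup>+x'. ennreal (\<bar>K x x' - K x y\<bar> * (mol j x' y / w y)) \<partial>lborel) \<partial>N)" for j x
 note S = smoothing_borel[OF N1 N2 N3, folded F_def R_def]
 have Fm[measurable]: "F j \<in> borel_measurable borel" and Rm[measurable]: "R j \<in> borel_measurable borel" for j
  using S(1)[of j] S(2)[of j] by simp_all
 have Fmm[measurable]: "F j \<in> borel_measurable m" for j using measurable_compose[OF idm Fm] by simp
 have Rmm[measurable]: "R j \<in> borel_measurable m" for j using measurable_compose[OF idm Rm] by simp
 have F2: "(\<integral>\<^sup>+x. F j x \<partial>m) \<le> ennreal (2 * ?H)" for j
  unfolding nn_integral_m[OF Fm] using S(3)[of j] H0 by (simp add: Ns ennreal_mult)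
 have Ffin: "AE x in m. F j x \<noteq> \<infinity>" for j
  by (rule nn_integral_PInf_AE[OF Fmm]) (use F2[of j] in \<open>auto simp: top_unique\<close>)
 \<comment> \<open>The mollified density may be infinite on a null set; there the real version takes
   the value 0.\<close>
 define f where "f j x = enn2real (F j x)" for j x
 have [measurable]: "f j \<in> borel_measurable m" for j unfolding f_def by measurable
 have fF: "AE x in m. ennreal (f j x) = F j x" for j
  using Ffin[of j] by eventually_elim (simp add: f_def less_top)
 have f1: "(\<integral>\<^sup>+x. ennreal (f j x) \<partial>m) \<le> ennreal (2 * ?H)" for j
  using nn_integral_cong_AE[OF fF[of j]] F2[of j] by simp
 have fi: "integrable m (f j)" for j
  by (rule integrableI_nonneg) (use f1[of j] in \<open>auto simp: f_def intro: le_less_trans\<close>)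
 have f2: "(LINT x|m. f j x) \<le> 2 * ?H" for j
 proof -
  have "ennreal (LINT x|m. f j x) = (\<integral>\<^sup>+x. ennreal (f j x) \<partial>m)"
   by (rule nn_integral_eq_integral[symmetric, OF fi]) (simp add: f_def)
  then have "ennreal (LINT x|m. f j x) \<le> ennreal (2 * ?H)" using f1[of j] by simp
  then show ?thesis by (rule ennreal_le_iff[THEN iffD1, rotated]) (use H0 in simp)
 qed
 have C: "AE x in m. ennreal \<bar>P m (f j) x - P n h x\<bar> \<le> R j x" for j
  using P_AE[OF adm_m fi[of j]] P_AE[OF n h]
 proof eventually_elim
  case (elim x)
  have [measurable]: "(\<lambda>y. ennreal (k x y)) \<in> borel_measurable borel"
   using measurable_compose[OF measurable_Pair[OF measurable_const measurable_ident] k_measurable_borel, of x] by simp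
  have [measurable]: "(\<lambda>y. ennreal (k x y)) \<in> borel_measurable m"
   using measurable_compose[OF idm \<open>(\<lambda>y. ennreal (k x y)) \<in> borel_measurable borel\<close>] by simp
  have p: "0 \<le> P m (f j) x" "0 \<le> P n h x"
   unfolding P_def using h0 ns k_nonneg by (auto intro!: integral_nonneg_AE AE_I2 simp: f_def)
  have "ennreal (P m (f j) x) = (\<integral>\<^sup>+y. ennreal (k x y * f j y) \<partial>m)"
   unfolding P_def using k_nonneg by (intro nn_integral_eq_integral[symmetric] elim) (auto simp: f_def)
  also have "... = (\<integral>\<^sup>+y. ennreal (k x y) * F j y \<partial>m)"
   by (rule nn_integral_cong_AE) (use fF[of j] in \<open>eventually_elim, simp add: k_nonneg ennreal_mult'\<close>)
  also have "... = (\<integral>\<^sup>+x'. ennreal (K x x') * F j x' \<partial>lborel)"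
   by (subst nn_integral_m) (auto simp: K_eq_k ennreal_mult k_nonneg w_nonneg mult_ac)
  finally have a: "ennreal (P m (f j) x) = (\<integral>\<^sup>+x'. ennreal (K x x') * F j x' \<partial>lborel)" .
  have "ennreal (P n h x) = (\<integral>\<^sup>+y. ennreal (k x y * h y) \<partial>n)"
   unfolding P_def using k_nonneg h0 ns by (intro nn_integral_eq_integral[symmetric] elim) (auto intro!: AE_I2)
  also have "... = (\<integral>\<^sup>+y. ennreal (k x y) \<partial>N)"
  proof (subst Nnn)
   show "(\<integral>\<^sup>+y. ennreal (k x y * h y) \<partial>n) = (\<integral>\<^sup>+y. ennreal (h y) * ennreal (k x y) \<partial>n)"
    using h0 by (intro nn_integral_cong) (simp add: ns ennreal_mult k_nonneg mult.commute)
  qed measurable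
  finally have b: "ennreal (P n h x) = (\<integral>\<^sup>+y. ennreal (k x y) \<partial>N)" .
  have "ennreal (P m (f j) x) \<le> ennreal (P n h x) + R j x" "ennreal (P n h x) \<le> ennreal (P m (f j) x) + R j x"
   unfolding a b by (rule S(4), rule S(5))
  then show ?case using p
   by (cases "R j x") (auto simp: ennreal_plus[symmetric] ennreal_le_iff simp del: ennreal_plus intro!: ennreal_leI)
 qed
 have "(\<lambda>j. LINT x|m. \<bar>P m (f j) x - P n h x\<bar>) \<longlonglongrightarrow> 0"
 proof -
  have i: "integrable m (\<lambda>x. \<bar>P m (f j) x - P n h x\<bar>)" for j
   by (intro integrable_abs int_diff P_int[OF adm_m] P_int[OF n] fi h)
  have le: "ennreal (LINT x|m. \<bar>P m (f j) x - P n h x\<bar>) \<le> (\<integral>\<^sup>+x. R j x * ennreal (w x) \<partial>lborel)" for j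
  proof -
   have "ennreal (LINT x|m. \<bar>P m (f j) x - P n h x\<bar>) = (\<integral>\<^sup>+x. ennreal \<bar>P m (f j) x - P n h x\<bar> \<partial>m)"
    by (rule nn_integral_eq_integral[symmetric, OF i]) simp
   also have "... \<le> (\<integral>\<^sup>+x. R j x \<partial>m)" by (rule nn_integral_mono_AE[OF C])
   finally show ?thesis unfolding nn_integral_m[OF Rm] .
  qed
  have "(\<lambda>j. ennreal (LINT x|m. \<bar>P m (f j) x - P n h x\<bar>)) \<longlonglongrightarrow> ennreal 0"
   by (rule tendsto_sandwich[OF _ _ tendsto_const S(6), folded ennreal_0]) (use le in auto)
  then show ?thesis by (subst (asm) tendsto_ennreal_iff) auto
 qed
 then show ?thesis using fi f2 by (intro exI[of _ f]) (auto simp: f_def)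
qed

sublocale kern_kato \<Omega> m k lc Lc
 by unfold_locales (rule kato_bounded smoothing; assumption)+

end

section \<open>Strong type bounds off small sets\<close>

lemma ennreal_le_suminf: "f i \<le> (\<Sum>i. f i)" for f :: "nat => ennreal"
 using sum_le_suminf[of f "{i}"] by (simp add: summableI)

text \<open>The argument \<open>g\<close> stands for the q-th power of the function on which the
  potential acts. Hence scaling by t^q gives the factor t, and a sum of such powers dominates each
  summand, so that only monotonicity of \<open>T\<close> is needed. Monotonicity is restricted to
  integrable majorants because infinite values are later replaced by 0.\<close>

locale weak_type = finite_measure n
 for m :: "'a measure" and n :: "'b measure" and T :: "('a => ennreal) => 'b => ennreal" and q :: real +
 assumes q1: "1 < q"
  and T_measurable: "g \<in> borel_measurable m ==> T g \<in> borel_measurable n"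
  and T_mono: "g \<in> borel_measurable m ==> g' \<in> borel_measurable m ==> (\<integral>\<^sup>+x. g' x \<partial>m) < \<infinity> ==>
   (\<And>x. g x \<le> g' x) ==> T g y \<le> T g' y"
  and T_scale: "g \<in> borel_measurable m ==> 0 < t ==> T (\<lambda>x. ennreal (t powr q) * g x) y = ennreal t * T g y"
  and T_finite: "g \<in> borel_measurable m ==> (\<integral>\<^sup>+x. g x \<partial>m) < \<infinity> ==> AE y in n. T g y < \<infinity>"
begin

text \<open>A set on which the weak type inequality at level 1 with constant \<open>C\<close> fails
  or is attained; scaling reduces other levels to this one.\<close>

definition bad :: "real => 'b set => bool" where
 "bad C B \<longleftrightarrow> B \<in> sets n \<and>
  (\<exists>g\<in>borel_measurable m. (\<forall>y\<in>B. 1 \<le> T g y) \<and> ennreal C * (\<integral>\<^sup>+x. g x \<partial>m) \<le> emeasure n B)"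

lemma less_top_of_mult_le:
 assumes "ennreal C * a \<le> b" "b < \<infinity>" "0 < C" shows "a < \<infinity>"
 using le_less_trans[OF assms(1,2)] assms(3) by (auto simp: ennreal_mult_less_top)

lemma emeasure_lt_top: "emeasure n A < \<infinity>"
 using emeasure_finite[of A] by (simp add: less_top[symmetric])

text \<open>The sum of the witnesses works for the union: it dominates every one of them, and the
  integrals add up just as the measures of the disjoint sets do.\<close>

lemma bad_UN:
 assumes B: "\<And>i::nat. bad C (B i)" "disjoint_family B" and C: "0 < C"
 shows "bad C (\<Union>i. B i)"
proof -
 obtain g where g[measurable]: "\<And>i. g i \<in> borel_measurable m" and T: "\<And>i y. y \<in> B i ==> 1 \<le> T (g i) y"
  and le: "\<And>i. ennreal C * (\<integral>\<^sup>+x. g i x \<partial>m) \<le> emeasure n (B i)"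
  using B(1) unfolding bad_def by metis
 have Bs: "B i \<in> sets n" for i using B(1)[of i] by (simp add: bad_def)
 have i: "ennreal C * (\<integral>\<^sup>+x. (\<Sum>i. g i x) \<partial>m) \<le> emeasure n (\<Union>i. B i)"
 proof -
  have "ennreal C * (\<integral>\<^sup>+x. (\<Sum>i. g i x) \<partial>m) = (\<Sum>i. ennreal C * (\<integral>\<^sup>+x. g i x \<partial>m))"
   by (subst nn_integral_suminf) auto
  also have "... \<le> (\<Sum>i. emeasure n (B i))" by (intro suminf_le le summableI)
  also have "... = emeasure n (\<Union>i. B i)" by (rule suminf_emeasure) (use Bs B(2) in auto)
  finally show ?thesis .
 qed
 have fin: "(\<integral>\<^sup>+x. (\<Sum>i. g i x) \<partial>m) < \<infinity>" by (rule less_top_of_mult_le[OF i emeasure_lt_top C])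
 have "1 \<le> T (\<lambda>x. \<Sum>i. g i x) y" if "y \<in> B i" for i y
 proof (rule order_trans[OF T[OF that] T_mono[OF _ _ fin]])
  show "g i x \<le> (\<Sum>i. g i x)" for x
   by (rule ennreal_le_suminf)
 qed measurable
 then show ?thesis unfolding bad_def using Bs i by (intro conjI bexI[of _ "\<lambda>x. \<Sum>i. g i x"]) auto
qed

lemma bad_empty: "0 < C ==> bad C {}"
 unfolding bad_def by (intro conjI bexI[of _ "\<lambda>_. 0"]) auto

text \<open>Greedy exhaustion: at each stage a bad set of at least half the largest available measure
 is removed.\<close>

lemma bad_exhaustion:
 assumes C: "0 < C"
 shows "\<exists>N. bad C N \<and> (\<forall>B. bad C B \<longrightarrow> B \<inter> N = {} \<longrightarrow> emeasure n B = 0)"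
proof -
 have "\<exists>B. bad C B \<and> B \<inter> S = {} \<and> (\<forall>B'. bad C B' \<and> B' \<inter> S = {} \<longrightarrow> measure n B' \<le> 2 * measure n B)" for S
 proof -
  let ?X = "{measure n B' | B'. bad C B' \<and> B' \<inter> S = {}}"
  have ne: "?X \<noteq> {}" using bad_empty[OF C] by blast
  have bdd: "bdd_above ?X" by (rule bdd_aboveI[of _ "measure n (space n)"]) (auto intro: bounded_measure)
  have ub: "measure n B' \<le> Sup ?X" if "bad C B'" "B' \<inter> S = {}" for B'
   by (rule cSup_upper[OF _ bdd]) (use that in blast)
  show ?thesis
  proof (cases "Sup ?X \<le> 0")
   case True
   then show ?thesis using bad_empty[OF C] ub by (intro exI[of _ "{}"]) (auto intro: order_trans)
  next
   case False
   then obtain x where "x \<in> ?X" "Sup ?X / 2 < x" using less_cSupE[OF _ ne, of "Sup ?X / 2"] by auto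
   then obtain B where "bad C B" "B \<inter> S = {}" "Sup ?X \<le> 2 * measure n B" by auto
   then show ?thesis using ub by (intro exI[of _ B]) (auto intro: order_trans)
  qed
 qed
 then obtain F where F: "\<And>S. bad C (F S)" "\<And>S. F S \<inter> S = {}"
  "\<And>S B'. bad C B' ==> B' \<inter> S = {} ==> measure n B' \<le> 2 * measure n (F S)" by metis
 define S where "S = rec_nat {} (\<lambda>i S. S \<union> F S)"
 have S: "S 0 = {}" "S (Suc i) = S i \<union> F (S i)" for i by (simp_all add: S_def)
 define B where "B i = F (S i)" for i
 have SU: "S i = (\<Union>j<i. B j)" for i
  by (induction i) (auto simp: S B_def lessThan_Suc)
 have "B i \<inter> B j = {}" if "j < i" for i j 
 proof -
  have "B j \<subseteq> S i" using that by (auto simp: SU)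
  then show ?thesis using F(2)[of "S i"] unfolding B_def by blast
 qed
 then have disj: "disjoint_family B" unfolding disjoint_family_on_def by (auto elim!: linorder_neqE_nat)
 have bad: "bad C (B i)" for i using F(1) by (simp add: B_def)
 have "(\<lambda>i. measure n (B i)) sums measure n (\<Union>i. B i)"
  by (rule finite_measure_UNION[OF _ disj]) (use bad in \<open>auto simp: bad_def\<close>)
 then have lim: "(\<lambda>i. 2 * measure n (B i)) \<longlonglongrightarrow> 2 * 0"
  by (intro tendsto_intros summable_LIMSEQ_zero sums_summable)
 \<comment> \<open>A bad set disjoint from all chosen ones competed at every stage, so its measure
   is at most twice that of each chosen set; these measures are summable and tend to 0.\<close>
 have "emeasure n B' = 0" if B': "bad C B'" "B' \<inter> (\<Union>i. B i) = {}" for B'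
 proof -
  have "measure n B' \<le> 2 * measure n (B i)" for i unfolding B_def
   by (rule F(3)[OF B'(1)]) (use B'(2) in \<open>auto simp: SU\<close>)
  then have "measure n B' \<le> 2 * 0" by (intro LIMSEQ_le_const[OF lim]) auto
  then have "measure n B' = 0" using measure_nonneg[of n B'] by simp
  then show ?thesis by (simp add: emeasure_eq_measure)
 qed
 then show ?thesis using bad_UN[OF bad disj C] by blast
qed

text \<open>Off a maximal bad set a level set violating the inequality would itself be bad, hence
  null. The witness of the exceptional set is retained, as its small integral later shows that the
  exceptional sets are negligible.\<close>

lemma weak_type_off_set:
 assumes C: "0 < C"
 shows "\<exists>N g. N \<in> sets n \<and> g \<in> borel_measurable m \<and> (\<forall>y\<in>N. 1 \<le> T g y) \<and>
  ennreal C * (\<integral>\<^sup>+x. g x \<partial>m) \<le> emeasure n (space n) \<and>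
  (\<forall>g'\<in>borel_measurable m. emeasure n ({y \<in> space n. 1 \<le> T g' y} - N) \<le> ennreal C * (\<integral>\<^sup>+x. g' x \<partial>m))"
proof -
 obtain N where N: "bad C N" "\<And>B. bad C B ==> B \<inter> N = {} ==> emeasure n B = 0"
  using bad_exhaustion[OF C] by blast
 then obtain g where g: "N \<in> sets n" "g \<in> borel_measurable m" "\<forall>y\<in>N. 1 \<le> T g y"
  "ennreal C * (\<integral>\<^sup>+x. g x \<partial>m) \<le> emeasure n N" unfolding bad_def by blast
 have "emeasure n ({y \<in> space n. 1 \<le> T g' y} - N) \<le> ennreal C * (\<integral>\<^sup>+x. g' x \<partial>m)" if g': "g' \<in> borel_measurable m" for g'
 proof (rule ccontr)
  assume "\<not> ?thesis"
  then have lt: "ennreal C * (\<integral>\<^sup>+x. g' x \<partial>m) < emeasure n ({y \<in> space n. 1 \<le> T g' y} - N)" by simp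
  note [measurable] = T_measurable[OF g']
  have "bad C ({y \<in> space n. 1 \<le> T g' y} - N)"
   unfolding bad_def using lt g(1) g' by (intro conjI bexI[of _ g']) auto
  from N(2)[OF this] have "emeasure n ({y \<in> space n. 1 \<le> T g' y} - N) = 0" by blast
  with lt show False by simp
 qed
 moreover have "emeasure n N \<le> emeasure n (space n)" by (rule emeasure_space)
 ultimately show ?thesis using g by (intro exI[of _ N] exI[of _ g]) (auto intro: order_trans)
qed

text \<open>A dyadic layer sum: by scaling, the set where \<open>T g\<close> is at least 2^i has
  measure at most C 2^{-qi}, which is summable against 2^(i+1) because q > 1. Values below 1
  contribute at most the total mass.\<close>

lemma strong_type_of_weak:
 assumes [measurable]: "A \<in> sets n" and C: "0 < C"
  and w: "\<And>g'. g' \<in> borel_measurable m ==> emeasure n ({y \<in> space n. 1 \<le> T g' y} \<inter> A) \<le> ennreal C * (\<integral>\<^sup>+x. g' x \<partial>m)"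
  and g[measurable]: "g \<in> borel_measurable m" and g1: "(\<integral>\<^sup>+x. g x \<partial>m) \<le> 1"
 shows "(\<integral>\<^sup>+y. T g y * indicator A y \<partial>n) \<le> emeasure n (space n) + ennreal (2 * C * (\<Sum>i. (2 powr (1 - q)) ^ i))"
proof -
 note [measurable] = T_measurable[OF g]
 let ?S = "\<lambda>i::nat. {y \<in> space n. ennreal (2 ^ i) \<le> T g y} \<inter> A"
 let ?s = "\<lambda>i y. ennreal (2 ^ Suc i) * indicator (?S i) y"
 have lv: "emeasure n (?S i) \<le> ennreal (C * 2 powr (- q * i))" for i :: nat
 proof -
  let ?t = "(1 / 2) ^ i :: real"
  have tq: "?t powr q = 2 powr (- q * i)"
  proof -
   have "?t = 2 powr (- real i)" by (simp add: powr_minus_divide powr_realpow power_one_over)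
   then show ?thesis by (simp add: powr_powr mult.commute)
  qed
  have "{y \<in> space n. ennreal (2 ^ i) \<le> T g y} \<subseteq> {y \<in> space n. 1 \<le> T (\<lambda>x. ennreal (?t powr q) * g x) y}"
  proof clarify
   fix y assume "ennreal (2 ^ i) \<le> T g y"
   then have "ennreal ?t * ennreal (2 ^ i) \<le> ennreal ?t * T g y" by (intro mult_left_mono) auto
   moreover have "ennreal ?t * ennreal (2 ^ i) = 1"
    by (subst ennreal_mult[symmetric]) (auto simp: power_mult_distrib[symmetric] simp del: power_mult_distrib)
   ultimately show "1 \<le> T (\<lambda>x. ennreal (?t powr q) * g x) y" by (subst T_scale[OF g]) auto
  qed
  then have "emeasure n (?S i) \<le> emeasure n ({y \<in> space n. 1 \<le> T (\<lambda>x. ennreal (?t powr q) * g x) y} \<inter> A)"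
   using T_measurable[of "\<lambda>x. ennreal (?t powr q) * g x"] by (intro emeasure_mono) auto
  also have "... \<le> ennreal C * (\<integral>\<^sup>+x. ennreal (?t powr q) * g x \<partial>m)" by (rule w) measurable
  also have "... = ennreal C * (ennreal (?t powr q) * (\<integral>\<^sup>+x. g x \<partial>m))" by (subst nn_integral_cmult) auto
  also have "... \<le> ennreal C * (ennreal (?t powr q) * 1)" by (intro mult_left_mono g1) auto
  also have "... = ennreal (C * 2 powr (- q * i))" unfolding tq using C by (simp add: ennreal_mult)
  finally show ?thesis .
 qed
 have r: "0 < 2 powr (1 - q)" "2 powr (1 - q) < 1" using q1 powr_less_mono[of "1 - q" 0 2] by auto
 have "(\<integral>\<^sup>+y. T g y * indicator A y \<partial>n)
  \<le> (\<integral>\<^sup>+y. 1 + (\<Sum>i. ?s i y) \<partial>n)"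
 proof (rule nn_integral_mono_AE)
  have "AE y in n. T g y < \<infinity>" by (rule T_finite[OF g le_less_trans[OF g1]]) simp
  then show "AE y in n. T g y * indicator A y \<le> 1 + (\<Sum>i. ?s i y)"
   using AE_space
  proof eventually_elim
   case (elim y)
   show ?case
   proof (cases "y \<in> A \<and> 1 \<le> T g y")
    case True
    obtain v where v: "T g y = ennreal v" "0 \<le> v" using elim(1) by (cases "T g y") auto
    have v1: "1 \<le> v" using True v by (simp add: ennreal_le_iff ennreal_1[symmetric] del: ennreal_1)
    obtain i where i: "2 ^ i \<le> v" "v < 2 ^ Suc i"
    proof -
     have "\<exists>j::nat. v < 2 ^ j" by (rule real_arch_pow) simp
     define j where "j = (LEAST j::nat. v < 2 ^ j)"
     have j: "v < 2 ^ j" unfolding j_def by (rule LeastI_ex) fact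
     then obtain i where ji: "j = Suc i" using v1 by (cases j) auto
     have "\<not> v < 2 ^ i" using not_less_Least[of i "\<lambda>j. v < 2 ^ j"] ji unfolding j_def by simp
     then show ?thesis using that[of i] j ji by simp
    qed
    let ?f = "\<lambda>i. ?s i y"
    have "T g y \<le> ?f i" using True i v elim(2) by (auto intro!: ennreal_leI)
    also have "... \<le> (\<Sum>i. ?f i)" by (rule ennreal_le_suminf)
    also have "... \<le> 1 + (\<Sum>i. ?f i)" by (rule add_increasing[OF zero_le order_refl])
    finally show ?thesis using True by simp
   next
    case False
    then have "T g y * indicator A y \<le> 1" by (auto simp: indicator_def)
    also have "... \<le> 1 + (\<Sum>i. ?s i y)"
     by (rule add_increasing2[OF zero_le order_refl])
    finally show ?thesis .
   qed
  qed
 qed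
 also have "... = (\<integral>\<^sup>+y. 1 \<partial>n) + (\<integral>\<^sup>+y. (\<Sum>i. ?s i y) \<partial>n)"
  by (rule nn_integral_add) measurable
 also have "(\<integral>\<^sup>+y. (\<Sum>i. ?s i y) \<partial>n)
  = (\<Sum>i. \<integral>\<^sup>+y. ?s i y \<partial>n)"
  by (rule nn_integral_suminf) measurable
 also have "... = (\<Sum>i. ennreal (2 ^ Suc i) * emeasure n (?S i))"
  by (intro suminf_cong nn_integral_cmult_indicator) measurable
 also have "(\<integral>\<^sup>+y. 1 \<partial>n) = emeasure n (space n)" by simp
 also have "emeasure n (space n) + (\<Sum>i. ennreal (2 ^ Suc i) * emeasure n (?S i)) \<le> emeasure n (space n) + (\<Sum>i. ennreal (2 * C * (2 powr (1 - q)) ^ i))"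
 proof (intro add_left_mono suminf_le summableI)
  fix i :: nat
  have "ennreal (2 ^ Suc i) * emeasure n (?S i) \<le> ennreal (2 ^ Suc i) * ennreal (C * 2 powr (- q * i))"
   by (intro mult_left_mono lv) auto
  also have "... = ennreal (2 ^ Suc i * (C * 2 powr (- q * i)))" using C by (intro ennreal_mult[symmetric]) auto
  also have "2 ^ Suc i * (C * 2 powr (- q * i)) = 2 * C * (2 powr (1 - q)) ^ i"
  proof -
   have "(2 powr (1 - q)) ^ i = 2 powr (real i + - q * i)" 
    by (subst powr_realpow[symmetric]) (simp_all add: powr_powr algebra_simps)
   also have "... = 2 ^ i * 2 powr (- q * i)" unfolding powr_add by (simp add: powr_realpow)
   finally show ?thesis by simp
  qed
  finally show "ennreal (2 ^ Suc i) * emeasure n (?S i) \<le> ennreal (2 * C * (2 powr (1 - q)) ^ i)" .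
 qed
 also have "(\<Sum>i. ennreal (2 * C * (2 powr (1 - q)) ^ i)) = ennreal (\<Sum>i. 2 * C * (2 powr (1 - q)) ^ i)"
  using r C by (intro suminf_ennreal2 summable_mult summable_geometric) auto
 also have "(\<Sum>i. 2 * C * (2 powr (1 - q)) ^ i) = 2 * C * (\<Sum>i. (2 powr (1 - q)) ^ i)"
  using r by (intro suminf_mult summable_geometric) auto
 finally show ?thesis .
qed

text \<open>Nikishin's step. The witnesses g(j) of the exceptional sets N(j) are superposed into one
  integrable function h whose image exceeds j on N(j). As \<open>T h\<close> is finite almost
  everywhere, almost every point lies in only finitely many N(j).\<close>

theorem strong_type_exhaustion:
 "\<exists>A :: nat => 'b set. range A \<subseteq> sets n \<and> incseq A \<and> emeasure n (space n - (\<Union>j. A j)) = 0 \<and>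
  (\<forall>j. \<exists>C<\<infinity>. \<forall>g\<in>borel_measurable m. (\<integral>\<^sup>+x. g x \<partial>m) \<le> 1 \<longrightarrow> (\<integral>\<^sup>+y. T g y * indicator (A j) y \<partial>n) \<le> C)"
proof -
 \<comment> \<open>The factor (j+1)^q raises the image of g(j) from 1 to j+1 on N(j); the extra 2^j
   in the weak type constants keeps the weighted sum integrable.\<close>
 define a where "a j = real (Suc j) powr q" for j
 have a: "0 < a j" for j by (simp add: a_def)
 define Q where "Q j N g \<longleftrightarrow> N \<in> sets n \<and> g \<in> borel_measurable m \<and> (\<forall>y\<in>N. 1 \<le> T g y) \<and>
  ennreal (2 ^ j * a j) * (\<integral>\<^sup>+x. g x \<partial>m) \<le> emeasure n (space n) \<and>
  (\<forall>g'\<in>borel_measurable m. emeasure n ({y \<in> space n. 1 \<le> T g' y} - N) \<le> ennreal (2 ^ j * a j) * (\<integral>\<^sup>+x. g' x \<partial>m))"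
  for j :: nat and N g
 have "\<exists>N g. Q j N g" for j
  unfolding Q_def by (rule weak_type_off_set) (use a[of j] in simp)
 then obtain N g where Q: "\<And>j. Q j (N j) (g j)" by metis
 have N[measurable]: "N j \<in> sets n" and g[measurable]: "g j \<in> borel_measurable m"
  and NT: "y \<in> N j ==> 1 \<le> T (g j) y"
  and gi: "ennreal (2 ^ j * a j) * (\<integral>\<^sup>+x. g j x \<partial>m) \<le> emeasure n (space n)"
  and wk: "g' \<in> borel_measurable m ==> emeasure n ({y \<in> space n. 1 \<le> T g' y} - N j) \<le> ennreal (2 ^ j * a j) * (\<integral>\<^sup>+x. g' x \<partial>m)" for j g' y
  using Q[of j] unfolding Q_def by blast+
 define h where "h x = (\<Sum>j. ennreal (a j) * g j x)" for x
 have hm[measurable]: "h \<in> borel_measurable m" unfolding h_def by measurable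
 have hi: "(\<integral>\<^sup>+x. h x \<partial>m) < \<infinity>"
 proof -
  have "(\<integral>\<^sup>+x. h x \<partial>m) = (\<Sum>j. ennreal (a j) * (\<integral>\<^sup>+x. g j x \<partial>m))"

  proof -
   have "(\<integral>\<^sup>+x. h x \<partial>m) = (\<Sum>j. \<integral>\<^sup>+x. ennreal (a j) * g j x \<partial>m)"
    unfolding h_def by (rule nn_integral_suminf) measurable
   also have "... = (\<Sum>j. ennreal (a j) * (\<integral>\<^sup>+x. g j x \<partial>m))"
    by (intro suminf_cong nn_integral_cmult) measurable
   finally show ?thesis .
  qed
  also have "... \<le> (\<Sum>j. emeasure n (space n) * ennreal ((1 / 2) ^ j))"
  proof (intro suminf_le summableI)
   fix j
   have "ennreal (a j) * (\<integral>\<^sup>+x. g j x \<partial>m) = ennreal ((1 / 2) ^ j) * (ennreal (2 ^ j * a j) * (\<integral>\<^sup>+x. g j x \<partial>m))"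
   proof -
    have "ennreal ((1 / 2) ^ j) * ennreal (2 ^ j * a j) = ennreal ((1 / 2) ^ j * (2 ^ j * a j))"
     using a[of j] by (intro ennreal_mult[symmetric]) auto
    also have "(1 / 2) ^ j * (2 ^ j * a j) = a j" by (simp add: mult.assoc[symmetric] power_mult_distrib[symmetric])
    finally show ?thesis by (simp add: mult.assoc[symmetric])
   qed
   also have "... \<le> ennreal ((1 / 2) ^ j) * emeasure n (space n)" by (intro mult_left_mono gi) auto
   finally show "ennreal (a j) * (\<integral>\<^sup>+x. g j x \<partial>m) \<le> emeasure n (space n) * ennreal ((1 / 2) ^ j)" by (simp only: mult.commute)
  qed
  also have "... = emeasure n (space n) * ennreal (\<Sum>j. (1 / 2) ^ j)"
   by (subst ennreal_suminf_cmult, subst suminf_ennreal2) (auto intro!: summable_geometric)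
  also have "... < \<infinity>" using emeasure_lt_top[of "space n"] by (simp add: ennreal_mult_less_top)
  finally show ?thesis .
 qed
 have big: "ennreal (real (Suc j)) \<le> T h y" if "y \<in> N j" for j y
 proof -
  have "ennreal (real (Suc j)) * 1 \<le> ennreal (real (Suc j)) * T (g j) y" by (intro mult_left_mono NT that) auto
  also have "... = T (\<lambda>x. ennreal (a j) * g j x) y" unfolding a_def by (rule T_scale[OF g, symmetric]) simp
  also have "... \<le> T h y"
  proof (rule T_mono[OF _ hm hi])
   show "ennreal (a j) * g j x \<le> h x" for x
    unfolding h_def by (rule ennreal_le_suminf)
  qed measurable
  finally show ?thesis by simp
 qed
 \<comment> \<open>Points avoiding all exceptional sets from index j on; in particular the weak type
   bound number j holds there.\<close>
 define A where "A j = space n - (\<Union>i\<in>{j..}. N i)" for j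
 have As[measurable]: "A j \<in> sets n" for j unfolding A_def by measurable
 have inc: "incseq A" unfolding incseq_def A_def by fastforce
 have null: "emeasure n (space n - (\<Union>j. A j)) = 0"
 proof -
  have "AE y in n. y \<in> (\<Union>j. A j)"
   using T_finite[OF hm hi] AE_space
  proof eventually_elim
   case (elim y)
   then obtain v where v: "T h y = ennreal v" "0 \<le> v" by (cases "T h y") auto
   obtain j :: nat where j: "v < j" using reals_Archimedean2 by blast
   have "y \<notin> N i" if "j \<le> i" for i
   proof
    assume "y \<in> N i"
    from big[OF this] have "real (Suc i) \<le> v" unfolding v using v(2) by (simp add: ennreal_le_iff del: of_nat_Suc)
    with j that show False by simp
   qed
   then show ?case using elim unfolding A_def by auto
  qed
  then show ?thesis by (subst (asm) AE_iff_measurable[of "space n - (\<Union>j. A j)"]) (auto simp: Diff_eq Collect_conj_eq)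
 qed
 have "\<exists>C<\<infinity>. \<forall>g\<in>borel_measurable m. (\<integral>\<^sup>+x. g x \<partial>m) \<le> 1 \<longrightarrow> (\<integral>\<^sup>+y. T g y * indicator (A j) y \<partial>n) \<le> C" for j
 proof (intro exI conjI ballI impI)
  fix g' assume g': "g' \<in> borel_measurable m" "(\<integral>\<^sup>+x. g' x \<partial>m) \<le> 1"
  show "(\<integral>\<^sup>+y. T g' y * indicator (A j) y \<partial>n) \<le> emeasure n (space n) + ennreal (2 * (2 ^ j * a j) * (\<Sum>i. (2 powr (1 - q)) ^ i))"
  proof (rule strong_type_of_weak[OF As _ _ g'])
   fix f :: "'a => ennreal" assume f: "f \<in> borel_measurable m"
   note [measurable] = T_measurable[OF f]
   have "emeasure n ({y \<in> space n. 1 \<le> T f y} \<inter> A j) \<le> emeasure n ({y \<in> space n. 1 \<le> T f y} - N j)"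
    by (rule emeasure_mono) (auto simp: A_def)
   also note wk[OF f, of j]
   finally show "emeasure n ({y \<in> space n. 1 \<le> T f y} \<inter> A j) \<le> ennreal (2 ^ j * a j) * (\<integral>\<^sup>+x. f x \<partial>m)" .
  qed (use a[of j] in simp)
 next
  show "emeasure n (space n) + ennreal (2 * (2 ^ j * a j) * (\<Sum>i. (2 powr (1 - q)) ^ i)) < \<infinity>"
   using emeasure_lt_top[of "space n"] by simp
 qed
 then show ?thesis using As inc null by (intro exI[of _ A]) auto
qed

end

section \<open>The adjoint potential on powers and duality\<close>

context kern begin

text \<open>The adjoint potential of g^{1/q}; for integrable \<open>g\<close> the function g^{1/q}
  runs through the nonnegative elements of L^q(m), up to null sets.\<close>

definition pot :: "real => ('a => ennreal) => 'a => ennreal" where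
 "pot q g y = (\<integral>\<^sup>+x. ennreal (k x y) * ennreal (enn2real (g x) powr (1 / q)) \<partial>m)"

lemma pot_measurable:
 assumes n: "adm n" and [measurable]: "g \<in> borel_measurable m"
 shows "pot q g \<in> borel_measurable n"
proof -
 interpret pair_sigma_finite m n by (rule adm_pair[OF n])
 have [measurable]: "(\<lambda>(y, x). k x y) \<in> borel_measurable (n \<Otimes>\<^sub>M m)"
  using measurable_compose[OF measurable_pair_swap' k_measurable[of m n]] n idm
  by (simp add: case_prod_beta adm_def)
 show ?thesis unfolding pot_def[abs_def] by measurable
qed

lemma weak_type_pot:
 assumes n: "adm n" and q: "1 < q"
  and fin: "\<And>g. g \<in> borel_measurable m ==> (\<integral>\<^sup>+x. g x \<partial>m) < \<infinity> ==> AE y in n. pot q g y < \<infinity>"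
 shows "weak_type m n (pot q) q"
proof -
 interpret n: finite_measure n using n by (simp add: adm_def)
 show ?thesis
 proof
  show "pot q g \<in> borel_measurable n" if "g \<in> borel_measurable m" for g by (rule pot_measurable[OF n that])
  show "AE y in n. pot q g y < \<infinity>" if "g \<in> borel_measurable m" "(\<integral>\<^sup>+x. g x \<partial>m) < \<infinity>" for g by (rule fin[OF that])
  show "pot q g y \<le> pot q g' y"
   if "g' \<in> borel_measurable m" "(\<integral>\<^sup>+x. g' x \<partial>m) < \<infinity>" and le: "\<And>x. g x \<le> g' x" for g g' y
  proof -
   have "AE x in m. g' x \<noteq> \<infinity>" by (rule nn_integral_PInf_AE) (use that in auto)
   then show ?thesis unfolding pot_def
   proof (intro nn_integral_mono_AE, eventually_elim)
    case (elim x)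
    have "enn2real (g x) \<le> enn2real (g' x)" using le[of x] elim by (intro enn2real_mono) (auto simp: less_top)
    then show ?case using q by (intro mult_left_mono ennreal_leI powr_mono2) auto
   qed
  qed
  show "pot q (\<lambda>x. ennreal (t powr q) * g x) y = ennreal t * pot q g y" if gm[measurable]: "g \<in> borel_measurable m" and t: "0 < t" for t g y
  proof -
   have e: "ennreal (k x y) * ennreal (enn2real (ennreal (t powr q) * g x) powr (1 / q))
    = ennreal t * (ennreal (k x y) * ennreal (enn2real (g x) powr (1 / q)))" for x
   proof -
    have "enn2real (ennreal (t powr q) * g x) powr (1 / q) = t * enn2real (g x) powr (1 / q)"
     using t q by (simp add: enn2real_mult powr_mult powr_powr)
    then show ?thesis using t by (simp add: ennreal_mult' mult_ac)
   qed
   have [measurable]: "(\<lambda>x. k x y) \<in> borel_measurable m"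
    using measurable_compose[OF measurable_Pair[OF idm measurable_const] km, of y] by simp
   show ?thesis unfolding pot_def e by (rule nn_integral_cmult) measurable
  qed
 qed (rule q)
qed

text \<open>The converse of Hoelder's inequality. The potential u is tested against its own power:
  with g = u^p the function g^{1/q} is u^{p-1}, so the pairing reproduces the integral of
  u^p.\<close>

lemma pot_duality:
 assumes n: "adm n" and A: "A \<in> sets n" and q: "1 < q" and p: "p = q / (q - 1)"
  and C: "C < \<infinity>" and wt: "weak_type m n (pot q) q"
  and le: "\<And>g. g \<in> borel_measurable m ==> (\<integral>\<^sup>+x. g x \<partial>m) \<le> 1 ==> (\<integral>\<^sup>+y. pot q g y * indicator A y \<partial>n) \<le> C"
 shows "integrable m (\<lambda>x. P n (indicator A) x powr p)"
proof -
 interpret weak_type m n "pot q" q by (rule wt)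
 interpret mn: pair_sigma_finite m n by (rule adm_pair[OF n])
 interpret fm: finite_measure m by (rule fin)
 note [measurable] = A
 have km'[measurable]: "(\<lambda>(x, y). k x y) \<in> borel_measurable (m \<Otimes>\<^sub>M n)"
  using k_measurable[of m n] n idm by (simp add: adm_def)
 have p0: "0 < p" and pq: "p * (1 / q) = p - 1" "1 - 1 / q = 1 / p" using q by (simp_all add: p field_simps)
 have ii: "integrable n (indicator A :: 'a => real)" using emeasure_lt_top[of A] by (intro integrable_real_indicator A) simp
 let ?u = "P n (indicator A)"
 let ?m = "\<lambda>N x. min (?u x) (real N)"
 have u0: "0 \<le> ?u x" for x unfolding P_def using k0 by (intro integral_nonneg_AE AE_I2) auto
 have um[measurable]: "?u \<in> borel_measurable m" using P_int[OF n ii] by auto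
 obtain c where c: "C = ennreal c" "0 \<le> c" using C by (cases C) auto
 \<comment> \<open>Truncation at N makes the integral of the power finite, so that it can be divided
   out.\<close>
 define g where "g N x = ennreal (?m N x powr p)" for N x
 have gm[measurable]: "g N \<in> borel_measurable m" for N unfolding g_def by measurable
 have bound: "(\<integral>\<^sup>+x. g N x \<partial>m) \<le> ennreal (c powr p)" for N
 proof -
  have "(\<integral>\<^sup>+x. g N x \<partial>m) \<le> (\<integral>\<^sup>+x. ennreal (real N powr p) \<partial>m)"
   unfolding g_def using u0 p0 by (intro nn_integral_mono ennreal_leI powr_mono2) auto
  also have "... < \<infinity>" using fm.emeasure_finite[of "space m"] by (simp add: ennreal_mult_eq_top_iff less_top[symmetric])
  finally have "(\<integral>\<^sup>+x. g N x \<partial>m) < \<infinity>" .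
  then obtain j where j: "(\<integral>\<^sup>+x. g N x \<partial>m) = ennreal j" "0 \<le> j" by (cases "\<integral>\<^sup>+x. g N x \<partial>m") auto
  show ?thesis
  proof (cases "j = 0")
   case False
   then have j0: "0 < j" using j by simp
   \<comment> \<open>Normalises the mass \<open>j\<close> of the test function to 1; the strong type
     bound then reads j^{1/p} at most c.\<close>
   define t where "t = j powr (- (1 / q))"
   have t: "0 < t" "t powr q = 1 / j" using j0 q powr_minus_divide[of j 1] by (auto simp: t_def powr_powr)
   have "ennreal j \<le> (\<integral>\<^sup>+y. pot q (g N) y * indicator A y \<partial>n)"
   proof -
    have "ennreal j \<le> (\<integral>\<^sup>+x. ennreal (?u x) * ennreal (?m N x powr (p - 1)) \<partial>m)"
     unfolding j(1)[symmetric] g_def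
    proof (intro nn_integral_mono)
     fix x
     have "?m N x powr p = ?m N x * ?m N x powr (p - 1)"
      using powr_add[of "?m N x" 1 "p - 1"] u0[of x] by (cases "?m N x = 0") auto
     also have "... \<le> ?u x * ?m N x powr (p - 1)" by (intro mult_right_mono) auto
     finally show "ennreal (?m N x powr p) \<le> ennreal (?u x) * ennreal (?m N x powr (p - 1))"
      using u0[of x] by (simp add: ennreal_mult[symmetric] ennreal_leI)
    qed
    also have "... = (\<integral>\<^sup>+x. (\<integral>\<^sup>+y. ennreal (k x y) * ennreal (?m N x powr (p - 1)) * indicator A y \<partial>n) \<partial>m)"
    proof (rule nn_integral_cong_AE)
     show "AE x in m. ennreal (?u x) * ennreal (?m N x powr (p - 1))
      = (\<integral>\<^sup>+y. ennreal (k x y) * ennreal (?m N x powr (p - 1)) * indicator A y \<partial>n)"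
      using P_AE[OF n ii] AE_space
     proof eventually_elim
      case (elim x)
      note [measurable] = measurable_Pair2[OF km' elim(2), simplified]
      have "ennreal (?u x) = (\<integral>\<^sup>+y. ennreal (k x y * indicator A y) \<partial>n)"
       unfolding P_def using k0 by (intro nn_integral_eq_integral[symmetric] elim) auto
      also have "... = (\<integral>\<^sup>+y. ennreal (k x y) * indicator A y \<partial>n)"
       by (intro nn_integral_cong) (auto simp: indicator_def)
      finally have u: "ennreal (?u x) = (\<integral>\<^sup>+y. ennreal (k x y) * indicator A y \<partial>n)" .
      have "(\<integral>\<^sup>+y. ennreal (k x y) * ennreal (?m N x powr (p - 1)) * indicator A y \<partial>n)
       = (\<integral>\<^sup>+y. ennreal (k x y) * indicator A y * ennreal (?m N x powr (p - 1)) \<partial>n)"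
       by (intro nn_integral_cong) (simp only: mult_ac)
      also have "... = (\<integral>\<^sup>+y. ennreal (k x y) * indicator A y \<partial>n) * ennreal (?m N x powr (p - 1))"
       by (rule nn_integral_multc) measurable
      finally show ?case unfolding u[symmetric] by (rule sym)
     qed
    qed
    also have "... = (\<integral>\<^sup>+y. (\<integral>\<^sup>+x. ennreal (k x y) * ennreal (?m N x powr (p - 1)) * indicator A y \<partial>m) \<partial>n)"
     by (rule mn.Fubini'[symmetric]) measurable
    also have "... = (\<integral>\<^sup>+y. pot q (g N) y * indicator A y \<partial>n)"
    proof (rule nn_integral_cong)
     fix y assume y: "y \<in> space n"
     note [measurable] = measurable_Pair1[OF km' y, simplified]
     have "(\<integral>\<^sup>+x. ennreal (k x y) * ennreal (?m N x powr (p - 1)) * indicator A y \<partial>m)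
      = (\<integral>\<^sup>+x. ennreal (k x y) * ennreal (?m N x powr (p - 1)) \<partial>m) * indicator A y"
      by (rule nn_integral_multc) measurable
     moreover have "enn2real (g N x) powr (1 / q) = ?m N x powr (p - 1)" for x
      unfolding g_def using pq by (simp add: powr_powr)
     ultimately show "(\<integral>\<^sup>+x. ennreal (k x y) * ennreal (?m N x powr (p - 1)) * indicator A y \<partial>m) = pot q (g N) y * indicator A y"
      unfolding pot_def by simp
    qed
    finally show ?thesis .
   qed
   then have "ennreal t * ennreal j \<le> ennreal t * (\<integral>\<^sup>+y. pot q (g N) y * indicator A y \<partial>n)" by (intro mult_left_mono) auto
   also have "... = (\<integral>\<^sup>+y. pot q (\<lambda>x. ennreal (t powr q) * g N x) y * indicator A y \<partial>n)"
    unfolding T_scale[OF gm t(1)] mult.assoc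
    by (rule nn_integral_cmult[symmetric]) (use pot_measurable[OF n gm] in measurable)
   also have "... \<le> ennreal c" unfolding c(1)[symmetric]
   proof (rule le)
    have "(\<integral>\<^sup>+x. ennreal (t powr q) * g N x \<partial>m) = ennreal (t powr q) * ennreal j"
     unfolding j(1)[symmetric] by (rule nn_integral_cmult) measurable
    also have "... = 1" using j0 t by (simp add: ennreal_mult[symmetric])
    finally show "(\<integral>\<^sup>+x. ennreal (t powr q) * g N x \<partial>m) \<le> 1" by simp
   qed measurable
   finally have "t * j \<le> c" using t j0 c(2) by (simp add: ennreal_mult[symmetric] ennreal_le_iff)
   moreover have "t * j = j powr (1 / p)"
    unfolding t_def pq(2)[symmetric] using j0 by (simp add: powr_diff powr_minus_divide)
   ultimately have "(j powr (1 / p)) powr p \<le> c powr p" using p0 by (intro powr_mono2) auto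
   then have "j \<le> c powr p" using j0 p0 by (simp add: powr_powr)
   then show ?thesis unfolding j(1) by (rule ennreal_leI)
  qed (simp add: j)
 qed
 \<comment> \<open>The bound is uniform in the truncation level, so Fatou's lemma removes the
   truncation.\<close>
 have "(\<integral>\<^sup>+x. ennreal (?u x powr p) \<partial>m) = (\<integral>\<^sup>+x. liminf (\<lambda>N. g N x) \<partial>m)"
 proof (intro nn_integral_cong lim_imp_Liminf[symmetric] tendsto_eventually)
  fix x
  obtain N :: nat where N: "?u x \<le> N" using real_arch_simple by blast
  have "g M x = ennreal (?u x powr p)" if "M \<ge> N" for M
   using N that unfolding g_def by (simp add: min_absorb1)
  then show "\<forall>\<^sub>F M in sequentially. g M x = ennreal (?u x powr p)" by (auto simp: eventually_sequentially)
 qed simp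
 also have "... \<le> liminf (\<lambda>N. \<integral>\<^sup>+x. g N x \<partial>m)" by (rule nn_integral_liminf) measurable
 also have "... \<le> liminf (\<lambda>N. ennreal (c powr p))" by (intro Liminf_mono always_eventually allI bound)
 also have "... < \<infinity>" by (simp add: Liminf_const)
 finally show ?thesis by (intro integrableI_nonneg) auto
qed

end

section \<open>From capacity to finiteness of the adjoint potential\<close>

context green_setting begin

lemma AE_lborel_reflect:
 assumes "AE z in lborel. Q z" and [measurable]: "{z. Q z} \<in> sets borel"
 shows "AE x in lborel. Q (y - x :: 'a)"
proof -
 have "(\<integral>\<^sup>+x. indicator (- {z. Q z}) x \<partial>lborel) = (\<integral>\<^sup>+x. indicator (- {z. Q z}) (y - x) \<partial>lborel)"
  using nn_integral_lborel_affine[of "indicator (- {z. Q z})" "-1" y] by (simp add: borel_comp)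
 moreover have "(\<integral>\<^sup>+x. indicator (- {z. Q z}) x \<partial>lborel) = (0 :: ennreal)"
  by (subst nn_integral_0_iff_AE) (use assms in \<open>auto simp: borel_comp elim!: eventually_mono\<close>)
 ultimately have "(\<integral>\<^sup>+x. indicator (- {z. Q z}) (y - x) \<partial>lborel) = (0 :: ennreal)" by (simp only:)
 then have "AE x in lborel. indicator (- {z. Q z}) (y - x) = (0 :: ennreal)"
  by (subst (asm) nn_integral_0_iff_AE) (auto simp: borel_comp intro!: measurable_compose[of "\<lambda>x. y - x" lborel borel])
 then show ?thesis by eventually_elim (auto simp: indicator_def)
qed

text \<open>The adjoint potential is dominated by a multiple of the Bessel potential of \<phi>, a
  function in L^q for Lebesgue measure. If it is infinite on E, then every small multiple of \<phi>
  is admissible for the capacity, whose value is therefore 0.\<close>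

lemma capacity_zero_of_pot_infinite:
 assumes q: "1 < q" and al: "0 < 2 * s - \<gamma> / q"
  and g[measurable]: "g \<in> borel_measurable m" and gf: "(\<integral>\<^sup>+x. g x \<partial>m) < \<infinity>"
  and E: "\<And>y. y \<in> E ==> y \<in> \<Omega> \<and> pot q g y = \<infinity>"
 shows "bessel_cap_compact (2 * s - \<gamma> / q) q E = 0"
proof -
 let ?\<alpha> = "2 * s - \<gamma> / q" let ?B = "bessel_kernel (2 * s - \<gamma> / q) :: 'a => real"
 have [measurable]: "?B \<in> borel_measurable borel" by (rule bessel_kernel_bounds(1)[OF al, of 1]) simp
 obtain cb where cb: "cb > 0" "AE z in lborel. norm (z::'a) \<le> D \<longrightarrow> cb * norm z powr (?\<alpha> - DIM('a)) \<le> ?B z"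
  using bessel_kernel_bounds(2)[OF al, of D] D(1) by auto
 \<comment> \<open>The factor \<delta>^{\<gamma>/q} makes the q-th power equal to g times the
   weight, so its Lebesgue integral is the integral of g with respect to \<open>m\<close>.\<close>
 define \<phi> where "\<phi> x = indicator \<Omega> x *\<^sub>R (enn2real (g x) powr (1 / q) * \<delta> x powr (\<gamma> / q))" for x
 have gM[measurable]: "g \<in> borel_measurable M1" using g by (simp add: borel_measurable_m)
 have \<delta>M[measurable]: "\<delta> \<in> borel_measurable M1" using measurable_compose[OF id_M1 \<delta>_measurable] by simp
 have \<phi>m[measurable]: "\<phi> \<in> borel_measurable lebesgue"
  unfolding \<phi>_def using sets_\<Omega>(2) by (subst borel_measurable_restrict_space_iff[symmetric]) auto
 have \<phi>0: "0 \<le> \<phi> x" for x by (auto simp: \<phi>_def)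
 have Bm[measurable]: "(\<lambda>x. ?B (y - x)) \<in> borel_measurable lebesgue" for y
  by (rule measurable_completion) measurable
 have \<phi>q: "(\<integral>\<^sup>+x. ennreal (\<phi> x powr q) \<partial>lebesgue) < \<infinity>"
 proof -
  have "(\<integral>\<^sup>+x. ennreal (\<phi> x powr q) \<partial>lebesgue) = (\<integral>\<^sup>+x. ennreal (enn2real (g x) * w x) * indicator \<Omega> x \<partial>lebesgue)"
   using q \<delta>_nonneg by (intro nn_integral_cong) (auto simp: \<phi>_def indicator_def w_def powr_mult powr_powr)
  also have "... = (\<integral>\<^sup>+x. ennreal (enn2real (g x) * w x) \<partial>M1)"
   using sets_\<Omega>(2) by (subst nn_integral_restrict_space) auto
  also have "... \<le> (\<integral>\<^sup>+x. ennreal (w x) * g x \<partial>M1)"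
  proof (rule nn_integral_mono)
   fix x show "ennreal (enn2real (g x) * w x) \<le> ennreal (w x) * g x"
    by (cases "g x") (auto simp: ennreal_mult w_nonneg mult.commute)
  qed
  also have "... = (\<integral>\<^sup>+x. g x \<partial>m)" unfolding m_def by (rule nn_integral_density[symmetric]) measurable
  finally show ?thesis using gf by simp
 qed
 have pin: "(\<integral>\<^sup>+x. ennreal (?B (y - x) * \<phi> x) \<partial>lebesgue) = \<infinity>" if y: "y \<in> E" for y
 proof -
  have y\<Omega>: "y \<in> \<Omega>" using E[OF y] by simp
  have [measurable]: "(\<lambda>x. k x y) \<in> borel_measurable M1"
   using K_section_measurable(1)[of y] unfolding k_def by measurable
  have kk: "ennreal (w x) * (ennreal (k x y) * ennreal (enn2real (g x) powr (1 / q)))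
    \<le> ennreal (c * 2 powr \<gamma> / cb) * ennreal (?B (y - x) * \<phi> x)"
   if x: "x \<in> \<Omega>" and b: "norm (y - x) \<le> D \<longrightarrow> cb * norm (y - x) powr (?\<alpha> - DIM('a)) \<le> ?B (y - x)" for x
  proof (cases "x = y")
   case False
   have b': "norm (x - y) powr (?\<alpha> - DIM('a)) \<le> ?B (y - x) / cb"
    using b D(3)[OF y\<Omega> x] cb(1) by (simp add: norm_minus_commute field_simps)
   \<comment> \<open>One factor goes into \<phi>, the other is spent on the kernel in
     \<open>green_bound_capacity\<close>.\<close>
   have wx: "w x = \<delta> x powr (\<gamma> * (1 - 1 / q)) * \<delta> x powr (\<gamma> / q)"
    unfolding w_def powr_add[symmetric] by (simp add: algebra_simps)
   have "w x * (k x y * enn2real (g x) powr (1 / q)) = (K x y / w y * \<delta> x powr (\<gamma> * (1 - 1 / q))) * \<phi> x"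
    using x by (simp add: wx \<phi>_def k_def)
   also have "... \<le> (c * (green_bound \<Omega> s \<gamma> x y / w y * \<delta> x powr (\<gamma> * (1 - 1 / q)))) * \<phi> x"
   proof (rule mult_right_mono[OF _ \<phi>0])
    have "K x y \<le> c * green_bound \<Omega> s \<gamma> x y" using G_off[OF x y\<Omega> False] x y\<Omega> False by (simp add: K_def)
    then have "K x y / w y * \<delta> x powr (\<gamma> * (1 - 1 / q)) \<le> c * green_bound \<Omega> s \<gamma> x y / w y * \<delta> x powr (\<gamma> * (1 - 1 / q))"
     by (intro mult_right_mono divide_right_mono w_nonneg) auto
    then show "K x y / w y * \<delta> x powr (\<gamma> * (1 - 1 / q)) \<le> c * (green_bound \<Omega> s \<gamma> x y / w y * \<delta> x powr (\<gamma> * (1 - 1 / q)))"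
     by (simp add: mult.assoc)
   qed
   also have "... \<le> (c * (2 powr \<gamma> * norm (x - y) powr (2 * s - \<gamma> * (1 / q) - DIM('a)))) * \<phi> x"
    using q c0 by (intro mult_right_mono mult_left_mono green_bound_capacity x y\<Omega> False \<phi>0) auto
   also have "... \<le> (c * (2 powr \<gamma> * (?B (y - x) / cb))) * \<phi> x"
    using c0 b' by (intro mult_right_mono mult_left_mono \<phi>0) auto
   also have "... = (c * 2 powr \<gamma> / cb) * (?B (y - x) * \<phi> x)" by simp
   finally have "ennreal (w x * (k x y * enn2real (g x) powr (1 / q))) \<le> ennreal ((c * 2 powr \<gamma> / cb) * (?B (y - x) * \<phi> x))"
    by (rule ennreal_leI)
   also have "... = ennreal (c * 2 powr \<gamma> / cb) * ennreal (?B (y - x) * \<phi> x)" using c0 cb(1) by (intro ennreal_mult') simp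
   finally show ?thesis by (simp add: ennreal_mult' w_nonneg k_nonneg)
  qed (simp add: k_def K_def)
  have "\<infinity> = pot q g y" using E[OF y] by simp
  also have "... = (\<integral>\<^sup>+x. ennreal (w x) * (ennreal (k x y) * ennreal (enn2real (g x) powr (1 / q))) \<partial>M1)"
   unfolding pot_def by (subst m_def, rule nn_integral_density) measurable
  also have "... = (\<integral>\<^sup>+x. ennreal (w x) * (ennreal (k x y) * ennreal (enn2real (g x) powr (1 / q))) * indicator \<Omega> x \<partial>lebesgue)"
   using sets_\<Omega>(2) by (subst nn_integral_restrict_space) auto
  also have "... \<le> (\<integral>\<^sup>+x. ennreal (c * 2 powr \<gamma> / cb) * ennreal (?B (y - x) * \<phi> x) \<partial>lebesgue)"
  proof (rule nn_integral_mono_AE)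
   have "AE x in lborel. norm (y - x) \<le> D \<longrightarrow> cb * norm (y - x) powr (?\<alpha> - DIM('a)) \<le> ?B (y - x)"
    by (rule AE_lborel_reflect[OF cb(2)]) measurable
   then have "AE x in lebesgue. norm (y - x) \<le> D \<longrightarrow> cb * norm (y - x) powr (?\<alpha> - DIM('a)) \<le> ?B (y - x)" by (rule AE_completion)
   then show "AE x in lebesgue. ennreal (w x) * (ennreal (k x y) * ennreal (enn2real (g x) powr (1 / q))) * indicator \<Omega> x
     \<le> ennreal (c * 2 powr \<gamma> / cb) * ennreal (?B (y - x) * \<phi> x)"
   proof eventually_elim
    case (elim x)
    show ?case using kk[OF _ elim] by (cases "x \<in> \<Omega>") auto
   qed
  qed
  also have "... = ennreal (c * 2 powr \<gamma> / cb) * (\<integral>\<^sup>+x. ennreal (?B (y - x) * \<phi> x) \<partial>lebesgue)"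
   by (rule nn_integral_cmult) measurable
  finally show ?thesis by (auto simp: top_unique ennreal_mult_eq_top_iff)
 qed
 obtain I where I: "(\<integral>\<^sup>+x. ennreal (\<phi> x powr q) \<partial>lebesgue) = ennreal I" "0 \<le> I"
  using \<phi>q by (cases "\<integral>\<^sup>+x. ennreal (\<phi> x powr q) \<partial>lebesgue") auto
 have le: "bessel_cap_compact ?\<alpha> q E \<le> ennreal (1 / real (Suc j) * I)" for j
 proof -
  \<comment> \<open>The capacity is homogeneous of degree q in the competitor, hence this multiple
    has energy 1/(j+1) times that of \<phi>.\<close>
  define r where "r = (1 / real (Suc j)) powr (1 / q)"
  have r: "0 < r" "r powr q = 1 / real (Suc j)" using q by (simp_all add: r_def powr_powr)
  have pq: "(\<lambda>x. (r * \<phi> x) powr q) = (\<lambda>x. 1 / real (Suc j) * \<phi> x powr q)"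
   using \<phi>0 r by (intro ext) (simp add: powr_mult)
  have i: "integrable lebesgue (\<lambda>x. \<phi> x powr q)" by (rule integrableI_nonneg) (use \<phi>q in auto)
  have pot: "indicator E x \<le> bessel_potential ?\<alpha> (\<lambda>x. r * \<phi> x) x" for x
  proof (cases "x \<in> E")
   case True
   have "bessel_potential ?\<alpha> (\<lambda>x. r * \<phi> x) x = (\<integral>\<^sup>+z. ennreal r * ennreal (?B (x - z) * \<phi> z) \<partial>lebesgue)"
    unfolding bessel_potential_def using r by (intro nn_integral_cong) (simp add: ennreal_mult'[symmetric] mult_ac)
   also have "... = ennreal r * (\<integral>\<^sup>+z. ennreal (?B (x - z) * \<phi> z) \<partial>lebesgue)" by (rule nn_integral_cmult) measurable
   also have "... = \<infinity>" using pin[OF True] r by (simp add: ennreal_mult_top)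
   finally show ?thesis by simp
  qed simp
  have "bessel_cap_compact ?\<alpha> q E \<le> (\<integral>\<^sup>+x. ennreal ((r * \<phi> x) powr q) \<partial>lebesgue)"
   unfolding bessel_cap_compact_def
   by (rule INF_lower) (use pot i r \<phi>0 in \<open>auto simp: pq\<close>)
  also have "... = (\<integral>\<^sup>+x. ennreal (1 / real (Suc j)) * ennreal (\<phi> x powr q) \<partial>lebesgue)"
   unfolding fun_cong[OF pq] by (intro nn_integral_cong ennreal_mult) auto
  also have "... = ennreal (1 / real (Suc j)) * ennreal I" unfolding I(1)[symmetric] by (rule nn_integral_cmult) measurable
  also have "... = ennreal (1 / real (Suc j) * I)" using I(2) by (intro ennreal_mult[symmetric]) auto
  finally show ?thesis .
 qed
 have "(\<lambda>j. 1 / real (Suc j) * I) \<longlonglongrightarrow> 0 * I" by (intro tendsto_mult tendsto_const LIMSEQ_Suc[OF lim_1_over_n])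
 then have "(\<lambda>j. ennreal (1 / real (Suc j) * I)) \<longlonglongrightarrow> ennreal (0 * I)" by (rule tendsto_ennrealI)
 then have "bessel_cap_compact ?\<alpha> q E \<le> ennreal (0 * I)" by (rule LIMSEQ_le_const) (use le in auto)
 then show ?thesis by simp
qed

text \<open>The measure is extended to a finite Borel measure on the whole space, where inner
  regularity reduces the infinity set of the potential to its compact subsets. On those, capacity
  zero forces measure zero.\<close>

lemma pot_finite_of_capacity:
 assumes n: "adm n" "sets n = sets (restrict_space borel \<Omega>)"
  and q: "1 < q" "0 < 2 * s - \<gamma> / q"
  and ac: "\<And>E. compact E ==> E \<subseteq> \<Omega> ==> bessel_cap_compact (2 * s - \<gamma> / q) q E = 0 ==> emeasure n E = 0"
  and g: "g \<in> borel_measurable m" "(\<integral>\<^sup>+x. g x \<partial>m) < \<infinity>"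
 shows "AE y in n. pot q g y < \<infinity>"
proof -
 interpret n: finite_measure n using n by (simp add: adm_def)
 have ns: "space n = \<Omega>" and idn: "(\<lambda>x. x) \<in> n \<rightarrow>\<^sub>M borel" using n by (auto simp: adm_def)
 note [measurable] = pot_measurable[OF n(1) g(1)]
 let ?S = "{y \<in> space n. pot q g y = \<infinity>}"
 have S: "?S \<in> sets n" by measurable
 have S': "?S \<in> sets borel" using S sets_\<Omega>(1) unfolding n(2) by (auto simp: sets_restrict_space_iff)
 have Nn: "emeasure (distr n borel (\<lambda>x. x)) E = emeasure n E" if "E \<in> sets borel" "E \<subseteq> \<Omega>" for E
  using that by (subst emeasure_distr[OF idn]) (auto simp: ns Int_absorb2)
 have "emeasure (distr n borel (\<lambda>x. x)) ?S = (SUP K\<in>{K. K \<subseteq> ?S \<and> compact K}. emeasure (distr n borel (\<lambda>x. x)) K)"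
  by (rule inner_regular) (use S' in \<open>auto simp: emeasure_distr[OF idn]\<close>)
 also have "... \<le> 0"
 proof (rule SUP_least)
  fix E assume "E \<in> {K. K \<subseteq> ?S \<and> compact K}"
  then have E: "compact E" "E \<subseteq> \<Omega>" "\<And>y. y \<in> E ==> y \<in> \<Omega> \<and> pot q g y = \<infinity>" using ns by auto
  have "emeasure n E = 0" by (rule ac[OF E(1,2) capacity_zero_of_pot_infinite[OF q g E(3)]])
  then show "emeasure (distr n borel (\<lambda>x. x)) E \<le> 0" using Nn[OF _ E(2)] E(1) by (simp add: borel_compact)
 qed
 finally have "emeasure n ?S = 0" using Nn[OF S'] ns by auto
 then show ?thesis using S by (intro AE_I[of _ _ ?S]) (auto simp: less_top[symmetric])
qed

lemma potential_exhaustion: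
 assumes n: "adm n" "sets n = sets (restrict_space borel \<Omega>)"
  and q: "1 < q" "0 < 2 * s - \<gamma> / q" and p: "p = q / (q - 1)"
  and ac: "\<And>E. compact E ==> E \<subseteq> \<Omega> ==> bessel_cap_compact (2 * s - \<gamma> / q) q E = 0 ==> emeasure n E = 0"
 shows "\<exists>A :: nat => 'a set. range A \<subseteq> sets n \<and> incseq A \<and> emeasure n (space n - (\<Union>j. A j)) = 0 \<and>
  (\<forall>j. integrable m (\<lambda>x. P n (indicator (A j)) x powr p))"
proof -
 have wt: "weak_type m n (pot q) q"
  by (rule weak_type_pot[OF n(1) q(1)]) (rule pot_finite_of_capacity[OF n q ac])
 obtain A :: "nat => 'a set" where A: "range A \<subseteq> sets n" "incseq A" "emeasure n (space n - (\<Union>j. A j)) = 0"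
  and C: "\<And>j. \<exists>C<\<infinity>. \<forall>g\<in>borel_measurable m. (\<integral>\<^sup>+x. g x \<partial>m) \<le> 1 \<longrightarrow> (\<integral>\<^sup>+y. pot q g y * indicator (A j) y \<partial>n) \<le> C"
  using weak_type.strong_type_exhaustion[OF wt] by blast
 have "integrable m (\<lambda>x. P n (indicator (A j)) x powr p)" for j
 proof -
  obtain C where "C < \<infinity>" "\<And>g. g \<in> borel_measurable m ==> (\<integral>\<^sup>+x. g x \<partial>m) \<le> 1 ==> (\<integral>\<^sup>+y. pot q g y * indicator (A j) y \<partial>n) \<le> C"
   using C[of j] by blast
  with A(1) show ?thesis by (intro pot_duality[OF n(1) _ q(1) p _ wt]) auto
 qed
 then show ?thesis using A by blast
qed

end

section \<open>Two-sided bounds and stability\<close>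

context kern_kato begin

lemma P_nonneg: "adm n ==> (\<And>y. y \<in> \<Omega> ==> 0 \<le> h y) ==> 0 \<le> P n h x"
 unfolding P_def adm_def using k0 by (intro integral_nonneg_AE AE_I2) auto

lemma P_minus: "P n (\<lambda>y. - h y) x = - P n h x"
 by (simp add: P_def)

text \<open>Kato's inequality with a = 1 for z = u - P n1 h1, which kills the contribution of n2.
  Only points with z nonnegative count; there u is nonnegative, so the nonlinear term has the
  favourable sign.\<close>

lemma upper_bound:
 assumes \<phi>: "mono \<phi>" "\<phi> 0 = (0::real)" and u: "integrable m u" "integrable m (\<lambda>x. \<phi> (u x))"
  and n1: "adm n1" "integrable n1 h1" "\<And>y. y \<in> \<Omega> ==> 0 \<le> h1 y"
  and n2: "adm n2" "integrable n2 h2" "\<And>y. y \<in> \<Omega> ==> 0 \<le> h2 y"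
  and e: "AE x in m. u x + P m (\<lambda>x. \<phi> (u x)) x = P n1 h1 x - P n2 h2 x"
 shows "AE x in m. u x \<le> P n1 h1 x"
proof -
 let ?z = "\<lambda>x. u x - P n1 h1 x" and ?f = "\<lambda>x. - \<phi> (u x)"
 have zi: "integrable m ?z" by (intro int_diff u P_int n1)
 have fi: "integrable m ?f" using u(2) by simp
 \<comment> \<open>The positive measure has been absorbed into z, so its slot is filled by the zero
   density on \<open>m\<close>.\<close>
 have z: "AE x in m. ?z x = P m ?f x + P m (\<lambda>_. 0) x - P n2 h2 x"
  using e by eventually_elim (simp add: P_minus, simp add: P_def)
 have "(LINT x|m. \<bar>?z x\<bar> + 1 * ?z x) \<le> (LINT x|m. (sgn (?z x) + 1) * (?f x * b x))
   + (1 + 1) * (2 * L * (LINT y|m. 0)) + (1 - 1) * (2 * L * (LINT y|n2. h2 y))"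
  by (rule kato_measure[OF fi adm_m _ _ n2 zi z]) auto
 also have "... = (LINT x|m. (sgn (?z x) + 1) * (?f x * b x))" by simp
 also have "... \<le> 0"
 proof -
  have "0 \<le> (LINT x|m. - ((sgn (?z x) + 1) * (?f x * b x)))"
  proof (rule integral_nonneg_AE, rule AE_I2)
   fix x assume "x \<in> space m"
   then have b0: "0 \<le> b x" using b_nonneg sp by simp
   show "0 \<le> - ((sgn (?z x) + 1) * (?f x * b x))"
   proof (cases "?z x < 0")
    case False
    then have "0 \<le> \<phi> (u x)" using P_nonneg[where h=h1 and x=x, OF n1(1,3)] monoD[OF \<phi>(1), of 0 "u x"] \<phi>(2) by simp
    moreover have "0 \<le> sgn (?z x) + 1" using False by (simp add: sgn_if)
    ultimately show ?thesis using b0 by simp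
   qed simp
  qed
  then show ?thesis by simp
 qed
 finally have le: "(LINT x|m. \<bar>?z x\<bar> + ?z x) \<le> 0" by simp
 have "(LINT x|m. \<bar>?z x\<bar> + ?z x) = 0" by (intro antisym le integral_nonneg_AE) auto
 moreover have "integrable m (\<lambda>x. \<bar>?z x\<bar> + ?z x)" by (intro int_add integrable_abs zi)
 ultimately have "AE x in m. \<bar>?z x\<bar> + ?z x = 0"
  by (subst (asm) integral_nonneg_eq_0_iff_AE) auto
 then show ?thesis by eventually_elim (simp add: abs_if split: if_splits)
qed

text \<open>The upper bound for -u: the odd reflection of \<phi> is again monotone and the two
  measures exchange their roles.\<close>

lemma lower_bound:
 assumes \<phi>: "mono \<phi>" "\<phi> 0 = (0::real)" and u: "integrable m u" "integrable m (\<lambda>x. \<phi> (u x))"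
  and n1: "adm n1" "integrable n1 h1" "\<And>y. y \<in> \<Omega> ==> 0 \<le> h1 y"
  and n2: "adm n2" "integrable n2 h2" "\<And>y. y \<in> \<Omega> ==> 0 \<le> h2 y"
  and e: "AE x in m. u x + P m (\<lambda>x. \<phi> (u x)) x = P n1 h1 x - P n2 h2 x"
 shows "AE x in m. - P n2 h2 x \<le> u x"
proof -
 have "AE x in m. - u x \<le> P n2 h2 x"
 proof (rule upper_bound[where \<phi>="\<lambda>t. - \<phi> (- t)", OF _ _ _ _ n2 n1])
  show "mono (\<lambda>t. - \<phi> (- t))" using monoD[OF \<phi>(1)] by (intro monoI) simp
  show "AE x in m. - u x + P m (\<lambda>x. - \<phi> (- (- u x))) x = P n2 h2 x - P n1 h1 x"
   using e by eventually_elim (simp add: P_minus)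
 qed (use u \<phi> in auto)
 then show ?thesis by eventually_elim simp
qed

text \<open>Kato's inequality with a = 0. Monotonicity gives the nonlinear difference a minus sign,
  and after moving it to the left the lower bound \<open>l\<close> of the column masses enters. The
  same estimate yields uniqueness, the a priori bound and the Cauchy property.\<close>

lemma stability:
 assumes \<phi>: "mono \<phi>" and u: "integrable m u" "integrable m (\<lambda>x. \<phi> (u x) :: real)"
  and v: "integrable m v" "integrable m (\<lambda>x. \<phi> (v x))"
  and n1: "adm n1" "integrable n1 h1" "\<And>y. y \<in> \<Omega> ==> 0 \<le> h1 y"
  and n2: "adm n2" "integrable n2 h2" "\<And>y. y \<in> \<Omega> ==> 0 \<le> h2 y"
  and e: "AE x in m. (u x + P m (\<lambda>x. \<phi> (u x)) x) - (v x + P m (\<lambda>x. \<phi> (v x)) x) = P n1 h1 x - P n2 h2 x"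
 shows "(LINT x|m. \<bar>u x - v x\<bar>) + l * (LINT x|m. \<bar>\<phi> (u x) - \<phi> (v x)\<bar>) \<le> 2 * L * ((LINT y|n1. h1 y) + (LINT y|n2. h2 y))"
proof -
 let ?z = "\<lambda>x. u x - v x" and ?f = "\<lambda>x. \<phi> (v x) - \<phi> (u x)"
 have zi: "integrable m ?z" and fi: "integrable m ?f" using u v by auto
 have z: "AE x in m. ?z x = P m ?f x + P n1 h1 x - P n2 h2 x"
  using e P_diff[OF adm_m v(2) u(2)] by eventually_elim simp
 have "(LINT x|m. \<bar>?z x\<bar> + 0 * ?z x) \<le> (LINT x|m. (sgn (?z x) + 0) * (?f x * b x))
   + (1 + 0) * (2 * L * (LINT y|n1. h1 y)) + (1 - 0) * (2 * L * (LINT y|n2. h2 y))"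
  by (rule kato_measure[OF fi n1 n2 zi z]) auto
 moreover have "(LINT x|m. sgn (?z x) * (?f x * b x)) = - (LINT x|m. \<bar>?f x\<bar> * b x)"
 proof -
  have "sgn (?z x) * (?f x * b x) = - (\<bar>?f x\<bar> * b x)" for x
   using monoD[OF \<phi>, of "u x" "v x"] monoD[OF \<phi>, of "v x" "u x"]
   by (cases "u x" "v x" rule: linorder_cases) (auto simp: left_diff_distrib)
  then show ?thesis by simp
 qed
 moreover have "l * (LINT x|m. \<bar>?f x\<bar>) \<le> (LINT x|m. \<bar>?f x\<bar> * b x)"
 proof -
  have "(LINT x|m. l * \<bar>?f x\<bar>) \<le> (LINT x|m. \<bar>?f x\<bar> * b x)"
  proof (rule integral_mono)
   fix x assume "x \<in> space m"
   then have "l \<le> b x" using kern.b_bounds[OF kern_axioms] sp by simp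
   from mult_right_mono[OF this, of "\<bar>?f x\<bar>"] show "l * \<bar>?f x\<bar> \<le> \<bar>?f x\<bar> * b x" by (simp add: mult.commute)
  qed (use integrable_abs[OF fi] hb_int[OF adm_m integrable_abs[OF fi]] in auto)
  then show ?thesis by simp
 qed
 moreover have "(LINT x|m. \<bar>?f x\<bar>) = (LINT x|m. \<bar>\<phi> (u x) - \<phi> (v x)\<bar>)" by (simp add: abs_minus_commute)
 ultimately show ?thesis by (simp add: distrib_left)
qed

end

section \<open>Existence and stability\<close>

definition spow :: "real => real => real" where "spow p t = \<bar>t\<bar> powr (p - 1) * t"

lemma abs_spow: "\<bar>spow p t\<bar> = \<bar>t\<bar> powr p"
 using powr_add[of "\<bar>t\<bar>" "p - 1" 1] by (cases "t = 0") (auto simp: spow_def abs_mult)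

lemma spow_nonneg: "0 \<le> t ==> spow p t = t powr p"
 using abs_spow[of p t] by (simp add: spow_def)

lemma spow_minus: "spow p (- t) = - spow p t" by (simp add: spow_def)

lemma spow_0: "spow p 0 = 0" by (simp add: spow_def)

lemma powr_diff_le:
 assumes p: "1 < p" and st: "0 \<le> s" "s \<le> t" "t \<le> (R::real)"
 shows "0 \<le> t powr p - s powr p" "t powr p - s powr p \<le> p * R powr (p - 1) * (t - s)"
proof -
 show "0 \<le> t powr p - s powr p" using powr_mono2[of p s t] st p by simp
 show "t powr p - s powr p \<le> p * R powr (p - 1) * (t - s)"
 \<comment> \<open>The mean value theorem is applied with a positive left end, where the derivative
   rule for \<open>powr\<close> is available; s = 0 is treated directly.\<close>
 proof (cases "s = t \<or> s = 0")
  case True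
  then show ?thesis
  proof
   assume s: "s = 0"
   have "t powr p = t powr (p - 1) * t" using powr_add[of t "p - 1" 1] st s by (cases "t = 0") auto
   also have "... \<le> 1 * R powr (p - 1) * t" using st s p by (simp, intro mult_right_mono powr_mono2) auto
   also have "... \<le> p * R powr (p - 1) * t" using st s p by (intro mult_right_mono) auto
   finally show ?thesis using s by simp
  qed simp
 next
  case False
  then have lt: "s < t" "0 < s" using st by auto
  have "\<exists>z. s < z \<and> z < t \<and> t powr p - s powr p = (t - s) * (p * z powr (p - 1))"
   by (rule MVT2[OF lt(1)]) (use lt in \<open>auto intro!: derivative_eq_intros\<close>)
  then obtain z where z: "s < z" "z < t" "t powr p - s powr p = (t - s) * (p * z powr (p - 1))" by blast
  have "p * z powr (p - 1) \<le> p * R powr (p - 1)" using z lt st p by (intro mult_left_mono powr_mono2) auto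
  from mult_left_mono[OF this, of "t - s"] show ?thesis using z(3) lt by (simp add: mult.commute)
 qed
qed

lemma spow_Lipschitz:
 assumes p: "1 < p" and R: "s \<le> t" "\<bar>s\<bar> \<le> R" "\<bar>t\<bar> \<le> R"
 shows "0 \<le> spow p t - spow p s" "spow p t - spow p s \<le> p * R powr (p - 1) * (t - s)"
proof -
 have "0 \<le> spow p t - spow p s \<and> spow p t - spow p s \<le> p * R powr (p - 1) * (t - s)"
 proof (cases "0 \<le> s")
  case True
  then show ?thesis using powr_diff_le[OF p True R(1), of R] R by (simp add: spow_nonneg)
 next
  case False
  have s: "spow p s = - ((- s) powr p)" using spow_minus[of p "- s"] spow_nonneg[of "- s" p] False by simp
  show ?thesis
  proof (cases "0 \<le> t")
   case True
   have "0 \<le> t powr p - 0 powr p \<and> t powr p - 0 powr p \<le> p * R powr (p - 1) * (t - 0)"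
    using powr_diff_le[OF p _ True, of R] R by simp
   moreover have "0 \<le> (- s) powr p - 0 powr p \<and> (- s) powr p - 0 powr p \<le> p * R powr (p - 1) * (- s - 0)"
    using powr_diff_le[OF p, of 0 "- s" R] R False by simp
   ultimately show ?thesis unfolding s spow_nonneg[OF True] by (simp add: algebra_simps)
  next
   case t: False
   have "spow p t = - ((- t) powr p)" using spow_minus[of p "- t"] spow_nonneg[of "- t" p] t by simp
   moreover have "0 \<le> (- s) powr p - (- t) powr p" "(- s) powr p - (- t) powr p \<le> p * R powr (p - 1) * (- s - - t)"
    by (rule powr_diff_le[OF p]; use R t in simp)+
   ultimately show ?thesis unfolding s by (simp add: algebra_simps)
  qed
 qed
 then show "0 \<le> spow p t - spow p s" "spow p t - spow p s \<le> p * R powr (p - 1) * (t - s)" by auto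
qed

lemma mono_spow: "1 < p ==> mono (spow p)"
proof (rule monoI)
 fix s t :: real assume "1 < p" "s \<le> t"
 from spow_Lipschitz(1)[OF this, of "max \<bar>s\<bar> \<bar>t\<bar>"] show "spow p s \<le> spow p t" by simp
qed

lemma continuous_spow: "1 < p ==> continuous_on UNIV (spow p)"
 unfolding spow_def[abs_def] by (intro continuous_intros continuous_on_powr') auto

context kern_kato begin

text \<open>Truncating the value at j is the same as truncating the argument at R = j^{1/p}, and on
  [-R, R] the odd power has Lipschitz constant p R^{p-1}.\<close>

lemma clamp_spow_Lipschitz:
 assumes p: "1 < p"
 shows "\<bar>clamp_at j (spow p s) - clamp_at j (spow p t)\<bar> \<le> p * (real j powr (1 / p)) powr (p - 1) * \<bar>s - t\<bar>"
proof -
 define R where "R = real j powr (1 / p)"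
 have R: "0 \<le> R" "spow p R = j" "spow p (- R) = - j"
  using p by (auto simp: R_def spow_minus spow_nonneg powr_powr)
 define cl where "cl t = max (- R) (min R t)" for t
 have c: "clamp_at j (spow p t) = spow p (cl t)" for t
 proof -
  have "spow p t \<le> j \<and> - j \<le> spow p t" if "- R \<le> t" "t \<le> R"
   using monoD[OF mono_spow[OF p] that(1)] monoD[OF mono_spow[OF p] that(2)] R by simp
  moreover have "j \<le> spow p t" if "R \<le> t" using monoD[OF mono_spow[OF p] that] R by simp
  moreover have "spow p t \<le> - j" if "t \<le> - R" using monoD[OF mono_spow[OF p] that] R by simp
  ultimately show ?thesis using R unfolding clamp_at_def cl_def
   by (cases "t \<le> - R"; cases "R \<le> t") (auto simp: max_def min_def)
 qed
 have b: "\<bar>cl t\<bar> \<le> R" for t using R(1) by (auto simp: cl_def)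
 have main: "\<bar>spow p (cl s) - spow p (cl t)\<bar> \<le> p * R powr (p - 1) * \<bar>cl s - cl t\<bar>"
  using spow_Lipschitz[OF p _ b b, of s t] spow_Lipschitz[OF p _ b b, of t s]
  by (cases "cl s \<le> cl t") auto
 also have "... \<le> p * R powr (p - 1) * \<bar>s - t\<bar>"
  using p by (intro mult_left_mono) (auto simp: cl_def max_def min_def)
 finally show ?thesis unfolding c R_def[symmetric] .
qed

lemma mono_clamp_spow: "1 < p ==> mono (\<lambda>t. clamp_at j (spow p t))"
 using monoD[OF mono_spow[of p]] unfolding clamp_at_def by (intro monoI max.mono min.mono) auto

text \<open>The two-sided bound holds for every truncated equation with the same potentials, so the
  p-th powers of these potentials form a majorant independent of the truncation level.\<close>

lemma solvable_of_powr_integrable: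
 assumes p: "1 < p"
  and n1: "adm n1" "integrable n1 h1" "\<And>y. y \<in> \<Omega> ==> 0 \<le> h1 y" "integrable m (\<lambda>x. P n1 h1 x powr p)"
  and n2: "adm n2" "integrable n2 h2" "\<And>y. y \<in> \<Omega> ==> 0 \<le> h2 y" "integrable m (\<lambda>x. P n2 h2 x powr p)"
 shows "\<exists>u. solves (spow p) (\<lambda>x. P n1 h1 x - P n2 h2 x) u"
proof -
 let ?h = "\<lambda>x. P n1 h1 x - P n2 h2 x"
 have hi: "integrable m ?h" by (intro int_diff P_int n1 n2)
 have z: "clamp_at k (spow p 0) = 0" for k by (simp add: spow_0 clamp_at_def)
 have "\<exists>u. solves (\<lambda>t. clamp_at k (spow p t)) ?h u" for k
  by (rule solvable_Lipschitz[OF mono_clamp_spow[OF p] z clamp_spow_Lipschitz[OF p] hi])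
 then obtain u where u: "\<And>k. solves (\<lambda>t. clamp_at k (spow p t)) ?h (u k)" by metis
 show ?thesis
 proof (rule solvable_dominated[OF mono_spow[OF p] continuous_spow[OF p] u])
  show "integrable m (\<lambda>x. P n1 h1 x powr p + P n2 h2 x powr p)"
   by (intro int_add n1 n2)
  fix k
  have uk: "integrable m (u k)" "integrable m (\<lambda>x. clamp_at k (spow p (u k x)))"
   "AE x in m. u k x + P m (\<lambda>x. clamp_at k (spow p (u k x))) x = ?h x"
   using u[of k] by (auto simp: solves_def)
  have ub: "AE x in m. u k x \<le> P n1 h1 x"
   by (rule upper_bound[OF mono_clamp_spow[OF p] z uk(1,2) n1(1,2) _ n2(1,2) _ uk(3)]) (use n1(3) n2(3) in auto)
  have lb: "AE x in m. - P n2 h2 x \<le> u k x"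
   by (rule lower_bound[OF mono_clamp_spow[OF p] z uk(1,2) n1(1,2) _ n2(1,2) _ uk(3)]) (use n1(3) n2(3) in auto)
  show "AE x in m. \<bar>spow p (u k x)\<bar> \<le> P n1 h1 x powr p + P n2 h2 x powr p"
   using ub lb
  proof eventually_elim
   case (elim x)
   have "\<bar>u k x\<bar> powr p \<le> P n1 h1 x powr p + P n2 h2 x powr p"
   proof (cases "0 \<le> u k x")
    case True
    then have "\<bar>u k x\<bar> powr p \<le> P n1 h1 x powr p" using elim p by (intro powr_mono2) auto
    then show ?thesis by (simp add: add_increasing2)
   next
    case False
    then have "\<bar>u k x\<bar> powr p \<le> P n2 h2 x powr p" using elim p by (intro powr_mono2) auto
    then show ?thesis by (simp add: add_increasing)
   qed
   then show ?case by (simp add: abs_spow)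
  qed
 qed
qed

text \<open>The full potentials need not lie in L^p(m), so the data are first restricted to the
  exhausting sets. Stability measures the distance of two such solutions by the mass of the added
  part of the data, hence the solutions and their nonlinear terms are Cauchy.\<close>

theorem solvable_of_exhaustion:
 assumes p: "1 < p" and n1: "adm n1" and n2: "adm n2"
  and A1: "range A1 \<subseteq> sets n1" "incseq A1" "emeasure n1 (space n1 - (\<Union>j. A1 j)) = 0"
   "\<And>j::nat. integrable m (\<lambda>x. P n1 (indicator (A1 j)) x powr p)"
  and A2: "range A2 \<subseteq> sets n2" "incseq A2" "emeasure n2 (space n2 - (\<Union>j. A2 j)) = 0"
   "\<And>j::nat. integrable m (\<lambda>x. P n2 (indicator (A2 j)) x powr p)"
 shows "\<exists>u. solves (spow p) (\<lambda>x. P n1 (\<lambda>_. 1) x - P n2 (\<lambda>_. 1) x) u"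
proof -
 have ii: "integrable n (indicator (A j) :: 'a => real)" if "adm n" "range A \<subseteq> sets n" for n A and j :: nat
 proof -
  interpret finite_measure n using that by (simp add: adm_def)
  show ?thesis using that(2) by (intro integrable_real_indicator) (auto simp: less_top[symmetric])
 qed
 have i1: "integrable n (\<lambda>_. 1 :: real)" if "adm n" for n
 proof -
  interpret finite_measure n using that by (simp add: adm_def)
  show ?thesis by simp
 qed
 have lim: "(\<lambda>j. measure n (A j)) \<longlonglongrightarrow> measure n (\<Union>j. A j)" if "adm n" "range A \<subseteq> sets n" "incseq A" for n and A :: "nat => 'a set"
 proof -
  interpret finite_measure n using that by (simp add: adm_def)
  show ?thesis by (rule finite_Lim_measure_incseq[OF that(2,3)])
 qed
 have L1: "(\<lambda>j. LINT x|n. \<bar>indicat_real (A j) x - 1\<bar>) \<longlonglongrightarrow> (0::real)"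
  if "adm n" "range A \<subseteq> sets n" "incseq A" "emeasure n (space n - (\<Union>j. A j)) = 0" for n and A :: "nat => 'a set"
 proof -
  interpret finite_measure n using that by (simp add: adm_def)
  have As: "A j \<in> sets n" for j using that(2) by auto
  have "(LINT x|n. \<bar>indicat_real (A j) x - 1\<bar>) = measure n (\<Union>j. A j) - measure n (A j)" for j
  proof -
   have "(LINT x|n. \<bar>indicat_real (A j) x - 1\<bar>) = (LINT x|n. indicat_real (space n - A j) x)"
    by (intro LINT_cong refl) (auto simp: indicator_def)
   also have "... = measure n (space n) - measure n (A j)" using As by (simp add: finite_measure_compl)
   also have "measure n (space n) = measure n (\<Union>j. A j)"
    using that(4) finite_measure_compl[of "\<Union>j. A j"] As by (simp add: measure_def)
   finally show ?thesis .
  qed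
  moreover have "(\<lambda>j. measure n (\<Union>j. A j) - measure n (A j)) \<longlonglongrightarrow> measure n (\<Union>j. A j) - measure n (\<Union>j. A j)"
   by (intro tendsto_intros lim that)
  ultimately show ?thesis by simp
 qed
 have "\<exists>u. solves (spow p) (\<lambda>x. P n1 (indicator (A1 j)) x - P n2 (indicator (A2 j)) x) u" for j
  by (rule solvable_of_powr_integrable[OF p n1 ii[OF n1 A1(1)] _ A1(4) n2 ii[OF n2 A2(1)] _ A2(4)]) auto
 then obtain u where u: "\<And>j. solves (spow p) (\<lambda>x. P n1 (indicator (A1 j)) x - P n2 (indicator (A2 j)) x) (u j)" by metis
 have ui: "integrable m (u j)" "integrable m (\<lambda>x. spow p (u j x))"
  "AE x in m. u j x + P m (\<lambda>x. spow p (u j x)) x = P n1 (indicator (A1 j)) x - P n2 (indicator (A2 j)) x" for j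
  using u[of j] by (auto simp: solves_def)
 let ?d = "\<lambda>i j. (LINT x|m. \<bar>u i x - u j x\<bar>) + l * (LINT x|m. \<bar>spow p (u i x) - spow p (u j x)\<bar>)"
 let ?M = "\<lambda>j. measure n1 (A1 j) + measure n2 (A2 j)"
 \<comment> \<open>For j at most i the data differ by the nonnegative densities on A(i) - A(j),
   whose masses are differences of convergent sequences.\<close>
 have d: "?d i j \<le> 2 * L * (?M i - ?M j)" if ji: "j \<le> i" for i j
 proof -
  have D: "integrable n (indicator (A i - A j) :: 'a => real)"
   "(LINT x|n. indicat_real (A i - A j) x) = measure n (A i) - measure n (A j)"
   "AE x in m. P n (indicator (A i)) x - P n (indicator (A j)) x = P n (indicator (A i - A j)) x"
   if n: "adm n" and A: "range A \<subseteq> sets n" "incseq A" for n A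
  proof -
   interpret finite_measure n using n by (simp add: adm_def)
   have As: "A j \<in> sets n" for j using A by auto
   have sub: "A j \<subseteq> A i" using A(2) ji by (auto simp: incseq_def)
   have eq: "indicator (A i - A j) = (\<lambda>x. indicator (A i) x - indicator (A j) x :: real)"
    using sub by (auto simp: indicator_def fun_eq_iff)
   show "integrable n (indicator (A i - A j) :: 'a => real)" unfolding eq by (intro int_diff ii n A)
   show "(LINT x|n. indicat_real (A i - A j) x) = measure n (A i) - measure n (A j)"
    using As sub by (simp add: finite_measure_Diff)
   show "AE x in m. P n (indicator (A i)) x - P n (indicator (A j)) x = P n (indicator (A i - A j)) x"
    unfolding eq using P_diff[OF n ii[OF n A(1), of i] ii[OF n A(1), of j]] by eventually_elim simp
  qed
  have "?d i j \<le> 2 * L * ((LINT x|n1. indicat_real (A1 i - A1 j) x) + (LINT x|n2. indicat_real (A2 i - A2 j) x))"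
  proof (rule stability[OF mono_spow[OF p] ui(1,2) ui(1,2) n1 D(1)[OF n1 A1(1,2)] _ n2 D(1)[OF n2 A2(1,2)]])
   show "AE x in m. u i x + P m (\<lambda>x. spow p (u i x)) x - (u j x + P m (\<lambda>x. spow p (u j x)) x)
    = P n1 (indicator (A1 i - A1 j)) x - P n2 (indicator (A2 i - A2 j)) x"
    using ui(3)[of i] ui(3)[of j] D(3)[OF n1 A1(1,2)] D(3)[OF n2 A2(1,2)] by eventually_elim simp
  qed auto
  also have "... = 2 * L * (?M i - ?M j)"
   unfolding D(2)[OF n1 A1(1,2)] D(2)[OF n2 A2(1,2)] by (simp only: algebra_simps)
  finally show ?thesis .
 qed
 have "convergent ?M"
  using tendsto_add[OF lim[OF n1 A1(1,2)] lim[OF n2 A2(1,2)]] by (auto simp: convergent_def)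
 then have Cau: "Cauchy ?M" by (rule convergent_Cauchy)
 have small: "\<exists>N. \<forall>i\<ge>N. \<forall>j\<ge>N. ?d i j < e" if e: "e > 0" for e
 proof -
  have "e / (2 * L) > 0" using e Lpos by simp
  from CauchyD[OF Cau this] obtain N where N: "\<And>i j. i \<ge> N ==> j \<ge> N ==> \<bar>?M i - ?M j\<bar> < e / (2 * L)" by auto
  have le: "?d i j < e" if "i \<ge> N" "j \<ge> N" "j \<le> i" for i j
  proof -
   have "2 * L * (?M i - ?M j) < 2 * L * (e / (2 * L))" using N[OF that(1,2)] Lpos by (intro mult_strict_left_mono) auto
   with d[OF that(3)] Lpos show ?thesis by simp
  qed
  have "?d i j < e" if "i \<ge> N" "j \<ge> N" for i j
   using le[OF that] le[OF that(2,1)] by (cases "j \<le> i") (auto simp: abs_minus_commute)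
  then show ?thesis by blast
 qed
 have nn: "0 \<le> (LINT x|m. \<bar>u i x - u j x\<bar>)" "0 \<le> (LINT x|m. \<bar>spow p (u i x) - spow p (u j x)\<bar>)" for i j by simp_all
 have C1: "\<exists>N. \<forall>i\<ge>N. \<forall>j\<ge>N. (LINT x|m. \<bar>u i x - u j x\<bar>) < e" if e: "e > 0" for e
 proof -
  obtain N where N: "\<And>i j. i \<ge> N ==> j \<ge> N ==> ?d i j < e" using small[OF e] by blast
  have "(LINT x|m. \<bar>u i x - u j x\<bar>) < e" if "i \<ge> N" "j \<ge> N" for i j
   using N[OF that] mult_nonneg_nonneg[OF less_imp_le[OF lpos] nn(2)[of i j]] by linarith
  then show ?thesis by blast
 qed
 have C2: "\<exists>N. \<forall>i\<ge>N. \<forall>j\<ge>N. (LINT x|m. \<bar>spow p (u i x) - spow p (u j x)\<bar>) < e" if e: "e > 0" for e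
 proof -
  have "l * e > 0" using e lpos by simp
  from small[OF this] obtain N where N: "\<And>i j. i \<ge> N ==> j \<ge> N ==> ?d i j < l * e" by blast
  have "(LINT x|m. \<bar>spow p (u i x) - spow p (u j x)\<bar>) < e" if "i \<ge> N" "j \<ge> N" for i j
  proof -
   have "l * (LINT x|m. \<bar>spow p (u i x) - spow p (u j x)\<bar>) < l * e" using N[OF that] nn(1)[of i j] by linarith
   then show ?thesis using lpos by simp
  qed
  then show ?thesis by blast
 qed
 note Pi = P_int[OF n1 ii[OF n1 A1(1)]] P_int[OF n2 ii[OF n2 A2(1)]] P_int[OF n1 i1[OF n1]] P_int[OF n2 i1[OF n2]]
 have H: "(\<lambda>j. LINT x|m. \<bar>P n1 (indicator (A1 j)) x - P n2 (indicator (A2 j)) x - (P n1 (\<lambda>_. 1) x - P n2 (\<lambda>_. 1) x)\<bar>) \<longlonglongrightarrow> 0"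
 proof (rule tendsto_sandwich[OF _ _ tendsto_const])
  let ?a = "\<lambda>j. \<integral>x. \<bar>P n1 (indicator (A1 j)) x - P n1 (\<lambda>_. 1) x\<bar> \<partial>m"
  let ?b = "\<lambda>j. \<integral>x. \<bar>P n2 (indicator (A2 j)) x - P n2 (\<lambda>_. 1) x\<bar> \<partial>m"
  have "?a \<longlonglongrightarrow> 0" by (rule P_L1_tendsto[OF n1 ii[OF n1 A1(1)] i1[OF n1] L1[OF n1 A1(1-3)]])
  moreover have "?b \<longlonglongrightarrow> 0" by (rule P_L1_tendsto[OF n2 ii[OF n2 A2(1)] i1[OF n2] L1[OF n2 A2(1-3)]])
  ultimately show "(\<lambda>j. ?a j + ?b j) \<longlonglongrightarrow> 0" using tendsto_add[of ?a 0 sequentially ?b 0] by simp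
  have "(LINT x|m. \<bar>P n1 (indicator (A1 j)) x - P n2 (indicator (A2 j)) x - (P n1 (\<lambda>_. 1) x - P n2 (\<lambda>_. 1) x)\<bar>) \<le> ?a j + ?b j" for j
   by (subst Bochner_Integration.integral_add[symmetric])
    (auto intro!: integral_mono int_add integrable_abs int_diff Pi)
  then show "\<forall>\<^sub>F j in sequentially. (LINT x|m. \<bar>P n1 (indicator (A1 j)) x - P n2 (indicator (A2 j)) x - (P n1 (\<lambda>_. 1) x - P n2 (\<lambda>_. 1) x)\<bar>) \<le> ?a j + ?b j" by simp
 qed simp
 show ?thesis
  by (rule solves_limit_Cauchy[OF u continuous_spow[OF p] _ _ H C1 C2]) (auto intro: int_diff Pi)
qed

end

section \<open>Equivalence with the weak-dual formulation\<close>

context green_setting begin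

lemma AE_m_iff: "(AE x in m. Q x) \<longleftrightarrow> (AE x in M1. Q x)"
proof -
 have "(AE x in m. Q x) \<longleftrightarrow> (AE x in M1. 0 < ennreal (w x) \<longrightarrow> Q x)"
  unfolding m_def by (rule AE_density) measurable
 also have "... \<longleftrightarrow> (AE x in M1. Q x)"
  by (intro AE_cong) (simp add: w_pos)
 finally show ?thesis .
qed

text \<open>By symmetry the potential of a weighted test function is the weight times the adjoint
  potential of its bounded factor.\<close>

lemma green_fun_eq:
 assumes \<zeta>: "\<zeta> \<in> borel_measurable M1" and \<xi>: "\<And>x. x \<in> \<Omega> ==> \<xi> x = w x * \<zeta> x" and x: "x \<in> \<Omega>"
 shows "green_fun \<Omega> G \<xi> x = w x * (LINT z|m. k z x * \<zeta> z)"
proof -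
 note [measurable] = K_section_measurable \<zeta>
 have "(\<lambda>x. w x * \<zeta> x) \<in> borel_measurable M1" by measurable
 then have "\<xi> \<in> borel_measurable M1" by (rule measurable_cong[THEN iffD1, rotated]) (simp add: \<xi>)
 then have "green_fun \<Omega> G \<xi> x = (LINT y|M1. K x y * \<xi> y)"
  using green_fun_eq_P[of \<xi> x] x by simp
 also have "... = (LINT y|M1. w x * ((k y x * \<zeta> y) * w y))"
  using w_pos[OF x] by (intro LINT_cong refl) (simp add: \<xi> k_def K_sym[of x])
 also have "... = w x * (LINT y|M1. (k y x * \<zeta> y) * w y)" by simp
 also have "(LINT y|M1. (k y x * \<zeta> y) * w y) = (LINT z|m. k z x * \<zeta> z)"
  by (rule integral_m[symmetric]) (unfold k_def, measurable)
 finally show ?thesis .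
qed

text \<open>Translates a measure with finite weighted mass into an admissible one: the factor w in
  the density cancels the one in \<open>k\<close>. The last claim is the adjoint relation, written
  for the test functions of the weak-dual formulation.\<close>

lemma weighted_measure:
 assumes \<sigma>: "sets \<sigma> = sets (restrict_space borel \<Omega>)" and fin: "(\<integral>\<^sup>+x. ennreal (w x) \<partial>\<sigma>) < \<infinity>"
 defines "n \<equiv> density \<sigma> (\<lambda>x. ennreal (w x))"
 shows "adm n" "sets n = sets (restrict_space borel \<Omega>)"
  and "measure n (space n) = (LINT x|\<sigma>. w x)"
  and "AE x in M1. green_meas G \<sigma> x = P n (\<lambda>_. 1) x"
  and "\<And>\<zeta> \<xi> C. \<zeta> \<in> borel_measurable M1 ==> AE x in M1. \<bar>\<zeta> x\<bar> \<le> C ==> (\<And>x. x \<in> \<Omega> ==> \<xi> x = w x * \<zeta> x) ==>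
   (LINT x|\<sigma>. green_fun \<Omega> G \<xi> x) = (LINT x|m. \<zeta> x * P n (\<lambda>_. 1) x)"
proof -
 have sp\<sigma>: "space \<sigma> = \<Omega>" using sets_eq_imp_space_eq[OF \<sigma>] by (simp add: space_restrict_space)
 have id\<sigma>: "(\<lambda>x. x) \<in> \<sigma> \<rightarrow>\<^sub>M borel"
  unfolding measurable_cong_sets[OF \<sigma> refl] by (intro measurable_restrict_space1) simp
 have [measurable]: "w \<in> borel_measurable \<sigma>" using measurable_compose[OF id\<sigma> w_measurable] by simp
 have idn: "(\<lambda>x. x) \<in> n \<rightarrow>\<^sub>M borel" using id\<sigma> by (simp add: n_def)
 have nE: "emeasure n (space n) = (\<integral>\<^sup>+x. ennreal (w x) \<partial>\<sigma>)"
  by (simp add: n_def emeasure_density)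
 show a: "adm n" unfolding adm_def using fin idn nE by (auto intro!: finite_measureI simp: n_def sp\<sigma>)
 show "sets n = sets (restrict_space borel \<Omega>)" by (simp add: n_def \<sigma>)
 show "measure n (space n) = (LINT x|\<sigma>. w x)"
  using w_nonneg by (simp add: measure_def nE integral_eq_nn_integral)
 interpret n: finite_measure n using a by (simp add: adm_def)
 have Km: "(\<lambda>y. K x y) \<in> borel_measurable \<sigma>" and km\<sigma>: "(\<lambda>y. k x y) \<in> borel_measurable \<sigma>" for x
  using measurable_compose[OF measurable_Pair[OF measurable_const id\<sigma>] K_measurable, of x]
   measurable_compose[OF measurable_Pair[OF measurable_const id\<sigma>] k_measurable_borel, of x] by simp_all
 \<comment> \<open>If x carries an atom, \<open>green_meas\<close> sees the unspecified value of G
   at (x, x). A finite measure has countably many atoms, so this concerns only a Lebesgue null set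
   of points x.\<close>
 have "countable {x. measure n {x} \<noteq> 0}" by (rule n.countable_support)
 then have "{x. measure n {x} \<noteq> 0} \<in> null_sets lborel" by (rule countable_imp_null_set_lborel)
 then have "AE x in lborel. measure n {x} = 0" by (rule AE_I'[of _ lborel]) auto
 then have "AE x in lebesgue. measure n {x} = 0" by (rule AE_completion)
 then have ae: "AE x in M1. measure n {x} = 0" using sets_\<Omega>(2) by (subst AE_restrict_space_iff) (auto elim: eventually_mono)
 show "AE x in M1. green_meas G \<sigma> x = P n (\<lambda>_. 1) x"
  using ae AE_space
 proof eventually_elim
  case (elim x)
  then have x: "x \<in> \<Omega>" by simp
  have xs: "{x} \<in> sets n" using x sets_\<Omega>(1) by (simp add: n_def \<sigma> sets_restrict_space_iff)
  have "AE y in n. y \<noteq> x"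
   by (rule AE_I'[of "{x}"]) (use elim xs in \<open>auto simp: null_sets_def n.emeasure_eq_measure\<close>)
  then have "AE y in \<sigma>. 0 < ennreal (w y) \<longrightarrow> y \<noteq> x" unfolding n_def by (subst (asm) AE_density) auto
  then have ne: "AE y in \<sigma>. y \<noteq> x" by (rule AE_mp) (intro AE_I2, simp add: w_pos sp\<sigma>)
  have "P n (\<lambda>_. 1) x = (LINT y|\<sigma>. w y *\<^sub>R (k x y * 1))"
   unfolding P_def n_def using km\<sigma> w_nonneg by (intro integral_density) auto
  also have "... = (LINT y|\<sigma>. K x y)" by (simp add: K_eq_k mult.commute)
  also have "... = green_meas G \<sigma> x" unfolding green_meas_def
  proof (rule integral_cong_AE[OF Km])
   have [measurable]: "(\<lambda>y. y = x) \<in> measurable \<sigma> (count_space UNIV)"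
    using measurable_compose[OF id\<sigma>, of "\<lambda>y. y = x" "count_space UNIV"] by (simp add: pred_def)
   note [measurable] = Km
   have "(\<lambda>y. if y = x then G x x else K x y) \<in> borel_measurable \<sigma>" by measurable
   then show "(\<lambda>y. G x y) \<in> borel_measurable \<sigma>"
    by (rule measurable_cong[THEN iffD1, rotated]) (use x sp\<sigma> in \<open>auto simp: K_def\<close>)
   show "AE y in \<sigma>. K x y = G x y"
    using ne by (rule AE_mp) (intro AE_I2 impI, use x sp\<sigma> in \<open>auto simp: K_def\<close>)
  qed
  finally show ?case by (rule sym)
 qed
 fix \<zeta> \<xi> C assume \<zeta>: "\<zeta> \<in> borel_measurable M1" and b: "AE x in M1. \<bar>\<zeta> x\<bar> \<le> C" and \<xi>: "\<And>x. x \<in> \<Omega> ==> \<xi> x = w x * \<zeta> x"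
 have \<zeta>m[measurable]: "\<zeta> \<in> borel_measurable m" using \<zeta> by (simp add: borel_measurable_m)
 have "(LINT x|m. \<zeta> x * P n (\<lambda>_. 1) x) = (LINT y|n. 1 * (LINT x|m. k x y * \<zeta> x))"
  by (rule P_pairing[OF a _ \<zeta>m, of _ C]) (use b in \<open>simp_all only: AE_m_iff n.integrable_const\<close>)
 also have "... = (LINT y|\<sigma>. w y *\<^sub>R (LINT x|m. k x y * \<zeta> x))"
 proof -
  interpret pm: pair_sigma_finite m n by (rule adm_pair[OF a])
  have [measurable]: "(\<lambda>(y, x). k x y) \<in> borel_measurable (n \<Otimes>\<^sub>M m)"
   using measurable_compose[OF measurable_pair_swap' k_measurable[OF idm idn]] by (simp add: case_prod_beta)
  have "(\<lambda>y. LINT x|m. k x y * \<zeta> x) \<in> borel_measurable n" by measurable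
  then have "(\<lambda>y. LINT x|m. k x y * \<zeta> x) \<in> borel_measurable \<sigma>" by (simp add: n_def)
  then show ?thesis unfolding n_def using w_nonneg by (simp add: integral_density)
 qed
 also have "... = (LINT x|\<sigma>. green_fun \<Omega> G \<xi> x)"
  by (intro LINT_cong refl) (simp add: sp\<sigma> green_fun_eq[OF \<zeta> \<xi>])
 finally show "(LINT x|\<sigma>. green_fun \<Omega> G \<xi> x) = (LINT x|m. \<zeta> x * P n (\<lambda>_. 1) x)" by (rule sym)
qed

lemma L1_weighted_iff: "u \<in> L1_weighted \<Omega> \<gamma> \<longleftrightarrow> integrable m u"
proof -
 have "u \<in> borel_measurable M1" if "integrable m u" using borel_measurable_integrable[OF that] by (simp only: borel_measurable_m)
 then show ?thesis unfolding L1_weighted_def w_def[symmetric] using integrable_m[of u] by blast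
qed

lemma L1_weighted_norm_eq: "integrable m u ==> L1_weighted_norm \<Omega> \<gamma> u = (LINT x|m. \<bar>u x\<bar>)"
 unfolding L1_weighted_norm_def w_def[symmetric]
 by (rule integral_m[symmetric]) (drule borel_measurable_integrable[OF integrable_abs], simp only: borel_measurable_m)

text \<open>Every weak-dual identity says that the residual R of the integrated equation is
  orthogonal to a bounded function \<zeta>, and every bounded measurable \<zeta> occurs.\<close>

lemma weak_dual_solution_iff:
 assumes p: "1 < p"
  and \<sigma>1: "sets (fst \<mu>) = sets (restrict_space borel \<Omega>)" "(\<integral>\<^sup>+x. ennreal (w x) \<partial>fst \<mu>) < \<infinity>"
  and \<sigma>2: "sets (snd \<mu>) = sets (restrict_space borel \<Omega>)" "(\<integral>\<^sup>+x. ennreal (w x) \<partial>snd \<mu>) < \<infinity>"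
 defines "n1 \<equiv> density (fst \<mu>) (\<lambda>x. ennreal (w x))" and "n2 \<equiv> density (snd \<mu>) (\<lambda>x. ennreal (w x))"
 shows "weak_dual_solution \<Omega> \<gamma> G p \<mu> u \<longleftrightarrow> solves (spow p) (\<lambda>x. P n1 (\<lambda>_. 1) x - P n2 (\<lambda>_. 1) x) u"
proof -
 note W1 = weighted_measure[OF \<sigma>1, folded n1_def] and W2 = weighted_measure[OF \<sigma>2, folded n2_def]
 let ?P1 = "P n1 (\<lambda>_. 1)" and ?P2 = "P n2 (\<lambda>_. 1)"
 let ?g = "\<lambda>\<xi>. \<integral>x. \<bar>u x\<bar> powr (p - 1) * u x * green_fun \<Omega> G \<xi> x \<partial>M1"
 interpret n1: finite_measure n1 using W1(1) by (simp add: adm_def)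
 interpret n2: finite_measure n2 using W2(1) by (simp add: adm_def)
 have Pi: "integrable m ?P1" "integrable m ?P2"
  by (rule P_int[OF W1(1)] P_int[OF W2(1)]; simp)+
 define R where "R x = u x + P m (\<lambda>x. spow p (u x)) x - (?P1 x - ?P2 x)" for x
 have powr_iff: "integrable m (\<lambda>x. \<bar>u x\<bar> powr p) \<longleftrightarrow> integrable m (\<lambda>x. spow p (u x))" if "integrable m u"
 proof -
  have [measurable]: "u \<in> borel_measurable m" using that by auto
  have "(\<lambda>x. spow p (u x)) \<in> borel_measurable m" unfolding spow_def by measurable
  from integrable_abs_iff[OF this] show ?thesis by (simp only: abs_spow)
 qed
 have pair: "(LINT x|M1. u x * \<xi> x) + (?g \<xi>) - signed_integral \<mu> (green_fun \<Omega> G \<xi>)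
   = (LINT x|m. \<zeta> x * R x)"
  if u: "integrable m u" "integrable m (\<lambda>x. spow p (u x))" and \<zeta>: "\<zeta> \<in> borel_measurable M1" "AE x in M1. \<bar>\<zeta> x\<bar> \<le> C"
   and \<xi>: "\<And>x. x \<in> \<Omega> ==> \<xi> x = w x * \<zeta> x" for \<zeta> \<xi> C
 proof -
  have \<zeta>m[measurable]: "\<zeta> \<in> borel_measurable m" using \<zeta>(1) by (simp add: borel_measurable_m)
  have \<zeta>C: "AE x in m. \<bar>\<zeta> x\<bar> \<le> C" using \<zeta>(2) by (simp only: AE_m_iff)
  have uM: "u \<in> borel_measurable M1" using borel_measurable_integrable[OF u(1)] by (simp only: borel_measurable_m)
  have \<zeta>i: "integrable m (\<lambda>x. \<zeta> x * f x)" if f: "integrable m f" for f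
  proof (rule int_bound[OF integrable_mult_right[OF f, of C]])
   have [measurable]: "f \<in> borel_measurable m" using f by auto
   show "(\<lambda>x. \<zeta> x * f x) \<in> borel_measurable m" by measurable
   show "AE x in m. norm (\<zeta> x * f x) \<le> norm (C * f x)"
    using \<zeta>C by eventually_elim (auto simp: abs_mult intro!: mult_right_mono)
  qed
  have 1: "(LINT x|M1. u x * \<xi> x) = (LINT x|m. \<zeta> x * u x)"
  proof -
   have "(LINT x|M1. u x * \<xi> x) = (LINT x|M1. (\<zeta> x * u x) * w x)"
    by (intro LINT_cong refl) (simp add: \<xi>)
   then show ?thesis using \<zeta>(1) uM by (subst integral_m) auto
  qed
  have 2: "(?g \<xi>) = (LINT x|m. \<zeta> x * P m (\<lambda>x. spow p (u x)) x)"
  proof -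
   interpret mm: pair_sigma_finite m m by (rule adm_pair[OF adm_m])
   have [measurable]: "(\<lambda>(y, x). k x y) \<in> borel_measurable (m \<Otimes>\<^sub>M m)"
    using measurable_compose[OF measurable_pair_swap' k_measurable[OF idm idm]] by (simp add: case_prod_beta)
   have [measurable]: "(\<lambda>x. spow p (u x)) \<in> borel_measurable m" using u(2) by auto
   have "(\<lambda>y. spow p (u y) * (LINT x|m. k x y * \<zeta> x)) \<in> borel_measurable m" by measurable
   then have mM: "(\<lambda>y. spow p (u y) * (LINT x|m. k x y * \<zeta> x)) \<in> borel_measurable M1" by (simp add: borel_measurable_m)
   have "(LINT x|m. \<zeta> x * P m (\<lambda>x. spow p (u x)) x) = (LINT y|m. spow p (u y) * (LINT x|m. k x y * \<zeta> x))"
    by (rule P_pairing[OF adm_m u(2) \<zeta>m \<zeta>C])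
   also have "... = (LINT y|M1. spow p (u y) * (LINT x|m. k x y * \<zeta> x) * w y)" by (rule integral_m[OF mM])
   also have "... = (?g \<xi>)"
    by (intro LINT_cong refl) (simp add: green_fun_eq[OF \<zeta>(1) \<xi>] spow_def)
   finally show ?thesis by (rule sym)
  qed
  have 3: "signed_integral \<mu> (green_fun \<Omega> G \<xi>) = (LINT x|m. \<zeta> x * ?P1 x) - (LINT x|m. \<zeta> x * ?P2 x)"
   unfolding signed_integral_def by (intro arg_cong2[of _ _ _ _ "(-)"] W1(5)[OF \<zeta>] W2(5)[OF \<zeta>] \<xi>)
  have "(LINT x|m. \<zeta> x * R x) = (LINT x|m. (\<zeta> x * u x + \<zeta> x * P m (\<lambda>x. spow p (u x)) x) - (\<zeta> x * ?P1 x - \<zeta> x * ?P2 x))"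
   unfolding R_def by (intro LINT_cong refl) (simp add: algebra_simps)
  also have "... = (LINT x|m. \<zeta> x * u x) + (LINT x|m. \<zeta> x * P m (\<lambda>x. spow p (u x)) x) - ((LINT x|m. \<zeta> x * ?P1 x) - (LINT x|m. \<zeta> x * ?P2 x))"
   using \<zeta>i[OF u(1)] \<zeta>i[OF P_int[OF adm_m u(2)]] \<zeta>i[OF Pi(1)] \<zeta>i[OF Pi(2)] by simp
  finally show ?thesis unfolding 1 2 3 by simp
 qed
 show ?thesis
 proof
  assume s: "solves (spow p) (\<lambda>x. ?P1 x - ?P2 x) u"
  then have u: "integrable m u" "integrable m (\<lambda>x. spow p (u x))" and e: "AE x in m. R x = 0"
   by (auto simp: solves_def R_def)
  show "weak_dual_solution \<Omega> \<gamma> G p \<mu> u"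
   unfolding weak_dual_solution_def L1_weighted_iff
  proof (intro conjI ballI u)
   show "integrable m (\<lambda>x. \<bar>u x\<bar> powr p)" using powr_iff[OF u(1)] u(2) by simp
   fix \<xi> assume "\<xi> \<in> Linf_weighted \<Omega> \<gamma>"
   then obtain \<zeta> C where \<zeta>: "\<zeta> \<in> borel_measurable M1" "AE x in M1. \<bar>\<zeta> x\<bar> \<le> C" "\<And>x. x \<in> \<Omega> ==> \<xi> x = w x * \<zeta> x"
    unfolding Linf_weighted_def Linf_def w_def by blast
   have "(LINT x|m. \<zeta> x * R x) = 0"
    by (rule integral_eq_zero_AE) (use e in eventually_elim, simp)
   with pair[OF u \<zeta>] show "(LINT x|M1. u x * \<xi> x) + (?g \<xi>) = signed_integral \<mu> (green_fun \<Omega> G \<xi>)"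
    by linarith
  qed
 next
  assume "weak_dual_solution \<Omega> \<gamma> G p \<mu> u"
  then have u1: "integrable m u" and u2: "integrable m (\<lambda>x. \<bar>u x\<bar> powr p)"
   and eq: "\<And>\<xi>. \<xi> \<in> Linf_weighted \<Omega> \<gamma> ==> (LINT x|M1. u x * \<xi> x) + (?g \<xi>) = signed_integral \<mu> (green_fun \<Omega> G \<xi>)"
   unfolding weak_dual_solution_def L1_weighted_iff by blast+
  have u: "integrable m u" "integrable m (\<lambda>x. spow p (u x))" using u1 u2 powr_iff by auto
  have Ri: "integrable m R" unfolding R_def[abs_def]
   by (intro int_diff int_add u P_int[OF adm_m] Pi)
  \<comment> \<open>Testing the residual with its own sign shows that its L^1(m) norm
    vanishes.\<close>
  let ?\<zeta> = "\<lambda>x. sgn (R x)"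
  have [measurable]: "R \<in> borel_measurable M1" using borel_measurable_integrable[OF Ri] by (simp only: borel_measurable_m)
  have \<zeta>: "?\<zeta> \<in> borel_measurable M1" by measurable
  have \<zeta>1: "AE x in M1. \<bar>?\<zeta> x\<bar> \<le> 1" by (rule AE_I2) (simp add: abs_sgn_eq)
  have "?\<zeta> \<in> Linf \<Omega>" unfolding Linf_def using \<zeta> \<zeta>1 by blast
  then have L: "(\<lambda>x. w x * ?\<zeta> x) \<in> Linf_weighted \<Omega> \<gamma>" unfolding Linf_weighted_def w_def by (intro CollectI bexI[of _ ?\<zeta>]) auto
  have "(LINT x|m. ?\<zeta> x * R x) = 0" using pair[OF u \<zeta> \<zeta>1 refl] eq[OF L] by linarith
  then have "(LINT x|m. \<bar>R x\<bar>) = 0" by (simp only: abs_sgn mult.commute)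
  then have "AE x in m. \<bar>R x\<bar> = 0"
   by (subst (asm) integral_nonneg_eq_0_iff_AE) (use integrable_abs[OF Ri] in auto)
  then have "AE x in m. u x + P m (\<lambda>x. spow p (u x)) x = ?P1 x - ?P2 x"
   by eventually_elim (simp add: R_def)
  with u show "solves (spow p) (\<lambda>x. ?P1 x - ?P2 x) u" by (simp add: solves_def)
 qed
qed

lemma weak_dual_problem:
 assumes \<mu>: "\<mu> \<in> meas_weighted \<Omega> \<gamma>" and p: "1 < p" "p' = p / (p - 1)" "s - \<gamma> / (2 * p') > 0"
  and ac: "abs_cont_bessel_cap \<Omega> (2 * s - \<gamma> / p') p' (weighted_meas \<Omega> \<gamma> \<mu>)"
 shows "\<exists>u. weak_dual_solution \<Omega> \<gamma> G p \<mu> u \<and>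
  (\<forall>v. weak_dual_solution \<Omega> \<gamma> G p \<mu> v \<longrightarrow> (AE x in M1. v x = u x)) \<and>
  (AE x in M1. - green_meas G (neg_part \<mu>) x \<le> u x \<and> u x \<le> green_meas G (pos_part \<mu>) x) \<and>
  L1_weighted_norm \<Omega> \<gamma> u + L1_weighted_norm \<Omega> \<gamma> (\<lambda>x. \<bar>u x\<bar> powr p) \<le> (2 * Lc + 2 * Lc / lc) * meas_weighted_norm \<Omega> \<gamma> \<mu>"
proof -
 define n1 where "n1 = density (fst \<mu>) (\<lambda>x. ennreal (w x))"
 define n2 where "n2 = density (snd \<mu>) (\<lambda>x. ennreal (w x))"
 have \<sigma>: "sets (fst \<mu>) = sets (restrict_space borel \<Omega>)" "sets (snd \<mu>) = sets (restrict_space borel \<Omega>)"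
  using \<mu> by (auto simp: meas_weighted_def signed_radon_def radon_on_def)
 have "(\<integral>\<^sup>+x. ennreal (w x) \<partial>fst \<mu>) + (\<integral>\<^sup>+x. ennreal (w x) \<partial>snd \<mu>) < \<infinity>"
  using \<mu> by (simp add: meas_weighted_def w_def)
 then have fin: "(\<integral>\<^sup>+x. ennreal (w x) \<partial>fst \<mu>) < \<infinity>" "(\<integral>\<^sup>+x. ennreal (w x) \<partial>snd \<mu>) < \<infinity>" by auto
 note W1 = weighted_measure[OF \<sigma>(1) fin(1), folded n1_def] and W2 = weighted_measure[OF \<sigma>(2) fin(2), folded n2_def]
 note iff = weak_dual_solution_iff[OF p(1) \<sigma>(1) fin(1) \<sigma>(2) fin(2), folded n1_def n2_def]
 let ?P1 = "P n1 (\<lambda>_. 1)" and ?P2 = "P n2 (\<lambda>_. 1)"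
 interpret n1: finite_measure n1 using W1(1) by (simp add: adm_def)
 interpret n2: finite_measure n2 using W2(1) by (simp add: adm_def)
 have q: "1 < p'" "p = p' / (p' - 1)" using p(1) by (simp_all add: p(2) field_simps)
 have al: "0 < 2 * s - \<gamma> / p'" using p(3) by (simp add: field_simps)
 have wm: "weighted_meas \<Omega> \<gamma> \<mu> = (n1, n2)" by (simp add: weighted_meas_def n1_def n2_def w_def)
 \<comment> \<open>On compact sets the general capacity is by definition the compact one, so
   absolute continuity of the total variation passes to both parts.\<close>
 have tv: "emeasure n1 E = 0" "emeasure n2 E = 0"
  if E: "compact E" "E \<subseteq> \<Omega>" "bessel_cap_compact (2 * s - \<gamma> / p') p' E = 0" for E
 proof -
  have "total_var (n1, n2) E = 0"
   using ac E borel_compact[OF E(1)] unfolding abs_cont_bessel_cap_def wm bessel_cap_def by auto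
  then show "emeasure n1 E = 0" "emeasure n2 E = 0" by (simp_all add: total_var_def)
 qed
 obtain A1 :: "nat => 'a set" where A1: "range A1 \<subseteq> sets n1" "incseq A1" "emeasure n1 (space n1 - (\<Union>j. A1 j)) = 0"
  "\<And>j. integrable m (\<lambda>x. P n1 (indicator (A1 j)) x powr p)"
  using potential_exhaustion[OF W1(1,2) q(1) al q(2) tv(1)] by blast
 obtain A2 :: "nat => 'a set" where A2: "range A2 \<subseteq> sets n2" "incseq A2" "emeasure n2 (space n2 - (\<Union>j. A2 j)) = 0"
  "\<And>j. integrable m (\<lambda>x. P n2 (indicator (A2 j)) x powr p)"
  using potential_exhaustion[OF W2(1,2) q(1) al q(2) tv(2)] by blast
 obtain u where u: "solves (spow p) (\<lambda>x. ?P1 x - ?P2 x) u"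
  using solvable_of_exhaustion[OF p(1) W1(1) W2(1) A1 A2] by blast
 then have ui: "integrable m u" "integrable m (\<lambda>x. spow p (u x))"
  "AE x in m. u x + P m (\<lambda>x. spow p (u x)) x = ?P1 x - ?P2 x" by (auto simp: solves_def)
 have i1: "integrable n1 (\<lambda>_. 1 :: real)" "integrable n2 (\<lambda>_. 1 :: real)" by simp_all
 have ub: "AE x in m. u x \<le> ?P1 x" and lb: "AE x in m. - ?P2 x \<le> u x"
  by (rule upper_bound[OF mono_spow[OF p(1)] spow_0 ui(1,2) W1(1) i1(1) _ W2(1) i1(2) _ ui(3)], simp_all)
   (rule lower_bound[OF mono_spow[OF p(1)] spow_0 ui(1,2) W1(1) i1(1) _ W2(1) i1(2) _ ui(3)], simp_all)
 show ?thesis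
 proof (intro exI[of _ u] conjI allI impI)
  show "weak_dual_solution \<Omega> \<gamma> G p \<mu> u" using u by (simp add: iff)
  show "AE x in M1. - green_meas G (neg_part \<mu>) x \<le> u x \<and> u x \<le> green_meas G (pos_part \<mu>) x"
   using ub lb W1(4) W2(4) unfolding AE_m_iff by eventually_elim simp
 next
  fix v assume "weak_dual_solution \<Omega> \<gamma> G p \<mu> v"
  then have v: "integrable m v" "integrable m (\<lambda>x. spow p (v x))"
   "AE x in m. v x + P m (\<lambda>x. spow p (v x)) x = ?P1 x - ?P2 x" by (auto simp: iff solves_def)
  \<comment> \<open>Two solutions with the same data: stability is used with zero densities in place
    of both measures.\<close>
  have "(LINT x|m. \<bar>v x - u x\<bar>) + lc * (LINT x|m. \<bar>spow p (v x) - spow p (u x)\<bar>) \<le> 2 * Lc * ((LINT y|m. 0) + (LINT y|m. 0))"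
  proof (rule stability[OF mono_spow[OF p(1)] v(1,2) ui(1,2) adm_m _ _ adm_m])
   show "AE x in m. v x + P m (\<lambda>x. spow p (v x)) x - (u x + P m (\<lambda>x. spow p (u x)) x) = P m (\<lambda>_. 0) x - P m (\<lambda>_. 0) x"
    using v(3) ui(3) by eventually_elim simp
  qed auto
  then have "(LINT x|m. \<bar>v x - u x\<bar>) + lc * (LINT x|m. \<bar>spow p (v x) - spow p (u x)\<bar>) \<le> 0" by simp
  moreover have "0 \<le> lc * (LINT x|m. \<bar>spow p (v x) - spow p (u x)\<bar>)" using lc_pos by simp
  moreover have "0 \<le> (LINT x|m. \<bar>v x - u x\<bar>)" by simp
  ultimately have "(LINT x|m. \<bar>v x - u x\<bar>) = 0" by linarith
  then have "AE x in m. \<bar>v x - u x\<bar> = 0"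
   by (subst (asm) integral_nonneg_eq_0_iff_AE) (use v ui in auto)
  then show "AE x in M1. v x = u x" unfolding AE_m_iff by eventually_elim simp
 next
  let ?N = "meas_weighted_norm \<Omega> \<gamma> \<mu>"
  \<comment> \<open>The a priori bound is stability against the zero solution. Estimating the two
    terms separately gives 2 Lc and 2 Lc / lc, whose sum is the constant.\<close>
  have "(LINT x|m. \<bar>u x - 0\<bar>) + lc * (LINT x|m. \<bar>spow p (u x) - spow p 0\<bar>) \<le> 2 * Lc * ((LINT y|n1. 1) + (LINT y|n2. 1))"
  proof (rule stability[OF mono_spow[OF p(1)] ui(1,2) _ _ W1(1) i1(1) _ W2(1) i1(2)])
   show "AE x in m. u x + P m (\<lambda>x. spow p (u x)) x - (0 + P m (\<lambda>x. spow p 0) x) = ?P1 x - ?P2 x"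
    using ui(3) by eventually_elim (simp add: spow_0, simp add: P_def)
  qed (auto simp: spow_0)
  moreover have "(LINT y|n1. 1) + (LINT y|n2. 1) = ?N"
   using W1(3) W2(3) by (simp add: meas_weighted_norm_def w_def)
  ultimately have le: "(LINT x|m. \<bar>u x\<bar>) + lc * (LINT x|m. \<bar>u x\<bar> powr p) \<le> 2 * Lc * ?N"
   by (simp add: spow_0 abs_spow)
  have nn: "0 \<le> (LINT x|m. \<bar>u x\<bar>)" "0 \<le> (LINT x|m. \<bar>u x\<bar> powr p)" by simp_all
  have "(LINT x|m. \<bar>u x\<bar>) \<le> 2 * Lc * ?N" using le mult_nonneg_nonneg[OF less_imp_le[OF lc_pos] nn(2)] by linarith
  moreover have "(LINT x|m. \<bar>u x\<bar> powr p) \<le> 2 * Lc * ?N / lc"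
  proof -
   have "(LINT x|m. \<bar>u x\<bar> powr p) * lc \<le> 2 * Lc * ?N" using le nn(1) unfolding mult.commute[of _ lc] by linarith
   then show ?thesis using lc_pos by (simp only: pos_le_divide_eq)
  qed
  moreover have "integrable m (\<lambda>x. \<bar>u x\<bar> powr p)" using integrable_abs[OF ui(2)] by (simp add: abs_spow)
  ultimately show "L1_weighted_norm \<Omega> \<gamma> u + L1_weighted_norm \<Omega> \<gamma> (\<lambda>x. \<bar>u x\<bar> powr p) \<le> (2 * Lc + 2 * Lc / lc) * ?N"
   using ui(1) by (simp add: L1_weighted_norm_eq distrib_right)
 qed
qed

end

theorem theorem3p6:
  fixes \<Omega> :: "'a::euclidean_space set" and s \<gamma> c :: real
  assumes "DIM('a) \<ge> 3"
    and "bounded \<Omega>" and "C2_domain \<Omega>"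
    and "0 < s" and "s \<le> 1" and "0 < \<gamma>" and "\<gamma> \<le> 1" and "real DIM('a) > 2 * s"
    and "c > 0"
  shows "\<exists>C>0. \<forall>(J :: 'a \<Rightarrow> 'a \<Rightarrow> real) (B :: 'a \<Rightarrow> real) (G :: 'a \<Rightarrow> 'a \<Rightarrow> real)
              (\<mu> :: 'a signed_measure) (p :: real) (p' :: real).
     cond_L1 \<Omega> J B \<and> cond_L2 \<Omega> J B \<and> cond_L3 \<Omega> J B \<and> cond_L4 \<Omega> s J B \<and>
     cond_G1 \<Omega> s \<gamma> c J B G \<and> cond_G2 \<Omega> G \<and> cond_G3 \<Omega> \<gamma> G \<and>
     \<mu> \<in> meas_weighted \<Omega> \<gamma> \<and>
     1 < p \<and> p' = p / (p - 1) \<and> s - \<gamma> / (2 * p') > 0 \<and>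
     abs_cont_bessel_cap \<Omega> (2 * s - \<gamma> / p') p' (weighted_meas \<Omega> \<gamma> \<mu>)
     \<longrightarrow> (\<exists>u. weak_dual_solution \<Omega> \<gamma> G p \<mu> u \<and>
            (\<forall>v. weak_dual_solution \<Omega> \<gamma> G p \<mu> v \<longrightarrow> (AE x in lebesgue_on \<Omega>. v x = u x)) \<and>
            (AE x in lebesgue_on \<Omega>.
               - green_meas G (neg_part \<mu>) x \<le> u x \<and> u x \<le> green_meas G (pos_part \<mu>) x) \<and>
            L1_weighted_norm \<Omega> \<gamma> u + L1_weighted_norm \<Omega> \<gamma> (\<lambda>x. \<bar>u x\<bar> powr p)
              \<le> C * meas_weighted_norm \<Omega> \<gamma> \<mu>)"
proof -
 interpret domain_setting \<Omega> s \<gamma> c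
  using assms by unfold_locales (auto simp: C2_domain_def)
 show ?thesis
 \<comment> \<open>The witness is built from \<Omega>, s, \<gamma> and c alone, so it can be given
   before the operator, the measure and the exponent are introduced.\<close>
 proof (intro exI[of _ "2 * Lc + 2 * Lc / lc"] conjI allI impI, goal_cases)
  case 1
  show ?case using Lc_pos lc_pos by (simp add: add_pos_pos)
 next
  case (2 J B G \<mu> p p')
  interpret green_setting \<Omega> s \<gamma> c J B G
   by unfold_locales (use 2 in auto)
  show ?case by (rule weak_dual_problem) (use 2 in auto)
 qed
qed

end
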